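(* Let $n\ge3$, $1\le k\le n-2$ and $r\ge k+1$, and let $\mathcal T_h$ be a conforming simplicial mesh of a bounded domain $\Omega\subset\mathbb R^n$. For each $f\in\Delta_\ell(\mathcal T_h)$, $\ell=0,\dots,n-1$, choose a global $t$-$n$ basis $\{\boldsymbol t_1^f,\dots,\boldsymbol t_\ell^f,\boldsymbol n_1^f,\dots,\boldsymbol n_{n-\ell}^f\}$ depending only on $f$; let $\{\mathrm dy_i^f\}$ be the corresponding basis of $\mathrm{Alt}^1$ and $\{\mathrm d\hat y_i^f\}$ its dual basis. Then the degrees of freedom (DoFs) (a) $\omega(\mathtt v)\in\mathbb X$, for $\mathtt v\in\Delta_0(\mathcal T_h)$; (b) $(\omega,\eta)_f$, for $\eta\in\mathbb P_{r-(\ell+1)}(f)\otimes\mathrm{span}\{\mathrm d\hat y^f_\sigma\otimes*\mathrm d\hat y^f_i:(\sigma,i)\text{ is free and in the normal constraint block of } f\}$, $f\in\Delta_\ell(\mathcal T_h)$, $\ell=1,\dots,k-1$; (c) $(\mathrm{tr}_F^{\mathrm{div}}\omega,\eta)_f$, for $\eta\in\mathbb P_{r-(\ell+1)}(f)\otimes\mathrm{span}\{\mathrm d\hat y^f_\sigma:\sigma\text{ is in the free block of } f\}$, $F\in\Delta_{n-1}(\mathcal T_h)$, $f\in\Delta_\ell(F)$, $\ell=1,\dots,k-1$; (d) $(\mathrm{tr}_F^{\mathrm{div}}\omega,\eta)_F$, for $\eta\in[\mathbb P_1(F)\oplus(\mathbb B_{r,k}(F)\cap\mathbb P_1^\perp(F))]\otimes\mathrm{Alt}^k$,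 $F\in\Delta_{n-1}(\mathcal T_h)$; (e) $(\omega,\eta)_T$, for $\eta\in\mathbb B_r(\mathrm{div},T;\mathbb X)$, $T\in\mathcal T_h$, determine a finite element space $V_h\subset H(\mathrm{div},\Omega;\mathbb X)$. That is, for each $T\in\mathcal T_h$ the DoFs (a)--(e) attached to $T$ and its sub-simplices uniquely determine an element of $\mathbb P_r(T;\mathbb X)$ (unisolvence), and the space $V_h$ of all $\omega\in L^2(\Omega;\mathbb X)$ with $\omega|_T\in\mathbb P_r(T;\mathbb X)$ for all $T\in\mathcal T_h$, with DoFs (a), (b) single-valued across each $f$, and with DoFs (c), (d) single-valued across each $F\in\Delta_{n-1}(\mathcal T_h)$, is contained in $H(\mathrm{div},\Omega;\mathbb X)$.
   Context: Forms. $\mathrm{Alt}^j$ is the space of alternating $j$-linear forms on $\mathbb R^n$ with the inner product for which $\{\mathrm dx_\sigma\}$ is orthonormal ($\mathrm dx_i$ the standard orthonormal basis of $\mathrm{Alt}^1$); $\mathrm{Alt}^{k,n-1}=\mathrm{Alt}^k\otimes\mathrm{Alt}^{n-1}$ has the tensor product inner product $\langle\cdot,\cdot\rangle$. The map $s^{k,n-1}:\mathrm{Alt}^{k,n-1}\to\mathrm{Alt}^{k-1}\otimes\mathrm{Alt}^n$ is $$s^{k,n-1}\omega(w_1,\dots,w_{k-1})(v_1,\dots,v_n)=\sum_{i=1}^n(-1)^{i-1}\omega(v_i,w_1,\dots,w_{k-1})(v_1,\dots,\widehat{v_i},\dots,v_n),$$ and $\mathbb X:=\ker(s^{k,n-1})$.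 $(\omega,\eta)_f=\int_f\langle\omega,\eta\rangle\,\mathrm dx_f$ (for $\mathrm{Alt}^{k,n-1}$- or $\mathrm{Alt}^k$-valued functions). Index notation. $\Sigma(1:j,1:n)$ is the set of increasing sequences of length $j$ in $\{1,\dots,n\}$, identified with subsets; $\sigma^c$ is the complement; $i+\tau=\tau\cup\{i\}$ for $i\notin\tau$. For a basis $\{\mathrm dy_i\}$ of $\mathrm{Alt}^1$: $\mathrm dy_\sigma=\mathrm dy_{\sigma(1)}\wedge\cdots\wedge \mathrm dy_{\sigma(k)}$, $*\mathrm dy_i=(-1)^{i-1}\mathrm dy_1\wedge\cdots\wedge\widehat{\mathrm dy_i}\wedge\cdots\wedge \mathrm dy_n$, and the dual basis $\{\mathrm d\hat y_i\}$ satisfies $\langle \mathrm d\hat y_i,\mathrm dy_j\rangle=\delta_{i,j}$. $t$-$n$ basis. $\Delta_\ell(\cdot)$ denotes the set of $\ell$-dimensional sub-simplices. A $t$-$n$ basis of $f$ (of dimension $\ell$) consists of $\ell$ linearly independent unit vectors $\boldsymbol t_i^f$ tangential to $f$ followed by $n-\ell$ linearly independent unit vectors $\boldsymbol n_j^f$ orthogonal to the tangent plane of $f$. The corresponding basis of $\mathrm{Alt}^1$ is $\mathrm dy_i^f(w)=\boldsymbol t_i^f\cdot w$ for $1\le i\le\ell$ and $\mathrm dy_i^f(w)=\boldsymbol n_{i-\ell}^f\cdot w$ for $\ell+1\le i\le n$. Constraints and blocks. For $\tau\in\Sigma(1:k-1,1:n)$ with $\tau^c=\{i_1<\dots<i_{n-k+1}\}$,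 the constraint sequence of $\tau$ is $\{(i_m+\tau,i_m)\}_{m=1}^{n-k+1}$ and $(i_1+\tau,i_1)$ is its pair index. An index $(\sigma,i)$, $\sigma\in\Sigma(1:k,1:n)$, is free if it is not the pair index of any constraint sequence. For $f$ of dimension $\ell$, a constraint is a normal constraint if all its $i_m\ge\ell+1$. For fixed $\sigma$, the row $\{(\sigma,i):i=\ell+1,\dots,n\}$ is a free row if none of these indices belongs to the constraint sequence of a normal constraint. The free rows form the free block of $f$; all the remaining rows (with $i=\ell+1,\dots,n$) form the normal constraint block of $f$. Spaces. A mesh is conforming if any two simplices intersect in the empty set or a common sub-simplex. $\mathbb P_r(f)$: polynomials of degree $\le r$ on $f$ ($\{0\}$ if $r<0$). With barycentric coordinates, $b_f=\prod_{i\in f}\lambda_i$, and for $f\in\Delta_\ell(F)$, $\mathbb P_{s}(f)$ is extended to $F$ by the Bernstein form $\mathrm{span}\{\prod_{i\in f}\lambda_i^{\alpha_i}:|\alpha|=s\}$; $\mathbb B_{r,k}(F)=\bigoplus_{\ell=k}^{n-1}\bigoplus_{f\in\Delta_\ell(F)}b_f\mathbb P_{r-(\ell+1)}(f)$. $\mathbb P_1^\perp(F)$ is the $L^2(F)$-orthogonal complement of $\mathbb P_1(F)$. For $\omega=\sum_{\sigma,i}a_{\sigma,i}\,\mathrm dx_\sigma\otimes*\mathrm dx_i$: $\mathrm{div}\,\omega=\sum_\sigma\big(\sum_i\partial_{x_i}a_{\sigma,i}\big)\mathrm dx_\sigma$; for an $(n-1)$-dimensional face $F$ with a fixed unit normal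 $\boldsymbol n_F$ (depending only on $F$), $\mathrm{tr}_F^{\mathrm{div}}\omega=\sum_\sigma\big(\sum_ia_{\sigma,i}(\boldsymbol n_F)_i\big)|_F\,\mathrm dx_\sigma$; $H(\mathrm{div},\Omega;\mathbb X)=\{\omega\in L^2(\Omega;\mathbb X):\mathrm{div}\,\omega\in L^2\}$; $\mathbb B_r(\mathrm{div},T;\mathbb X)=\{\omega\in\mathbb P_r(T;\mathbb X):\mathrm{tr}_F^{\mathrm{div}}\omega=0\ \forall F\in\Delta_{n-1}(T)\}$. A DoF is single-valued across $f$ (resp. $F$) if its values computed from $\omega|_T$ and $\omega|_{T'}$ coincide for all $T,T'\in\mathcal T_h$ containing $f$ (resp. $F$). *)

theory Defs
  imports "HOL-Analysis.Analysis"
begin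

section \<open>Alternating forms on $\mathbb R^n$\<close>

text \<open>
  The space $\mathbb R^n$ is \<^typ>\<open>real^'n\<close> with \<open>n = CARD('n)\<close>; the linear order on \<open>'n\<close> fixes the
  numbering \<open>1, \<dots>, n\<close> of the coordinates.  Indices and multi-indices are (sets of) naturals in
  \<open>{1..n}\<close>.  An increasing sequence \<open>\<sigma>\<close> is the set of its members.
\<close>

type_synonym 'n rvec = "(real, 'n) vec"

definition unit_vec :: "nat \<Rightarrow> 'n::{finite,linorder} rvec" where
  "unit_vec i = axis (sorted_list_of_set (UNIV :: 'n set) ! (i - 1)) 1"

text \<open>
  A form is a function on argument lists.  A \<open>j\<close>-form takes the value 0, by convention, on lists of
  a length other than \<open>j\<close>.  Elements of a tensor product of two such spaces are identified with
  functions of two argument lists which are a form in each of them.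
\<close>

type_synonym 'a form = "'a list \<Rightarrow> real"
type_synonym 'a dform = "'a list \<times> 'a list \<Rightarrow> real"

definition Alt :: "nat \<Rightarrow> ('a::real_vector) form set" where
  "Alt j = {\<phi>.
     (\<forall>vs. length vs \<noteq> j \<longrightarrow> \<phi> vs = 0) \<and>
     (\<forall>vs i. length vs = j \<longrightarrow> i < j \<longrightarrow> linear (\<lambda>x. \<phi> (vs[i := x]))) \<and>
     (\<forall>vs. length vs = j \<longrightarrow> \<not> distinct vs \<longrightarrow> \<phi> vs = 0)}"

definition Alt2 :: "nat \<Rightarrow> nat \<Rightarrow> ('a::real_vector) dform set" where
  "Alt2 j m = {\<omega>. (\<forall>vs. (\<lambda>ws. \<omega> (ws, vs)) \<in> Alt j) \<and> (\<forall>ws. (\<lambda>vs. \<omega> (ws, vs)) \<in> Alt m)}"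

definition form_tensor :: "'a form \<Rightarrow> 'a form \<Rightarrow> 'a dform" where
  "form_tensor \<phi> \<psi> = (\<lambda>(ws, vs). \<phi> ws * \<psi> vs)"

text \<open>\<open>s_map k\<close> is $s^{k,n-1}$; list positions are counted from 0, hence the sign $(-1)^i$.\<close>

definition s_map :: "nat \<Rightarrow> 'n::finite rvec dform \<Rightarrow> 'n rvec dform" where
  "s_map k \<omega> = (\<lambda>(ws, vs).
     if length ws = k - 1 \<and> length vs = CARD('n)
     then \<Sum>i<CARD('n). (-1) ^ i * \<omega> (vs ! i # ws, take i vs @ drop (Suc i) vs)
     else 0)"

definition XX :: "nat \<Rightarrow> 'n::finite rvec dform set" where
  "XX k = {\<omega> \<in> Alt2 k (CARD('n) - 1). s_map k \<omega> = (\<lambda>_. 0)}"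

definition Sig :: "nat \<Rightarrow> nat \<Rightarrow> nat set set" where
  "Sig n j = {\<sigma>. \<sigma> \<subseteq> {1..n} \<and> card \<sigma> = j}"

definition wedge :: "'a form list \<Rightarrow> 'a form" where
  "wedge \<phi>s = (\<lambda>vs. if length vs = length \<phi>s
     then \<Sum>p | p permutes {..<length \<phi>s}.
            of_int (sign p) * (\<Prod>i<length \<phi>s. (\<phi>s ! i) [vs ! p i])
     else 0)"

definition wedge_ix :: "(nat \<Rightarrow> 'a form) \<Rightarrow> nat set \<Rightarrow> 'a form" where
  "wedge_ix dy \<sigma> = wedge (map dy (sorted_list_of_set \<sigma>))"

definition star_ix :: "nat \<Rightarrow> (nat \<Rightarrow> 'a form) \<Rightarrow> nat \<Rightarrow> 'a form" where
  "star_ix n dy i = (\<lambda>vs. (-1) ^ (i - 1) * wedge_ix dy ({1..n} - {i}) vs)"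

definition covec :: "'a::real_inner \<Rightarrow> 'a form" where
  "covec b = (\<lambda>ws. if length ws = 1 then b \<bullet> hd ws else 0)"

abbreviation dx :: "nat \<Rightarrow> 'n::{finite,linorder} rvec form" where
  "dx i \<equiv> covec (unit_vec i)"

definition unit_vecs :: "nat set \<Rightarrow> 'n::{finite,linorder} rvec list" where
  "unit_vecs \<sigma> = map unit_vec (sorted_list_of_set \<sigma>)"

text \<open>
  A \<open>j\<close>-form equals $\sum_\sigma \phi(e_{\sigma(1)},\dots,e_{\sigma(j)})\,\mathrm dx_\sigma$, so these are the
  inner products which make the $\mathrm dx_\sigma$, and the $\mathrm dx_\sigma\otimes\mathrm dx_\rho$, orthonormal.
\<close>

definition form_inner :: "nat \<Rightarrow> 'n::{finite,linorder} rvec form \<Rightarrow> 'n rvec form \<Rightarrow> real" where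
  "form_inner j \<phi> \<psi> = (\<Sum>\<sigma>\<in>Sig CARD('n) j. \<phi> (unit_vecs \<sigma>) * \<psi> (unit_vecs \<sigma>))"

definition dform_inner ::
  "nat \<Rightarrow> nat \<Rightarrow> 'n::{finite,linorder} rvec dform \<Rightarrow> 'n rvec dform \<Rightarrow> real" where
  "dform_inner j m \<omega> \<eta> = (\<Sum>\<sigma>\<in>Sig CARD('n) j. \<Sum>\<rho>\<in>Sig CARD('n) m.
     \<omega> (unit_vecs \<sigma>, unit_vecs \<rho>) * \<eta> (unit_vecs \<sigma>, unit_vecs \<rho>))"

text \<open>
  The coefficient $a_{\sigma,i}$ in $\omega=\sum a_{\sigma,i}\,\mathrm dx_\sigma\otimes{*\mathrm dx_i}$; the sign is that
  in the definition of $*\mathrm dx_i$.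
\<close>

definition coef :: "'n::{finite,linorder} rvec dform \<Rightarrow> nat set \<Rightarrow> nat \<Rightarrow> real" where
  "coef \<omega> \<sigma> i = (-1) ^ (i - 1) * \<omega> (unit_vecs \<sigma>, unit_vecs ({1..CARD('n)} - {i}))"

lemma unit_vec_inner:
  assumes "i \<in> {1..CARD('n)}" "j \<in> {1..CARD('n)}"
  shows "(unit_vec i :: 'n::{finite,linorder} rvec) \<bullet> unit_vec j = (if i = j then 1 else 0)"
proof -
  let ?l = "sorted_list_of_set (UNIV :: 'n set)"
  have "?l ! (i - 1) = ?l ! (j - 1) \<longleftrightarrow> i - 1 = j - 1"
    using assms by (intro nth_eq_iff_index_eq) auto
  also have "\<dots> \<longleftrightarrow> i = j"
    using assms by auto
  finally show ?thesis
    by (simp add: unit_vec_def inner_axis_axis)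
qed

lemma wedge_ix_dx:
  assumes \<sigma>: "\<sigma> \<in> Sig CARD('n) j" and \<rho>: "\<rho> \<in> Sig CARD('n) j"
  shows "wedge_ix dx \<sigma> (unit_vecs \<rho> :: 'n::{finite,linorder} rvec list) = (if \<sigma> = \<rho> then 1 else 0)"
proof -
  define xs where "xs = sorted_list_of_set \<sigma>"
  define ys where "ys = sorted_list_of_set \<rho>"
  have fin: "finite \<sigma>" "finite \<rho>"
    using \<sigma> \<rho> by (auto simp: Sig_def intro: finite_subset)
  have len: "length xs = j" "length ys = j"
    using \<sigma> \<rho> by (auto simp: xs_def ys_def Sig_def)
  have set: "set xs = \<sigma>" "set ys = \<rho>" and dist: "distinct xs" "distinct ys"
    using fin by (auto simp: xs_def ys_def)
  have rng: "xs ! i \<in> {1..CARD('n)}" "ys ! i \<in> {1..CARD('n)}" if "i < j" for i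
  proof -
    have "xs ! i \<in> \<sigma>" "ys ! i \<in> \<rho>"
      using that len set nth_mem by metis+
    then show "xs ! i \<in> {1..CARD('n)}" "ys ! i \<in> {1..CARD('n)}"
      using \<sigma> \<rho> unfolding Sig_def by blast+
  qed
  have "wedge_ix dx \<sigma> (unit_vecs \<rho> :: 'n rvec list) =
      (\<Sum>p | p permutes {..<j}. of_int (sign p) *
         (\<Prod>i<j. if xs ! i = ys ! p i then 1 else 0))"
  proof -
    have "(\<Prod>i<j. (map dx xs ! i) [map unit_vec ys ! p i :: 'n rvec]) =
        (\<Prod>i<j. if xs ! i = ys ! p i then 1 else (0 :: real))" if "p permutes {..<j}" for p
    proof (rule prod.cong[OF refl])
      fix i assume "i \<in> {..<j}"
      moreover from this have "p i < j"
        using permutes_in_image[OF that] by blast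
      ultimately show "(map dx xs ! i) [map unit_vec ys ! p i :: 'n rvec] =
          (if xs ! i = ys ! p i then 1 else 0)"
        using len rng unit_vec_inner[of "xs ! i" "ys ! p i", where 'n = 'n]
        by (simp add: covec_def)
    qed
    then show ?thesis
      by (simp add: wedge_ix_def wedge_def unit_vecs_def len flip: xs_def ys_def)
  qed
  also have "\<dots> = (\<Sum>p | p permutes {..<j}. if p = id \<and> \<sigma> = \<rho> then 1 else 0)"
  proof (rule sum.cong[OF refl])
    fix p assume "p \<in> {p. p permutes {..<j}}"
    then have p: "p permutes {..<j}" by simp
    have pj: "p i < j" if "i < j" for i
      using permutes_in_image[OF p] that by blast
    have *: "(\<forall>i<j. xs ! i = ys ! p i) \<longleftrightarrow> p = id \<and> \<sigma> = \<rho>"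
    proof
      assume all: "\<forall>i<j. xs ! i = ys ! p i"
      have "\<sigma> \<subseteq> \<rho>"
        using all len set pj by (metis in_set_conv_nth subsetI)
      then have eq: "\<sigma> = \<rho>"
        using \<sigma> \<rho> fin card_subset_eq[of \<rho> \<sigma>] by (auto simp: Sig_def)
      have "p i = i" for i
      proof (cases "i < j")
        case True
        then have "ys ! i = ys ! p i"
          using all eq by (simp add: xs_def ys_def)
        then show ?thesis
          using True pj len dist nth_eq_iff_index_eq by metis
      next
        case False
        then show ?thesis
          using p by (simp add: permutes_def)
      qed
      with eq show "p = id \<and> \<sigma> = \<rho>" by auto
    qed (auto simp: xs_def ys_def)
    show "of_int (sign p) * (\<Prod>i<j. if xs ! i = ys ! p i then 1 else 0) =
        (if p = id \<and> \<sigma> = \<rho> then 1 else (0 :: real))"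
    proof (cases "\<forall>i<j. xs ! i = ys ! p i")
      case True
      with * have "p = id \<and> \<sigma> = \<rho>" by blast
      with True show ?thesis by simp
    next
      case False
      then have "(\<Prod>i<j. if xs ! i = ys ! p i then 1 else (0 :: real)) = 0"
        by (intro prod_zero) auto
      with False * show ?thesis by auto
    qed
  qed
  also have "\<dots> = (if \<sigma> = \<rho> then 1 else 0)"
    by (cases "\<sigma> = \<rho>") (simp_all add: permutes_id finite_permutations)
  finally show ?thesis .
qed

lemma coef_dx:
  assumes "\<sigma> \<in> Sig CARD('n) k" "\<rho> \<in> Sig CARD('n) k"
    and i: "i \<in> {1..CARD('n)}" and j: "j \<in> {1..CARD('n)}"
  shows "coef (form_tensor (wedge_ix dx \<rho>) (star_ix CARD('n) dx j) :: 'n::{finite,linorder} rvec dform) \<sigma> i =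
    (if \<rho> = \<sigma> \<and> j = i then 1 else 0)"
proof -
  have "{1..CARD('n)} - {l} \<in> Sig CARD('n) (CARD('n) - 1)" if "l \<in> {1..CARD('n)}" for l
    using that by (auto simp: Sig_def)
  then have "wedge_ix dx ({1..CARD('n)} - {j}) (unit_vecs ({1..CARD('n)} - {i}) :: 'n rvec list) =
      (if {1..CARD('n)} - {j} = {1..CARD('n)} - {i} then 1 else 0)"
    using i j by (intro wedge_ix_dx) auto
  also have "{1..CARD('n)} - {j} = {1..CARD('n)} - {i} \<longleftrightarrow> j = i"
    using i j by blast
  finally show ?thesis
    using assms(1,2)
    by (simp add: coef_def form_tensor_def star_ix_def wedge_ix_dx del: One_nat_def)
qed

definition dual_basis ::
  "(nat \<Rightarrow> 'n::{finite,linorder} rvec form) \<Rightarrow> (nat \<Rightarrow> 'n rvec form) \<Rightarrow> bool" where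
  "dual_basis dy dyh \<longleftrightarrow>
     (\<forall>i\<in>{1..CARD('n)}. dyh i \<in> Alt 1 \<and>
        (\<forall>j\<in>{1..CARD('n)}. form_inner 1 (dyh i) (dy j) = (if i = j then 1 else 0)))"


section \<open>Constraint sequences and blocks\<close>

definition constraint_seq :: "nat \<Rightarrow> nat set \<Rightarrow> (nat set \<times> nat) set" where
  "constraint_seq n \<tau> = {(insert i \<tau>, i) | i. i \<in> {1..n} - \<tau>}"

definition pair_index :: "nat \<Rightarrow> nat set \<Rightarrow> nat set \<times> nat" where
  "pair_index n \<tau> = (let i = Min ({1..n} - \<tau>) in (insert i \<tau>, i))"

definition free_index :: "nat \<Rightarrow> nat \<Rightarrow> nat set \<Rightarrow> nat \<Rightarrow> bool" where
  "free_index n k \<sigma> i \<longleftrightarrow> (\<forall>\<tau>\<in>Sig n (k - 1). (\<sigma>, i) \<noteq> pair_index n \<tau>)"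

definition normal_constraint :: "nat \<Rightarrow> nat \<Rightarrow> nat \<Rightarrow> nat set \<Rightarrow> bool" where
  "normal_constraint n k l \<tau> \<longleftrightarrow> \<tau> \<in> Sig n (k - 1) \<and> (\<forall>i\<in>{1..n} - \<tau>. l + 1 \<le> i)"

definition free_row :: "nat \<Rightarrow> nat \<Rightarrow> nat \<Rightarrow> nat set \<Rightarrow> bool" where
  "free_row n k l \<sigma> \<longleftrightarrow> \<sigma> \<in> Sig n k \<and>
     (\<forall>i\<in>{l + 1..n}. \<forall>\<tau>. normal_constraint n k l \<tau> \<longrightarrow> (\<sigma>, i) \<notin> constraint_seq n \<tau>)"

definition normal_block :: "nat \<Rightarrow> nat \<Rightarrow> nat \<Rightarrow> (nat set \<times> nat) set" where
  "normal_block n k l = {(\<sigma>, i). \<sigma> \<in> Sig n k \<and> i \<in> {l + 1..n} \<and> \<not> free_row n k l \<sigma>}"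


section \<open>Simplices, meshes and \<open>t\<close>-\<open>n\<close> bases\<close>

definition verts :: "'a::euclidean_space set \<Rightarrow> 'a set" where
  "verts f = {v. v extreme_point_of f}"

definition Delta :: "nat \<Rightarrow> 'a::euclidean_space set \<Rightarrow> 'a set set" where
  "Delta l T = {f. f face_of T \<and> int l simplex f}"

definition mesh_Delta :: "nat \<Rightarrow> 'a::euclidean_space set set \<Rightarrow> 'a set set" where
  "mesh_Delta l Th = (\<Union>T\<in>Th. Delta l T)"

text \<open>\<^const>\<open>triangulation\<close> is conformity: intersections are (possibly empty) common faces.\<close>

definition conforming_mesh :: "'a::euclidean_space set \<Rightarrow> 'a set set \<Rightarrow> bool" where
  "conforming_mesh \<Omega> Th \<longleftrightarrow>
     triangulation Th \<and> (\<forall>T\<in>Th. int DIM('a) simplex T) \<and> \<Union>Th = closure \<Omega>"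

definition tangent_space :: "'a::euclidean_space set \<Rightarrow> 'a set" where
  "tangent_space f = span {x - y | x y. x \<in> f \<and> y \<in> f}"

definition tn_basis :: "nat \<Rightarrow> 'a::euclidean_space set \<Rightarrow> (nat \<Rightarrow> 'a) \<Rightarrow> bool" where
  "tn_basis l f b \<longleftrightarrow>
     (\<forall>i\<in>{1..DIM('a)}. norm (b i) = 1) \<and>
     (\<forall>i\<in>{1..l}. b i \<in> tangent_space f) \<and>
     (\<forall>i\<in>{l + 1..DIM('a)}. \<forall>t\<in>tangent_space f. b i \<bullet> t = 0) \<and>
     inj_on b {1..l} \<and> independent (b ` {1..l}) \<and>
     inj_on b {l + 1..DIM('a)} \<and> independent (b ` {l + 1..DIM('a)})"

definition unit_normal :: "'a::euclidean_space set \<Rightarrow> 'a \<Rightarrow> bool" where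
  "unit_normal F \<nu> \<longleftrightarrow> norm \<nu> = 1 \<and> (\<forall>t\<in>tangent_space F. \<nu> \<bullet> t = 0)"

text \<open>Only the values \<open>bary F v x\<close> with \<open>v\<close> a vertex of \<open>F\<close> and \<open>x\<close> in the affine hull matter.\<close>

definition bary :: "'a::euclidean_space set \<Rightarrow> 'a \<Rightarrow> 'a \<Rightarrow> real" where
  "bary F v x = (SOME c. sum c (verts F) = 1 \<and> (\<Sum>w\<in>verts F. c w *\<^sub>R w) = x) v"

text \<open>
  Lebesgue measure of the affine hull of \<open>f\<close>: the product Lebesgue measure transported by
  orthonormal coordinates.  It does not depend on the chosen origin \<open>p\<close> and orthonormal basis \<open>B\<close>.
  If \<open>f\<close> is a point it is the unit mass there.
\<close>

definition face_measure :: "'a::euclidean_space set \<Rightarrow> 'a measure" where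
  "face_measure f =
     (let p = (SOME p. p \<in> f);
          B = (SOME B. pairwise orthogonal B \<and> (\<forall>b\<in>B. norm b = 1) \<and> span B = tangent_space f)
      in distr (Pi\<^sub>M B (\<lambda>_. lborel)) borel (\<lambda>s. p + (\<Sum>b\<in>B. s b *\<^sub>R b)))"

definition face_integral :: "'a::euclidean_space set \<Rightarrow> ('a \<Rightarrow> real) \<Rightarrow> real" where
  "face_integral f g = (LINT x:f|face_measure f. g x)"


section \<open>Polynomial spaces\<close>

text \<open>
  Functions on a simplex are represented by their extension by 0, so that equality of functions
  on the simplex is equality.
\<close>

definition Poly :: "int \<Rightarrow> 'n::finite rvec set \<Rightarrow> ('n rvec \<Rightarrow> real) set" where
  "Poly s f = {p. \<exists>c. \<forall>x. p x =
     (if x \<in> f then \<Sum>\<alpha> | int (\<Sum>i\<in>UNIV. \<alpha> i) \<le> s. c \<alpha> * (\<Prod>i\<in>UNIV. (x $ i) ^ \<alpha> i) else 0)}"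

text \<open>The summand $b_f\,\mathbb P_s(f)$, extended to \<open>F\<close> by the Bernstein form.\<close>

definition bubble_Poly :: "'a::euclidean_space set \<Rightarrow> 'a set \<Rightarrow> int \<Rightarrow> ('a \<Rightarrow> real) set" where
  "bubble_Poly F f s = {p. \<exists>c. \<forall>x. p x =
     (if x \<in> F then
        (\<Prod>v\<in>verts f. bary F v x) *
        (\<Sum>\<alpha> | (\<forall>v. v \<notin> verts f \<longrightarrow> \<alpha> v = 0) \<and> int (\<Sum>v\<in>verts f. \<alpha> v) = s.
           c \<alpha> * (\<Prod>v\<in>verts f. bary F v x ^ \<alpha> v))
      else 0)}"

definition Bubble :: "nat \<Rightarrow> nat \<Rightarrow> 'a::euclidean_space set \<Rightarrow> ('a \<Rightarrow> real) set" where
  "Bubble r k F = {u. \<exists>g.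
     (\<forall>l\<in>{k..DIM('a) - 1}. \<forall>f\<in>Delta l F. g f \<in> bubble_Poly F f (int r - int (l + 1))) \<and>
     u = (\<lambda>x. \<Sum>l\<in>{k..DIM('a) - 1}. \<Sum>f\<in>Delta l F. g f x)}"

definition P1_perp :: "'n::finite rvec set \<Rightarrow> ('n rvec \<Rightarrow> real) set" where
  "P1_perp F = {u. set_borel_measurable (face_measure F) F u \<and>
     set_integrable (face_measure F) F (\<lambda>x. (u x)\<^sup>2) \<and>
     (\<forall>p\<in>Poly 1 F. face_integral F (\<lambda>x. u x * p x) = 0)}"

text \<open>\<open>fun_tensor P I g\<close> is $P\otimes\mathrm{span}\{g_i : i\in I\}$.\<close>

definition fun_tensor ::
  "('x \<Rightarrow> real) set \<Rightarrow> 'i set \<Rightarrow> ('i \<Rightarrow> 'b \<Rightarrow> real) \<Rightarrow> ('x \<Rightarrow> 'b \<Rightarrow> real) set" where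
  "fun_tensor P I g =
     {\<eta>. \<exists>p. (\<forall>i\<in>I. p i \<in> P) \<and> \<eta> = (\<lambda>x a. \<Sum>i\<in>I. p i x * g i a)}"

definition PolyX :: "nat \<Rightarrow> nat \<Rightarrow> 'n::finite rvec set \<Rightarrow> ('n rvec \<Rightarrow> 'n rvec dform) set" where
  "PolyX r k T = {\<omega>. (\<forall>a. (\<lambda>x. \<omega> x a) \<in> Poly (int r) T) \<and> (\<forall>x\<in>T. \<omega> x \<in> XX k)}"

definition tr_div :: "nat \<Rightarrow> 'n::{finite,linorder} rvec set \<Rightarrow> 'n rvec \<Rightarrow>
    ('n rvec \<Rightarrow> 'n rvec dform) \<Rightarrow> 'n rvec \<Rightarrow> 'n rvec form" where
  "tr_div k F \<nu> \<omega> = (\<lambda>x ws. if x \<in> F then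
     \<Sum>\<sigma>\<in>Sig CARD('n) k. (\<Sum>i\<in>{1..CARD('n)}. coef (\<omega> x) \<sigma> i * (\<nu> \<bullet> unit_vec i)) * wedge_ix dx \<sigma> ws
     else 0)"

definition Bdiv :: "nat \<Rightarrow> nat \<Rightarrow> ('n::{finite,linorder} rvec set \<Rightarrow> 'n rvec) \<Rightarrow> 'n rvec set \<Rightarrow>
    ('n rvec \<Rightarrow> 'n rvec dform) set" where
  "Bdiv r k nF T =
     {\<omega> \<in> PolyX r k T. \<forall>F\<in>Delta (CARD('n) - 1) T. tr_div k F (nF F) \<omega> = (\<lambda>_ _. 0)}"


section \<open>Degrees of freedom\<close>

definition form_pair :: "nat \<Rightarrow> 'n::{finite,linorder} rvec set \<Rightarrow>
    ('n rvec \<Rightarrow> 'n rvec form) \<Rightarrow> ('n rvec \<Rightarrow> 'n rvec form) \<Rightarrow> real" where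
  "form_pair k f \<phi> \<eta> = face_integral f (\<lambda>x. form_inner k (\<phi> x) (\<eta> x))"

definition dform_pair :: "nat \<Rightarrow> 'n::{finite,linorder} rvec set \<Rightarrow>
    ('n rvec \<Rightarrow> 'n rvec dform) \<Rightarrow> ('n rvec \<Rightarrow> 'n rvec dform) \<Rightarrow> real" where
  "dform_pair k f \<omega> \<eta> = face_integral f (\<lambda>x. dform_inner k (CARD('n) - 1) (\<omega> x) (\<eta> x))"

text \<open>
  In \<open>test_b\<close> and \<open>test_c\<close>, \<open>l\<close> is the dimension of \<open>f\<close> and \<open>dyh\<close> the dual basis
  $\{\mathrm d\hat y_i^f\}$.
\<close>

definition test_b :: "nat \<Rightarrow> nat \<Rightarrow> nat \<Rightarrow> 'n::{finite,linorder} rvec set \<Rightarrow>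
    (nat \<Rightarrow> 'n rvec form) \<Rightarrow> ('n rvec \<Rightarrow> 'n rvec dform) set" where
  "test_b r k l f dyh = fun_tensor (Poly (int r - int (l + 1)) f)
     {(\<sigma>, i) \<in> normal_block CARD('n) k l. free_index CARD('n) k \<sigma> i}
     (\<lambda>(\<sigma>, i). form_tensor (wedge_ix dyh \<sigma>) (star_ix CARD('n) dyh i))"

definition test_c :: "nat \<Rightarrow> nat \<Rightarrow> nat \<Rightarrow> 'n::{finite,linorder} rvec set \<Rightarrow>
    (nat \<Rightarrow> 'n rvec form) \<Rightarrow> ('n rvec \<Rightarrow> 'n rvec form) set" where
  "test_c r k l f dyh = fun_tensor (Poly (int r - int (l + 1)) f)
     {\<sigma>. free_row CARD('n) k l \<sigma>} (wedge_ix dyh)"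

definition test_d :: "nat \<Rightarrow> nat \<Rightarrow> 'n::{finite,linorder} rvec set \<Rightarrow>
    ('n rvec \<Rightarrow> 'n rvec form) set" where
  "test_d r k F = fun_tensor
     {\<lambda>x. p x + q x | p q. p \<in> Poly 1 F \<and> q \<in> Bubble r k F \<inter> P1_perp F}
     (Sig CARD('n) k) (wedge_ix dx)"

definition linear_functional_on :: "('x \<Rightarrow> 'b \<Rightarrow> real) set \<Rightarrow> (('x \<Rightarrow> 'b \<Rightarrow> real) \<Rightarrow> real) \<Rightarrow> bool" where
  "linear_functional_on S L \<longleftrightarrow>
     (\<forall>\<eta>\<in>S. \<forall>\<zeta>\<in>S. L (\<lambda>x a. \<eta> x a + \<zeta> x a) = L \<eta> + L \<zeta>) \<and>
     (\<forall>c. \<forall>\<eta>\<in>S. L (\<lambda>x a. c * \<eta> x a) = c * L \<eta>)"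

text \<open>
  Unisolvence: prescribed values of the degrees of freedom (arbitrary elements of \<open>XX k\<close> at the
  vertices, arbitrary linear functionals on the test spaces) are attained by exactly one element of
  \<open>PolyX r k T\<close>.
\<close>

definition unisolvent :: "nat \<Rightarrow> nat \<Rightarrow> ('n::{finite,linorder} rvec set \<Rightarrow> 'n rvec) \<Rightarrow>
    ('n rvec set \<Rightarrow> nat \<Rightarrow> 'n rvec form) \<Rightarrow> 'n rvec set \<Rightarrow> bool" where
  "unisolvent r k nF dyh T \<longleftrightarrow>
    (\<forall>A Lb Lc Ld Le.
       (\<forall>v\<in>verts T. A v \<in> XX k) \<longrightarrow>
       (\<forall>l\<in>{1..k - 1}. \<forall>f\<in>Delta l T. linear_functional_on (test_b r k l f (dyh f)) (Lb f)) \<longrightarrow>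
       (\<forall>F\<in>Delta (CARD('n) - 1) T. \<forall>l\<in>{1..k - 1}. \<forall>f\<in>Delta l F.
          linear_functional_on (test_c r k l f (dyh f)) (Lc F f)) \<longrightarrow>
       (\<forall>F\<in>Delta (CARD('n) - 1) T. linear_functional_on (test_d r k F) (Ld F)) \<longrightarrow>
       linear_functional_on (Bdiv r k nF T) Le \<longrightarrow>
       (\<exists>!\<omega>. \<omega> \<in> PolyX r k T \<and>
          (\<forall>v\<in>verts T. \<omega> v = A v) \<and>
          (\<forall>l\<in>{1..k - 1}. \<forall>f\<in>Delta l T. \<forall>\<eta>\<in>test_b r k l f (dyh f).
             dform_pair k f \<omega> \<eta> = Lb f \<eta>) \<and>
          (\<forall>F\<in>Delta (CARD('n) - 1) T. \<forall>l\<in>{1..k - 1}. \<forall>f\<in>Delta l F.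
             \<forall>\<eta>\<in>test_c r k l f (dyh f). form_pair k f (tr_div k F (nF F) \<omega>) \<eta> = Lc F f \<eta>) \<and>
          (\<forall>F\<in>Delta (CARD('n) - 1) T. \<forall>\<eta>\<in>test_d r k F.
             form_pair k F (tr_div k F (nF F) \<omega>) \<eta> = Ld F \<eta>) \<and>
          (\<forall>\<eta>\<in>Bdiv r k nF T. dform_pair k T \<omega> \<eta> = Le \<eta>)))"


section \<open>The function spaces on the domain\<close>

definition L2 :: "'a::euclidean_space set \<Rightarrow> ('a \<Rightarrow> real) set" where
  "L2 \<Omega> = {u. u \<in> borel_measurable (lebesgue_on \<Omega>) \<and> integrable (lebesgue_on \<Omega>) (\<lambda>x. (u x)\<^sup>2)}"

text \<open>Square integrable functions whose values are forms in \<open>V\<close>.\<close>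

definition L2_forms :: "'a::euclidean_space set \<Rightarrow> ('b \<Rightarrow> real) set \<Rightarrow> ('a \<Rightarrow> 'b \<Rightarrow> real) set" where
  "L2_forms \<Omega> V = {\<omega>. (\<forall>a. (\<lambda>x. \<omega> x a) \<in> L2 \<Omega>) \<and> (AE x in lebesgue_on \<Omega>. \<omega> x \<in> V)}"

definition partial :: "nat \<Rightarrow> ('n::{finite,linorder} rvec \<Rightarrow> real) \<Rightarrow> 'n rvec \<Rightarrow> real" where
  "partial i \<phi> x = frechet_derivative \<phi> (at x) (unit_vec i)"

primrec Ck :: "nat \<Rightarrow> ('n::{finite,linorder} rvec \<Rightarrow> real) \<Rightarrow> bool" where
  "Ck 0 \<phi> \<longleftrightarrow> continuous_on UNIV \<phi>"
| "Ck (Suc m) \<phi> \<longleftrightarrow> \<phi> differentiable_on UNIV \<and> (\<forall>i\<in>{1..CARD('n)}. Ck m (partial i \<phi>))"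

definition test_functions :: "'n::{finite,linorder} rvec set \<Rightarrow> ('n rvec \<Rightarrow> real) set" where
  "test_functions \<Omega> = {\<phi>. (\<forall>m. Ck m \<phi>) \<and>
     compact (closure {x. \<phi> x \<noteq> 0}) \<and> closure {x. \<phi> x \<noteq> 0} \<subseteq> \<Omega>}"

definition weak_div :: "nat \<Rightarrow> 'n::{finite,linorder} rvec set \<Rightarrow>
    ('n rvec \<Rightarrow> 'n rvec dform) \<Rightarrow> ('n rvec \<Rightarrow> 'n rvec form) \<Rightarrow> bool" where
  "weak_div k \<Omega> \<omega> d \<longleftrightarrow> (\<forall>\<phi>\<in>test_functions \<Omega>. \<forall>\<sigma>\<in>Sig CARD('n) k.
     (LINT x|lebesgue_on \<Omega>. (\<Sum>i\<in>{1..CARD('n)}. coef (\<omega> x) \<sigma> i * partial i \<phi> x)) =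
     - (LINT x|lebesgue_on \<Omega>. d x (unit_vecs \<sigma>) * \<phi> x))"

definition Hdiv :: "nat \<Rightarrow> 'n::{finite,linorder} rvec set \<Rightarrow> ('n rvec \<Rightarrow> 'n rvec dform) set" where
  "Hdiv k \<Omega> = {\<omega> \<in> L2_forms \<Omega> (XX k). \<exists>d \<in> L2_forms \<Omega> (Alt k). weak_div k \<Omega> \<omega> d}"

text \<open>\<open>w T\<close> is the polynomial representing the almost-everywhere class \<open>\<omega>|\<^sub>T\<close>.\<close>

definition Vh :: "nat \<Rightarrow> nat \<Rightarrow> ('n::{finite,linorder} rvec set \<Rightarrow> 'n rvec) \<Rightarrow>
    ('n rvec set \<Rightarrow> nat \<Rightarrow> 'n rvec form) \<Rightarrow> 'n rvec set \<Rightarrow>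
    'n rvec set set \<Rightarrow> ('n rvec \<Rightarrow> 'n rvec dform) set" where
  "Vh r k nF dyh \<Omega> Th = {\<omega> \<in> L2_forms \<Omega> (XX k). \<exists>w.
     (\<forall>T\<in>Th. w T \<in> PolyX r k T \<and> (AE x in lebesgue_on (T \<inter> \<Omega>). \<omega> x = w T x)) \<and>
     (\<forall>T\<in>Th. \<forall>T'\<in>Th. \<forall>v\<in>verts T \<inter> verts T'. w T v = w T' v) \<and>
     (\<forall>l\<in>{1..k - 1}. \<forall>f\<in>mesh_Delta l Th. \<forall>T\<in>Th. \<forall>T'\<in>Th. f \<subseteq> T \<longrightarrow> f \<subseteq> T' \<longrightarrow>
        (\<forall>\<eta>\<in>test_b r k l f (dyh f). dform_pair k f (w T) \<eta> = dform_pair k f (w T') \<eta>)) \<and>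
     (\<forall>F\<in>mesh_Delta (CARD('n) - 1) Th. \<forall>T\<in>Th. \<forall>T'\<in>Th. F \<subseteq> T \<longrightarrow> F \<subseteq> T' \<longrightarrow>
        (\<forall>l\<in>{1..k - 1}. \<forall>f\<in>Delta l F. \<forall>\<eta>\<in>test_c r k l f (dyh f).
           form_pair k f (tr_div k F (nF F) (w T)) \<eta> =
           form_pair k f (tr_div k F (nF F) (w T')) \<eta>) \<and>
        (\<forall>\<eta>\<in>test_d r k F.
           form_pair k F (tr_div k F (nF F) (w T)) \<eta> =
           form_pair k F (tr_div k F (nF F) (w T')) \<eta>))}"

end

theory Submission
  imports Defs
begin

text \<open>
  By Hodge duality in the second factor an element of \<open>Alt2 k (n - 1)\<close> is a vector-valued
  \<open>k\<close>-form, whose normal component on a facet is the trace.  If all degrees of freedom on the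
  faces of a facet \<open>F\<close> vanish, then, by induction on the dimension, so does the trace on the
  faces of dimension less than \<open>k\<close>: the constraints express the components with respect to an
  adapted basis which are not tested by those which are, and the free ones can be prescribed
  independently in the kernel of \<open>s\<close>.  Hence each coefficient of the trace is a combination of
  bubbles of faces of dimension at least \<open>k\<close>; integrating by parts along the edges shows that its
  moments determine it.  What remains is in the bubble space, which the interior moments test.
  Existence corrects prescribed values face by face, in the order of increasing dimension.

  For the conformity no divergence theorem is used.  Piecewise test fields are multiplied by a
  partition into cutoffs at the faces: near a facet the fields of its two neighbours are glued
  by a step function in the normal direction and the integral of the derivative of a compactly
  supported function is zero, while the lower dimensional faces contribute \<open>O(ep)\<close>.
\<close>

section \<open>Alternating forms as functions on lists\<close>

text \<open>No dimension is counted. Injectivity together with equal dimensions would require the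
  dimension of \<open>XX k\<close> and the number of free indices. Existence is proved directly
  instead: each group of moments is a pairing that is nondegenerate in the test function, and
  \<open>riesz_pairing\<close> turns this into solvability. What it takes at each face are elements
  of the kernel of s dual to the tested components. They exist because every constraint that meets a
  tested normal component also contains an untested one, which can absorb the defect.

  On a facet the bubbles are paired with a different space, the affine functions plus the bubbles
  orthogonal to them. An affine function orthogonal to all bubbles must vanish, and here k <= n - 2
  enters: integration along an edge of the facet takes k further vertices besides its two ends.

  The test forms use the dual basis, so a moment reads a value at dual vectors. The first l of these
  are tangential to the face; a statement about the span of an argument list is therefore
  independent of the basis and can be carried between faces whose t-n bases are unrelated.\<close>

lemma Alt_length: "ph : Alt j ==> length vs ~= j ==> ph vs = 0" by (simp add: Alt_def)

lemma Alt_linear: "ph : Alt j ==> length vs = j ==> i < j ==> linear (%x. ph (vs[i := x]))" unfolding Alt_def by blast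

lemma Alt_not_distinct: "ph : Alt j ==> ~distinct vs ==> ph vs = 0" by (cases "length vs = j") (simp_all add: Alt_def)

lemma Alt_add: "ph : Alt j ==> ps : Alt j ==> (%vs. ph vs + ps vs) : Alt j" by (auto simp: Alt_def intro: linear_compose_add)

lemma Alt_scale: "ph : Alt j ==> (%vs. c * ph vs) : Alt j" unfolding Alt_def mem_Collect_eq by (auto simp: linear_iff algebra_simps)

lemma Alt_zero: "(%vs. 0) : Alt j" by (simp add: Alt_def linear_zero)

lemma Alt_sum: "(!!i. i : I ==> ph i : Alt j) ==> (%vs. SUM i:I. ph i vs) : Alt j"
proof (induction I rule: infinite_finite_induct)
  case (insert i I)
  thus ?case using Alt_add[of "ph i" j "%vs. SUM i:I. ph i vs"] by simp
qed (simp_all add: Alt_zero)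

lemma Alt_diff: "ph : Alt j ==> ps : Alt j ==> (%vs. ph vs - ps vs) : Alt j"
  using Alt_add[of ph j "%vs. -1 * ps vs"] Alt_scale[of ps j "-1"] by fastforce

lemma Alt_swap:
  assumes ph: "ph : Alt j" and pq: "p < j" "q < j" "p ~= q" and len: "length vs = j"
  shows "ph (vs[p := x, q := y]) = - ph (vs[p := y, q := x])"
proof -
  let ?g = "%x y. ph (vs[p := x, q := y])"
  have l2: "linear (?g x)" for x using Alt_linear[OF ph, of "vs[p := x]" q] pq len by simp
  have l1: "linear (%x. ?g x y)" for y using Alt_linear[OF ph, of "vs[q := y]" p] pq len by (simp add: list_update_swap)
  have z: "?g x x = 0" for x
  proof (rule Alt_not_distinct[OF ph])
    have "vs[p := x, q := x] ! p = vs[p := x, q := x] ! q" "p < length (vs[p := x, q := x])"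
      "q < length (vs[p := x, q := x])" using pq len by auto
    thus "~distinct (vs[p := x, q := x])" using pq(3) distinct_conv_nth by blast
  qed
  have "0 = ?g (x + y) (x + y)" by (simp add: z)
  also have "... = ?g x x + ?g x y + (?g y x + ?g y y)" by (simp add: linear_add[OF l1] linear_add[OF l2])
  finally show ?thesis by (simp add: z)
qed

text \<open>An argument reaches the front by i swaps of neighbours. The sign is the one in
  \<open>s_map\<close> and in the Hodge star, against which it cancels.\<close>

lemma Alt_move:
  assumes ph: "ph : Alt j"
  shows "length vs = j ==> i < j ==>
    ph (x # take i vs @ drop (Suc i) vs) = (-1) ^ i * ph (vs[i := x])"
proof (induction i arbitrary: vs)
  case 0
  thus ?case by (cases vs) auto
next
  case (Suc i)
  \<comment> \<open>The argument before the gap is shifted into it; the gap is then one place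
    further left and the induction hypothesis applies.\<close>
  let ?vs = "vs[Suc i := vs ! i]"
  have "take (Suc i) vs = take i vs @ [vs ! i]" using Suc.prems by (simp add: take_Suc_conv_app_nth)
  moreover have "drop (Suc i) ?vs = vs ! i # drop (Suc (Suc i)) vs"
    using Suc.prems by (metis Cons_nth_drop_Suc drop_update_cancel length_list_update lessI nth_list_update_eq)
  ultimately have "x # take (Suc i) vs @ drop (Suc (Suc i)) vs = x # take i ?vs @ drop (Suc i) ?vs" by simp
  hence "ph (x # take (Suc i) vs @ drop (Suc (Suc i)) vs) = (-1) ^ i * ph (?vs[i := x])" using Suc.IH[of ?vs] Suc.prems by simp
  also have "ph (?vs[i := x]) = - ph (vs[Suc i := x, i := vs ! i])" using Alt_swap[OF ph, of "Suc i" i vs "vs ! i" x] Suc.prems by simp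
  also have "vs[Suc i := x, i := vs ! i] = vs[Suc i := x]" by (metis list_update_id nth_list_update_neq n_not_Suc_n)
  finally show ?case by simp
qed

lemma Alt_abs_move_front:
  assumes ph: "ph : Alt j"
  shows "\<bar>ph (as @ ys @ x # zs)\<bar> = \<bar>ph (as @ x # ys @ zs)\<bar>"
proof (induction ys arbitrary: as)
  case (Cons y ys)
  let ?v = "as @ x # y # ys @ zs"
  have "\<bar>ph (as @ (y # ys) @ x # zs)\<bar> = \<bar>ph (as @ y # x # ys @ zs)\<bar>" using Cons[of "as @ [y]"] by simp
  also have "... = \<bar>ph ?v\<bar>"
  proof (cases "length ?v = j")
    case True
    have "ph (?v[length as := y, Suc (length as) := x]) = - ph (?v[length as := x, Suc (length as) := y])" using True by (intro Alt_swap[OF ph]) auto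
    thus ?thesis by (simp add: list_update_append)
  next
    case False
    thus ?thesis using Alt_length[OF ph, of ?v] Alt_length[OF ph, of "as @ y # x # ys @ zs"] by simp
  qed
  finally show ?case by simp
qed simp

text \<open>Reordering changes a value by a sign only. With absolute values the sign of the sorting
  permutation never has to be computed; later uses only ask whether a value vanishes.\<close>

lemma Alt_abs_mset:
  assumes ph: "ph : Alt j"
  shows "mset xs = mset ys ==> \<bar>ph (as @ xs)\<bar> = \<bar>ph (as @ ys)\<bar>"
proof (induction xs arbitrary: as ys)
  case (Cons x xs)
  hence "x : set ys" by (metis list.set_intros(1) set_mset_mset)
  then obtain y1 y2 where ys: "ys = y1 @ x # y2" by (meson split_list)
  hence "mset xs = mset (y1 @ y2)" using Cons.prems by simp
  from Cons.IH[OF this, of "as @ [x]"] show ?case by (simp add: ys Alt_abs_move_front[OF ph])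
qed simp

lemma Alt_eq_zero_basis:
  assumes ph: "ph : Alt j" and B: "span (B ` {1..n}) = UNIV"
    and z: "!!sg. sg : Sig n j ==> ph (map B (sorted_list_of_set sg)) = 0"
  shows "ph vs = 0"
proof -
  have 1: "ph (map B is) = 0" if len: "length is = j" and sub: "set is <= {1..n}" for "is"
  proof (cases "distinct is")
    case False
    thus ?thesis by (intro Alt_not_distinct[OF ph]) (auto simp: distinct_map)
  next
    case True
    have "mset (sorted_list_of_set (set is)) = mset is" using True by (simp add: mset_set_set sorted_list_of_set_sort_remdups distinct_remdups_id)
    hence ms: "mset (map B is) = mset (map B (sorted_list_of_set (set is)))" by simp
    have "set is : Sig n j" using True len sub by (simp add: Sig_def distinct_card)
    thus ?thesis using Alt_abs_mset[OF ph ms, of "[]"] z by simp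
  qed
  \<comment> \<open>Induction on the number m of leading arguments that may be arbitrary, the
    remaining ones being basis vectors. Fact 1 is the case m = 0.\<close>
  have 2: "ph vs = 0" if "m <= j" "length vs = j" "!!i. m <= i ==> i < j ==> vs ! i : B ` {1..n}" for m vs using that
  proof (induction m arbitrary: vs)
    case 0
    hence "set vs <= B ` {1..n}" by (auto simp: in_set_conv_nth)
    hence "vs : lists (B ` {1..n})" by auto
    then obtain "is" where "vs = map B is" "set is <= {1..n}" by (auto simp: lists_image)
    with 0 show ?case using 1 by simp
  next
    case (Suc m)
    have "ph (vs[m := x]) = 0" if "x : B ` {1..n}" for x by (rule Suc.IH) (use Suc.prems that in \<open>auto simp: nth_list_update\<close>)
    hence "ph (vs[m := vs ! m]) = 0" by (rule linear_eq_0_on_span[OF Alt_linear[OF ph], rotated 2]) (use Suc.prems B in auto)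
    thus ?case by simp
  qed
  show ?thesis using 2[of j vs] Alt_length[OF ph] by (cases "length vs = j") auto
qed

text \<open>A vector \<open>w0\<close> of the list that occurs in the expansion of \<open>z\<close>
  can be replaced by \<open>z\<close>: this multiplies the value by its coefficient, since the other
  vectors of the list give repeated arguments. So a form that is killed by \<open>z\<close> vanishes
  on every list whose span contains \<open>z\<close>.\<close>

lemma Alt_zero_of_span:
  assumes ph: "ph : Alt j" and z: "z : span (set ws)" "z ~= 0"
    and 0: "!!us. z : set us ==> ph us = 0"
  shows "ph ws = 0"
proof (cases "length ws = j & distinct ws")
  case False
  thus ?thesis using Alt_length[OF ph] Alt_not_distinct[OF ph] by blast
next
  case True
  obtain u where "z = (SUM w:set ws. u w *\<^sub>R w)" using z(1) by (auto simp: span_finite)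
  moreover have "EX w0:set ws. u w0 ~= 0"
  proof (rule ccontr)
    assume "~?thesis"
    hence "(SUM w:set ws. u w *\<^sub>R w) = 0" by (intro sum.neutral) simp
    with calculation z(2) show False by simp
  qed
  ultimately obtain w0 where w0: "w0 : set ws" "u w0 ~= 0" and zu: "z = (SUM w:set ws. u w *\<^sub>R w)" by blast
  then obtain p where p: "p < j" "ws ! p = w0" using True by (auto simp: in_set_conv_nth)
  have lin: "linear (%x. ph (ws[p := x]))" using Alt_linear[OF ph] True p by blast
  have oth: "ph (ws[p := w]) = 0" if w: "w : set ws" "w ~= w0" for w
  proof (rule Alt_not_distinct[OF ph])
    obtain q where q: "q < j" "ws ! q = w" using w True by (auto simp: in_set_conv_nth)
    hence "q ~= p" using p w by auto
    hence "ws[p := w] ! p = ws[p := w] ! q" using p q True by simp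
    thus "~distinct (ws[p := w])" using \<open>q ~= p\<close> p q True by (metis length_list_update nth_eq_iff_index_eq)
  qed
  have "0 = ph (ws[p := z])" using 0[of "ws[p := z]"] p True by (simp add: set_update_memI)
  also have "... = (SUM w:set ws. u w * ph (ws[p := w]))" unfolding zu by (simp add: linear_sum[OF lin] linear_scale[OF lin])
  also have "... = u w0 * ph (ws[p := w0])" using w0(1) oth by (subst sum.remove[OF _ w0(1)]) auto
  also have "ph (ws[p := w0]) = ph ws" using p by auto
  finally show ?thesis using w0 by simp
qed

section \<open>Wedge products of covectors\<close>

text \<open>The value at \<open>vs\<close> is the determinant of the inner products of the two lists
  and thus symmetric in them. This symmetry lets \<open>cow us\<close> represent evaluation at
  \<open>us\<close>.\<close>

definition cow :: "'a::real_inner list => 'a form" where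
  "cow us = wedge (map covec us)"

lemma cow_eq:
  assumes "length vs = length us"
  shows "cow us vs = (SUM p | p permutes {..<length us}.
            of_int (sign p) * (PROD i<length us. (us ! i) \<bullet> (vs ! p i)))"
proof -
  have "(PROD i<length us. (map covec us ! i) [vs ! p i]) = (PROD i<length us. (us ! i) \<bullet> (vs ! p i))" for p by (rule prod.cong) (auto simp: covec_def)
  thus ?thesis using assms by (simp add: wedge_def cow_def)
qed

lemma cow_length: "length vs ~= length us ==> cow us vs = 0" by (simp add: wedge_def cow_def)

lemma cow_commute: "cow us vs = cow vs us"
proof (cases "length vs = length us")
  case False
  thus ?thesis by (simp add: cow_length)
next
  case True
  let ?j = "length us"
  have "cow us vs = (SUM p | p permutes {..<?j}. of_int (sign (inv p)) * (PROD i<?j. (us ! i) \<bullet> (vs ! inv p i)))"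
    unfolding cow_eq[OF True] by (rule sum_permutations_inverse)
  also have "... = (SUM p | p permutes {..<?j}. of_int (sign p) * (PROD i<?j. (vs ! i) \<bullet> (us ! p i)))"
  proof (rule sum.cong[OF refl])
    fix p assume "p : {p. p permutes {..<?j}}"
    hence p: "p permutes {..<?j}" by simp
    have "(PROD i<?j. (us ! i) \<bullet> (vs ! inv p i)) = (PROD i<?j. (us ! p i) \<bullet> (vs ! inv p (p i)))" by (rule prod.permute[OF p, unfolded o_def])
    also have "... = (PROD i<?j. (vs ! i) \<bullet> (us ! p i))" by (simp add: permutes_inverses[OF p] inner_commute)
    finally show "of_int (sign (inv p)) * (PROD i<?j. (us ! i) \<bullet> (vs ! inv p i)) =
        of_int (sign p) * (PROD i<?j. (vs ! i) \<bullet> (us ! p i))" using p by (simp add: sign_inverse permutation_permutes)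
        (metis finite_lessThan permutation_permutes sign_inverse)
  qed
  also have "... = cow vs us" using True by (subst cow_eq) auto
  finally show ?thesis .
qed

lemma cow_zero_orthogonal:
  assumes "z : set vs" "!!u. u : set us ==> u \<bullet> z = 0"
  shows "cow us vs = 0"
proof (cases "length vs = length us")
  case False
  thus ?thesis by (simp add: cow_length)
next
  case True
  obtain q where q: "q < length us" "vs ! q = z" using assms(1) True by (auto simp: in_set_conv_nth)
  have "(PROD i<length us. (us ! i) \<bullet> (vs ! p i)) = 0" if p: "p permutes {..<length us}" for p
  proof (rule prod_zero)
    have "inv p q < length us" using p q permutes_in_image[OF permutes_inv[OF p]] by blast
    moreover have "p (inv p q) = q" using permutes_inverses[OF p] by simp
    ultimately show "EX i:{..<length us}. us ! i \<bullet> vs ! p i = 0" using q assms(2) by (intro bexI[of _ "inv p q"]) auto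
  qed simp
  hence "(SUM p | p permutes {..<length us}.
      of_int (sign p) * (PROD i<length us. (us ! i) \<bullet> (vs ! p i))) = (0::real)" by (intro sum.neutral) simp
  thus ?thesis by (simp only: cow_eq[OF True])
qed

lemma cow_Alt: "cow us : Alt (length us)"
proof -
  let ?j = "length us"
  have lin: "linear (%x. cow us (vs[m := x]))" if len: "length vs = ?j" and m: "m < ?j" for vs m
  proof -
    have "linear (%x. SUM p | p permutes {..<?j}. of_int (sign p) * (PROD i<?j. (us ! i) \<bullet> (vs[m := x] ! p i)))"
    proof (intro linear_compose_sum ballI)
      fix p assume "p : {p. p permutes {..<?j}}"
      hence p: "p permutes {..<?j}" by simp
      let ?m = "inv p m"
      have m': "?m : {..<?j}" using m permutes_in_image[OF permutes_inv[OF p]] by blast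
      have pm: "p ?m = m" using permutes_inverses[OF p] by simp
      have ne: "p i ~= m" if "i ~= ?m" for i using that permutes_inverses[OF p] by metis
      have "(PROD i<?j. (us ! i) \<bullet> (vs[m := x] ! p i)) =
          (us ! ?m \<bullet> x) * (PROD i:{..<?j} - {?m}. (us ! i) \<bullet> (vs ! p i))" for x
      proof (subst prod.remove[OF _ m'])
        have "(PROD i:{..<?j} - {?m}. (us ! i) \<bullet> (vs[m := x] ! p i)) =
            (PROD i:{..<?j} - {?m}. (us ! i) \<bullet> (vs ! p i))" by (intro prod.cong refl) (metis DiffE ne nth_list_update_neq singletonI)
        thus "us ! ?m \<bullet> vs[m := x] ! p ?m * (PROD i:{..<?j} - {?m}. (us ! i) \<bullet> (vs[m := x] ! p i)) =
          (us ! ?m \<bullet> x) * (PROD i:{..<?j} - {?m}. (us ! i) \<bullet> (vs ! p i))" using m len by (simp add: pm)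
      qed simp
      thus "linear (%x. of_int (sign p) * (PROD i<?j. (us ! i) \<bullet> (vs[m := x] ! p i)))" by (intro linearI) (simp_all add: inner_add_right algebra_simps)
    qed
    thus ?thesis using len by (simp add: cow_eq)
  qed
  have dist: "cow us vs = 0" if len: "length vs = ?j" and nd: "~distinct vs" for vs
  proof -
    obtain a b where ab: "a < ?j" "b < ?j" "a ~= b" "vs ! a = vs ! b" using nd len by (auto simp: distinct_conv_nth)
    let ?f = "%p. of_int (sign p) * (PROD i<?j. (us ! i) \<bullet> (vs ! p i))"
    have t: "Transposition.transpose a b permutes {..<?j}" using ab by (simp add: permutes_swap_id)
    \<comment> \<open>Composition with the transposition of the two equal arguments is a bijection
      of the summands that reverses signs.\<close>
    have "sum ?f {p. p permutes {..<?j}} = sum (%p. ?f (Transposition.transpose a b \<circ> p)) {p. p permutes {..<?j}}" by (rule setum_permutations_compose_left[OF t])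
    also have "... = sum (%p. - ?f p) {p. p permutes {..<?j}}"
    proof (rule sum.cong[OF refl])
      fix p assume "p : {p. p permutes {..<?j}}"
      hence p: "p permutes {..<?j}" by simp
      have "sign (Transposition.transpose a b \<circ> p) = - sign p"
        using p t ab by (subst sign_compose) (auto simp: permutation_permutes sign_swap_id)
      moreover have "vs ! Transposition.transpose a b x = vs ! x" for x using ab(4) by (simp add: Transposition.transpose_def)
      ultimately show "?f (Transposition.transpose a b \<circ> p) = - ?f p" by simp
    qed
    also have "... = - sum ?f {p. p permutes {..<?j}}" by (simp add: sum_negf)
    finally show ?thesis by (simp add: cow_eq[OF len])
  qed
  show ?thesis unfolding Alt_def using lin dist cow_length by blast
qed

section \<open>Biorthogonal bases\<close>

text \<open>A t-n basis need not be orthonormal, so components are read off with a second basis.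
  Vectors stand for covectors: \<open>dyh i\<close> will be \<open>covec (bt i)\<close>.\<close>

definition biorth :: "(nat => 'n::finite rvec) => (nat => 'n rvec) => bool" where
  "biorth b bt \<longleftrightarrow> (ALL i:{1..CARD('n)}. ALL j:{1..CARD('n)}. b i \<bullet> bt j = (if i = j then 1 else 0))"

lemma biorth_sym: "biorth b bt ==> biorth bt b" by (auto simp: biorth_def inner_commute)

lemma biorth_unit: "biorth unit_vec (unit_vec :: nat => 'n::{finite,linorder} rvec)" unfolding biorth_def using unit_vec_inner by blast

lemma biorth_span:
  assumes "biorth b (bt :: nat => 'n::finite rvec)"
  shows "span (bt ` {1..CARD('n)}) = UNIV"
proof -
  let ?N = "{1..CARD('n)}"
  have bi: "b i \<bullet> bt j = (if i = j then 1 else 0)" if "i : ?N" "j : ?N" for i j using assms that unfolding biorth_def by blast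
  have inj: "inj_on bt ?N"
  proof (rule inj_onI)
    fix i j assume "i : ?N" "j : ?N" "bt i = bt j"
    thus "i = j" using bi[of i i] bi[of i j] by (auto split: if_splits)
  qed
  have "independent (bt ` ?N)"
  proof (rule independent_if_scalars_zero)
    fix f x assume s: "(SUM x:bt ` ?N. f x *\<^sub>R x) = 0" and "x : bt ` ?N"
    then obtain j where j: "j : ?N" "x = bt j" by blast
    have "0 = b j \<bullet> (SUM i:?N. f (bt i) *\<^sub>R bt i)" using s by (simp only: sum.reindex[OF inj] o_def inner_zero_right)
    also have "... = (SUM i:?N. f (bt i) * (if j = i then 1 else 0))" unfolding inner_sum_right by (rule sum.cong) (use bi j in auto)
    also have "... = (SUM i:?N. if j = i then f (bt i) else 0)" by (rule sum.cong) auto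
    also have "... = f x" using j by simp
    finally show "f x = 0" by simp
  qed simp
  moreover have "card (bt ` ?N) = DIM('n rvec)" using inj by (simp add: card_image)
  ultimately show ?thesis using card_ge_dim_independent[of "bt ` ?N" UNIV] by auto
qed

lemma biorth_expand:
  assumes "biorth b (bt :: nat => 'n::finite rvec)"
  shows "x = (SUM i:{1..CARD('n)}. (b i \<bullet> x) *\<^sub>R bt i)"
proof -
  let ?N = "{1..CARD('n)}"
  have bi: "b i \<bullet> bt j = (if i = j then 1 else 0)" if "i : ?N" "j : ?N" for i j using assms that unfolding biorth_def by blast
  have lin: "linear (%x. x - (SUM i:?N. (b i \<bullet> x) *\<^sub>R bt i))" by (intro linear_compose_sub linear_id linear_compose_sum ballI linearI)
       (simp_all add: inner_add_right algebra_simps)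
  have van: "bt j - (SUM i:?N. (b i \<bullet> bt j) *\<^sub>R bt i) = 0" if j: "j : ?N" for j
  proof -
    have "(SUM i:?N. (b i \<bullet> bt j) *\<^sub>R bt i) = (SUM i:?N. if i = j then bt j else 0)" using bi j by (intro sum.cong) auto
    thus ?thesis using j by simp
  qed
  have "x - (SUM i:?N. (b i \<bullet> x) *\<^sub>R bt i) = 0"
  proof (rule linear_eq_0_on_span[OF lin])
    show "x : span (bt ` ?N)" unfolding biorth_span[OF assms] by simp
  qed (use van in blast)
  thus ?thesis by simp
qed

abbreviation bvecs :: "(nat => 'a) => nat set => 'a list" where
  "bvecs bt sg \<equiv> map bt (sorted_list_of_set sg)"

lemma finite_Sig [simp]: "finite (Sig n j)" by (rule finite_subset[of _ "Pow {1..n}"]) (auto simp: Sig_def)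

lemma Sig_finite: "sg : Sig n j ==> finite sg" by (auto simp: Sig_def intro: finite_subset)

lemma Sig_subset: "sg : Sig n j ==> sg <= {1..n}" by (simp add: Sig_def)

lemma length_bvecs: "sg : Sig n j ==> length (bvecs bt sg) = j" by (simp add: Sig_def)

lemma length_unit_vecs: "sg : Sig n j ==> length (unit_vecs sg) = j" by (simp add: Sig_def unit_vecs_def)

lemma cow_biorth:
  assumes bi: "biorth b (bt :: nat => 'n::finite rvec)"
    and sg: "sg : Sig CARD('n) j" and rh: "rh : Sig CARD('n) j"
  shows "cow (bvecs b sg) (bvecs bt rh) = (if sg = rh then 1 else 0)"
proof (cases "sg = rh")
  case False
  obtain m where m: "m : rh" "m ~: sg" using False sg rh card_subset_eq[of sg rh] Sig_finite[OF sg] by (auto simp: Sig_def)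
  have "cow (bvecs b sg) (bvecs bt rh) = 0"
  proof (rule cow_zero_orthogonal)
    show "bt m : set (bvecs bt rh)" using m Sig_finite[OF rh] by simp
    fix u assume "u : set (bvecs b sg)"
    then obtain i where "i : sg" "u = b i" using Sig_finite[OF sg] by auto
    moreover have "i : {1..CARD('n)}" "m : {1..CARD('n)}" using \<open>i : sg\<close> m(1) Sig_subset[OF sg] Sig_subset[OF rh] by blast+
    ultimately show "u \<bullet> bt m = 0" using bi m unfolding biorth_def by auto
  qed
  thus ?thesis using False by simp
next
  case True
  define xs where "xs = sorted_list_of_set sg"
  have len: "length xs = j" and dist: "distinct xs" and set: "set xs = sg" using sg Sig_finite[OF sg] by (simp_all add: xs_def Sig_def)
  have rng: "xs ! i : {1..CARD('n)}" if "i < j" for i using that len set Sig_subset[OF sg] nth_mem by blast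
  have "cow (bvecs b sg) (bvecs bt sg) =
      (SUM p | p permutes {..<j}. of_int (sign p) * (PROD i<j. if xs ! i = xs ! p i then 1 else 0))"
  proof -
    have "(PROD i<j. (map b xs ! i) \<bullet> (map bt xs ! p i)) = (PROD i<j. if xs ! i = xs ! p i then 1 else (0::real))"
      if "p permutes {..<j}" for p
    proof (rule prod.cong[OF refl])
      fix i assume "i : {..<j}"
      moreover from this have "p i < j" using permutes_in_image[OF that] by blast
      ultimately show "(map b xs ! i) \<bullet> (map bt xs ! p i) = (if xs ! i = xs ! p i then 1 else 0)"
        using len rng bi unfolding biorth_def by simp
    qed
    thus ?thesis using len by (subst cow_eq) (auto simp flip: xs_def)
  qed
  also have "... = (SUM p | p permutes {..<j}. if p = id then 1 else 0)"
  proof (rule sum.cong[OF refl])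
    fix p assume "p : {p. p permutes {..<j}}"
    hence p: "p permutes {..<j}" by simp
    show "of_int (sign p) * (PROD i<j. if xs ! i = xs ! p i then 1 else 0) = (if p = id then 1 else (0::real))"
    proof (cases "ALL i<j. xs ! i = xs ! p i")
      case True
      have "p i = i" for i
      proof (cases "i < j")
        case i: True
        hence "p i < j" using permutes_in_image[OF p] by blast
        thus ?thesis using True i len dist nth_eq_iff_index_eq by metis
      next
        case False
        thus ?thesis using p by (simp add: permutes_def)
      qed
      hence "p = id" by auto
      thus ?thesis by simp
    next
      case False
      hence "(PROD i<j. if xs ! i = xs ! p i then 1 else (0::real)) = 0" by (intro prod_zero) auto
      with False show ?thesis by auto
    qed
  qed
  also have "... = 1" by (simp add: permutes_id finite_permutations)
  finally show ?thesis using True by simp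
qed

lemma Alt_eqI_basis:
  assumes bi: "biorth b (bt :: nat => 'n::finite rvec)" and "ph : Alt j" "ps : Alt j"
    and "!!sg. sg : Sig CARD('n) j ==> ph (bvecs bt sg) = ps (bvecs bt sg)"
  shows "ph = ps"
proof
  fix vs
  show "ph vs = ps vs" using Alt_eq_zero_basis[OF Alt_diff[OF assms(2,3)] biorth_span[OF bi], of vs] assms(4) by simp
qed

lemma Alt_expand:
  assumes bi: "biorth b (bt :: nat => 'n::finite rvec)" and ph: "ph : Alt j"
  shows "ph vs = (SUM sg:Sig CARD('n) j. ph (bvecs bt sg) * cow (bvecs b sg) vs)"
proof -
  have "ph = (%vs. SUM sg:Sig CARD('n) j. ph (bvecs bt sg) * cow (bvecs b sg) vs)"
  proof (rule Alt_eqI_basis[OF bi ph])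
    show "(%vs. SUM sg:Sig CARD('n) j. ph (bvecs bt sg) * cow (bvecs b sg) vs) : Alt j" by (intro Alt_sum Alt_scale) (use cow_Alt length_bvecs in metis)
    fix sg assume sg: "sg : Sig CARD('n) j"
    have "(SUM rh:Sig CARD('n) j. ph (bvecs bt rh) * cow (bvecs b rh) (bvecs bt sg)) =
        (SUM rh:Sig CARD('n) j. if rh = sg then ph (bvecs bt rh) else 0)" by (rule sum.cong) (auto simp: cow_biorth[OF bi _ sg])
    thus "ph (bvecs bt sg) = (SUM rh:Sig CARD('n) j. ph (bvecs bt rh) * cow (bvecs b rh) (bvecs bt sg))" using sg by simp
  qed
  thus ?thesis by (rule fun_cong)
qed

text \<open>Reproducing property: in the expansion of \<open>ph us\<close> the coefficients are the
  values of \<open>cow us\<close>. Testing with the wedge of dual covectors therefore evaluates a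
  form at the dual vectors.\<close>

lemma form_inner_cow:
  assumes ph: "ph : Alt j"
  shows "form_inner j ph (cow us) = ph (us :: 'n::{finite,linorder} rvec list)"
proof -
  have "ph us = (SUM sg:Sig CARD('n) j. ph (unit_vecs sg) * cow us (unit_vecs sg))" by (subst Alt_expand[OF biorth_unit ph]) (simp add: unit_vecs_def cow_commute)
  thus ?thesis by (simp add: form_inner_def)
qed

lemma Alt2_left: "om : Alt2 j m ==> (%ws. om (ws, vs)) : Alt j" by (simp add: Alt2_def)

lemma Alt2_right: "om : Alt2 j m ==> (%vs. om (ws, vs)) : Alt m" by (simp add: Alt2_def)

lemma dform_inner_cow:
  assumes om: "om : Alt2 j m"
  shows "dform_inner j m om (form_tensor (cow us) (cow vs)) = om (us, vs :: 'n::{finite,linorder} rvec list)"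
proof -
  have "dform_inner j m om (form_tensor (cow us) (cow vs)) =
      (SUM sg:Sig CARD('n) j. form_inner m (%vs. om (unit_vecs sg, vs)) (cow vs) * cow us (unit_vecs sg))" by (simp add: dform_inner_def form_inner_def form_tensor_def sum_distrib_right sum_distrib_left mult_ac)
  also have "... = form_inner j (%ws. om (ws, vs)) (cow us)" by (simp add: form_inner_cow[OF Alt2_right[OF om]]) (simp add: form_inner_def)
  also have "... = om (us, vs)" by (rule form_inner_cow[OF Alt2_left[OF om]])
  finally show ?thesis .
qed

declare One_nat_def [simp del] upt_Suc [simp del]

section \<open>The volume form and the Hodge star\<close>

lemma Alt_Cons:
  assumes ph: "ph : Alt (Suc j)"
  shows "(%ws. ph (w # ws)) : Alt j" unfolding Alt_def mem_Collect_eq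
proof (intro conjI allI impI)
  fix vs :: "'a list" and i assume "length vs = j" "i < j"
  thus "linear (%x. ph (w # vs[i := x]))" using Alt_linear[OF ph, of "w # vs" "Suc i"] by simp
qed (auto intro: Alt_length[OF ph] Alt_not_distinct[OF ph])

lemma Alt_Cons_linear:
  assumes ph: "ph : Alt (Suc j)"
  shows "linear (%x. ph (x # ws))"
proof (cases "length ws = j")
  case True
  thus ?thesis using Alt_linear[OF ph, of "x # ws" 0 for x] by simp
next
  case False
  hence "(%x. ph (x # ws)) = (%x. 0)" using Alt_length[OF ph] by auto
  thus ?thesis by (simp add: linear_zero)
qed

lemma bvecs_full: "bvecs bt {1..n} = map bt [1..<Suc n]" by (simp del: upt_Suc flip: atLeastLessThanSuc_atLeastAtMost)

lemma bvecs_omit: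
  assumes "i : {1..n}"
  shows "bvecs bt ({1..n} - {i}) = take (i - 1) (bvecs bt {1..n}) @ drop i (bvecs bt {1..n})"
proof -
  have "[1..<Suc n] = [1..<i] @ i # [Suc i..<Suc n]"
    using assms by (metis atLeastAtMost_iff le_imp_less_Suc less_imp_le_nat upt_conv_Cons upt_add_eq_append le_Suc_ex)
  hence "remove1 i [1..<Suc n] = [1..<i] @ [Suc i..<Suc n]" by (simp add: remove1_append del: upt_Suc)
  moreover have "sorted_list_of_set ({1..n} - {i}) = remove1 i [1..<Suc n]" by (subst sorted_list_of_set_remove)
      (simp_all del: upt_Suc flip: atLeastLessThanSuc_atLeastAtMost)
  ultimately show ?thesis using assms by (simp add: bvecs_full take_map drop_map take_upt drop_upt plus_1_eq_Suc)
qed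

lemma Sig_omitE:
  assumes "sg : Sig n (n - 1)" "n >= 1"
  obtains i where "i : {1..n}" "sg = {1..n} - {i}"
proof -
  have "card ({1..n} - sg) = 1" using assms Sig_finite[OF assms(1)] by (simp add: Sig_def card_Diff_subset)
  then obtain i where i: "{1..n} - sg = {i}" using card_1_singletonE by blast
  hence "i : {1..n}" "sg = {1..n} - {i}" using Sig_subset[OF assms(1)] by auto
  thus thesis by (rule that)
qed

definition vol :: "'n::{finite,linorder} rvec form" where
  "vol = cow (unit_vecs {1..CARD('n)})"

lemma full_Sig: "{1..n} : Sig n n" by (simp add: Sig_def)

lemma Sig_full: "sg : Sig n n ==> sg = {1..n}" by (simp add: Sig_def card_subset_eq)

lemma vol_Alt: "(vol :: 'n::{finite,linorder} rvec form) : Alt CARD('n)"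
  unfolding vol_def using cow_Alt[of "unit_vecs {1..CARD('n)} :: 'n rvec list"] by (simp add: length_unit_vecs[OF full_Sig])

lemma vol_unit: "vol (bvecs unit_vec {1..CARD('n)} :: 'n::{finite,linorder} rvec list) = 1"
  unfolding vol_def unit_vecs_def by (subst cow_biorth[OF biorth_unit full_Sig full_Sig]) simp

lemma vol_basis_nonzero:
  assumes bi: "biorth b (bt :: nat => 'n::{finite,linorder} rvec)"
  shows "vol (bvecs bt {1..CARD('n)}) ~= 0"
proof
  assume z: "vol (bvecs bt {1..CARD('n)}) = 0"
  have "vol (bvecs unit_vec {1..CARD('n)} :: 'n rvec list) = 0" by (rule Alt_eq_zero_basis[OF vol_Alt biorth_span[OF bi]]) (use z Sig_full in blast)
  thus False by (simp add: vol_unit)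
qed

lemma nth_bvecs_full: "i < n ==> bvecs bt {1..n} ! i = bt (Suc i)" by (simp add: bvecs_full plus_1_eq_Suc)

lemma nth_sorted_full [simp]: "i < n ==> sorted_list_of_set {1..n} ! i = Suc i" by (simp add: plus_1_eq_Suc flip: atLeastLessThanSuc_atLeastAtMost)

lemma length_bvecs_full [simp]: "length (bvecs bt {1..n}) = n" by simp

text \<open>Expanding \<open>x\<close> in the basis, every member except the one replaced gives a
  repeated argument. Positions count from 0 and indices from 1, hence \<open>Suc i\<close>.\<close>

lemma vol_update:
  assumes bi: "biorth b (bt :: nat => 'n::{finite,linorder} rvec)" and i: "i < CARD('n)"
  shows "vol ((bvecs bt {1..CARD('n)})[i := x]) = (b (Suc i) \<bullet> x) * vol (bvecs bt {1..CARD('n)})"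
proof -
  let ?L = "bvecs bt {1..CARD('n)}"
  have lin: "linear (%x. vol (?L[i := x]))" by (rule Alt_linear[OF vol_Alt length_bvecs_full i])
  have j: "vol (?L[i := bt j]) = (if j = Suc i then vol ?L else 0)" if "j : {1..CARD('n)}" for j
  proof (cases "j = Suc i")
    case True
    have "?L[i := bt (Suc i)] = ?L" using nth_bvecs_full[OF i, of bt] by (metis list_update_id)
    thus ?thesis using True by simp
  next
    case False
    have "?L[i := bt j] ! i = ?L[i := bt j] ! (j - 1)" using that i False nth_bvecs_full[of "j - 1" "CARD('n)" bt] by auto
    moreover have "j - 1 ~= i" "j - 1 < length (?L[i := bt j])" "i < length (?L[i := bt j])" using that i False by auto
    ultimately have "~distinct (?L[i := bt j])" using distinct_conv_nth by blast
    thus ?thesis using False Alt_not_distinct[OF vol_Alt] by simp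
  qed
  have "vol (?L[i := x]) = (SUM j:{1..CARD('n)}. (b j \<bullet> x) * vol (?L[i := bt j]))" by (subst biorth_expand[OF bi, of x]) (simp only: linear_sum[OF lin] linear_scale[OF lin] real_scaleR_def)
  also have "... = (SUM j:{1..CARD('n)}. if j = Suc i then (b j \<bullet> x) * vol ?L else 0)" by (rule sum.cong) (simp_all add: j del: One_nat_def)
  also have "... = (b (Suc i) \<bullet> x) * vol ?L" using i by simp
  finally show ?thesis .
qed

text \<open>Cramer's rule, without assuming the vectors independent.\<close>

lemma sum_vol_update:
  assumes lf: "linear lf" and vs: "length vs = CARD('n)"
  shows "(SUM i<CARD('n). lf (vs ! i) * vol (vs[i := w])) = (lf w :: real) * vol (vs :: 'n::{finite,linorder} rvec list)"
proof -
  let ?n = "CARD('n)"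
  \<comment> \<open>Both sides are alternating in \<open>vs\<close>, so it suffices to compare them
    at the unit vectors, where the claim is the expansion of \<open>w\<close>. The case distinction
    makes \<open>G\<close> obey the convention on lists of wrong length.\<close>
  define G where "G vs = (if length vs = ?n then SUM i<?n. lf (vs ! i) * vol (vs[i := w]) else 0)" for vs :: "'n rvec list"
  have "G : Alt ?n" unfolding Alt_def mem_Collect_eq
  proof (intro conjI allI impI)
    fix vs :: "'n rvec list" and m assume len: "length vs = ?n" and m: "m < ?n"
    have "linear (%x. lf (vs[m := x] ! i) * vol (vs[m := x, i := w]))" if i: "i < ?n" for i
    proof (cases "i = m")
      case True
      hence "(%x. lf (vs[m := x] ! i) * vol (vs[m := x, i := w])) = (%x. vol (vs[m := w]) * lf x)" using len m by auto
      thus ?thesis using linear_compose_scale_right[OF lf, of "vol (vs[m := w])"] by simp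
    next
      case False
      hence "(%x. lf (vs[m := x] ! i) * vol (vs[m := x, i := w])) = (%x. lf (vs ! i) *\<^sub>R vol (vs[i := w, m := x]))" by (simp add: list_update_swap)
      moreover have "linear (%x. lf (vs ! i) *\<^sub>R vol (vs[i := w, m := x]))" by (rule linear_compose_scale_right, rule Alt_linear[OF vol_Alt]) (use len m in auto)
      ultimately show ?thesis by simp
    qed
    hence "linear (%x. SUM i<?n. lf (vs[m := x] ! i) * vol (vs[m := x, i := w]))" by (intro linear_compose_sum) auto
    thus "linear (%x. G (vs[m := x]))" by (simp add: G_def len)
  next
    fix vs :: "'n rvec list" assume len: "length vs = ?n" and nd: "~distinct vs"
    then obtain p q where pq: "p < ?n" "q < ?n" "p ~= q" "vs ! p = vs ! q" by (auto simp: distinct_conv_nth)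
    have 0: "vol (vs[i := w]) = 0" if "i ~= p" "i ~= q" for i
    proof (rule Alt_not_distinct[OF vol_Alt])
      have "vs[i := w] ! p = vs[i := w] ! q" using that pq by simp
      thus "~distinct (vs[i := w])" using pq len by (metis length_list_update nth_eq_iff_index_eq)
    qed
    \<comment> \<open>If two arguments are equal, only their own two terms remain, and these differ
      by a swap.\<close>
    have "(SUM i<?n. lf (vs ! i) * vol (vs[i := w])) = (SUM i:{p, q}. lf (vs ! i) * vol (vs[i := w]))" by (rule sum.mono_neutral_right) (use pq 0 in auto)
    also have "... = lf (vs ! p) * (vol (vs[p := w]) + vol (vs[q := w]))" using pq by (simp add: algebra_simps)
    also have "vol (vs[p := w]) = - vol (vs[q := w])"
    proof -
      have "vs[p := w, q := vs ! p] = vs[q := vs ! p, p := w]" by (rule list_update_swap) (use pq in simp)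
      also have "... = vs[p := w]" by (simp add: pq(4))
      finally show ?thesis using Alt_swap[OF vol_Alt pq(1-3) len, of w "vs ! p"] by simp
    qed
    finally show "G vs = 0" by (simp add: G_def)
  qed (simp add: G_def)
  moreover have "(%vs :: 'n rvec list. lf w * vol vs) : Alt ?n" by (rule Alt_scale[OF vol_Alt])
  ultimately have Geq: "G = (%vs. lf w * vol vs)"
  proof (rule Alt_eqI_basis[OF biorth_unit])
    fix sg assume "sg : Sig ?n ?n"
    hence sg: "sg = {1..?n}" by (rule Sig_full)
    have "G (bvecs unit_vec {1..?n}) = (SUM i<?n. lf (unit_vec (Suc i)) * (unit_vec (Suc i) \<bullet> w))"
      unfolding G_def by (simp add: nth_bvecs_full vol_update[OF biorth_unit] vol_unit del: One_nat_def)
    also have "... = (SUM i:{1..?n}. lf (unit_vec i) * (unit_vec i \<bullet> w))" by (rule sum.reindex_bij_witness[of _ "%i. i - 1" Suc]) auto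
    also have "... = lf (SUM i:{1..?n}. (unit_vec i \<bullet> w) *\<^sub>R unit_vec i)" by (simp add: linear_sum[OF lf] linear_scale[OF lf] mult.commute)
    also have "... = lf w" by (subst (2) biorth_expand[OF biorth_unit, of w]) simp
    finally show "G (bvecs unit_vec sg) = lf w * vol (bvecs unit_vec sg :: 'n rvec list)" by (simp only: sg vol_unit mult_1_right)
  qed
  have "G vs = lf w * vol vs" by (simp only: Geq)
  thus ?thesis using vs by (simp add: G_def)
qed

text \<open>The interior product of the volume form with \<open>w\<close>. These are all the (n -
  1)-forms, so the second factor of a double form can be replaced by a vector.\<close>

definition hook :: "'n::{finite,linorder} rvec => 'n rvec form" where
  "hook w = (%vs. vol (w # vs))"

text \<open>The vector corresponding to an \<open>(n - 1)\<close>-form: $\mathrm dx_i$-components of the Hodge star.\<close>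

definition starv :: "'n::{finite,linorder} rvec form => 'n rvec" where
  "starv ps = (SUM i:{1..CARD('n)}. ((-1) ^ (i - 1) * ps (unit_vecs ({1..CARD('n)} - {i}))) *\<^sub>R unit_vec i)"

lemma hook_Alt: "hook w : Alt (CARD('n) - 1)" for w :: "'n::{finite,linorder} rvec" unfolding hook_def using vol_Alt by (intro Alt_Cons) simp

text \<open>Moving \<open>w\<close> into the gap produces the sign of the Hodge star, and Cramer's
  rule produces the component along the dual vector. This works for bases that are not orthonormal,
  as t-n bases require.\<close>

lemma hook_omit:
  assumes bi: "biorth b (bt :: nat => 'n::{finite,linorder} rvec)" and i: "i : {1..CARD('n)}"
  shows "hook w (bvecs bt ({1..CARD('n)} - {i})) =
    (-1) ^ (i - 1) * ((b i \<bullet> w) * vol (bvecs bt {1..CARD('n)}))"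
proof -
  let ?L = "bvecs bt {1..CARD('n)}"
  have "hook w (bvecs bt ({1..CARD('n)} - {i})) = vol (w # take (i - 1) ?L @ drop (Suc (i - 1)) ?L)" using i by (simp add: hook_def bvecs_omit)
  also have "... = (-1) ^ (i - 1) * vol (?L[i - 1 := w])" by (rule Alt_move[OF vol_Alt length_bvecs_full]) (use i in auto)
  also have "vol (?L[i - 1 := w]) = (b i \<bullet> w) * vol ?L" using vol_update[OF bi, of "i - 1" w] i by (auto simp del: One_nat_def)
  finally show ?thesis .
qed

lemma inner_starv_unit:
  fixes ps :: "'n::{finite,linorder} rvec form"
  assumes i: "i : {1..CARD('n)}"
  shows "unit_vec i \<bullet> starv ps = (-1) ^ (i - 1) * ps (unit_vecs ({1..CARD('n)} - {i}))"
proof -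
  have "unit_vec i \<bullet> starv ps = (SUM j:{1..CARD('n)}. if j = i then (-1) ^ (i - 1) * ps (unit_vecs ({1..CARD('n)} - {i})) else 0)"
    unfolding starv_def inner_sum_right by (rule sum.cong) (use i unit_vec_inner[OF i] in \<open>auto simp del: One_nat_def\<close>)
  thus ?thesis using i by simp
qed

lemma eq_by_unit:
  assumes "!!i. i : {1..CARD('n)} ==> unit_vec i \<bullet> x = unit_vec i \<bullet> y"
  shows "x = (y :: 'n::{finite,linorder} rvec)"
proof -
  have "x = (SUM i:{1..CARD('n)}. (unit_vec i \<bullet> x) *\<^sub>R unit_vec i)" by (rule biorth_expand[OF biorth_unit])
  also have "... = (SUM i:{1..CARD('n)}. (unit_vec i \<bullet> y) *\<^sub>R unit_vec i)" by (rule sum.cong) (simp_all add: assms)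
  also have "... = y" by (rule biorth_expand[OF biorth_unit, symmetric])
  finally show ?thesis .
qed

lemma starv_hook: "starv (hook w) = (w :: 'n::{finite,linorder} rvec)"
proof (rule eq_by_unit)
  fix i assume i: "i : {1..CARD('n)}"
  have "unit_vec i \<bullet> starv (hook w) = (-1) ^ (i - 1) * ((-1) ^ (i - 1) * ((unit_vec i \<bullet> w) * 1))"
    unfolding inner_starv_unit[OF i] unit_vecs_def hook_omit[OF biorth_unit i] vol_unit ..
  also have "... = ((-1) ^ (i - 1) * (-1) ^ (i - 1)) * (unit_vec i \<bullet> w)" by (simp only: mult.assoc mult_1_right)
  also have "(-1) ^ (i - 1) * (-1) ^ (i - 1) = (1::real)" by (simp flip: power_add mult_2)
  finally show "unit_vec i \<bullet> starv (hook w) = unit_vec i \<bullet> w" by simp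
qed

lemma hook_starv:
  fixes ps :: "'n::{finite,linorder} rvec form"
  assumes ps: "ps : Alt (CARD('n) - 1)"
  shows "ps = hook (starv ps)"
proof (rule Alt_eqI_basis[OF biorth_unit ps hook_Alt])
  fix sg assume "sg : Sig CARD('n) (CARD('n) - 1)"
  then obtain i where i: "i : {1..CARD('n)}" "sg = {1..CARD('n)} - {i}" by (rule Sig_omitE) (simp_all add: Suc_le_eq One_nat_def)
  have "hook (starv ps) (bvecs unit_vec sg) = ((-1) ^ (i - 1) * (-1) ^ (i - 1)) * ps (bvecs unit_vec sg)"
    unfolding i(2) hook_omit[OF biorth_unit i(1)] inner_starv_unit[OF i(1)] vol_unit unit_vecs_def by (simp only: mult.assoc mult_1_right)
  also have "(-1) ^ (i - 1) * (-1) ^ (i - 1) = (1::real)" by (simp flip: power_add mult_2)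
  finally show "ps (bvecs unit_vec sg) = hook (starv ps) (bvecs unit_vec sg)" by simp
qed

lemma starv_add: "starv (%vs. ph vs + ps vs) = starv ph + starv ps" by (simp add: starv_def algebra_simps sum.distrib)

lemma starv_scale: "starv (%vs. c * ph vs) = c *\<^sub>R starv ph" by (simp add: starv_def scaleR_sum_right mult_ac)

section \<open>Double forms as vector-valued forms\<close>

definition vf :: "'n::{finite,linorder} rvec dform => 'n rvec list => 'n rvec" where
  "vf om ws = starv (%vs. om (ws, vs))"

lemma vf_add: "vf (%a. om a + et a) ws = vf om ws + vf et ws" by (simp add: vf_def starv_add)

lemma vf_scale: "vf (%a. c * om a) ws = c *\<^sub>R vf om ws" by (simp add: vf_def starv_scale)

lemma vf_diff: "vf (%a. om a - et a) ws = vf om ws - vf et ws" using vf_add[of om "%a. -1 * et a" ws] by (simp add: vf_scale[of "-1" et, simplified])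

lemma vf_zero: "vf (%a. 0) ws = 0" by (simp add: vf_def starv_def)

lemma vf_sum: "vf (%a. SUM i:I. om i a) ws = (SUM i:I. vf (om i) ws)" by (induction I rule: infinite_finite_induct) (simp_all add: vf_zero vf_add)

lemma vf_Alt:
  fixes om :: "'n::{finite,linorder} rvec dform"
  assumes om: "om : Alt2 k m"
  shows "(%ws. nk \<bullet> vf om ws) : Alt k"
proof -
  have "(%ws. SUM i:{1..CARD('n)}. ((-1) ^ (i - 1) * (nk \<bullet> unit_vec i)) * om (ws, unit_vecs ({1..CARD('n)} - {i}))) : Alt k" by (intro Alt_sum Alt_scale Alt2_left[OF om])
  moreover have "(%ws. nk \<bullet> vf om ws) = (%ws. SUM i:{1..CARD('n)}. ((-1) ^ (i - 1) * (nk \<bullet> unit_vec i)) * om (ws, unit_vecs ({1..CARD('n)} - {i})))" by (simp add: vf_def starv_def inner_sum_right mult_ac)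
  ultimately show ?thesis by simp
qed

lemma Alt2_eq_zero:
  fixes om :: "'n::{finite,linorder} rvec dform"
  assumes om: "om : Alt2 k (CARD('n) - 1)"
    and z: "!!sg. sg : Sig CARD('n) k ==> vf om (unit_vecs sg) = 0"
  shows "om a = 0"
proof -
  have "om (unit_vecs sg, vs) = 0" if "sg : Sig CARD('n) k" for sg vs
  proof -
    have "om (unit_vecs sg, vs) = hook 0 vs"
      using fun_cong[OF hook_starv[OF Alt2_right[OF om, of "unit_vecs sg"]], of vs] z[OF that] by (simp add: vf_def)
    also have "... = 0" unfolding hook_def using linear_0[OF Alt_Cons_linear, of vol "CARD('n) - 1" vs] vol_Alt by simp
    finally show ?thesis .
  qed
  hence "om (ws, vs) = 0" for ws vs using Alt_eq_zero_basis[OF Alt2_left[OF om] biorth_span[OF biorth_unit], of vs ws] by (simp add: unit_vecs_def)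
  thus ?thesis by (cases a) simp
qed

lemma wedge_ix_dx_eq: "wedge_ix dx sg = cow (unit_vecs sg)" by (simp add: wedge_ix_def cow_def unit_vecs_def comp_def)

lemma trace_eq_vf:
  fixes om :: "'n::{finite,linorder} rvec dform"
  assumes om: "om : Alt2 k (CARD('n) - 1)"
  shows "(SUM sg:Sig CARD('n) k. (SUM i:{1..CARD('n)}. coef om sg i * (nk \<bullet> unit_vec i)) * wedge_ix dx sg ws) = nk \<bullet> vf om ws"
proof -
  have "(SUM i:{1..CARD('n)}. coef om sg i * (nk \<bullet> unit_vec i)) = nk \<bullet> vf om (unit_vecs sg)" for sg by (simp add: coef_def vf_def starv_def inner_sum_right)
  thus ?thesis by (subst Alt_expand[OF biorth_unit vf_Alt[OF om]]) (simp add: wedge_ix_dx_eq unit_vecs_def)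
qed

lemma coef_sum_vf: "(SUM i:{1..CARD('n)}. coef om sg i * (nk \<bullet> unit_vec i)) = nk \<bullet> vf om (unit_vecs sg)"
  for om :: "'n::{finite,linorder} rvec dform" by (simp add: coef_def vf_def starv_def inner_sum_right)

lemma wedge_ix_dual:
  assumes "!!i. i : {1..n} ==> dyh i = covec (bt i)" "sg <= {1..n}"
  shows "wedge_ix dyh sg = cow (bvecs bt sg)"
proof -
  have "finite sg" using assms(2) finite_subset by auto
  hence "map dyh (sorted_list_of_set sg) = map (%i. covec (bt i)) (sorted_list_of_set sg)" using assms by auto
  thus ?thesis by (simp only: wedge_ix_def cow_def map_map comp_def)
qed

text \<open>The wedge in the first factor evaluates \<open>om\<close> at dual vectors, and the dual
  vector missing in the second factor leaves the component along \<open>b i\<close>. The two signs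
  cancel and the volume is a nonzero constant, so the tests of (b) correspond to single
  components.\<close>

lemma dform_inner_dual:
  fixes om :: "'n::{finite,linorder} rvec dform"
  assumes om: "om : Alt2 k (CARD('n) - 1)" and bi: "biorth b bt"
    and dyh: "!!i. i : {1..CARD('n)} ==> dyh i = covec (bt i)"
    and sg: "sg : Sig CARD('n) k" and i: "i : {1..CARD('n)}"
  shows "dform_inner k (CARD('n) - 1) om (form_tensor (wedge_ix dyh sg) (star_ix CARD('n) dyh i)) =
    vol (bvecs bt {1..CARD('n)}) * (b i \<bullet> vf om (bvecs bt sg))"
proof -
  let ?N = "{1..CARD('n)}"
  have w: "wedge_ix dyh rh = cow (bvecs bt rh)" if "rh <= ?N" for rh by (rule wedge_ix_dual[OF dyh that])
  have "dform_inner k (CARD('n) - 1) om (form_tensor (wedge_ix dyh sg) (star_ix CARD('n) dyh i)) =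
      (-1) ^ (i - 1) * dform_inner k (CARD('n) - 1) om (form_tensor (cow (bvecs bt sg)) (cow (bvecs bt (?N - {i}))))"
    unfolding star_ix_def w[OF Sig_subset[OF sg]] w[OF Diff_subset] by (simp add: dform_inner_def form_tensor_def sum_distrib_left mult_ac)
  also have "... = (-1) ^ (i - 1) * om (bvecs bt sg, bvecs bt (?N - {i}))" by (simp only: dform_inner_cow[OF om])
  also have "om (bvecs bt sg, bvecs bt (?N - {i})) = hook (vf om (bvecs bt sg)) (bvecs bt (?N - {i}))"
    unfolding vf_def using fun_cong[OF hook_starv[OF Alt2_right[OF om]]] .
  also have "... = (-1) ^ (i - 1) * ((b i \<bullet> vf om (bvecs bt sg)) * vol (bvecs bt ?N))" by (rule hook_omit[OF bi i])
  finally show ?thesis by (simp only: flip: mult.assoc power_add mult_2) (simp add: mult.commute)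
qed

section \<open>Dual bases of covectors and their vectors\<close>

lemma covec_eq_cow: "covec v = cow [v]"
proof
  fix ws
  show "covec v ws = cow [v] ws"
  proof (cases "length ws = 1")
    case True
    then obtain x where "ws = [x]" by (auto simp: length_Suc_conv One_nat_def)
    thus ?thesis by (simp add: cow_eq covec_def lessThan_Suc)
  qed (simp add: covec_def cow_length)
qed

lemma form_inner_covec:
  assumes "ph : Alt 1"
  shows "form_inner 1 ph (covec v) = ph [v :: 'n::{finite,linorder} rvec]" unfolding covec_eq_cow by (rule form_inner_cow[OF assms])

lemma Alt_1_covec:
  fixes ph :: "'n::{finite,linorder} rvec form"
  assumes ph: "ph : Alt 1"
  obtains w where "ph = covec w"
proof
  let ?w = "SUM j:{1..CARD('n)}. ph [unit_vec j] *\<^sub>R unit_vec j"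
  show "ph = covec ?w"
  proof
    fix ws
    show "ph ws = covec ?w ws"
    proof (cases "length ws = 1")
      case True
      then obtain x where x: "ws = [x]" by (auto simp: length_Suc_conv One_nat_def)
      have lin: "linear (%x. ph [x])" using Alt_Cons_linear[of ph 0 "[]"] ph by (simp add: One_nat_def)
      have "ph [x] = (SUM j:{1..CARD('n)}. (unit_vec j \<bullet> x) * ph [unit_vec j])" by (subst biorth_expand[OF biorth_unit, of x])
          (simp only: linear_sum[OF lin] linear_scale[OF lin] real_scaleR_def)
      thus ?thesis by (simp add: x covec_def inner_sum_left mult.commute)
    qed (simp add: Alt_length[OF ph] covec_def)
  qed
qed

text \<open>\<open>dual_basis\<close> speaks of forms; each 1-form is the inner product with a
  vector, and these vectors form the dual basis.\<close>

lemma dual_basis_biorth: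
  fixes b :: "nat => 'n::{finite,linorder} rvec"
  assumes "dual_basis (%i. covec (b i)) dyh"
  obtains bt where "biorth b bt" "!!i. i : {1..CARD('n)} ==> dyh i = covec (bt i)"
proof -
  have "EX w. dyh i = covec w" if "i : {1..CARD('n)}" for i using Alt_1_covec[of "dyh i"] assms that unfolding dual_basis_def by blast
  then obtain bt where bt: "!!i. i : {1..CARD('n)} ==> dyh i = covec (bt i)" by metis
  have "b i \<bullet> bt j = (if i = j then 1 else 0)" if ij: "i : {1..CARD('n)}" "j : {1..CARD('n)}" for i j
  proof -
    have "form_inner 1 (dyh j) (covec (b i)) = (if j = i then 1 else 0)" "dyh j : Alt 1" using assms ij unfolding dual_basis_def by blast+
    hence "covec (bt j) [b i] = (if j = i then 1 else 0)" using form_inner_covec bt[OF ij(2)] by metis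
    thus ?thesis by (auto simp: covec_def inner_commute)
  qed
  hence "biorth b bt" unfolding biorth_def by blast
  with bt show thesis using that by blast
qed

section \<open>The kernel of the \<open>s\<close> map\<close>

lemma XX_Alt2: "om : XX k ==> om : Alt2 k (CARD('n) - 1)" for om :: "'n::{finite,linorder} rvec dform" by (simp add: XX_def)

lemma Alt2_add: "om : Alt2 j m ==> et : Alt2 j m ==> (%a. om a + et a) : Alt2 j m" by (simp add: Alt2_def Alt_add)

lemma Alt2_scale: "om : Alt2 j m ==> (%a. c * om a) : Alt2 j m" by (simp add: Alt2_def Alt_scale)

lemma Alt2_zero: "(%a. 0) : Alt2 j m" by (simp add: Alt2_def Alt_zero)

lemma Alt2_tensor: "ph : Alt j ==> ps : Alt m ==> form_tensor ph ps : Alt2 j m"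
  using Alt_scale[of ph j "ps _"] Alt_scale[of ps m "ph _"] by (simp add: Alt2_def form_tensor_def mult.commute)

lemma s_map_add: "s_map k (%a. om a + et a) = (%a. s_map k om a + s_map k et a)" by (auto simp: s_map_def fun_eq_iff algebra_simps sum.distrib)

lemma s_map_scale: "s_map k (%a. c * om a) = (%a. c * s_map k om a)" by (auto simp: s_map_def fun_eq_iff sum_distrib_left mult_ac)

lemma XX_add: "om : XX k ==> et : XX k ==> (%a. om a + et a) : XX k" by (simp add: XX_def Alt2_add s_map_add)

lemma XX_scale: "om : XX k ==> (%a. c * om a) : XX k" by (simp add: XX_def Alt2_scale s_map_scale)

lemma XX_zero: "(%a. 0) : XX k" by (simp add: XX_def Alt2_zero) (auto simp: s_map_def fun_eq_iff)

lemma XX_sum: "(!!i. i : I ==> om i : XX k) ==> (%a. SUM i:I. om i a) : XX k" by (induction I rule: infinite_finite_induct) (simp_all add: XX_zero XX_add)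

text \<open>Putting the vector of the second factor into the place of the omitted argument absorbs
  the sign. So s replaces the arguments of the volume form one at a time.\<close>

lemma s_map_eq_vf:
  fixes om :: "'n::{finite,linorder} rvec dform"
  assumes om: "om : Alt2 k (CARD('n) - 1)" and ws: "length ws = k - 1" and vs: "length vs = CARD('n)"
  shows "s_map k om (ws, vs) = (SUM i<CARD('n). vol (vs[i := vf om (vs ! i # ws)]))"
proof -
  have "(-1) ^ i * om (vs ! i # ws, take i vs @ drop (Suc i) vs) = vol (vs[i := vf om (vs ! i # ws)])"
    if i: "i < CARD('n)" for i
  proof -
    have "om (vs ! i # ws, take i vs @ drop (Suc i) vs) = vol (vf om (vs ! i # ws) # take i vs @ drop (Suc i) vs)"
      using fun_cong[OF hook_starv[OF Alt2_right[OF om]]] unfolding vf_def hook_def .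
    also have "... = (-1) ^ i * vol (vs[i := vf om (vs ! i # ws)])" by (rule Alt_move[OF vol_Alt vs i])
    finally show ?thesis by (simp flip: mult.assoc power_add mult_2)
  qed
  thus ?thesis using ws vs by (simp add: s_map_def)
qed

text \<open>At a basis Cramer's rule reduces the terms of s to diagonal entries: the kernel
  condition says that the contraction of the vector value with the first argument is 0. If
  \<open>ws\<close> is the list of dual vectors of a set ta, the terms with index in ta vanish by
  repetition and the others form the constraint sequence of ta.\<close>

lemma XX_constraint:
  fixes om :: "'n::{finite,linorder} rvec dform"
  assumes om: "om : XX k" and bi: "biorth b bt" and ws: "length ws = k - 1"
  shows "(SUM i:{1..CARD('n)}. b i \<bullet> vf om (bt i # ws)) = 0"
proof -
  let ?L = "bvecs bt {1..CARD('n)}"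
  have "0 = s_map k om (ws, ?L)" using om by (simp add: XX_def)
  also have "... = (SUM i<CARD('n). (b (Suc i) \<bullet> vf om (bt (Suc i) # ws)) * vol ?L)"
    unfolding s_map_eq_vf[OF XX_Alt2[OF om] ws length_bvecs_full] by (rule sum.cong) (simp_all add: nth_bvecs_full vol_update[OF bi] del: One_nat_def)
  also have "... = (SUM i<CARD('n). b (Suc i) \<bullet> vf om (bt (Suc i) # ws)) * vol ?L" by (simp add: sum_distrib_right)
  finally have "(SUM i<CARD('n). b (Suc i) \<bullet> vf om (bt (Suc i) # ws)) = 0" using vol_basis_nonzero[OF bi] by simp
  moreover have "(SUM i:{1..CARD('n)}. b i \<bullet> vf om (bt i # ws)) = (SUM i<CARD('n). b (Suc i) \<bullet> vf om (bt (Suc i) # ws))" by (rule sum.reindex_bij_witness[of _ Suc "%i. i - 1"]) auto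
  ultimately show ?thesis by simp
qed

lemma vf_tensor: "vf (form_tensor ph (hook w)) ws = ph ws *\<^sub>R w" by (simp add: vf_def form_tensor_def starv_scale starv_hook)

text \<open>By \<open>sum_vol_update\<close>, s contracts \<open>ph\<close> with \<open>w\<close>
  and multiplies by the volume form. Elements of the kernel are hence built by making contractions
  cancel.\<close>

lemma s_map_tensor:
  fixes w :: "'n::{finite,linorder} rvec"
  assumes ph: "ph : Alt k" and k: "k >= 1"
  shows "s_map k (form_tensor ph (hook w)) =
    (%(ws, vs). if length ws = k - 1 & length vs = CARD('n) then ph (w # ws) * vol vs else 0)"
proof (rule ext, clarify)
  fix ws vs :: "'n rvec list"
  show "s_map k (form_tensor ph (hook w)) (ws, vs) =
      (if length ws = k - 1 & length vs = CARD('n) then ph (w # ws) * vol vs else 0)"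
  proof (cases "length ws = k - 1 & length vs = CARD('n)")
    case False
    thus ?thesis by (auto simp: s_map_def)
  next
    case True
    have lin: "linear (%x. ph (x # ws))" using Alt_Cons_linear[of ph "k - 1"] ph k by simp
    have "s_map k (form_tensor ph (hook w)) (ws, vs) = (SUM i<CARD('n). vol (vs[i := ph (vs ! i # ws) *\<^sub>R w]))"
      using s_map_eq_vf[OF Alt2_tensor[OF ph hook_Alt], of ws vs w] True by (simp add: vf_tensor)
    also have "... = (SUM i<CARD('n). ph (vs ! i # ws) * vol (vs[i := w]))" by (rule sum.cong) (use True linear_scale[OF Alt_linear[OF vol_Alt]] in auto)
    also have "... = ph (w # ws) * vol vs" using sum_vol_update[OF lin, of vs w] True by simp
    finally show ?thesis using True by simp
  qed
qed

lemma abs_Alt_insert: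
  assumes ph: "ph : Alt j" and "finite rh" "i ~: rh"
  shows "\<bar>ph (bt i # bvecs bt rh)\<bar> = \<bar>ph (bvecs bt (insert i rh))\<bar>"
proof -
  have "mset (bt i # bvecs bt rh) = mset (bvecs bt (insert i rh))" using assms(2,3) by (simp add: sorted_list_of_set_insert_remove)
  from Alt_abs_mset[OF ph this, of "[]"] show ?thesis by simp
qed

text \<open>The factor is 1 or -1. Only that it is nonzero matters below, so the sign of the
  insertion is left undetermined.\<close>

lemma cow_contract:
  assumes bi: "biorth b (bt :: nat => 'n::{finite,linorder} rvec)"
    and ta: "ta : Sig CARD('n) j" and i: "i : {1..CARD('n)} - ta"
  obtains ep where "ep ~= 0" "!!ws. cow (bvecs b (insert i ta)) (bt i # ws) = ep * cow (bvecs b ta) ws"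
proof
  let ?ph = "cow (bvecs b (insert i ta))"
  have ins: "insert i rh : Sig CARD('n) (Suc j)" if "rh : Sig CARD('n) j" "i ~: rh" for rh using that i Sig_finite[OF that(1)] by (auto simp: Sig_def)
  have ph: "?ph : Alt (Suc j)" using cow_Alt[of "bvecs b (insert i ta)"] length_bvecs[OF ins[OF ta]] i by simp
  have abs: "\<bar>?ph (bt i # bvecs bt rh)\<bar> = (if rh = ta then 1 else 0)" if rh: "rh : Sig CARD('n) j" for rh
  proof (cases "i : rh")
    case True
    hence "~distinct (bt i # bvecs bt rh)" using Sig_finite[OF rh] by simp
    thus ?thesis using Alt_not_distinct[OF ph] True i by auto
  next
    case False
    hence "insert i ta = insert i rh \<longleftrightarrow> rh = ta" using i by auto
    thus ?thesis using abs_Alt_insert[OF ph Sig_finite[OF rh] False, of bt]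
        cow_biorth[OF bi ins[OF ta] ins[OF rh False]] i by simp
  qed
  show "?ph (bt i # bvecs bt ta) ~= 0" using abs[OF ta] by auto
  fix ws
  have "?ph (bt i # ws) = (SUM rh:Sig CARD('n) j. ?ph (bt i # bvecs bt rh) * cow (bvecs b rh) ws)" by (rule Alt_expand[OF bi Alt_Cons[OF ph]])
  also have "... = (SUM rh:Sig CARD('n) j. if rh = ta then ?ph (bt i # bvecs bt ta) * cow (bvecs b ta) ws else 0)"
  proof (rule sum.cong[OF refl])
    fix rh assume rh: "rh : Sig CARD('n) j"
    show "?ph (bt i # bvecs bt rh) * cow (bvecs b rh) ws =
        (if rh = ta then ?ph (bt i # bvecs bt ta) * cow (bvecs b ta) ws else 0)" using abs[OF rh] by (cases "rh = ta") simp_all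
  qed
  also have "... = ?ph (bt i # bvecs bt ta) * cow (bvecs b ta) ws" using ta by simp
  finally show "?ph (bt i # ws) = ?ph (bt i # bvecs bt ta) * cow (bvecs b ta) ws" .
qed

text \<open>The indices which the constraints leave free among the normal components at a face.\<close>

definition good :: "nat => nat => nat => nat set => nat => bool" where
  "good n k l sg i \<longleftrightarrow> free_row n k l sg | free_index n k sg i"

text \<open>The components are tied by constraints. If i0 is not in sg0, no constraint meets the
  component. Otherwise only the constraint of sg0 - {i0} does, and it has another member that is
  tangential or not \<open>good\<close>; this member receives the opposite contraction and remains
  invisible in the conclusion.\<close>

lemma XX_dual_element:
  assumes bi: "biorth b (bt :: nat => 'n::{finite,linorder} rvec)" and k: "k >= 1"
    and sg0: "sg0 : Sig CARD('n) k" and i0: "i0 : {l + 1..CARD('n)}" and g0: "good CARD('n) k l sg0 i0"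
  obtains c where "c : XX k"
    "!!sg i. sg : Sig CARD('n) k ==> i : {l + 1..CARD('n)} ==> good CARD('n) k l sg i ==>
      b i \<bullet> vf c (bvecs bt sg) = (if sg = sg0 & i = i0 then 1 else 0)"
proof -
  let ?N = "{1..CARD('n)}"
  let ?t = "%sg i. form_tensor (cow (bvecs b sg)) (hook (bt i))"
  have cAlt: "cow (bvecs b sg) : Alt k" if "sg : Sig CARD('n) k" for sg using cow_Alt[of "bvecs b sg"] length_bvecs[OF that] by metis
  have tA: "?t sg i : Alt2 k (CARD('n) - 1)" if "sg : Sig CARD('n) k" for sg i by (rule Alt2_tensor[OF cAlt[OF that] hook_Alt])
  have comp: "b i \<bullet> vf (?t rh j) (bvecs bt sg) = (if sg = rh & i = j then 1 else 0)"
    if "sg : Sig CARD('n) k" "rh : Sig CARD('n) k" "i : ?N" "j : ?N" for rh sg i j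
    using cow_biorth[OF bi that(2,1)] bi that(3,4) by (simp add: vf_tensor biorth_def)
  have i0N: "i0 : ?N" using i0 by auto
  show thesis
  proof (cases "i0 : sg0")
    case False
    have "cow (bvecs b sg0) (bt i0 # ws) = 0" for ws
    proof (rule cow_zero_orthogonal[of "bt i0"])
      fix u assume "u : set (bvecs b sg0)"
      then obtain m where "m : sg0" "u = b m" using Sig_finite[OF sg0] by auto
      thus "u \<bullet> bt i0 = 0" using bi i0N Sig_subset[OF sg0] False unfolding biorth_def by auto
    qed simp
    hence "s_map k (?t sg0 i0) = (%_. 0)" by (auto simp: s_map_tensor[OF cAlt[OF sg0] k] fun_eq_iff)
    hence "?t sg0 i0 : XX k" using tA[OF sg0] by (simp add: XX_def)
    thus thesis by (rule that) (use comp sg0 i0N in auto)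
  next
    case True
    define ta where "ta = sg0 - {i0}"
    have sg0eq: "sg0 = insert i0 ta" and i0ta: "i0 ~: ta" using True by (auto simp: ta_def)
    have ta: "ta : Sig CARD('n) (k - 1)" using sg0 True Sig_finite[OF sg0] by (auto simp: ta_def Sig_def)
    \<comment> \<open>A constraint that is not normal has a tangential member. For a normal one none
      of its rows is free and its pair index is not a free index, so the pair index can be given
      up.\<close>
    have "EX j:?N - ta. j ~= i0 & (j <= l | ~good CARD('n) k l (insert j ta) j)"
    proof (cases "EX j:?N - ta. j <= l")
      case True
      then obtain j where "j : ?N - ta" "j <= l" by blast
      moreover from this have "j ~= i0" using i0 by auto
      ultimately show ?thesis by blast
    next
      case False
      hence nc: "normal_constraint CARD('n) k l ta" using ta by (auto simp: normal_constraint_def not_le Suc_le_eq simp flip: Suc_eq_plus1)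
      have nfr: "~free_row CARD('n) k l (insert j ta)" if "j : ?N - ta" for j
      proof
        assume "free_row CARD('n) k l (insert j ta)"
        moreover have "j : {l + 1..CARD('n)}" using False that by (auto simp: not_le Suc_le_eq simp flip: Suc_eq_plus1)
        ultimately have "(insert j ta, j) ~: constraint_seq CARD('n) ta" using nc unfolding free_row_def by blast
        thus False using that by (auto simp: constraint_seq_def)
      qed
      define i1 where "i1 = Min (?N - ta)"
      have ne: "?N - ta ~= {}" using i0N i0ta by blast
      have i1: "i1 : ?N - ta" unfolding i1_def by (rule Min_in) (use ne in auto)
      have p: "pair_index CARD('n) ta = (insert i1 ta, i1)" by (simp add: pair_index_def i1_def Let_def)
      have nfi: "~free_index CARD('n) k (insert i1 ta) i1" using p ta unfolding free_index_def by metis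
      hence "~good CARD('n) k l (insert i1 ta) i1" using nfr[OF i1] by (simp add: good_def)
      moreover from this have "i1 ~= i0" using g0 sg0eq by metis
      ultimately show ?thesis using i1 by blast
    qed
    then obtain j where j: "j : ?N - ta" "j ~= i0" "j <= l | ~good CARD('n) k l (insert j ta) j" by blast
    let ?rh = "insert j ta"
    have rh: "?rh : Sig CARD('n) k" using ta j(1) k Sig_finite[OF ta] by (auto simp: Sig_def)
    obtain ep where ep: "!!ws. cow (bvecs b sg0) (bt i0 # ws) = ep * cow (bvecs b ta) ws"
      using cow_contract[OF bi ta, of i0] i0N i0ta sg0eq by (metis DiffI)
    obtain de where de: "de ~= 0" "!!ws. cow (bvecs b ?rh) (bt j # ws) = de * cow (bvecs b ta) ws" using cow_contract[OF bi ta j(1)] by metis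
    \<comment> \<open>The ratio for which the contractions of the two terms cancel.\<close>
    define a where "a = - ep / de"
    let ?c = "%x. ?t sg0 i0 x + a * ?t ?rh j x"
    have "s_map k ?c = (%_. 0)" unfolding s_map_add s_map_scale s_map_tensor[OF cAlt[OF sg0] k] s_map_tensor[OF cAlt[OF rh] k]
      using de(1) by (auto simp: fun_eq_iff ep de(2) a_def)
    hence "?c : XX k" using tA[OF sg0] tA[OF rh] by (simp add: XX_def Alt2_add Alt2_scale)
    thus thesis
    proof (rule that)
      fix sg i assume sg: "sg : Sig CARD('n) k" and i: "i : {l + 1..CARD('n)}" and g: "good CARD('n) k l sg i"
      hence iN: "i : ?N" by auto
      have "~(sg = ?rh & i = j)" using j(3) i g by auto
      hence "b i \<bullet> vf (?t ?rh j) (bvecs bt sg) = 0" using comp[OF sg rh iN, of j] j(1) by auto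
      thus "b i \<bullet> vf ?c (bvecs bt sg) = (if sg = sg0 & i = i0 then 1 else 0)"
        unfolding vf_add vf_scale inner_add_right inner_scaleR_right comp[OF sg sg0 iN i0N] by simp
    qed
  qed
qed

lemma XX_prescribed:
  assumes bi: "biorth b (bt :: nat => 'n::{finite,linorder} rvec)" and k: "k >= 1"
  obtains c where "c : XX k"
    "!!sg i. sg : Sig CARD('n) k ==> i : {l + 1..CARD('n)} ==> good CARD('n) k l sg i ==>
      b i \<bullet> vf c (bvecs bt sg) = y sg i"
proof -
  define G where "G = {(sg, i). sg : Sig CARD('n) k & i : {l + 1..CARD('n)} & good CARD('n) k l sg i}"
  have fin: "finite G" by (rule finite_subset[of _ "Sig CARD('n) k \<times> {l + 1..CARD('n)}"]) (auto simp: G_def)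
  have "EX c:XX k. ALL q:G. b (snd q) \<bullet> vf c (bvecs bt (fst q)) = (if q = p then 1 else 0)" if "p : G" for p
  proof -
    obtain sg0 i0 where p: "p = (sg0, i0)" by (cases p)
    have 0: "sg0 : Sig CARD('n) k" "i0 : {l + 1..CARD('n)}" "good CARD('n) k l sg0 i0" using that p by (auto simp: G_def)
    obtain c where "c : XX k" "!!sg i. sg : Sig CARD('n) k ==> i : {l + 1..CARD('n)} ==> good CARD('n) k l sg i ==>
      b i \<bullet> vf c (bvecs bt sg) = (if sg = sg0 & i = i0 then 1 else 0)" using XX_dual_element[OF bi k 0] by blast
    thus ?thesis by (intro bexI[of _ c]) (auto simp: G_def p)
  qed
  then obtain C where C: "!!p. p : G ==> C p : XX k"
    "!!p q. p : G ==> q : G ==> b (snd q) \<bullet> vf (C p) (bvecs bt (fst q)) = (if q = p then 1 else 0)" by metis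
  let ?c = "%a. SUM p:G. y (fst p) (snd p) * C p a"
  show thesis
  proof (rule that)
    show "?c : XX k" by (intro XX_sum XX_scale C(1))
    fix sg i assume "sg : Sig CARD('n) k" "i : {l + 1..CARD('n)}" "good CARD('n) k l sg i"
    hence q: "(sg, i) : G" by (simp add: G_def)
    have "b i \<bullet> vf ?c (bvecs bt sg) = (SUM p:G. y (fst p) (snd p) * (b i \<bullet> vf (C p) (bvecs bt sg)))" by (simp add: vf_sum vf_scale inner_sum_right)
    also have "... = (SUM p:G. if p = (sg, i) then y sg i else 0)" by (rule sum.cong) (use C(2)[OF _ q] in auto)
    also have "... = y sg i" using q fin by simp
    finally show "b i \<bullet> vf ?c (bvecs bt sg) = y sg i" .
  qed
qed

section \<open>Polynomials\<close>

text \<open>Polynomial functions of degree at most s, generated without coordinates: products,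
  derivatives and the barycentric form are obtained by induction, and \<open>Poly_iff_pf\<close>
  connects them with \<open>Poly\<close>. They are defined on the whole space, as differentiation
  demands.\<close>

inductive pf :: "nat => ('a::real_inner => real) => bool" where
  pf_const: "pf s (%x. c)"
| pf_add: "pf s p ==> pf s q ==> pf s (%x. p x + q x)"
| pf_affine_mult: "pf s p ==> pf (Suc s) (%x. (a \<bullet> x + b) * p x)"

lemma pf_Suc: "pf s p ==> pf (Suc s) p" using pf_affine_mult[of s p 0 1] by simp

lemma pf_mono: "pf s p ==> s <= t ==> pf t p" by (induction t) (auto simp: le_Suc_eq intro: pf_Suc)

lemma pf_scale: "pf s p ==> pf s (%x. c * p x)"
proof (induction rule: pf.induct)
  case (pf_add s p q)
  thus ?case using pf.pf_add[of s "%x. c * p x" "%x. c * q x"] by (simp add: algebra_simps)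
next
  case (pf_affine_mult s p a b)
  thus ?case using pf.pf_affine_mult[of s "%x. c * p x" a b] by (simp add: mult.left_commute)
qed (rule pf.pf_const)

lemma pf_mult: "pf s p ==> pf t q ==> pf (s + t) (%x. p x * q x)"
proof (induction rule: pf.induct)
  case (pf_const s c)
  thus ?case using pf_mono[OF pf_scale[of t q c], of "s + t"] by simp
next
  case (pf_add s p1 p2)
  thus ?case using pf.pf_add[of "s + t" "%x. p1 x * q x" "%x. p2 x * q x"] by (simp add: algebra_simps)
next
  case (pf_affine_mult s p a b)
  thus ?case using pf.pf_affine_mult[of "s + t" "%x. p x * q x" a b] by (simp add: mult.assoc)
qed

lemma pf_sum: "(!!i. i : I ==> pf s (p i)) ==> pf s (%x. SUM i:I. p i x)" by (induction I rule: infinite_finite_induct) (simp_all add: pf_const pf_add)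

lemma pf_affine: "pf 1 (%x. a \<bullet> x + b)" using pf_affine_mult[of 0 "%x. 1" a b] by (simp add: pf_const One_nat_def)

lemma pf_power: "pf 1 p ==> pf m (%x. p x ^ m)"
proof (induction m)
  case (Suc m)
  thus ?case using pf_mult[of 1 p m "%x. p x ^ m"] by (simp add: plus_1_eq_Suc)
qed (simp add: pf_const)

lemma pf_prod: "finite I ==> (!!i. i : I ==> pf (d i) (p i)) ==> pf (SUM i:I. d i) (%x. PROD i:I. p i x)" by (induction I rule: finite_induct) (simp_all add: pf_const pf_mult)

lemma pf_derivative:
  "pf s p ==> EX p'. (ALL x. (p has_derivative (%h. p' x \<bullet> h)) (at x)) & continuous_on UNIV p'"
proof (induction rule: pf.induct)
  case (pf_const s c)
  show ?case by (intro exI[of _ "%x. 0"]) simp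
next
  case (pf_add s p q)
  then obtain p' q' where
    "!!x. (p has_derivative (%h. p' x \<bullet> h)) (at x)" "continuous_on UNIV p'"
    "!!x. (q has_derivative (%h. q' x \<bullet> h)) (at x)" "continuous_on UNIV q'" by blast
  thus ?case by (intro exI[of _ "%x. p' x + q' x"])
      (auto intro!: continuous_intros derivative_eq_intros simp: inner_add_left)
next
  case (pf_affine_mult s p a b)
  then obtain p' where
    p': "!!x. (p has_derivative (%h. p' x \<bullet> h)) (at x)" "continuous_on UNIV p'" by blast
  hence "continuous_on UNIV p" by (meson continuous_at_imp_continuous_on has_derivative_continuous)
  with p' show ?case by (intro exI[of _ "%x. (a \<bullet> x + b) *\<^sub>R p' x + p x *\<^sub>R a"])
      (auto intro!: continuous_intros derivative_eq_intros simp: inner_add_left)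
qed

lemma pf_continuous: "pf s p ==> continuous_on A p" by (meson pf_derivative continuous_at_imp_continuous_on has_derivative_continuous)

text \<open>Multiplication by one variable shifts exponent vectors. The index set is arbitrary, so
  the lemma serves the Cartesian coordinates and, with vertices as indices, the barycentric
  ones.\<close>

lemma monomials_shift:
  fixes c :: "('i => nat) => real"
  assumes I: "finite I" "j : I" and A': "finite A'" and A: "!!al. al : A ==> al(j := Suc (al j)) : A'"
  shows "EX c'. ALL X :: 'i => real. X j * (SUM al:A. c al * (PROD i:I. X i ^ al i)) = (SUM al:A'. c' al * (PROD i:I. X i ^ al i))"
proof -
  define sh where "sh al = al(j := Suc (al j))" for al :: "'i => nat"
  define us where "us al = al(j := al j - 1)" for al :: "'i => nat"
  have us_sh: "us (sh al) = al" for al by (simp add: us_def sh_def)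
  define c' where "c' bt = (if bt : sh ` A then c (us bt) else 0)" for bt
  have "X j * (SUM al:A. c al * (PROD i:I. X i ^ al i)) = (SUM al:A'. c' al * (PROD i:I. X i ^ al i))" for X
  proof -
    have m: "(PROD i:I. X i ^ sh al i) = X j * (PROD i:I. X i ^ al i)" for al
    proof -
      have "(PROD i:I - {j}. X i ^ sh al i) = (PROD i:I - {j}. X i ^ al i)" by (rule prod.cong) (auto simp: sh_def)
      thus ?thesis by (simp add: prod.remove[OF I] sh_def)
    qed
    have "(SUM al:A'. c' al * (PROD i:I. X i ^ al i)) = (SUM bt:sh ` A. c' bt * (PROD i:I. X i ^ bt i))" by (rule sum.mono_neutral_right) (use A' A in \<open>auto simp: c'_def sh_def\<close>)
    also have "... = (SUM al:A. c' (sh al) * (PROD i:I. X i ^ sh al i))" by (subst sum.reindex) (auto intro!: inj_on_inverseI[of _ us] us_sh)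
    also have "... = (SUM al:A. X j * (c al * (PROD i:I. X i ^ al i)))" by (rule sum.cong) (auto simp: c'_def us_sh m)
    finally show ?thesis by (simp add: sum_distrib_left)
  qed
  thus ?thesis by blast
qed

text \<open>The degree is an integer because r - (l + 1) may be negative; the set is then empty and
  \<open>Poly\<close> is {0}.\<close>

definition degs_le :: "int => ('n::finite => nat) set" where
  "degs_le s = {al. int (SUM i:UNIV. al i) <= s}"

lemma finite_degs_le: "finite (degs_le s :: ('n::finite => nat) set)"
proof (rule finite_subset)
  show "degs_le s <= {al :: 'n => nat. ALL i. (i : UNIV --> al i : {..nat s}) & (i ~: UNIV --> al i = 0)}"
  proof
    fix al :: "'n => nat" assume "al : degs_le s"
    hence "int (sum al UNIV) <= s" by (simp add: degs_le_def del: of_nat_sum)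
    hence "sum al UNIV <= nat s" using nat_mono[of "int (sum al UNIV)" s] by (simp only: nat_int)
    moreover have "al i <= sum al UNIV" for i by (rule member_le_sum) auto
    ultimately show "al : {al. ALL i. (i : UNIV --> al i : {..nat s}) & (i ~: UNIV --> al i = 0)}" by (auto intro: order_trans)
  qed
qed (rule finite_set_of_finite_funs, auto)

lemma Poly_alt: "Poly s f = {p. EX c. ALL x. p x =
     (if x : f then SUM al:degs_le s. c al * (PROD i:UNIV. (x $ i) ^ al i) else 0)}" by (simp add: Poly_def degs_le_def)

lemma pf_monomials:
  fixes p :: "'n::finite rvec => real"
  shows "pf s p ==> EX c. ALL x. p x = (SUM al:degs_le (int s). c al * (PROD i:UNIV. (x $ i) ^ al i))"
proof (induction rule: pf.induct)
  case (pf_const s c)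
  let ?c = "%al :: 'n => nat. if al = (%_. 0) then c else 0"
  have h: "(SUM al:degs_le (int s). ?c al * (PROD i:UNIV. (x $ i) ^ al i)) = c" for x
  proof -
    have "(SUM al:degs_le (int s). ?c al * (PROD i:UNIV. (x $ i) ^ al i)) =
        (SUM al:degs_le (int s). ?c al)" by (rule sum.cong) auto
    also have "... = c"
    proof -
      have "(%_. 0) : (degs_le (int s) :: ('n => nat) set)" by (simp add: degs_le_def)
      thus ?thesis by (simp add: finite_degs_le)
    qed
    finally show ?thesis .
  qed
  show ?case by (intro exI[of _ ?c] allI) (rule h[symmetric])
next
  case (pf_add s p q)
  then obtain c d where
    "!!x. p x = (SUM al:degs_le (int s). c al * (PROD i:UNIV. (x $ i) ^ al i))"
    "!!x. q x = (SUM al:degs_le (int s). d al * (PROD i:UNIV. (x $ i) ^ al i))" by blast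
  thus ?case by (intro exI[of _ "%al. c al + d al"]) (simp add: algebra_simps sum.distrib)
next
  case (pf_affine_mult s p a b)
  let ?m = "%(al :: 'n => nat) (x :: 'n rvec). PROD i:UNIV. (x $ i) ^ al i"
  obtain c where c: "!!x. p x = (SUM al:degs_le (int s). c al * ?m al x)" using pf_affine_mult by blast
  have "EX c'. ALL X :: 'n => real. X j * (SUM al:degs_le (int s). c al * (PROD i:UNIV. X i ^ al i)) =
      (SUM al:degs_le (int (Suc s)). c' al * (PROD i:UNIV. X i ^ al i))" for j
  proof (rule monomials_shift)
    fix al :: "'n => nat" assume "al : degs_le (int s)"
    moreover have "sum (al(j := Suc (al j))) UNIV = Suc (sum al UNIV)" by (simp add: sum.remove[of UNIV j])
    ultimately show "al(j := Suc (al j)) : degs_le (int (Suc s))" by (simp add: degs_le_def del: of_nat_sum fun_upd_apply)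
  qed (auto simp: finite_degs_le)
  then obtain d where d: "!!j x. x $ j * p x = (SUM al:degs_le (int (Suc s)). d j al * ?m al x)" unfolding c by metis
  \<comment> \<open>The coefficients of \<open>p\<close>, padded by 0 to the larger range of
    degrees.\<close>
  define e where "e al = (if al : degs_le (int s) then c al else 0)" for al :: "'n => nat"
  have e: "p x = (SUM al:degs_le (int (Suc s)). e al * ?m al x)" for x
  proof -
    have "(SUM al:degs_le (int (Suc s)). e al * ?m al x) = (SUM al:degs_le (int s). e al * ?m al x)" by (rule sum.mono_neutral_right[OF finite_degs_le]) (auto simp: degs_le_def e_def)
    also have "... = p x" unfolding c by (rule sum.cong) (auto simp: e_def)
    finally show ?thesis ..
  qed
  have h: "(a \<bullet> x + b) * p x = (SUM al:degs_le (int (Suc s)). ((SUM j:UNIV. a $ j * d j al) + b * e al) * ?m al x)" for x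
  proof -
    have "(a \<bullet> x + b) * p x = (SUM j:UNIV. a $ j * (x $ j * p x)) + b * p x" by (simp add: inner_vec_def algebra_simps sum_distrib_left)
    also have "(SUM j:UNIV. a $ j * (x $ j * p x)) = (SUM al:degs_le (int (Suc s)). (SUM j:UNIV. a $ j * d j al) * ?m al x)"
      unfolding d sum_distrib_left sum_distrib_right by (subst sum.swap) (simp add: mult.assoc)
    also have "b * p x = (SUM al:degs_le (int (Suc s)). (b * e al) * ?m al x)" unfolding e sum_distrib_left by (simp add: mult.assoc)
    finally show ?thesis by (simp add: sum.distrib algebra_simps)
  qed
  show ?case by (intro exI[of _ "%al. (SUM j:UNIV. a $ j * d j al) + b * e al"] allI) (rule h)
qed

lemma Poly_iff_pf: "p : Poly (int s) f \<longleftrightarrow> (EX q. pf s q & p = (%x. if x : f then q x else 0))"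
  for p :: "'n::finite rvec => real"
proof
  assume "p : Poly (int s) f"
  then obtain c where c: "!!x. p x = (if x : f then SUM al:degs_le (int s). c al * (PROD i:UNIV. (x $ i) ^ al i) else 0)" unfolding Poly_alt by blast
  have "pf s (%x :: 'n rvec. c al * (PROD i:UNIV. (x $ i) ^ al i))" if "al : degs_le (int s)" for al
  proof (rule pf_scale)
    have "pf 1 (%x :: 'n rvec. x $ i)" for i using pf_affine[of "axis i (1 :: real)" 0] by (simp add: inner_axis' inner_real_def)
    hence "pf (SUM i:UNIV. al i) (%x :: 'n rvec. PROD i:UNIV. (x $ i) ^ al i)" by (intro pf_prod pf_power) auto
    thus "pf s (%x :: 'n rvec. PROD i:UNIV. (x $ i) ^ al i)" by (rule pf_mono) (use that in \<open>simp add: degs_le_def del: of_nat_sum\<close>)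
  qed
  hence "pf s (%x :: 'n rvec. SUM al:degs_le (int s). c al * (PROD i:UNIV. (x $ i) ^ al i))" by (rule pf_sum)
  with c show "EX q. pf s q & p = (%x. if x : f then q x else 0)" by (intro exI conjI) auto
next
  assume "EX q. pf s q & p = (%x. if x : f then q x else 0)"
  then obtain q where q: "pf s q" "p = (%x. if x : f then q x else 0)" by blast
  with pf_monomials[OF q(1)] show "p : Poly (int s) f" unfolding Poly_alt by (auto simp: fun_eq_iff)
qed

lemma Poly_neg: "s < 0 ==> Poly s f = {%x. 0}"
proof -
  assume "s < 0"
  hence "degs_le s = ({} :: ('a => nat) set)" by (auto simp: degs_le_def simp del: of_nat_sum)
  thus ?thesis by (auto simp: Poly_alt fun_eq_iff)
qed

lemma Poly_zero: "(%x. 0) : Poly s f" unfolding Poly_alt by (auto intro!: exI[of _ "%_. 0"])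

lemma Poly_add: "p : Poly s f ==> q : Poly s f ==> (%x. p x + q x) : Poly s f"
proof -
  assume "p : Poly s f" "q : Poly s f"
  then obtain c d where "!!x. p x = (if x : f then SUM al:degs_le s. c al * (PROD i:UNIV. (x $ i) ^ al i) else 0)"
    "!!x. q x = (if x : f then SUM al:degs_le s. d al * (PROD i:UNIV. (x $ i) ^ al i) else 0)" unfolding Poly_alt by blast
  thus ?thesis unfolding Poly_alt by (auto intro!: exI[of _ "%al. c al + d al"] simp: algebra_simps sum.distrib)
qed

lemma Poly_scale: "p : Poly s f ==> (%x. a * p x) : Poly s f"
proof -
  assume "p : Poly s f"
  then obtain c where "!!x. p x = (if x : f then SUM al:degs_le s. c al * (PROD i:UNIV. (x $ i) ^ al i) else 0)" unfolding Poly_alt by blast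
  thus ?thesis unfolding Poly_alt by (auto intro!: exI[of _ "%al. a * c al"] simp: mult.assoc sum_distrib_left)
qed

lemma Poly_sum: "(!!i. i : I ==> p i : Poly s f) ==> (%x. SUM i:I. p i x) : Poly s f" by (induction I rule: infinite_finite_induct) (simp_all add: Poly_zero Poly_add)

lemma Poly_diff: "p : Poly s f ==> q : Poly s f ==> (%x. p x - q x) : Poly s f"
  using Poly_add[of p s f "%x. -1 * q x"] Poly_scale[of q s f "-1"] by simp

lemma Poly_mult:
  assumes "p : Poly (int s) f" "q : Poly (int t) f"
  shows "(%x. p x * q x) : Poly (int (s + t)) (f :: 'n::finite rvec set)"
proof -
  obtain p' q' where "pf s p'" "p = (%x. if x : f then p' x else 0)" "pf t q'" "q = (%x. if x : f then q' x else 0)"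
    using assms unfolding Poly_iff_pf by blast
  thus ?thesis unfolding Poly_iff_pf by (intro exI[of _ "%x. p' x * q' x"]) (auto intro: pf_mult)
qed

lemma Poly_mono:
  assumes "p : Poly s f" "s <= t"
  shows "p : Poly t (f :: 'n::finite rvec set)"
proof (cases "s < 0")
  case True
  thus ?thesis using assms(1) Poly_neg[of s f] Poly_zero by auto
next
  case False
  hence s: "s = int (nat s)" "t = int (nat t)" using assms(2) by auto
  then obtain q where "pf (nat s) q" "p = (%x. if x : f then q x else 0)" using assms(1) Poly_iff_pf[of p "nat s" f] by auto
  moreover have "nat s <= nat t" using assms(2) by simp
  ultimately have "p : Poly (int (nat t)) f" unfolding Poly_iff_pf using pf_mono by blast
  thus ?thesis using s(2) by simp
qed

lemma Poly_outside: "p : Poly s f ==> x ~: f ==> p x = 0" unfolding Poly_alt by auto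

lemma Poly_restrict:
  assumes "p : Poly s F" "f <= F"
  shows "(%x. if x : f then p x else 0) : Poly s f"
proof -
  obtain c where "!!x. p x = (if x : F then SUM al:degs_le s. c al * (PROD i:UNIV. (x $ i) ^ al i) else 0)" using assms(1) unfolding Poly_alt by blast
  thus ?thesis unfolding Poly_alt using assms(2) by (auto intro!: exI[of _ c])
qed

lemma Poly_extend:
  assumes "p : Poly s f"
  obtains q where "q : Poly s F" "!!x. x : f ==> x : F ==> q x = p x"
proof -
  obtain c where "!!x. p x = (if x : f then SUM al:degs_le s. c al * (PROD i:UNIV. (x $ i) ^ al i) else 0)" using assms(1) unfolding Poly_alt by blast
  thus thesis by (intro that[of "%x. if x : F then SUM al:degs_le s. c al * (PROD i:UNIV. (x $ i) ^ al i) else 0"])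
      (auto simp: Poly_alt)
qed

lemma Poly_continuous:
  assumes "p : Poly s f"
  shows "continuous_on f (p :: 'n::finite rvec => real)"
proof (cases "s < 0")
  case True
  thus ?thesis using assms(1) Poly_neg[of s f] by auto
next
  case False
  then obtain m where "s = int m" by (metis nonneg_int_cases linorder_not_less)
  then obtain q where q: "pf m q" "p = (%x. if x : f then q x else 0)" using assms Poly_iff_pf by blast
  show ?thesis by (rule continuous_on_eq[OF pf_continuous[OF q(1)]]) (simp add: q(2))
qed

section \<open>Simplices and barycentric coordinates\<close>

lemma verts_convex_hull:
  assumes "~affine_dependent S"
  shows "verts (convex hull S) = S" using extreme_point_of_convex_hull_affine_independent[OF assms] by (auto simp: verts_def)

lemma simplexD:
  assumes "int l simplex F"
  shows "finite (verts F)" "~affine_dependent (verts F)" "card (verts F) = l + 1"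
    "F = convex hull (verts F)"
proof -
  obtain S where S: "~affine_dependent S" "int (card S) = int l + 1" "F = convex hull S" using assms unfolding simplex_def by blast
  hence "verts F = S" by (simp add: verts_convex_hull)
  thus "finite (verts F)" "~affine_dependent (verts F)" "card (verts F) = l + 1"
    "F = convex hull (verts F)" using S by (auto simp: aff_independent_finite)
qed

lemma simplex_convex_hull:
  assumes "~affine_dependent S" "card S = l + 1"
  shows "int l simplex (convex hull S)" using assms unfolding simplex_def by auto

lemma Delta_iff:
  assumes T: "int m simplex T"
  shows "f : Delta l T \<longleftrightarrow> (EX S<=verts T. card S = l + 1 & f = convex hull S)"
proof
  assume f: "f : Delta l T"
  hence "f face_of convex hull (verts T)" "int l simplex f" using simplexD(4)[OF T] by (auto simp: Delta_def)
  then obtain S where S: "S <= verts T" "f = convex hull S" using face_of_convex_hull_affine_independent[OF simplexD(2)[OF T]] by blast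
  moreover have "~affine_dependent S" using affine_independent_subset[OF simplexD(2)[OF T] S(1)] .
  ultimately have "verts f = S" by (simp add: verts_convex_hull)
  thus "EX S<=verts T. card S = l + 1 & f = convex hull S" using S simplexD(3)[OF \<open>int l simplex f\<close>] by blast
next
  assume "EX S<=verts T. card S = l + 1 & f = convex hull S"
  then obtain S where S: "S <= verts T" "card S = l + 1" "f = convex hull S" by blast
  hence "f face_of T" using face_of_convex_hull_affine_independent[OF simplexD(2)[OF T]] simplexD(4)[OF T] by metis
  moreover have "~affine_dependent S" using affine_independent_subset[OF simplexD(2)[OF T] S(1)] .
  ultimately show "f : Delta l T" using S simplex_convex_hull by (auto simp: Delta_def)
qed

lemma Delta_simplex: "f : Delta l T ==> int l simplex f" by (simp add: Delta_def)

lemma Delta_verts: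
  assumes T: "int m simplex T" and f: "f : Delta l T"
  shows "verts f <= verts T"
proof -
  obtain S where S: "S <= verts T" "f = convex hull S" using f Delta_iff[OF T] by blast
  moreover have "~affine_dependent S" using affine_independent_subset[OF simplexD(2)[OF T] S(1)] .
  ultimately show ?thesis by (simp add: verts_convex_hull)
qed

lemma Delta_subset: "f : Delta l T ==> f <= T" by (auto simp: Delta_def face_of_imp_subset)

lemma Delta_trans: "f : Delta l F ==> F : Delta m T ==> f : Delta l T" unfolding Delta_def using face_of_trans by blast

lemma finite_Delta:
  assumes T: "int m simplex T"
  shows "finite (Delta l T)"
proof -
  have "Delta l T <= (%S. convex hull S) ` Pow (verts T)" using Delta_iff[OF T] by blast
  thus ?thesis using simplexD(1)[OF T] finite_subset by blast
qed

lemma bary_props: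
  assumes F: "int l simplex F" and x: "x : affine hull (verts F)"
  shows "(SUM v:verts F. bary F v x) = 1" "(SUM v:verts F. bary F v x *\<^sub>R v) = x"
proof -
  let ?P = "%c. sum c (verts F) = 1 & (SUM w:verts F. c w *\<^sub>R w) = x"
  have "EX c. ?P c" using x simplexD(1)[OF F] by (simp add: affine_hull_finite)
  hence "?P (SOME c. ?P c)" by (rule someI_ex)
  thus "(SUM v:verts F. bary F v x) = 1" "(SUM v:verts F. bary F v x *\<^sub>R v) = x" unfolding bary_def by auto
qed

lemma bary_unique:
  assumes F: "int l simplex F" and c: "sum c (verts F) = 1" "(SUM w:verts F. c w *\<^sub>R w) = x"
    and v: "v : verts F"
  shows "bary F v x = c v"
proof (rule ccontr)
  assume ne: "bary F v x ~= c v"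
  have "x : affine hull (verts F)" using c simplexD(1)[OF F] by (auto simp: affine_hull_finite)
  note b = bary_props[OF F this]
  have "affine_dependent (verts F)" unfolding affine_dependent_explicit_finite[OF simplexD(1)[OF F]] by (intro exI[of _ "%v. bary F v x - c v"])
      (use b c ne v in \<open>auto simp: sum_subtractf scaleR_left_diff_distrib\<close>)
  thus False using simplexD(2)[OF F] by blast
qed

lemma simplex_affine_hull: "int l simplex F ==> x : F ==> x : affine hull (verts F)" using simplexD(4) convex_hull_subset_affine_hull by blast

lemma bary_nonneg:
  assumes F: "int l simplex F" and x: "x : F" and v: "v : verts F"
  shows "bary F v x >= 0"
proof -
  have "x : convex hull (verts F)" using x simplexD(4)[OF F] by simp
  then obtain u where u: "!!v. v : verts F ==> 0 <= u v" "sum u (verts F) = 1" "(SUM v:verts F. u v *\<^sub>R v) = x"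
    unfolding convex_hull_finite[OF simplexD(1)[OF F]] by blast
  thus ?thesis using bary_unique[OF F u(2,3) v] v by simp
qed

lemma in_simplexI:
  assumes F: "int l simplex F" and c: "sum c (verts F) = 1" "(SUM w:verts F. c w *\<^sub>R w) = x"
    and nn: "!!v. v : verts F ==> c v >= 0"
  shows "x : F" by (subst simplexD(4)[OF F]) (use c nn in \<open>auto simp: convex_hull_finite[OF simplexD(1)[OF F]]\<close>)

lemma in_simplex_iff_bary:
  assumes F: "int l simplex F" and x: "x : affine hull (verts F)"
  shows "x : F \<longleftrightarrow> (ALL v:verts F. bary F v x >= 0)" using bary_nonneg[OF F] in_simplexI[OF F bary_props[OF F x]] by blast

text \<open>Coordinates of the face padded by 0 are coordinates in T, and these are unique.\<close>

lemma bary_face: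
  assumes T: "int m simplex T" and f: "f : Delta l T" and x: "x : affine hull (verts f)" and v: "v : verts T"
  shows "bary T v x = (if v : verts f then bary f v x else 0)"
proof (rule bary_unique[OF T _ _ v])
  note b = bary_props[OF Delta_simplex[OF f] x]
  note fin = simplexD(1)[OF T] and sub = Delta_verts[OF T f]
  have "(SUM v:verts T. if v : verts f then bary f v x else 0) = (SUM v:verts f. bary f v x)"
    using sum.inter_restrict[OF fin, of "%v. bary f v x" "verts f"] sub by (simp add: Int_absorb1)
  thus "(SUM v:verts T. if v : verts f then bary f v x else 0) = 1" using b by simp
  have "(SUM w:verts T. (if w : verts f then bary f w x else 0) *\<^sub>R w) = (SUM w:verts T. if w : verts f then bary f w x *\<^sub>R w else 0)" by (rule sum.cong) auto
  also have "... = (SUM w:verts f. bary f w x *\<^sub>R w)"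
    using sum.inter_restrict[OF fin, of "%w. bary f w x *\<^sub>R w" "verts f"] sub by (simp add: Int_absorb1)
  finally show "(SUM w:verts T. (if w : verts f then bary f w x else 0) *\<^sub>R w) = x" using b by simp
qed

lemma in_face_iff_bary:
  assumes T: "int m simplex T" and f: "f : Delta l T" and x: "x : T"
  shows "x : f \<longleftrightarrow> (ALL v:verts T - verts f. bary T v x = 0)"
proof
  assume "x : f"
  thus "ALL v:verts T - verts f. bary T v x = 0" using bary_face[OF T f simplex_affine_hull[OF Delta_simplex[OF f]]] by auto
next
  assume z: "ALL v:verts T - verts f. bary T v x = 0"
  note fin = simplexD(1)[OF T] and sub = Delta_verts[OF T f]
  note b = bary_props[OF T simplex_affine_hull[OF T x]]
  show "x : f"
  proof (rule in_simplexI[OF Delta_simplex[OF f]])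
    show "(SUM v:verts f. bary T v x) = 1" using sum.mono_neutral_left[OF fin sub, of "%v. bary T v x"] z b by simp
    show "(SUM v:verts f. bary T v x *\<^sub>R v) = x" using sum.mono_neutral_left[OF fin sub, of "%v. bary T v x *\<^sub>R v"] z b by simp
  qed (use bary_nonneg[OF T x] sub in auto)
qed

lemma bary_vertex:
  assumes F: "int l simplex F" and v: "v : verts F" and w: "w : verts F"
  shows "bary F v w = (if v = w then 1 else 0)"
proof (rule bary_unique[OF F _ _ v])
  have "(SUM u:verts F. (if u = w then 1 else 0) *\<^sub>R u) = (SUM u:verts F. if u = w then w else 0)" by (rule sum.cong) auto
  thus "(SUM u:verts F. (if u = w then 1 else 0) *\<^sub>R u) = w" using simplexD(1)[OF F] w by simp
qed (use simplexD(1)[OF F] w in simp)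

text \<open>A linear map with value -1 on all edges leaving \<open>w\<close> expresses the
  coordinate as 1 plus its value at x - w. The formula holds on the affine hull; \<open>a\<close>
  and \<open>b\<close> are unique only if the simplex has full dimension.\<close>

lemma bary_affine:
  fixes F :: "'a::euclidean_space set"
  assumes F: "int l simplex F" and w: "w : verts F"
  obtains a b where "!!x. x : affine hull (verts F) ==> bary F w x = a \<bullet> x + b"
proof -
  let ?S = "verts F"
  let ?B = "(%u. - w + u) ` (?S - {w})"
  have "independent ?B" using simplexD(2)[OF F] affine_dependent_iff_dependent2[OF w] by blast
  then obtain g :: "'a => real" where g: "linear g" "!!y. y : ?B ==> g y = -1" using linear_independent_extend[of ?B "%_. -1 :: real"] by blast
  have gin: "g y = adjoint g 1 \<bullet> y" for y using adjoint_works[OF g(1), of y 1] by (simp add: inner_commute)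
  show thesis
  proof (rule that[of "adjoint g 1" "1 - adjoint g 1 \<bullet> w"])
    fix x assume x: "x : affine hull ?S"
    note b = bary_props[OF F x] and fin = simplexD(1)[OF F]
    have gu: "g (u - w) = -1" if "u : ?S - {w}" for u using g(2)[of "- w + u"] that by auto
    have "x - w = (SUM u:?S. bary F u x *\<^sub>R (u - w))" using b by (simp add: scaleR_right_diff_distrib sum_subtractf flip: scaleR_left.sum)
    hence "g (x - w) = (SUM u:?S. bary F u x * g (u - w))" by (simp add: linear_sum[OF g(1)] linear_scale[OF g(1)])
    also have "... = bary F w x * g 0 + (SUM u:?S - {w}. bary F u x * g (u - w))" by (simp add: sum.remove[OF fin w])
    also have "(SUM u:?S - {w}. bary F u x * g (u - w)) = (SUM u:?S - {w}. - bary F u x)" by (rule sum.cong) (simp_all add: gu)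
    also have "... = - (SUM u:?S - {w}. bary F u x)" by (rule sum_negf)
    also have "(SUM u:?S - {w}. bary F u x) = 1 - bary F w x" using b(1) sum.remove[OF fin w, of "%u. bary F u x"] by simp
    finally have "bary F w x = 1 + g (x - w)" using linear_0[OF g(1)] by simp
    thus "bary F w x = adjoint g 1 \<bullet> x + (1 - adjoint g 1 \<bullet> w)" by (simp add: gin inner_diff_right)
  qed
qed

lemma bary_prod_Poly:
  fixes F :: "'n::finite rvec set"
  assumes F: "int l simplex F" and S: "S <= verts F"
  shows "(%x. if x : F then PROD v:S. bary F v x ^ al v else 0) : Poly (int (SUM v:S. al v)) F"
proof -
  have "ALL w:S. EX q. ALL x:affine hull (verts F). bary F w x = fst q \<bullet> x + snd q"
  proof
    fix w assume "w : S"
    then obtain a b where "!!x. x : affine hull (verts F) ==> bary F w x = a \<bullet> x + b" using bary_affine[OF F, of w] S by blast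
    thus "EX q. ALL x:affine hull (verts F). bary F w x = fst q \<bullet> x + snd q" by (intro exI[of _ "(a, b)"]) simp
  qed
  from bchoice[OF this] obtain q where
    q: "ALL w:S. ALL x:affine hull (verts F). bary F w x = fst (q w) \<bullet> x + snd (q w)" by blast
  define a where "a w = fst (q w)" for w
  define b where "b w = snd (q w)" for w
  have ab: "!!w x. w : S ==> x : affine hull (verts F) ==> bary F w x = a w \<bullet> x + b w" using q by (simp add: a_def b_def)
  have "finite S" using S simplexD(1)[OF F] finite_subset by blast
  hence "pf (SUM v:S. al v) (%x. PROD v:S. (a v \<bullet> x + b v) ^ al v)" by (intro pf_prod pf_power pf_affine)
  moreover have "(%x. if x : F then PROD v:S. bary F v x ^ al v else 0) =
      (%x. if x : F then PROD v:S. (a v \<bullet> x + b v) ^ al v else 0)" using ab simplex_affine_hull[OF F] by (auto intro!: prod.cong)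
  ultimately show ?thesis unfolding Poly_iff_pf by blast
qed

section \<open>Bernstein decomposition\<close>

definition bern_degs :: "'a set => int => ('a => nat) set" where
  "bern_degs S s = {al. (ALL v. v ~: S --> al v = 0) & int (SUM v:S. al v) = s}"

definition bern_sum :: "'a::euclidean_space set => 'a set => int => (('a => nat) => real) => 'a => real" where
  "bern_sum F S s c x = (SUM al:bern_degs S s. c al * (PROD v:S. bary F v x ^ al v))"

lemma bubble_Poly_alt:
  "bubble_Poly F f s = {p. EX c. ALL x. p x = (if x : F then (PROD v:verts f. bary F v x) * bern_sum F (verts f) s c x else 0)}" by (simp add: bubble_Poly_def bern_sum_def bern_degs_def)

lemma finite_bern_degs:
  assumes "finite S"
  shows "finite (bern_degs S s)"
proof (rule finite_subset)
  show "bern_degs S s <= {al. ALL v. (v : S --> al v : {..nat s}) & (v ~: S --> al v = 0)}"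
  proof
    fix al assume "al : bern_degs S s"
    hence "int (sum al S) = s" and z: "ALL v. v ~: S --> al v = 0" by (simp_all add: bern_degs_def del: of_nat_sum)
    hence "sum al S <= nat s" using nat_mono[of "int (sum al S)" s] by (simp only: nat_int)
    note this z
    moreover have "al v <= sum al S" if "v : S" for v using assms that by (intro member_le_sum) auto
    ultimately show "al : {al. ALL v. (v : S --> al v : {..nat s}) & (v ~: S --> al v = 0)}" by (auto intro: order_trans)
  qed
qed (rule finite_set_of_finite_funs, use assms in auto)

lemma bern_sum_add: "bern_sum F S s c x + bern_sum F S s d x = bern_sum F S s (%al. c al + d al) x" by (simp add: bern_sum_def algebra_simps sum.distrib)

lemma bern_sum_scale: "a * bern_sum F S s c x = bern_sum F S s (%al. a * c al) x" by (simp add: bern_sum_def sum_distrib_left mult.assoc)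

lemma bern_sum_lin: "finite I ==> (SUM i:I. a i * bern_sum F S s (c i) x) = bern_sum F S s (%al. SUM i:I. a i * c i al) x"
proof (induction I rule: finite_induct)
  case empty
  thus ?case by (simp add: bern_sum_def)
qed (simp add: bern_sum_scale bern_sum_add)

text \<open>On F the coordinates sum to 1, so an affine function is a homogeneous linear form in
  them, with its vertex values as coefficients. Multiplication thus raises the degree by exactly one
  and keeps homogeneity.\<close>

lemma bern_sum_affine_mult:
  assumes F: "int l simplex F"
  shows "EX c'. ALL x:F. (a \<bullet> x + b) * bern_sum F (verts F) (int s) c x = bern_sum F (verts F) (int (Suc s)) c' x"
proof -
  let ?S = "verts F"
  note fin = simplexD(1)[OF F]
  have "ALL v:?S. EX c'. ALL X. X v * (SUM al:bern_degs ?S (int s). c al * (PROD i:?S. X i ^ al i)) =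
      (SUM al:bern_degs ?S (int (Suc s)). c' al * (PROD i:?S. X i ^ al i))"
  proof (rule ballI, rule monomials_shift[OF fin _ finite_bern_degs[OF fin]])
    fix v assume v: "v : ?S"
    fix al assume al: "al : bern_degs ?S (int s)"
    have "sum (al(v := Suc (al v))) ?S = Suc (al v) + sum (al(v := Suc (al v))) (?S - {v})" by (simp add: sum.remove[OF fin v])
    also have "sum (al(v := Suc (al v))) (?S - {v}) = sum al (?S - {v})" by (rule sum.cong) auto
    also have "Suc (al v) + sum al (?S - {v}) = Suc (sum al ?S)" by (simp add: sum.remove[OF fin v])
    finally show "al(v := Suc (al v)) : bern_degs ?S (int (Suc s))" using al v by (simp add: bern_degs_def del: of_nat_sum fun_upd_apply) auto
  qed
  from bchoice[OF this] obtain d where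
    d: "ALL v:?S. ALL X. X v * (SUM al:bern_degs ?S (int s). c al * (PROD i:?S. X i ^ al i)) =
      (SUM al:bern_degs ?S (int (Suc s)). d v al * (PROD i:?S. X i ^ al i))" by blast
  have d': "bary F v x * bern_sum F ?S (int s) c x = bern_sum F ?S (int (Suc s)) (d v) x" if "v : ?S" for v x
    unfolding bern_sum_def using d[rule_format, OF that, of "%v. bary F v x"] .
  show ?thesis
  proof (intro exI ballI)
    fix x assume "x : F"
    note bp = bary_props[OF F simplex_affine_hull[OF F this]]
    have "a \<bullet> x + b = (SUM v:?S. bary F v x * (a \<bullet> v)) + b * (SUM v:?S. bary F v x)" by (subst bp(2)[symmetric]) (simp add: inner_sum_right bp(1))
    also have "... = (SUM v:?S. (a \<bullet> v + b) * bary F v x)" by (simp add: sum_distrib_left sum.distrib algebra_simps)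
    finally show "(a \<bullet> x + b) * bern_sum F ?S (int s) c x =
        bern_sum F ?S (int (Suc s)) (%al. SUM v:?S. (a \<bullet> v + b) * d v al) x" by (simp add: sum_distrib_right mult.assoc d' bern_sum_lin[OF fin])
  qed
qed

lemma pf_bern_sum:
  assumes F: "int l simplex F"
  shows "pf s p ==> EX c. ALL x:F. p x = bern_sum F (verts F) (int s) c x"
proof (induction rule: pf.induct)
  case (pf_const s c)
  show ?case
  proof (induction s)
    case 0
    have "bern_degs (verts F) (int 0) = {%_. 0}" using simplexD(1)[OF F] by (auto simp: bern_degs_def fun_eq_iff simp del: of_nat_sum)
    thus ?case by (intro exI[of _ "%_. c"]) (simp add: bern_sum_def)
  next
    case (Suc s)
    then obtain d where "ALL x:F. c = bern_sum F (verts F) (int s) d x" by blast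
    \<comment> \<open>Degree elevation: the factor 1 is the sum of the coordinates.\<close>
    with bern_sum_affine_mult[OF F, of 0 1 s d] show ?case by simp
  qed
next
  case (pf_add s p q)
  then obtain c d where "ALL x:F. p x = bern_sum F (verts F) (int s) c x" "ALL x:F. q x = bern_sum F (verts F) (int s) d x" by blast
  thus ?case by (intro exI[of _ "%al. c al + d al"]) (simp flip: bern_sum_add)
next
  case (pf_affine_mult s p a b)
  then obtain d where "ALL x:F. p x = bern_sum F (verts F) (int s) d x" by blast
  with bern_sum_affine_mult[OF F, of a b s d] show ?case by simp
qed

lemma bern_sum_Poly:
  fixes F :: "'n::finite rvec set"
  assumes F: "int l simplex F" and S: "S <= verts F"
  shows "(%x. if x : F then bern_sum F S s c x else 0) : Poly s F"
proof -
  have "(%x. SUM al:bern_degs S s. c al * (if x : F then PROD v:S. bary F v x ^ al v else 0)) : Poly s F"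
  proof (intro Poly_sum Poly_scale)
    fix al assume "al : bern_degs S s"
    hence "s = int (SUM v:S. al v)" by (simp add: bern_degs_def)
    thus "(%x. if x : F then PROD v:S. bary F v x ^ al v else 0) : Poly s F" using bary_prod_Poly[OF F S] by simp
  qed
  moreover have "(%x. SUM al:bern_degs S s. c al * (if x : F then PROD v:S. bary F v x ^ al v else 0)) =
      (%x. if x : F then bern_sum F S s c x else 0)" by (auto simp: bern_sum_def)
  ultimately show ?thesis by simp
qed

lemma bern_sum_neg: "s < 0 ==> bern_sum F S s c x = 0" unfolding bern_sum_def bern_degs_def by (rule sum.neutral) (auto simp del: of_nat_sum)

lemma bubble_prod_Poly:
  fixes F :: "'n::finite rvec set"
  assumes F: "int l simplex F" and S: "S <= verts F"
  shows "(%x. if x : F then PROD v:S. bary F v x else 0) : Poly (int (card S)) F"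
  using bary_prod_Poly[OF F S, of "%_. 1"] by (simp only: power_one_right sum_constant mult_1_right of_nat_mult of_nat_1 of_nat_id)

lemma bubble_Poly_Poly:
  fixes F :: "'n::finite rvec set"
  assumes F: "int l simplex F" and f: "f : Delta m F" and p: "p : bubble_Poly F f (int r - int (m + 1))"
  shows "p : Poly (int r) F"
proof -
  have S: "verts f <= verts F" and card: "card (verts f) = m + 1" using Delta_verts[OF F f] simplexD(3)[OF Delta_simplex[OF f]] by auto
  obtain c where c: "!!x. p x = (if x : F then (PROD v:verts f. bary F v x) * bern_sum F (verts f) (int r - int (m + 1)) c x else 0)"
    using p unfolding bubble_Poly_alt by blast
  show ?thesis
  proof (cases "r < m + 1")
    case True
    hence "p = (%x. 0)" by (simp add: fun_eq_iff c bern_sum_neg)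
    thus ?thesis by (simp add: Poly_zero)
  next
    case False
    hence s: "int r - int (m + 1) = int (r - (m + 1))" by simp
    have "(%x. (if x : F then PROD v:verts f. bary F v x else 0) * (if x : F then bern_sum F (verts f) (int (r - (m + 1))) c x else 0))
        : Poly (int (m + 1 + (r - (m + 1)))) F" using bubble_prod_Poly[OF F S] bern_sum_Poly[OF F S] unfolding card by (rule Poly_mult)
    moreover have "p = (%x. (if x : F then PROD v:verts f. bary F v x else 0) * (if x : F then bern_sum F (verts f) (int (r - (m + 1))) c x else 0))"
      using c unfolding s by auto
    ultimately show ?thesis using False by simp
  qed
qed

lemma bubble_Poly_add: "p : bubble_Poly F f s ==> q : bubble_Poly F f s ==> (%x. p x + q x) : bubble_Poly F f s"
proof -
  assume "p : bubble_Poly F f s" "q : bubble_Poly F f s"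
  then obtain c d where
    "!!x. p x = (if x : F then (PROD v:verts f. bary F v x) * bern_sum F (verts f) s c x else 0)"
    "!!x. q x = (if x : F then (PROD v:verts f. bary F v x) * bern_sum F (verts f) s d x else 0)" unfolding bubble_Poly_alt by blast
  thus ?thesis unfolding bubble_Poly_alt by (intro CollectI exI[of _ "%al. c al + d al"]) (simp add: distrib_left flip: bern_sum_add)
qed

lemma bubble_Poly_scale: "p : bubble_Poly F f s ==> (%x. a * p x) : bubble_Poly F f s"
proof -
  assume "p : bubble_Poly F f s"
  then obtain c where
    "!!x. p x = (if x : F then (PROD v:verts f. bary F v x) * bern_sum F (verts f) s c x else 0)" unfolding bubble_Poly_alt by blast
  thus ?thesis unfolding bubble_Poly_alt by (intro CollectI exI[of _ "%al. a * c al"]) (simp flip: bern_sum_scale)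
qed

lemma bubble_Poly_zero: "(%x. 0) : bubble_Poly F f s" unfolding bubble_Poly_alt by (intro CollectI exI[of _ "%_. 0"]) (simp add: bern_sum_def)

lemma subset_simplex:
  assumes F: "int l simplex F" and g: "g <= verts F" "g ~= {}"
  shows "convex hull g : Delta (card g - 1) F" "verts (convex hull g) = g"
proof -
  have "~affine_dependent g" using affine_independent_subset[OF simplexD(2)[OF F] g(1)] .
  thus "verts (convex hull g) = g" by (rule verts_convex_hull)
  have "card g > 0" using g simplexD(1)[OF F] by (simp add: card_gt_0_iff finite_subset)
  thus "convex hull g : Delta (card g - 1) F" using g(1) by (subst Delta_iff[OF F]) auto
qed

text \<open>Bernstein monomials are grouped by their support g. All coordinates of g divide each of
  them, which yields the bubble. A group depends only on the coordinates of g and is homogeneous of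
  degree r, so its values on the face of g determine it. Since r >= 1 no monomial has empty
  support.\<close>

lemma bern_decomp:
  assumes F: "int l simplex F" and r: "r >= 1"
    and u: "!!x. x : F ==> u x = bern_sum F (verts F) (int r) c x"
  obtains R where
    "!!x. x : F ==> u x = (SUM g:Pow (verts F). R g x)"
    "!!g. g <= verts F ==> R g : bubble_Poly F (convex hull g) (int r - int (card g))"
    "!!g x v. g <= verts F ==> v : g ==> bary F v x = 0 ==> R g x = 0"
    "!!g x. g <= verts F ==> (!!y. y : convex hull g ==> R g y = 0) ==> R g x = 0"
    "!!x. R {} x = 0"
proof -
  let ?S = "verts F"
  note fin = simplexD(1)[OF F]
  define supp where "supp al = {v. al v ~= 0}" for al :: "'a => nat"
  define D where "D g = {al : bern_degs ?S (int r). supp al = g}" for g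
  let ?m = "%al x. PROD v:?S. bary F v x ^ al v"
  define R where "R g x = (if x : F then SUM al:D g. c al * ?m al x else 0)" for g x
  have mg: "?m al x = (PROD v:g. bary F v x ^ al v)" if "al : D g" for al g x
  proof (rule prod.mono_neutral_right[OF fin])
    show "g <= ?S" using that by (auto simp: D_def supp_def bern_degs_def)
  qed (use that in \<open>auto simp: D_def supp_def\<close>)
  show thesis
  proof (rule that)
    fix x assume x: "x : F"
    have "(SUM g:Pow ?S. SUM al:{al : bern_degs ?S (int r). supp al = g}. c al * ?m al x) =
        (SUM al:bern_degs ?S (int r). c al * ?m al x)" by (rule sum.group) (use fin finite_bern_degs[OF fin] in \<open>auto simp: supp_def bern_degs_def\<close>)
    thus "u x = (SUM g:Pow ?S. R g x)" using x by (simp add: R_def D_def u bern_sum_def)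
  next
    fix g assume g: "g <= ?S"
    have fing: "finite g" using g fin finite_subset by blast
    have vg: "verts (convex hull g) = g" using affine_independent_subset[OF simplexD(2)[OF F] g] by (rule verts_convex_hull)
    \<comment> \<open>\<open>up\<close> multiplies a monomial by the bubble of g, \<open>dn\<close>
      divides by it.\<close>
    define up where "up al = (%v. if v : g then Suc (al v) else 0)" for al :: "'a => nat"
    define dn where "dn al = (%v. if v : g then al v - 1 else 0)" for al :: "'a => nat"
    have sumg: "sum al ?S = sum al g" if "!!v. v ~: g ==> al v = 0" for al :: "'a => nat" by (rule sum.mono_neutral_right[OF fin g]) (use that in auto)
    have updn: "up (dn al) = al" if "al : D g" for al using that by (auto simp: D_def supp_def up_def dn_def)
    have dnup: "dn (up al) = al" if "al : bern_degs g s" for al s using that by (auto simp: bern_degs_def up_def dn_def)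
    have sumup: "sum (up al) g = sum al g + card g" for al
    proof -
      have "sum (up al) g = (SUM v:g. al v + 1)" by (rule sum.cong) (auto simp: up_def One_nat_def)
      thus ?thesis by (simp only: sum.distrib card_eq_sum)
    qed
    have upD: "up al : D g" if "al : bern_degs g (int r - int (card g))" for al
    proof -
      have s1: "sum (up al) ?S = sum al g + card g" unfolding sumup[symmetric] by (rule sumg) (simp add: up_def)
      have "int (sum (up al) ?S) = int r" using that unfolding s1 bern_degs_def by (simp del: of_nat_sum)
      moreover have "ALL v. v ~: ?S --> up al v = 0" using g by (auto simp: up_def)
      moreover have "supp (up al) = g" by (auto simp: supp_def up_def)
      ultimately show ?thesis by (simp add: D_def bern_degs_def del: of_nat_sum)
    qed
    have dnD: "dn al : bern_degs g (int r - int (card g))" if "al : D g" for al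
    proof -
      have "sum al ?S = sum al g" by (rule sumg) (use that in \<open>auto simp: D_def supp_def\<close>)
      hence "int (sum al ?S) = int (sum (dn al) g) + int (card g)" using sumup[of "dn al"] updn[OF that] by simp
      moreover have "int (sum al ?S) = int r" using that by (simp add: D_def bern_degs_def del: of_nat_sum)
      ultimately have "int (sum (dn al) g) = int r - int (card g)" by linarith
      thus ?thesis by (simp add: bern_degs_def dn_def del: of_nat_sum)
    qed
    have mup: "?m (up al) x = (PROD v:g. bary F v x) * (PROD v:g. bary F v x ^ al v)"
      if "al : bern_degs g (int r - int (card g))" for al x
    proof -
      have "?m (up al) x = (PROD v:g. bary F v x * bary F v x ^ al v)" unfolding mg[OF upD[OF that]] by (rule prod.cong) (auto simp: up_def)
      thus ?thesis by (simp add: prod.distrib)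
    qed
    have Req: "R g x = (if x : F then (PROD v:g. bary F v x) * bern_sum F g (int r - int (card g)) (%al. c (up al)) x else 0)" for x
    proof -
      have "(SUM al:D g. c al * ?m al x) = (SUM al:bern_degs g (int r - int (card g)). c (up al) * ?m (up al) x)" by (rule sum.reindex_bij_witness[of _ up dn]) (auto simp: updn dnup upD dnD)
      also have "... = (PROD v:g. bary F v x) * bern_sum F g (int r - int (card g)) (%al. c (up al)) x"
        unfolding bern_sum_def sum_distrib_left by (rule sum.cong) (auto simp: mup)
      finally show ?thesis by (simp add: R_def)
    qed
    thus "R g : bubble_Poly F (convex hull g) (int r - int (card g))" unfolding bubble_Poly_alt vg by blast
    show z: "R g x = 0" if "v : g" "bary F v x = 0" for x v
    proof -
      have "(PROD v:g. bary F v x) = 0" using that fing by (intro prod_zero) auto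
      thus ?thesis by (simp add: Req)
    qed
    show "R g x = 0" if zero: "!!y. y : convex hull g ==> R g y = 0" for x
    proof (cases "x : F & g ~= {} & (ALL v:g. bary F v x ~= 0)")
      case False
      then consider "x ~: F" | "g = {}" | v where "v : g" "bary F v x = 0" by blast
      thus ?thesis
      proof cases
        case 2
        hence "D g = {}" using r by (auto simp: D_def bern_degs_def supp_def)
        thus ?thesis by (simp add: R_def)
      next
        case 3
        thus ?thesis by (rule z)
      qed (simp add: R_def)
    next
      case True
      hence x: "x : F" and ne: "g ~= {}" and pos: "!!v. v : g ==> bary F v x > 0" using bary_nonneg[OF F] g by (auto simp: less_le)
      define t where "t = (SUM v:g. bary F v x)"
      have t: "t > 0" unfolding t_def using pos ne fing by (simp add: sum_pos)
      \<comment> \<open>The point of the face of g whose coordinates have the same ratios as those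
        of x. By homogeneity the values at x and y differ by the factor t ^ r.\<close>
      define y where "y = (SUM v:g. (bary F v x / t) *\<^sub>R v)"
      have one: "(SUM v:g. bary F v x / t) = 1" using t by (simp add: t_def flip: sum_divide_distrib)
      have yg: "y : convex hull g" unfolding convex_hull_finite[OF fing]
        using one t pos by (intro CollectI exI[of _ "%v. bary F v x / t"]) (auto simp: y_def less_imp_le)
      have bry: "bary F v y = bary F v x / t" if v: "v : g" for v
      proof -
        note fc = subset_simplex[OF F g ne]
        have "y : affine hull verts (convex hull g)" unfolding fc(2) using yg convex_hull_subset_affine_hull by blast
        hence "bary F v y = bary (convex hull g) v y" using bary_face[OF F fc(1), of y v] v g fc(2) by auto
        also have "... = bary F v x / t" by (rule bary_unique[OF Delta_simplex[OF fc(1)]]) (use one y_def v fc(2) in auto)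
        finally show ?thesis .
      qed
      have yF: "y : F" using yg g hull_mono[OF g, of convex] simplexD(4)[OF F] by blast
      have "?m al y = ?m al x / t ^ r" if al: "al : D g" for al
      proof -
        have "sum al ?S = sum al g" by (rule sumg) (use al in \<open>auto simp: D_def supp_def\<close>)
        moreover have "int (sum al ?S) = int r" using al by (simp add: D_def bern_degs_def del: of_nat_sum)
        ultimately have "sum al g = r" by (simp del: of_nat_sum)
        have "?m al y = (PROD v:g. bary F v x ^ al v / t ^ al v)" unfolding mg[OF al] by (rule prod.cong) (auto simp: bry power_divide)
        also have "... = (PROD v:g. bary F v x ^ al v) / t ^ sum al g" by (simp add: prod_dividef power_sum)
        finally show ?thesis by (simp only: mg[OF al] \<open>sum al g = r\<close>)
      qed
      hence "R g y = R g x / t ^ r" using x yF by (simp add: R_def sum_divide_distrib)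
      thus ?thesis using zero[OF yg] t by simp
    qed
  next
    fix x
    have "D {} = {}" using r by (auto simp: D_def bern_degs_def supp_def)
    thus "R {} x = 0" by (simp add: R_def)
  qed
qed

text \<open>Induction on the size of g. On the face of g the groups with a vertex outside g vanish,
  those of proper subsets are 0 by induction, and so \<open>R g\<close> coincides with p, which is 0
  there. Sizes count vertices: \<open>card g <= k\<close> means dimension below k.\<close>

lemma bern_decomp_vanishing:
  assumes F: "int l simplex F" and r: "r >= 1"
    and u: "pf r p" and z: "!!g y. g <= verts F ==> g ~= {} ==> card g <= k ==> y : convex hull g ==> p y = 0"
  obtains R where
    "!!x. x : F ==> p x = (SUM g:{g : Pow (verts F). k < card g}. R g x)"
    "!!g. g <= verts F ==> R g : bubble_Poly F (convex hull g) (int r - int (card g))"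
proof -
  let ?S = "verts F"
  note fin = simplexD(1)[OF F]
  obtain c where c: "!!x. x : F ==> p x = bern_sum F ?S (int r) c x" using pf_bern_sum[OF F u] by blast
  obtain R where R: "!!x. x : F ==> p x = (SUM g:Pow ?S. R g x)"
    and Rb: "!!g. g <= ?S ==> R g : bubble_Poly F (convex hull g) (int r - int (card g))"
    and R0: "!!g x v. g <= ?S ==> v : g ==> bary F v x = 0 ==> R g x = 0"
    and Rh: "!!g x. g <= ?S ==> (!!y. y : convex hull g ==> R g y = 0) ==> R g x = 0"
    and Re: "!!x. R {} x = 0" by (rule bern_decomp[OF F r, of p c]) (use c that in blast)+
  have "R g x = 0" if "g <= ?S" "card g <= k" for g x using that
  proof (induction "card g" arbitrary: g x rule: less_induct)
    case less
    show ?case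
    proof (cases "g = {}")
      case True
      thus ?thesis by (simp add: Re)
    next
      case ne: False
      note fc = subset_simplex[OF F less.prems(1) ne]
      have fing: "finite g" using less.prems(1) fin finite_subset by blast
      show ?thesis
      proof (rule Rh[OF less.prems(1)])
        fix y assume y: "y : convex hull g"
        have yF: "y : F" using y hull_mono[OF less.prems(1), of convex] simplexD(4)[OF F] by blast
        have yh: "y : affine hull verts (convex hull g)" unfolding fc(2) using y convex_hull_subset_affine_hull by blast
        have h0: "R h y = 0" if h: "h <= ?S" "h ~= g" for h
        proof (cases "h <= g")
          case True
          hence "card h < card g" using h(2) fing by (simp add: psubset_card_mono psubsetI)
          thus ?thesis using less h(1) by force
        next
          case False
          then obtain v where v: "v : h" "v ~: g" by blast
          hence "bary F v y = 0" using bary_face[OF F fc(1) yh, of v] h(1) fc(2) by auto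
          thus ?thesis using R0[OF h(1) v(1)] by blast
        qed
        have "0 = p y" using z[OF less.prems(1) ne less.prems(2) y] by simp
        also have "... = (SUM h:{g}. R h y)" unfolding R[OF yF] by (rule sum.mono_neutral_right) (use fin less.prems(1) h0 in auto)
        finally show "R g y = 0" by simp
      qed
    qed
  qed
  hence "p x = (SUM g:{g : Pow ?S. k < card g}. R g x)" if "x : F" for x
    unfolding R[OF that] by (intro sum.mono_neutral_right) (use fin in \<open>auto simp: not_less\<close>)
  thus thesis using Rb that by blast
qed

text \<open>Only the group with full support survives, and it is the bubble times a Bernstein sum of
  the remaining degree.\<close>

lemma Poly_vanishing_on_boundary:
  fixes f :: "'n::finite rvec set"
  assumes f: "int l simplex f" and r: "r >= 1" and u: "u : Poly (int r) f"
    and z: "!!m g y. m < l ==> g : Delta m f ==> y : g ==> u y = 0"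
  obtains q where "q : Poly (int r - int (l + 1)) f" "!!x. x : f ==> u x = (PROD v:verts f. bary f v x) * q x"
proof -
  let ?S = "verts f"
  obtain p where p: "pf r p" "u = (%x. if x : f then p x else 0)" using u unfolding Poly_iff_pf by blast
  have z': "p y = 0" if g: "g <= ?S" "g ~= {}" "card g <= l" and y: "y : convex hull g" for g y
  proof -
    note fc = subset_simplex[OF f g(1,2)]
    have "card g > 0" using g simplexD(1)[OF f] by (simp add: card_gt_0_iff finite_subset)
    hence "u y = 0" using z[OF _ fc(1) y] g(3) by auto
    moreover have "y : f" using Delta_subset[OF fc(1)] y by blast
    ultimately show ?thesis using p(2) by simp
  qed
  obtain R where R: "!!x. x : f ==> p x = (SUM g:{g : Pow ?S. l < card g}. R g x)"
    and Rb: "!!g. g <= ?S ==> R g : bubble_Poly f (convex hull g) (int r - int (card g))"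
  proof (rule bern_decomp_vanishing[OF f r p(1), of l])
    show "p y = 0" if "g <= ?S" "g ~= {}" "card g <= l" "y : convex hull g" for g y by (rule z'[OF that])
  qed (rule that)
  have "{g : Pow ?S. l < card g} = {?S}"
  proof -
    have "g = ?S" if "g <= ?S" "l < card g" for g by (rule card_seteq) (use that simplexD[OF f] in auto)
    thus ?thesis using simplexD(3)[OF f] by auto
  qed
  with R have pS: "p x = R ?S x" if "x : f" for x using that by simp
  obtain c where c: "!!x. R ?S x = (if x : f then (PROD v:?S. bary f v x) * bern_sum f ?S (int r - int (l + 1)) c x else 0)"
    using Rb[OF order_refl] unfolding simplexD(4)[OF f, symmetric] simplexD(3)[OF f] bubble_Poly_alt by blast
  show thesis
  proof (rule that)
    show "(%x. if x : f then bern_sum f ?S (int r - int (l + 1)) c x else 0) : Poly (int r - int (l + 1)) f" by (rule bern_sum_Poly[OF f order_refl])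
  qed (simp add: p(2) pS c)
qed

lemma Poly_vanishing_Bubble:
  fixes F :: "'n::finite rvec set"
  assumes F: "int (CARD('n) - 1) simplex F" and r: "r >= 1" and u: "u : Poly (int r) F"
    and z: "!!m g y. m < k ==> g : Delta m F ==> y : g ==> u y = 0"
  shows "u : Bubble r k F"
proof -
  let ?S = "verts F" and ?n = "CARD('n)"
  obtain p where p: "pf r p" "u = (%x. if x : F then p x else 0)" using u unfolding Poly_iff_pf by blast
  have n: "?n >= 1" by (simp add: Suc_le_eq One_nat_def)
  have z': "p y = 0" if g: "g <= ?S" "g ~= {}" "card g <= k" and y: "y : convex hull g" for g y
  proof -
    note fc = subset_simplex[OF F g(1,2)]
    have "card g > 0" using g simplexD(1)[OF F] by (simp add: card_gt_0_iff finite_subset)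
    hence "u y = 0" using z[OF _ fc(1) y] g(3) by auto
    moreover have "y : F" using Delta_subset[OF fc(1)] y by blast
    ultimately show ?thesis using p(2) by simp
  qed
  obtain R where R: "!!x. x : F ==> p x = (SUM g:{g : Pow ?S. k < card g}. R g x)"
    and Rb: "!!g. g <= ?S ==> R g : bubble_Poly F (convex hull g) (int r - int (card g))"
  proof (rule bern_decomp_vanishing[OF F r p(1), of k])
    show "p y = 0" if "g <= ?S" "g ~= {}" "card g <= k" "y : convex hull g" for g y by (rule z'[OF that])
  qed (rule that)
  show ?thesis unfolding Bubble_def
  proof (intro CollectI exI[of _ "%f. R (verts f)"] conjI ballI)
    fix l f assume l: "l : {k..DIM('n rvec) - 1}" and f: "f : Delta l F"
    show "R (verts f) : bubble_Poly F f (int r - int (l + 1))" using Rb[OF Delta_verts[OF F f]] simplexD(3,4)[OF Delta_simplex[OF f]] by simp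
  next
    have "u x = (SUM l:{k..?n - 1}. SUM f:Delta l F. R (verts f) x)" for x
    proof (cases "x : F")
      case False
      have "R (verts f) x = 0" if "f : Delta l F" for l f using Rb[OF Delta_verts[OF F that]] False unfolding bubble_Poly_alt by auto
      thus ?thesis using False p(2) by simp
    next
      case True
      have "u x = (SUM g:{g : Pow ?S. k < card g}. R g x)" using True R p(2) by simp
      also have "... = (SUM (l, f):(SIGMA l:{k..?n - 1}. Delta l F). R (verts f) x)"
      proof (rule sum.reindex_bij_witness[of _ "%(l, f). verts f" "%g. (card g - 1, convex hull g)"])
        fix g assume g: "g : {g : Pow ?S. k < card g}"
        hence ne: "g ~= {}" by auto
        note fc = subset_simplex[OF F _ ne]
        show "(case (card g - 1, convex hull g) of (l, f) => verts f) = g" using fc(2) g by auto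
        have "card g <= card ?S" using g simplexD(1)[OF F] by (auto intro: card_mono)
        hence "card g - 1 : {k..?n - 1}" using g simplexD(3)[OF F] n by auto
        thus "(card g - 1, convex hull g) : (SIGMA l:{k..?n - 1}. Delta l F)" using fc(1) g by auto
        show "(case (card g - 1, convex hull g) of (l, f) => R (verts f) x) = R g x" using fc(2) g by auto
      next
        fix q assume q: "q : (SIGMA l:{k..?n - 1}. Delta l F)"
        obtain l f where lf: "q = (l, f)" by (cases q)
        hence f: "l : {k..?n - 1}" "f : Delta l F" using q by auto
        note sd = simplexD[OF Delta_simplex[OF f(2)]]
        show "(card (case q of (l, f) => verts f) - 1, convex hull (case q of (l, f) => verts f)) = q" using sd(3,4) lf by simp
        show "(case q of (l, f) => verts f) : {g : Pow ?S. k < card g}" using sd(3) f Delta_verts[OF F f(2)] lf by auto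
      qed
      also have "... = (SUM l:{k..?n - 1}. SUM f:Delta l F. R (verts f) x)" by (rule sum.Sigma[symmetric]) (auto simp: finite_Delta[OF F])
      finally show ?thesis .
    qed
    thus "u = (%x. SUM l:{k..DIM('n rvec) - 1}. SUM f:Delta l F. R (verts f) x)" by auto
  qed
qed

lemma Bubble_Poly:
  fixes F :: "'n::finite rvec set"
  assumes F: "int m simplex F" and u: "u : Bubble r k F"
  shows "u : Poly (int r) F"
proof -
  obtain g where g: "!!l f. l : {k..DIM('n rvec) - 1} ==> f : Delta l F ==> g f : bubble_Poly F f (int r - int (l + 1))"
    "u = (%x. SUM l:{k..DIM('n rvec) - 1}. SUM f:Delta l F. g f x)" using u unfolding Bubble_def by blast
  show ?thesis unfolding g(2) by (intro Poly_sum bubble_Poly_Poly[OF F _ g(1)])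
qed

lemma Bubble_lin:
  assumes "u : Bubble r k F" "v : Bubble r k F"
  shows "(%x. u x + a * v x) : Bubble r k F"
proof -
  obtain g h where g: "!!l f. l : {k..DIM('a) - 1} ==> f : Delta l F ==> g f : bubble_Poly F f (int r - int (l + 1))"
    "u = (%x. SUM l:{k..DIM('a) - 1}. SUM f:Delta l F. g f x)"
    "!!l f. l : {k..DIM('a) - 1} ==> f : Delta l F ==> h f : bubble_Poly F f (int r - int (l + 1))"
    "v = (%x. SUM l:{k..DIM('a) - 1}. SUM f:Delta l F. h f x)" using assms unfolding Bubble_def by blast
  show ?thesis unfolding Bubble_def
  proof (intro CollectI exI[of _ "%f x. g f x + a * h f x"] conjI ballI)
    fix l f assume "l : {k..DIM('a) - 1}" "f : Delta l F"
    thus "(%x. g f x + a * h f x) : bubble_Poly F f (int r - int (l + 1))" by (intro bubble_Poly_add bubble_Poly_scale g(1,3))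
  qed (simp add: g(2,4) sum.distrib sum_distrib_left)
qed

section \<open>Translation invariance and integration by parts\<close>

text \<open>Under an invariant measure every difference quotient has integral 0, and the Lipschitz
  bound justifies the limit. Convergence is required almost everywhere only, so that
  \<open>G\<close> may be a function truncated to a convex set.\<close>

lemma integral_translation_derivative_zero:
  fixes mm :: "'a::euclidean_space measure" and G G' :: "'a => real"
  assumes sets [simp, measurable_cong]: "sets mm = sets borel"
    and inv: "!!t. distr mm borel (%x. x + t *\<^sub>R d) = mm"
    and fin: "!!R. emeasure mm (cball 0 R) < \<infinity>"
    and G [measurable]: "G : borel_measurable borel" and G' [measurable]: "G' : borel_measurable borel"
    and supp: "!!x. norm x > R ==> G x = 0" and bnd: "!!x. \<bar>G x\<bar> <= M"
    and lip: "!!x t. 0 < t ==> t <= 1 ==> \<bar>G (x + t *\<^sub>R d) - G x\<bar> <= L * t"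
    and lim: "AE x in mm. (%m. (G (x + inverse (real (Suc m)) *\<^sub>R d) - G x) * real (Suc m)) \<longlonglongrightarrow> G' x"
  shows "integral\<^sup>L mm G' = 0"
proof -
  have intG: "integrable mm G" by (rule integrableI_bounded_set[where A = "cball 0 R" and B = M])
      (use fin bnd supp in \<open>auto simp: not_le\<close>)
  let ?s = "%m x. (G (x + inverse (real (Suc m)) *\<^sub>R d) - G x) * real (Suc m)"
  have sh: "integrable mm (%x. G (x + t *\<^sub>R d))" "(\<integral>x. G (x + t *\<^sub>R d) \<partial>mm) = integral\<^sup>L mm G" for t
  proof -
    have m: "(%x. x + t *\<^sub>R d) : measurable mm borel" by measurable
    show "integrable mm (%x. G (x + t *\<^sub>R d))" using intG integrable_distr_eq[OF m G] inv[of t] by simp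
    show "(\<integral>x. G (x + t *\<^sub>R d) \<partial>mm) = integral\<^sup>L mm G" using integral_distr[OF m G] inv[of t] by simp
  qed
  have z: "integral\<^sup>L mm (?s m) = 0" for m by (simp add: sh intG)
  have "(%m. integral\<^sup>L mm (?s m)) \<longlonglongrightarrow> integral\<^sup>L mm G'"
  proof (rule integral_dominated_convergence[where w = "%x. indicator (cball 0 (R + norm d)) x * L"])
    show "integrable mm (%x. indicator (cball 0 (R + norm d)) x * L)" by (intro integrable_mult_left integrable_real_indicator) (use fin in auto)
    show "AE x in mm. norm (?s m x) <= indicator (cball 0 (R + norm d)) x * L" for m
    proof (rule AE_I2)
      fix x
      let ?t = "inverse (real (Suc m))"
      have t: "0 < ?t" "?t <= 1" by (auto simp: field_simps)
      have "?s m x = 0" if far: "norm x > R + norm d"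
      proof -
        have "norm x <= norm (x + ?t *\<^sub>R d) + norm (?t *\<^sub>R d)" using norm_triangle_ineq4[of "x + ?t *\<^sub>R d" "?t *\<^sub>R d"] by simp
        moreover have "norm (?t *\<^sub>R d) <= norm d" using t by (simp add: mult_left_le_one_le)
        ultimately have "norm (x + ?t *\<^sub>R d) > R" using far by linarith
        moreover have "norm x > R" using far norm_ge_zero[of d] by linarith
        ultimately show ?thesis using supp by simp
      qed
      moreover have "\<bar>?s m x\<bar> <= L"
      proof -
        have "\<bar>?s m x\<bar> <= (L * ?t) * real (Suc m)" using lip[OF t, of x] by (simp add: abs_mult mult_right_mono)
        also have "... = L * (inverse (real (Suc m)) * real (Suc m))" by (simp only: mult.assoc)
        also have "inverse (real (Suc m)) * real (Suc m) = 1" by (rule left_inverse) simp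
        finally show ?thesis by simp
      qed
      ultimately show "norm (?s m x) <= indicator (cball 0 (R + norm d)) x * L" by (auto simp: indicator_def not_le)
    qed
  qed (use lim in auto)
  hence "(%m. 0 :: real) \<longlonglongrightarrow> integral\<^sup>L mm G'" by (simp only: z)
  thus ?thesis by (simp add: LIMSEQ_const_iff)
qed

section \<open>The measure of a face\<close>

text \<open>\<open>face_measure\<close> is defined by a choice of origin and orthonormal frame. The
  properties below are proved for whatever was chosen.\<close>

lemma face_chart:
  fixes f :: "'a::euclidean_space set"
  assumes "f ~= {}"
  obtains p B where "p : f" "finite B" "pairwise orthogonal B" "!!b. b : B ==> norm b = 1"
    "span B = tangent_space f"
    "face_measure f = distr (Pi\<^sub>M B (%_. lborel)) borel (%s. p + (SUM b:B. s b *\<^sub>R b))"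
proof -
  define p where "p = (SOME p. p : f)"
  let ?Q = "%B. pairwise orthogonal B & (ALL b:B. norm b = 1) & span B = tangent_space f"
  define B where "B = (SOME B. ?Q B)"
  have p: "p : f" unfolding p_def using assms by (simp add: some_in_eq)
  have "EX B. ?Q B"
  proof -
    have "subspace (tangent_space f)" by (simp add: tangent_space_def)
    then obtain C where "pairwise orthogonal C" "!!x. x : C ==> norm x = 1" "span C = tangent_space f" by (rule orthonormal_basis_subspace) (rule that)
    thus ?thesis by (intro exI[of _ C]) simp
  qed
  hence B: "?Q B" unfolding B_def by (rule someI_ex[of ?Q])
  hence "norm b = 1" if "b : B" for b using that by blast
  hence "0 ~: B" by (metis norm_zero zero_neq_one)
  hence "independent B" using B by (intro pairwise_orthogonal_independent) auto
  hence "finite B" by (rule independent_imp_finite)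
  moreover have "face_measure f = distr (Pi\<^sub>M B (%_. lborel)) borel (%s. p + (SUM b:B. s b *\<^sub>R b))" by (simp add: face_measure_def Let_def flip: p_def B_def)
  ultimately show thesis using that p B by blast
qed

lemma chart_measurable [measurable]:
  "finite B ==> (%s. p + (SUM b:B. s b *\<^sub>R b)) : borel_measurable (Pi\<^sub>M B (%_. lborel :: real measure))"
  for p :: "'a::euclidean_space" by measurable

lemma chart_inner:
  assumes "finite B" "pairwise orthogonal B" "!!b. b : B ==> norm b = 1" "b : B"
  shows "(SUM b:B. s b *\<^sub>R b) \<bullet> b = (s b :: real)"
proof -
  have "(SUM c:B. s c *\<^sub>R c) \<bullet> b = (SUM c:B. s c * (c \<bullet> b))" by (simp add: inner_sum_left)
  also have "... = (SUM c:B. if c = b then s b else 0)"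
  proof (rule sum.cong[OF refl])
    fix c assume c: "c : B"
    show "s c * (c \<bullet> b) = (if c = b then s b else 0)"
    proof (cases "c = b")
      case True
      thus ?thesis using assms(3)[OF assms(4)] by (simp add: norm_eq_1)
    next
      case False
      hence "orthogonal c b" using assms(2,4) c by (auto simp: pairwise_def)
      thus ?thesis using False by (simp add: orthogonal_def)
    qed
  qed
  also have "... = s b" using assms by simp
  finally show ?thesis .
qed

lemma sets_face_measure [simp, measurable_cong]: "sets (face_measure f) = sets borel" by (simp add: face_measure_def Let_def)

lemma space_face_measure [simp]: "space (face_measure f) = UNIV" by (simp add: face_measure_def Let_def)

lemma face_measure_finite:
  fixes f :: "'a::euclidean_space set"
  assumes "f ~= {}"
  shows "emeasure (face_measure f) (cball 0 R) < \<infinity>"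
proof -
  interpret P: product_sigma_finite "%_ :: 'a. lborel :: real measure" by standard
  obtain p B where pB: "p : f" "finite B" "pairwise orthogonal B" "!!b. b : B ==> norm b = 1"
    "span B = tangent_space f"
    "face_measure f = distr (Pi\<^sub>M B (%_. lborel)) borel (%s. p + (SUM b:B. s b *\<^sub>R b))" using face_chart[OF assms] by blast
  let ?ph = "%s. p + (SUM b:B. s b *\<^sub>R b)" and ?M = "Pi\<^sub>M B (%_. lborel :: real measure)"
  define r where "r = R + norm p"
  have "emeasure (face_measure f) (cball 0 R) = emeasure ?M (?ph -` cball 0 R \<inter> space ?M)"
    unfolding pB(6) by (rule emeasure_distr) (use chart_measurable[OF pB(2)] in auto)
  also have "... <= emeasure ?M (Pi\<^sub>E B (%_. {- r..r}))"
  proof (rule emeasure_mono)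
    show "?ph -` cball 0 R \<inter> space ?M <= Pi\<^sub>E B (%_. {- r..r})"
    proof
      fix s assume s: "s : ?ph -` cball 0 R \<inter> space ?M"
      have "s b : {- r..r}" if b: "b : B" for b
      proof -
        have "s b = (?ph s - p) \<bullet> b" using chart_inner[OF pB(2-4) b, of s] by simp
        also have "\<bar>\<dots>\<bar> <= norm (?ph s - p) * norm b" by (rule Cauchy_Schwarz_ineq2)
        also have "... <= r" using s norm_triangle_ineq4[of "?ph s" p] pB(4)[OF b] by (simp add: r_def)
        finally show ?thesis by (auto simp: abs_le_iff)
      qed
      thus "s : Pi\<^sub>E B (%_. {- r..r})" using s by (simp add: space_PiM PiE_iff)
    qed
    show "Pi\<^sub>E B (%_. {- r..r}) : sets ?M" by (rule sets_PiM_I_finite) (use pB(2) in auto)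
  qed
  also have "... = (PROD b:B. emeasure lborel {- r..r})" by (rule P.emeasure_PiM) (use pB(2) in auto)
  also have "... = ennreal ((if - r <= r then r - (- r) else 0) ^ card B)" by (subst emeasure_lborel_Icc_eq) (simp add: ennreal_power)
  also have "... < \<infinity>" by simp
  finally show ?thesis .
qed

text \<open>In the chart a tangential translation is a shift of coordinates; that the product
  measure is invariant under shifts is checked on boxes.\<close>

lemma face_measure_translation:
  fixes f :: "'a::euclidean_space set"
  assumes "f ~= {}" and d: "d : tangent_space f"
  shows "distr (face_measure f) borel (%x. x + d) = face_measure f"
proof -
  interpret P: product_sigma_finite "%_ :: 'a. lborel :: real measure" by standard
  obtain p B where pB: "p : f" "finite B" "pairwise orthogonal B" "!!b. b : B ==> norm b = 1"
    "span B = tangent_space f"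
    "face_measure f = distr (Pi\<^sub>M B (%_. lborel)) borel (%s. p + (SUM b:B. s b *\<^sub>R b))" using face_chart[OF assms(1)] by blast
  let ?ph = "%s. p + (SUM b:B. s b *\<^sub>R b)" and ?M = "Pi\<^sub>M B (%_. lborel :: real measure)"
  obtain de where de: "d = (SUM b:B. de b *\<^sub>R b)" using d unfolding pB(5)[symmetric] span_finite[OF pB(2)] by blast
  define ta where "ta s = restrict (%b. de b + s b) B" for s :: "'a => real"
  have taM [measurable]: "ta : measurable ?M ?M" unfolding ta_def by (rule measurable_restrict) measurable
  have "distr ?M ?M ta = ?M"
  proof (rule P.PiM_eqI[OF pB(2)])
    fix A :: "'a => real set" assume A: "!!i. i : B ==> A i : sets lborel"
    have "emeasure (distr ?M ?M ta) (Pi\<^sub>E B A) = emeasure ?M (ta -` Pi\<^sub>E B A \<inter> space ?M)" by (rule emeasure_distr[OF taM sets_PiM_I_finite]) (use pB(2) A in auto)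
    also have "ta -` Pi\<^sub>E B A \<inter> space ?M = Pi\<^sub>E B (%b. (%x. de b + x) -` A b)" by (auto simp: ta_def space_PiM PiE_def Pi_def extensional_def)
    also have "emeasure ?M \<dots> = (PROD b:B. emeasure lborel ((%x. de b + x) -` A b))"
    proof (rule P.emeasure_PiM[OF pB(2)])
      fix b assume b: "b : B"
      have "(%x. de b + x) -` A b \<inter> space borel : sets borel" by (rule measurable_sets[of _ _ borel]) (use A[OF b] in auto)
      thus "(%x. de b + x) -` A b : sets lborel" by simp
    qed
    also have "... = (PROD b:B. emeasure lborel (A b))"
    proof (rule prod.cong[OF refl])
      fix b assume b: "b : B"
      have "emeasure lborel (A b) = emeasure (distr lborel borel ((+) (de b))) (A b)" by (simp add: lborel_distr_plus)
      also have "... = emeasure lborel ((%x. de b + x) -` A b)" by (subst emeasure_distr) (use A[OF b] in auto)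
      finally show "emeasure lborel ((%x. de b + x) -` A b) = emeasure lborel (A b)" by simp
    qed
    finally show "emeasure (distr ?M ?M ta) (Pi\<^sub>E B A) = (PROD b:B. emeasure lborel (A b))" .
  qed simp
  hence "face_measure f = distr (distr ?M ?M ta) borel ?ph" by (simp add: pB(6))
  also have "... = distr ?M borel (?ph \<circ> ta)" by (rule distr_distr[OF chart_measurable[OF pB(2)] taM])
  also have "?ph \<circ> ta = (%x. x + d) \<circ> ?ph"
  proof
    fix s
    have "(SUM b:B. ta s b *\<^sub>R b) = (SUM b:B. de b *\<^sub>R b + s b *\<^sub>R b)" by (rule sum.cong) (auto simp: ta_def algebra_simps)
    thus "(?ph \<circ> ta) s = ((%x. x + d) \<circ> ?ph) s" by (simp add: de sum.distrib algebra_simps)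
  qed
  also have "distr ?M borel ((%x. x + d) \<circ> ?ph) = distr (face_measure f) borel (%x. x + d)"
    unfolding pB(6) by (rule distr_distr[symmetric]) (use chart_measurable[OF pB(2)] in auto)
  finally show ?thesis by simp
qed

lemma tangent_space_affine:
  assumes "p : f" "d : tangent_space f"
  shows "p + d : affine hull f"
proof -
  have "{x - y | x y. x : f & y : f} <= {x - p | x. x : affine hull f}"
  proof
    fix z assume "z : {x - y | x y. x : f & y : f}"
    then obtain x y where xy: "z = x - y" "x : f" "y : f" by blast
    have "p + 1 *\<^sub>R (x - y) : affine hull f" by (rule mem_affine_3_minus) (use xy assms(1) in \<open>auto simp: hull_inc affine_affine_hull\<close>)
    thus "z : {x - p | x. x : affine hull f}" using xy by (intro CollectI exI[of _ "p + (x - y)"]) auto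
  qed
  moreover have "subspace {x - p | x. x : affine hull f}"
    using affine_diffs_subspace_subtract[of "affine hull f" p] assms(1) by (simp add: hull_inc affine_affine_hull) (simp add: image_def Collect_disj_eq setcompr_eq_image)
  ultimately have "tangent_space f <= {x - p | x. x : affine hull f}" unfolding tangent_space_def by (rule span_minimal)
  thus ?thesis using assms(2) by auto
qed

lemma diff_in_tangent_space:
  assumes "x : affine hull f" "y : affine hull f"
  shows "x - y : tangent_space f"
proof -
  have f: "f ~= {}" using assms(1) by auto
  then obtain p where p: "p : f" by blast
  have "f <= (%z. p + z) ` tangent_space f"
  proof
    fix z assume "z : f"
    hence "z - p : tangent_space f" unfolding tangent_space_def using p by (intro span_base) blast
    thus "z : (%z. p + z) ` tangent_space f" by (intro image_eqI[of _ _ "z - p"]) auto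
  qed
  moreover have "affine ((%z. p + z) ` tangent_space f)" unfolding affine_translation[symmetric] tangent_space_def by (intro subspace_imp_affine) simp
  ultimately have "affine hull f <= (%z. p + z) ` tangent_space f" by (rule hull_minimal)
  then obtain a b where "a : tangent_space f" "b : tangent_space f" "x = p + a" "y = p + b" using assms by blast
  thus ?thesis unfolding tangent_space_def by (simp add: span_diff)
qed

lemma face_measure_pos:
  fixes f :: "'a::euclidean_space set"
  assumes x0: "x0 : rel_interior f" and e: "e > 0" and fb: "f : sets borel"
  shows "emeasure (face_measure f) (f \<inter> ball x0 e) > 0"
proof -
  interpret P: product_sigma_finite "%_ :: 'a. lborel :: real measure" by standard
  have x0f: "x0 : f" using x0 rel_interior_subset by blast
  obtain p B where pB: "p : f" "finite B" "pairwise orthogonal B" "!!b. b : B ==> norm b = 1"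
    "span B = tangent_space f"
    "face_measure f = distr (Pi\<^sub>M B (%_. lborel)) borel (%s. p + (SUM b:B. s b *\<^sub>R b))" using face_chart[of f] x0f by blast
  let ?ph = "%s. p + (SUM b:B. s b *\<^sub>R b)" and ?M = "Pi\<^sub>M B (%_. lborel :: real measure)"
  obtain de where de: "de > 0" "ball x0 de \<inter> affine hull f <= f" using x0 unfolding mem_rel_interior_ball by blast
  have "x0 - p : span B" unfolding pB(5) by (rule diff_in_tangent_space) (use x0f pB(1) in \<open>auto simp: hull_inc\<close>)
  then obtain s0 where s0: "x0 - p = (SUM b:B. s0 b *\<^sub>R b)" unfolding span_finite[OF pB(2)] by blast
  \<comment> \<open>A coordinate box of this half-width about x0 stays within distance min e de, as
    the frame consists of \<open>card B\<close> unit vectors.\<close>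
  define et where "et = min e de / (real (card B) + 1)"
  have et: "et > 0" using e de by (simp add: et_def)
  have "real (card B) * et < (real (card B) + 1) * et" using et by simp
  also have "... = min e de" by (simp add: et_def)
  finally have etB: "real (card B) * et < min e de" .
  let ?A = "%b. {s0 b - et..s0 b + et}"
  have sub: "Pi\<^sub>E B ?A <= ?ph -` (f \<inter> ball x0 e) \<inter> space ?M"
  proof
    fix s assume s: "s : Pi\<^sub>E B ?A"
    have "?ph s - x0 = (SUM b:B. (s b - s0 b) *\<^sub>R b)" using s0 by (simp add: algebra_simps sum_subtractf)
    also have "norm \<dots> <= (SUM b:B. et)"
    proof (rule order_trans[OF norm_sum sum_mono])
      fix b assume b: "b : B"
      hence "s b : ?A b" using s by (auto simp: PiE_def)
      thus "norm ((s b - s0 b) *\<^sub>R b) <= et" using pB(4)[OF b] by (auto simp: abs_le_iff)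
    qed
    finally have d: "dist x0 (?ph s) < min e de" using etB by (simp add: dist_norm norm_minus_commute)
    have "?ph s : affine hull f"
    proof (rule tangent_space_affine[OF pB(1)])
      show "(SUM b:B. s b *\<^sub>R b) : tangent_space f" unfolding pB(5)[symmetric] by (intro span_sum span_scale span_base)
    qed
    hence "?ph s : f" using de(2) d by auto
    thus "s : ?ph -` (f \<inter> ball x0 e) \<inter> space ?M" using d s by (auto simp: space_PiM PiE_def)
  qed
  have "0 < (PROD b:B. emeasure lborel (?A b))" using et pB(2) by (subst zero_less_iff_neq_zero) auto
  also have "... = emeasure ?M (Pi\<^sub>E B ?A)" by (rule P.emeasure_PiM[symmetric]) (use pB(2) in auto)
  also have "... <= emeasure ?M (?ph -` (f \<inter> ball x0 e) \<inter> space ?M)" by (rule emeasure_mono[OF sub], rule measurable_sets[OF chart_measurable[OF pB(2)]]) (use fb in auto)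
  also have "... = emeasure (face_measure f) (f \<inter> ball x0 e)"
    unfolding pB(6) by (rule emeasure_distr[symmetric]) (use chart_measurable[OF pB(2)] fb in auto)
  finally show ?thesis .
qed

lemma simplex_compact: "int l simplex f ==> compact f" using simplexD(1,4) finite_imp_compact_convex_hull by metis

lemma simplex_convex: "int l simplex f ==> convex f" using simplexD(4) convex_convex_hull by metis

lemma simplex_nonempty: "int l simplex f ==> f ~= {}" using simplexD(3,4)[of l f] by (metis card.empty convex_hull_eq_empty add_is_0 one_neq_zero)

lemma simplex_closed: "int l simplex f ==> closed f" using simplex_compact compact_imp_closed by blast

lemma face_integrable:
  fixes g :: "'a::euclidean_space => real"
  assumes f: "int l simplex f" and g: "continuous_on f g"
  shows "integrable (face_measure f) (%x. indicator f x *\<^sub>R g x)"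
proof -
  have "compact (g ` f)" using compact_continuous_image[OF g simplex_compact[OF f]] .
  then obtain M where M: "!!x. x : f ==> \<bar>g x\<bar> <= M" using compact_imp_bounded[of "g ` f"] unfolding bounded_iff by auto
  obtain R where "ALL x:f. norm x <= R" using compact_imp_bounded[OF simplex_compact[OF f]] unfolding bounded_iff by blast
  hence R: "f <= cball 0 R" by auto
  have fb: "f : sets borel" using simplex_closed[OF f] by (rule borel_closed)
  have "emeasure (face_measure f) f <= emeasure (face_measure f) (cball 0 R)" by (rule emeasure_mono[OF R]) simp
  hence fin: "emeasure (face_measure f) f < \<infinity>" using face_measure_finite[OF simplex_nonempty[OF f], of R] by (rule le_less_trans)
  have m: "(%x. indicator f x *\<^sub>R g x) : borel_measurable (face_measure f)"
    unfolding measurable_cong_sets[OF sets_face_measure refl] by (rule borel_measurable_continuous_on_indicator[OF fb g])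
  show ?thesis by (rule integrableI_bounded_set[where A = f and B = M]) (use m fb fin M in auto)
qed

lemma face_integral_add:
  fixes g h :: "'a::euclidean_space => real"
  assumes f: "int l simplex f" and "continuous_on f g" "continuous_on f h"
  shows "face_integral f (%x. g x + h x) = face_integral f g + face_integral f h"
  using face_integrable[OF assms(1,2)] face_integrable[OF assms(1,3)] by (simp add: face_integral_def set_lebesgue_integral_def algebra_simps)

lemma face_integral_scale: "face_integral f (%x. c * g x) = c * face_integral f g" by (simp add: face_integral_def set_lebesgue_integral_def mult.left_commute[of _ c])

lemma face_integral_cong:
  "(!!x. x : f ==> g x = h x) ==> face_integral f g = face_integral f h"
  unfolding face_integral_def set_lebesgue_integral_def by (rule Bochner_Integration.integral_cong) (auto simp: indicator_def)

lemma face_integral_zero: "face_integral f (%x. 0) = 0" by (simp add: face_integral_def set_lebesgue_integral_def)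

text \<open>Relative balls about points of the relative interior have positive measure, so
  \<open>g\<close> vanishes there; the simplex is the closure of its relative interior.\<close>

lemma face_integral_pos_def:
  fixes g :: "'a::euclidean_space => real"
  assumes f: "int l simplex f" and g: "continuous_on f g" and nn: "!!x. x : f ==> g x >= 0"
    and z: "face_integral f g = 0" and x: "x : f"
  shows "g x = 0"
proof -
  have fb: "f : sets borel" using simplex_closed[OF f] by (rule borel_closed)
  have ae: "AE x in face_measure f. indicator f x *\<^sub>R g x = 0"
    using integral_nonneg_eq_0_iff_AE[OF face_integrable[OF f g]] z nn by (auto simp: face_integral_def set_lebesgue_integral_def indicator_def)
  have "g y = 0" if y: "y : rel_interior f" for y
  proof (rule ccontr)
    assume "g y ~= 0"
    have yf: "y : f" using y rel_interior_subset by blast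
    then obtain e where e: "e > 0" "!!x. x : f ==> dist x y < e ==> dist (g x) (g y) < \<bar>g y\<bar>"
      using g \<open>g y ~= 0\<close> unfolding continuous_on_iff by (metis zero_less_abs_iff)
    have "AE x in face_measure f. x ~: f \<inter> ball y e" using ae
    proof eventually_elim
      case (elim x)
      show ?case
      proof
        assume x: "x : f \<inter> ball y e"
        hence "dist (g x) (g y) < \<bar>g y\<bar>" using e(2)[of x] by (simp add: dist_commute)
        hence "g x ~= 0" by (auto simp: dist_norm)
        thus False using elim x by simp
      qed
    qed
    from emeasure_eq_0_AE[OF this] have "emeasure (face_measure f) (f \<inter> ball y e) = 0" by (simp only: space_face_measure UNIV_I simp_thms Collect_mem_eq)
    thus False using face_measure_pos[OF y e(1) fb] by simp
  qed
  moreover have cl: "closure (rel_interior f) = f" using convex_closure_rel_interior[OF simplex_convex[OF f]] simplex_closed[OF f] by simp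
  ultimately show ?thesis using continuous_constant_on_closure[of "rel_interior f" g 0 x] g x by simp
qed

section \<open>Orthogonality to the face bubbles\<close>

lemma face_integral_eq: "face_integral f g = (\<integral>x. indicator f x * g x \<partial>face_measure f)" by (simp add: face_integral_def set_lebesgue_integral_def)

lemma tangent_space_scale: "d : tangent_space f ==> t *\<^sub>R d : tangent_space f" by (simp add: tangent_space_def span_scale)

text \<open>If a line in direction d meets E at most once, the translates of E by d / (m + 1) are
  pairwise disjoint. Infinitely many sets of equal measure lie in one ball of finite
  measure.\<close>

lemma null_transversal:
  fixes mm :: "'a::euclidean_space measure"
  assumes sets: "sets mm = sets borel" and inv: "!!t. distr mm borel (%x. x + t *\<^sub>R d) = mm"
    and fin: "!!R. emeasure mm (cball 0 R) < \<infinity>" and E: "E : sets borel" "E <= cball 0 R"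
    and dis: "!!x u. x : E ==> u > 0 ==> x + u *\<^sub>R d ~: E"
  shows "emeasure mm E = 0"
proof -
  define t where "t m = inverse (real (Suc m))" for m
  define D where "D m = (%x. x + t m *\<^sub>R d) -` E" for m
  have t01: "0 < t m" "t m <= 1" for m by (auto simp: t_def field_simps)
  have sp: "space mm = UNIV" using sets_eq_imp_space_eq[OF sets] by simp
  have Db: "D m : sets mm" for m
  proof -
    have "(%x. x + t m *\<^sub>R d) -` E \<inter> space borel : sets borel" by (rule measurable_sets[of _ _ borel]) (use E in auto)
    thus ?thesis by (simp add: D_def sets)
  qed
  have Dm: "emeasure mm (D m) = emeasure mm E" for m
  proof -
    have "emeasure mm E = emeasure (distr mm borel (%x. x + t m *\<^sub>R d)) E" by (simp add: inv)
    also have "... = emeasure mm (D m)" by (subst emeasure_distr) (use E sp in \<open>auto simp: D_def measurable_cong_sets[OF sets refl]\<close>)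
    finally show ?thesis by simp
  qed
  have Dsub: "D m <= cball 0 (R + norm d)" for m
  proof
    fix x assume "x : D m"
    hence "norm (x + t m *\<^sub>R d) <= R" using E(2) by (auto simp: D_def)
    moreover have "norm x <= norm (x + t m *\<^sub>R d) + norm (t m *\<^sub>R d)"
      using norm_triangle_ineq4[of "x + t m *\<^sub>R d" "t m *\<^sub>R d"] by simp
    moreover have "norm (t m *\<^sub>R d) <= norm d" using t01[of m] by (simp add: mult_left_le_one_le)
    ultimately show "x : cball 0 (R + norm d)" by simp
  qed
  have D0: "D i \<inter> D j = {}" if "t j < t i" for i j
  proof (intro equals0I)
    fix x assume "x : D i \<inter> D j"
    hence "x + t j *\<^sub>R d : E" "(x + t j *\<^sub>R d) + (t i - t j) *\<^sub>R d : E" by (auto simp: D_def algebra_simps)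
    thus False using dis that by simp
  qed
  have disj: "D i \<inter> D j = {}" if "i ~= j" for i j
  proof -
    have "t i ~= t j" using that by (simp add: t_def)
    thus ?thesis using D0[of i j] D0[of j i] by (cases "t j < t i") (auto simp: Int_commute)
  qed
  have le: "of_nat N * emeasure mm E <= emeasure mm (cball 0 (R + norm d))" for N
  proof -
    have "of_nat N * emeasure mm E = (SUM m<N. emeasure mm (D m))" by (simp add: Dm)
    also have "... = emeasure mm (UN m<N. D m)" by (rule sum_emeasure) (use Db disj in \<open>auto simp: disjoint_family_on_def\<close>)
    also have "... <= emeasure mm (cball 0 (R + norm d))" by (rule emeasure_mono) (use Dsub in \<open>auto simp: sets\<close>)
    finally show ?thesis .
  qed
  have finE: "emeasure mm E < \<infinity>" using le[of 1] fin[of "R + norm d"] by (simp add: le_less_trans)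
  obtain u where u: "u >= 0" "emeasure mm E = ennreal u" using finE by (cases "emeasure mm E") auto
  obtain w where w: "w >= 0" "emeasure mm (cball 0 (R + norm d)) = ennreal w"
    using fin[of "R + norm d"] by (cases "emeasure mm (cball 0 (R + norm d))") auto
  have "real N * u <= w" for N using le[of N] u w by (simp add: ennreal_of_nat_eq_real_of_nat flip: ennreal_mult)
  hence "u = 0" using u(1) reals_Archimedean3[of u] by (metis less_le not_le)
  thus ?thesis using u by simp
qed

text \<open>The largest parameter up to t at which the ray is in F. By convexity the ray cannot
  return, so F is left for good at this point.\<close>

lemma exit_point:
  fixes F :: "'a::euclidean_space set"
  assumes F: "compact F" "convex F" and x: "x : F" "x + t *\<^sub>R e ~: F" and t: "0 < t"
  obtains s where "0 <= s" "s <= t" "x + s *\<^sub>R e : F" "!!u. u > 0 ==> (x + s *\<^sub>R e) + u *\<^sub>R e ~: F"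
proof -
  let ?S = "{0..t} \<inter> (%s. x + s *\<^sub>R e) -` F"
  have "compact ?S" by (intro compact_Int_closed compact_Icc continuous_closed_vimage compact_imp_closed[OF F(1)]) (auto intro!: continuous_intros)
  moreover have "0 : ?S" using x(1) t by simp
  ultimately obtain s where s: "s : ?S" "ALL r:?S. r <= s" using compact_attains_sup[of ?S] by blast
  have "(x + s *\<^sub>R e) + u *\<^sub>R e ~: F" if u: "u > 0" for u
  proof
    assume "(x + s *\<^sub>R e) + u *\<^sub>R e : F"
    hence y: "x + (s + u) *\<^sub>R e : F" by (simp add: algebra_simps)
    have su: "s + u > t"
    proof (rule ccontr)
      assume "~s + u > t"
      hence "s + u : ?S" using y s(1) u by simp
      thus False using s(2) u by force
    qed
    have "(1 - c) *\<^sub>R x + c *\<^sub>R (x + (s + u) *\<^sub>R e) = x + (c * (s + u)) *\<^sub>R e" for c by (simp add: algebra_simps)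
    from this[of "t / (s + u)"] have "x + t *\<^sub>R e = (1 - t / (s + u)) *\<^sub>R x + (t / (s + u)) *\<^sub>R (x + (s + u) *\<^sub>R e)"
      using su t by simp
    hence "x + t *\<^sub>R e : F" using convexD[OF F(2) x(1) y, of "1 - t / (s + u)" "t / (s + u)"] su t by simp
    thus False using x(2) by contradiction
  qed
  with s show thesis by (intro that[of s]) auto
qed

section \<open>Functions with a continuous gradient and their truncation to convex sets\<close>

definition C1 :: "('a::euclidean_space => real) => ('a => 'a) => bool" where
  "C1 g D \<longleftrightarrow> (ALL x. (g has_derivative (%h. D x \<bullet> h)) (at x)) & continuous_on UNIV D"

lemma C1_D: "C1 g D ==> (g has_derivative (%h. D x \<bullet> h)) (at x)" by (simp add: C1_def)

lemma C1_continuous: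
  assumes "C1 g D"
  shows "continuous_on A D" "continuous_on A g"
proof -
  show "continuous_on A D" using assms unfolding C1_def by (blast intro: continuous_on_subset)
  show "continuous_on A g" by (rule has_derivative_continuous_on, rule has_derivative_at_withinI, rule C1_D[OF assms])
qed

lemma C1_zero: "C1 (%x. 0) (%x. 0)" by (simp add: C1_def)

lemma C1_mult: "C1 f Df ==> C1 g Dg ==> C1 (%x. f x * g x) (%x. f x *\<^sub>R Dg x + g x *\<^sub>R Df x)" unfolding C1_def
proof (intro conjI allI)
  assume a: "(ALL x. (f has_derivative (\<bullet>) (Df x)) (at x)) & continuous_on UNIV Df"
    "(ALL x. (g has_derivative (\<bullet>) (Dg x)) (at x)) & continuous_on UNIV Dg"
  hence fg: "C1 f Df" "C1 g Dg" by (simp_all add: C1_def)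
  show "((%x. f x * g x) has_derivative (\<bullet>) (f x *\<^sub>R Dg x + g x *\<^sub>R Df x)) (at x)" for x by (rule has_derivative_eq_rhs[OF has_derivative_mult[OF C1_D[OF fg(1)] C1_D[OF fg(2)]]])
      (simp add: fun_eq_iff inner_add_left mult.commute)
  show "continuous_on UNIV (%x. f x *\<^sub>R Dg x + g x *\<^sub>R Df x)"
    using a C1_continuous(2)[OF fg(1)] C1_continuous(2)[OF fg(2)] by (intro continuous_intros) auto
qed

lemma C1_add_scale: "C1 f Df ==> C1 g Dg ==> C1 (%x. f x + c * g x) (%x. Df x + c *\<^sub>R Dg x)" unfolding C1_def
proof (intro conjI allI)
  fix x assume a: "(ALL x. (f has_derivative (\<bullet>) (Df x)) (at x)) & continuous_on UNIV Df"
    "(ALL x. (g has_derivative (\<bullet>) (Dg x)) (at x)) & continuous_on UNIV Dg"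
  show "((%x. f x + c * g x) has_derivative (\<bullet>) (Df x + c *\<^sub>R Dg x)) (at x)" by (rule has_derivative_eq_rhs[OF has_derivative_add[OF a(1)[THEN conjunct1, rule_format] has_derivative_mult_right[OF a(2)[THEN conjunct1, rule_format]]]])
      (simp add: fun_eq_iff inner_add_left)
qed (auto intro!: continuous_intros)

lemma C1_sum: "(!!i. i : I ==> C1 (f i) (D i)) ==> C1 (%x. SUM i:I. c i * f i x) (%x. SUM i:I. c i *\<^sub>R D i x)"
proof (induction I rule: infinite_finite_induct)
  case (insert j J)
  have "C1 (%x. (SUM i:J. c i * f i x) + c j * f j x) (%x. (SUM i:J. c i *\<^sub>R D i x) + c j *\<^sub>R D j x)" by (rule C1_add_scale) (use insert in auto)
  thus ?case using insert.hyps by (simp add: add.commute)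
qed (simp_all add: C1_zero)

lemma C1_prod:
  assumes "!!i. i : I ==> C1 (f i) (D i)"
  shows "C1 (%x. PROD i:I. f i x) (%x. SUM i:I. (PROD j:I - {i}. f j x) *\<^sub>R D i x)" unfolding C1_def
proof (intro conjI allI)
  show "((%x. PROD i:I. f i x) has_derivative (\<bullet>) (SUM i:I. (PROD j:I - {i}. f j x) *\<^sub>R D i x)) (at x)" for x by (rule has_derivative_eq_rhs[OF has_derivative_prod[of I f "%i h. D i x \<bullet> h", OF C1_D[OF assms]]])
      (auto simp: fun_eq_iff inner_sum_left mult.commute)
  show "continuous_on UNIV (%x. SUM i:I. (PROD j:I - {i}. f j x) *\<^sub>R D i x)" by (intro continuous_intros C1_continuous[OF assms]) auto
qed

lemma C1_along:
  assumes "C1 g D"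
  shows "((%t. g (x + t *\<^sub>R d)) has_real_derivative D (x + t *\<^sub>R d) \<bullet> d) (at t)"
proof -
  have "((%t. x + t *\<^sub>R d) has_derivative (%h. h *\<^sub>R d)) (at t)" by (auto intro!: derivative_eq_intros)
  from has_derivative_compose[OF this C1_D[OF assms]]
  show ?thesis by (simp add: has_field_derivative_def mult.commute[of "D _ \<bullet> d"] mult_commute_abs)
qed

lemma C1_segment:
  assumes g: "C1 g D" and M: "!!y. y : cball 0 R ==> \<bar>D y \<bullet> d\<bar> <= L" and x: "x + s *\<^sub>R d : cball 0 R" "x + t *\<^sub>R d : cball 0 R"
  shows "\<bar>g (x + t *\<^sub>R d) - g (x + s *\<^sub>R d)\<bar> <= L * \<bar>t - s\<bar>"
proof -
  have *: "\<bar>g (x + t *\<^sub>R d) - g (x + s *\<^sub>R d)\<bar> <= L * \<bar>t - s\<bar>"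
    if st: "s < t" and x: "x + s *\<^sub>R d : cball 0 R" "x + t *\<^sub>R d : cball 0 R" for s t
  proof -
    obtain z where z: "s < z" "z < t" and e: "g (x + t *\<^sub>R d) - g (x + s *\<^sub>R d) = (t - s) * (D (x + z *\<^sub>R d) \<bullet> d)"
      using MVT2[OF st, of "%t. g (x + t *\<^sub>R d)" "%t. D (x + t *\<^sub>R d) \<bullet> d"] C1_along[OF g] by blast
    define u where "u = (z - s) / (t - s)"
    have u: "0 <= u" "u <= 1" using z st by (auto simp: u_def field_simps)
    have "u * (t - s) = z - s" using st by (simp add: u_def)
    hence u3: "z = (1 - u) * s + u * t" by (simp add: algebra_simps)
    have "x + z *\<^sub>R d = (1 - u) *\<^sub>R (x + s *\<^sub>R d) + u *\<^sub>R (x + t *\<^sub>R d)" unfolding u3 by (simp add: algebra_simps)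
    hence "x + z *\<^sub>R d : cball 0 R" using convexD[OF convex_cball x, of "1 - u" u] u by simp
    from M[OF this] have "(t - s) * \<bar>D (x + z *\<^sub>R d) \<bullet> d\<bar> <= (t - s) * L" using st by (intro mult_left_mono) auto
    thus ?thesis using st unfolding e by (simp add: abs_mult mult.commute)
  qed
  show ?thesis
  proof (cases s t rule: linorder_cases)
    case less thus ?thesis using * x by blast
  next
    case greater thus ?thesis using *[OF greater x(2,1)] by (simp add: abs_minus_commute)
  qed simp
qed

lemma C1_quotient_limit:
  assumes g: "C1 g D"
  shows "(%m. (g (x + inverse (real (Suc m)) *\<^sub>R d) - g x) * real (Suc m)) \<longlonglongrightarrow> D x \<bullet> d"
proof -
  have "((%h. (g (x + h *\<^sub>R d) - g x) / h) \<longlongrightarrow> D x \<bullet> d) (at 0)"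
    using C1_along[OF g, of x d 0] by (simp add: DERIV_def)
  moreover have "filterlim (%m. inverse (real (Suc m))) (at 0) sequentially" by (rule filterlim_atI[OF LIMSEQ_inverse_real_of_nat]) simp
  ultimately have "(%m. (g (x + inverse (real (Suc m)) *\<^sub>R d) - g x) / inverse (real (Suc m))) \<longlonglongrightarrow> D x \<bullet> d" by (rule filterlim_compose)
  thus ?thesis by (simp add: divide_inverse)
qed

text \<open>The truncation of \<open>g\<close> to F may jump at the boundary, but it is Lipschitz
  along \<open>d\<close>: \<open>g\<close> is 0 wherever a line in this direction enters or leaves
  F. The translation argument therefore applies and no boundary integral has to be
  described.\<close>

lemma truncated_ibp:
  fixes mm :: "'a::euclidean_space measure"
  assumes sets: "sets mm = sets borel" and inv: "!!t. distr mm borel (%x. x + t *\<^sub>R d) = mm"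
    and fin: "!!R. emeasure mm (cball 0 R) < \<infinity>" and F: "compact F" "convex F" and g: "C1 g D"
    and exit: "!!x. x : F ==> (!!t. t > 0 ==> x + t *\<^sub>R d ~: F) ==> g x = 0"
    and entry: "!!x. x : F ==> (!!t. t > 0 ==> x + t *\<^sub>R - d ~: F) ==> g x = 0"
  shows "(\<integral>x. indicator F x * (D x \<bullet> d) \<partial>mm) = 0"
proof -
  define G where "G x = indicator F x * g x" for x
  have Fc: "closed F" by (rule compact_imp_closed[OF F(1)])
  obtain R where "ALL x:F. norm x <= R" using compact_imp_bounded[OF F(1)] unfolding bounded_iff ..
  hence R: "x : cball 0 R" if "x : F" for x using that by simp
  have bd: "EX L. ALL x:cball 0 R. \<bar>h x\<bar> <= L" if "continuous_on (cball 0 R) h" for h :: "'a => real"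
    using compact_imp_bounded[OF compact_continuous_image[OF that compact_cball]] by (auto simp: bounded_iff)
  have cD: "continuous_on A (%x. D x \<bullet> d)" for A by (intro continuous_intros C1_continuous(1)[OF g])
  obtain L' where L': "ALL x:cball 0 R. \<bar>D x \<bullet> d\<bar> <= L'" using bd[OF cD] ..
  define L where "L = \<bar>L'\<bar>"
  have L: "ALL x:cball 0 R. \<bar>D x \<bullet> d\<bar> <= L" "0 <= L" using L' by (force simp: L_def)+
  obtain M where M: "ALL x:cball 0 R. \<bar>g x\<bar> <= M" using bd[OF C1_continuous(2)[OF g]] ..
  have seg: "\<bar>g (x + t *\<^sub>R d) - g (x + s *\<^sub>R d)\<bar> <= L * \<bar>t - s\<bar>" if "x + s *\<^sub>R d : F" "x + t *\<^sub>R d : F" for x s t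
    using C1_segment[OF g _ R R] L(1) that by blast
  have lip: "\<bar>G (x + t *\<^sub>R d) - G x\<bar> <= L * t" if t: "0 < t" for x t
  proof -
    have Lm: "L * s <= L * t" if "s <= t" for s by (rule mult_left_mono[OF that L(2)])
    consider "x : F" "x + t *\<^sub>R d : F" | "x : F" "x + t *\<^sub>R d ~: F" | "x ~: F" "x + t *\<^sub>R d : F" | "x ~: F" "x + t *\<^sub>R d ~: F" by blast
    thus ?thesis
    proof cases
      case 1
      thus ?thesis using seg[of x 0 t] t by (simp add: G_def)
    next
      case 2
      \<comment> \<open>The endpoint outside F is replaced by the exit point, where \<open>g\<close>
        has the same value 0 as the truncation outside.\<close>
      obtain s where s: "0 <= s" "s <= t" "x + s *\<^sub>R d : F" "!!u. u > 0 ==> (x + s *\<^sub>R d) + u *\<^sub>R d ~: F"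
        using exit_point[OF F 2 t] by blast
      show ?thesis using seg[of x 0 s] exit[OF s(3,4)] s(1,3) 2 Lm[OF s(2)] by (simp add: G_def)
    next
      case 3
      have e: "(x + t *\<^sub>R d) + t *\<^sub>R - d ~: F" using 3 by simp
      obtain s where s: "0 <= s" "s <= t" "(x + t *\<^sub>R d) + s *\<^sub>R - d : F" "!!u. u > 0 ==> ((x + t *\<^sub>R d) + s *\<^sub>R - d) + u *\<^sub>R - d ~: F"
        using exit_point[OF F 3(2) e t] by blast
      have y: "(x + t *\<^sub>R d) + s *\<^sub>R - d = x + (t - s) *\<^sub>R d" by (simp add: algebra_simps)
      show ?thesis using seg[OF s(3)[unfolded y] 3(2)] entry[OF s(3,4), unfolded y] s(1) 3 Lm[OF s(2)] by (simp add: G_def)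
    next
      case 4
      thus ?thesis using L(2) t by (simp add: G_def)
    qed
  qed
  have cm: "f : borel_measurable borel" if "continuous_on UNIV f" for f :: "'a => real" using that by (rule borel_measurable_continuous_onI)
  show ?thesis
  proof (rule integral_translation_derivative_zero[where G = G and R = R and M = "\<bar>M\<bar>" and L = L and d = d, OF sets inv fin])
    show "G : borel_measurable borel"
      unfolding G_def[abs_def] by (intro borel_measurable_times borel_measurable_indicator borel_closed Fc cm C1_continuous(2)[OF g])
    show "(%x. indicator F x * (D x \<bullet> d)) : borel_measurable borel" by (intro borel_measurable_times borel_measurable_indicator borel_closed Fc cm cD)
    show "G x = 0" if "norm x > R" for x using R[of x] that by (cases "x : F") (auto simp: G_def)
    show "\<bar>G x\<bar> <= \<bar>M\<bar>" for x using R[of x] M by (cases "x : F") (force simp: G_def)+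
    show "\<bar>G (x + t *\<^sub>R d) - G x\<bar> <= L * t" if "0 < t" for x t by (rule lip[OF that])
    let ?t = "%m. inverse (real (Suc m))"
    \<comment> \<open>The points at which the line leaves F at once. Only there can the one-sided
      quotients of the truncation fail to converge to the derivative.\<close>
    define E where "E = F - (\<Union>m. (%x. x + ?t m *\<^sub>R d) -` F)"
    have small: "x + s *\<^sub>R d : F" if "x : F" "x + u *\<^sub>R d : F" "0 <= s" "s <= u" for x s u
    proof (cases "u = 0")
      case False
      have "x + s *\<^sub>R d = (1 - s / u) *\<^sub>R x + (s / u) *\<^sub>R (x + u *\<^sub>R d)" using False by (simp add: algebra_simps)
      thus ?thesis using convexD[OF F(2) that(1,2), of "1 - s / u" "s / u"] that False by simp
    qed (use that in auto)
    have t0: "?t \<longlonglongrightarrow> 0" by (rule LIMSEQ_inverse_real_of_nat)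
    have "emeasure mm E = 0"
    proof (rule null_transversal[OF sets inv fin])
      show Eb: "E : sets borel"
        unfolding E_def by (intro sets.Diff sets.countable_UN borel_closed Fc image_subsetI continuous_closed_vimage) (auto intro!: continuous_intros)
      show "E <= cball 0 R" using R by (auto simp: E_def)
      fix x u assume x: "x : E" and u: "(u::real) > 0"
      obtain m where m: "?t m < u" using order_tendstoD(2)[OF t0 u] by (auto simp: eventually_sequentially)
      thus "x + u *\<^sub>R d ~: E" using small[of x u "?t m"] x by (auto simp: E_def)
    qed
    moreover have "E : sets borel"
      unfolding E_def by (intro sets.Diff sets.countable_UN borel_closed Fc image_subsetI continuous_closed_vimage) (auto intro!: continuous_intros)
    ultimately have "AE x in mm. x ~: E" by (intro AE_not_in null_setsI) (simp_all add: sets)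
    thus "AE x in mm. (%m. (G (x + ?t m *\<^sub>R d) - G x) * real (Suc m)) \<longlonglongrightarrow> indicator F x * (D x \<bullet> d)"
    proof eventually_elim
      case (elim x)
      show ?case
      proof (cases "x : F")
        case False
        have "(%m. x + ?t m *\<^sub>R d) \<longlonglongrightarrow> x + 0 *\<^sub>R d" by (intro tendsto_intros t0)
        hence "eventually (%m. x + ?t m *\<^sub>R d : - F) sequentially" by (rule topological_tendstoD) (use Fc False in \<open>auto simp: open_Compl\<close>)
        hence "eventually (%m. (G (x + ?t m *\<^sub>R d) - G x) * real (Suc m) = 0) sequentially" by eventually_elim (use False in \<open>simp add: G_def\<close>)
        thus ?thesis using False by (simp add: tendsto_eventually)
      next
        case True
        then obtain k where k: "x + ?t k *\<^sub>R d : F" using elim by (auto simp: E_def)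
        have "eventually (%m. ?t m < ?t k) sequentially" by (rule order_tendstoD(2)[OF t0]) simp
        hence "eventually (%m. (g (x + ?t m *\<^sub>R d) - g x) * real (Suc m) = (G (x + ?t m *\<^sub>R d) - G x) * real (Suc m)) sequentially"
        proof eventually_elim
          case (elim m)
          hence "x + ?t m *\<^sub>R d : F" by (intro small[OF True k]) auto
          thus ?case using True by (simp add: G_def)
        qed
        from Lim_transform_eventually[OF C1_quotient_limit[OF g] this] show ?thesis using True by simp
      qed
    qed
  qed
qed

lemma C1_affine: "C1 (%x. a \<bullet> x + b) (%x. a)" by (auto simp: C1_def intro!: derivative_eq_intros)

lemma pf_0: "pf 0 p ==> EX c. p = (%x. c)" by (induction "0 :: nat" p rule: pf.induct) auto

lemma pf_1: "pf 1 p ==> EX a b. p = (%x. a \<bullet> x + b)"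
proof (induction "1 :: nat" p rule: pf.induct)
  case (pf_const c)
  show ?case by (intro exI[of _ 0] exI[of _ c]) simp
next
  case (pf_add p q)
  then obtain a b c d where "p = (%x. a \<bullet> x + b)" "q = (%x. c \<bullet> x + d)" by blast
  thus ?case by (intro exI[of _ "a + c"] exI[of _ "b + d"]) (simp add: inner_add_left algebra_simps)
next
  case (pf_affine_mult s p a b)
  hence "pf 0 p" by (simp add: One_nat_def)
  then obtain c where "p = (%x. c)" using pf_0 by blast
  thus ?case by (intro exI[of _ "c *\<^sub>R a"] exI[of _ "b * c"]) (simp add: algebra_simps)
qed

lemma bary_affine_family:
  fixes F :: "'a::euclidean_space set"
  assumes F: "int l simplex F"
  obtains a b where "!!w x. w : verts F ==> x : affine hull (verts F) ==> bary F w x = a w \<bullet> x + b w"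
proof -
  have "ALL w:verts F. EX q. ALL x:affine hull (verts F). bary F w x = fst q \<bullet> x + snd q"
  proof
    fix w assume "w : verts F"
    then obtain a b where "!!x. x : affine hull (verts F) ==> bary F w x = a \<bullet> x + b" using bary_affine[OF F, of w] by blast
    thus "EX q. ALL x:affine hull (verts F). bary F w x = fst q \<bullet> x + snd q" by (intro exI[of _ "(a, b)"]) simp
  qed
  from bchoice[OF this] obtain q where
    q: "ALL w:verts F. ALL x:affine hull (verts F). bary F w x = fst (q w) \<bullet> x + snd (q w)" by blast
  show thesis by (rule that[of "%w. fst (q w)" "%w. snd (q w)"]) (use q in blast)
qed

text \<open>
  Integration by parts on \<open>F\<close> in the direction \<open>d = v - w\<close> of one of its edges, applied to
  \<open>B p\<close> times the barycentric coordinates of \<open>v\<close> and \<open>w\<close>.  This product vanishes where a line in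
  direction \<open>d\<close> leaves \<open>F\<close>, and \<open>B\<close> is constant along such lines.
\<close>

lemma face_integration_by_parts:
  fixes F :: "'a::euclidean_space set"
  assumes F: "int l simplex F" and v: "v : verts F" and w: "w : verts F" and vw: "v ~= w"
    and S: "S <= verts F - {v, w}"
  shows "face_integral F (%x. (bary F w x - bary F v x) * (PROD u:S. bary F u x) * (a \<bullet> x + b)
      + bary F v x * bary F w x * (PROD u:S. bary F u x) * (a \<bullet> (v - w))) = 0"
proof -
  let ?V = "verts F"
  obtain g h where gh: "!!w x. w : ?V ==> x : affine hull ?V ==> bary F w x = g w \<bullet> x + h w" using bary_affine_family[OF F] by blast
  define d where "d = v - w"
  have vh: "v : affine hull ?V" "w : affine hull ?V" using v w by (auto intro: hull_inc)
  have gd: "g u \<bullet> d = (if u = v then 1 else if u = w then -1 else 0)" if u: "u : ?V" for u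
  proof -
    have "g u \<bullet> d = bary F u v - bary F u w" using gh[OF u] vh by (simp add: d_def inner_diff_right)
    thus ?thesis using bary_vertex[OF F u v] bary_vertex[OF F u w] vw by auto
  qed
  have aff: "affine hull F = affine hull ?V" using simplexD(4)[OF F] affine_hull_convex_hull[of ?V] by simp
  have dT: "d : tangent_space F" unfolding d_def by (rule diff_in_tangent_space) (use vh aff in auto)
  have FV: "x : affine hull ?V" if "x : F" for x using simplex_affine_hull[OF F that] .
  have out: "EX u:?V. g u \<bullet> x + h u + t * (g u \<bullet> d) < 0" if x: "x : F" "x + t *\<^sub>R d ~: F" for x t
  proof -
    have A: "x + t *\<^sub>R d : affine hull ?V" using tangent_space_affine[OF x(1) tangent_space_scale[OF dT, of t]] aff by simp
    thus ?thesis using in_simplex_iff_bary[OF F A] x(2) gh[OF _ A] by (force simp: inner_add_right not_le)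
  qed
  have pos: "0 <= g u \<bullet> x + h u" if "u : ?V" "x : F" for u x using bary_nonneg[OF F that(2,1)] gh[OF that(1) FV[OF that(2)]] by simp
  \<comment> \<open>The coordinate of w' is the only one that can decrease along s d, with rate at
    most 1. Were it positive, a step of this length would still be in F.\<close>
  have ex: "g w' \<bullet> x + h w' = 0" if x: "x : F" "!!t. t > 0 ==> x + (t * s) *\<^sub>R d ~: F"
    and w': "w' : ?V" "!!u. u : ?V ==> s * (g u \<bullet> d) >= (if u = w' then -1 else 0)" for x s w'
  proof (rule ccontr)
    let ?t = "g w' \<bullet> x + h w'"
    assume "?t ~= 0"
    hence t: "?t > 0" using pos[OF w'(1) x(1)] by simp
    obtain u where u: "u : ?V" "g u \<bullet> x + h u + (?t * s) * (g u \<bullet> d) < 0" using out[OF x(1) x(2)[OF t]] by blast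
    have "?t * (if u = w' then -1 else 0) <= ?t * (s * (g u \<bullet> d))" by (rule mult_left_mono[OF w'(2)[OF u(1)]]) (use t in simp)
    thus False using u pos[OF u(1) x(1)] by (auto simp: mult.assoc split: if_splits)
  qed
  let ?B = "%x. PROD u:S. g u \<bullet> x + h u" and ?DB = "%x. SUM i:S. (PROD j:S - {i}. g j \<bullet> x + h j) *\<^sub>R g i"
  have DB: "?DB x \<bullet> d = 0" for x unfolding inner_sum_left by (rule sum.neutral) (use S gd in \<open>auto simp: subset_iff\<close>)
  note C1q = C1_mult[OF C1_mult[OF C1_affine[of "g v" "h v"] C1_affine[of "g w" "h w"]] C1_mult[OF C1_prod[of S "%u x. g u \<bullet> x + h u" "%u x. g u", OF C1_affine] C1_affine[of a b]]]
  note ibp = truncated_ibp[OF sets_face_measure face_measure_translation[OF simplex_nonempty[OF F] tangent_space_scale[OF dT]]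
      face_measure_finite[OF simplex_nonempty[OF F]] simplex_compact[OF F] simplex_convex[OF F] C1q]
  have I: "(\<integral>x. indicator F x * ((((g v \<bullet> x + h v) * (g w \<bullet> x + h w)) *\<^sub>R (?B x *\<^sub>R a + (a \<bullet> x + b) *\<^sub>R ?DB x)
      + (?B x * (a \<bullet> x + b)) *\<^sub>R ((g v \<bullet> x + h v) *\<^sub>R g w + (g w \<bullet> x + h w) *\<^sub>R g v)) \<bullet> d) \<partial>face_measure F) = 0" by (rule ibp)
      (use ex[of _ 1 w] ex[of _ "-1" v] gd v w in \<open>auto split: if_splits\<close>)
  have "face_integral F (%x. (bary F w x - bary F v x) * (PROD u:S. bary F u x) * (a \<bullet> x + b)
      + bary F v x * bary F w x * (PROD u:S. bary F u x) * (a \<bullet> (v - w))) =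
    (\<integral>x. indicator F x * ((((g v \<bullet> x + h v) * (g w \<bullet> x + h w)) *\<^sub>R (?B x *\<^sub>R a + (a \<bullet> x + b) *\<^sub>R ?DB x)
      + (?B x * (a \<bullet> x + b)) *\<^sub>R ((g v \<bullet> x + h v) *\<^sub>R g w + (g w \<bullet> x + h w) *\<^sub>R g v)) \<bullet> d) \<partial>face_measure F)"
    unfolding face_integral_eq
  proof (rule Bochner_Integration.integral_cong[OF refl])
    fix x
    show "indicator F x * ((bary F w x - bary F v x) * (PROD u:S. bary F u x) * (a \<bullet> x + b)
      + bary F v x * bary F w x * (PROD u:S. bary F u x) * (a \<bullet> (v - w))) = indicator F x * ((((g v \<bullet> x + h v) * (g w \<bullet> x + h w)) *\<^sub>R (?B x *\<^sub>R a + (a \<bullet> x + b) *\<^sub>R ?DB x)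
      + (?B x * (a \<bullet> x + b)) *\<^sub>R ((g v \<bullet> x + h v) *\<^sub>R g w + (g w \<bullet> x + h w) *\<^sub>R g v)) \<bullet> d)"
    proof (cases "x : F")
      case True
      have "(PROD u:S. bary F u x) = ?B x" by (rule prod.cong) (use S gh FV[OF True] in auto)
      thus ?thesis
        using True gh[OF v FV[OF True]] gh[OF w FV[OF True]] gd[OF v] gd[OF w] vw by (simp only: inner_add_left inner_scaleR_left DB) (simp add: algebra_simps flip: d_def)
    qed simp
  qed
  thus ?thesis using I by (simp add: mult.assoc)
qed

lemma bary_continuous:
  assumes F: "int l simplex F" and v: "v : verts F"
  shows "continuous_on F (bary F v)"
proof -
  obtain a b where ab: "!!x. x : affine hull (verts F) ==> bary F v x = a \<bullet> x + b" using bary_affine[OF F v] by blast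
  have "continuous_on F (%x. a \<bullet> x + b)" by (intro continuous_intros)
  thus ?thesis by (rule continuous_on_eq) (use ab simplex_affine_hull[OF F] in auto)
qed

lemma bary_prod_continuous:
  assumes F: "int l simplex F" and S: "S <= verts F"
  shows "continuous_on F (%x. PROD v:S. bary F v x)" by (intro continuous_on_prod bary_continuous[OF F]) (use S in blast)

definition barycenter :: "'a::euclidean_space set => 'a" where
  "barycenter F = (SUM v:verts F. (1 / real (card (verts F))) *\<^sub>R v)"

lemma barycenter:
  assumes F: "int l simplex F"
  shows "barycenter F : F" "v : verts F ==> bary F v (barycenter F) > 0"
proof -
  let ?c = "%v. 1 / real (card (verts F))"
  have s: "sum ?c (verts F) = 1" using simplexD(3)[OF F] by simp
  show "barycenter F : F" by (rule in_simplexI[OF F s]) (auto simp: barycenter_def)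
  show "bary F v (barycenter F) > 0" if "v : verts F"
    using bary_unique[OF F s _ that, of "barycenter F"] simplexD(3)[OF F] by (simp add: barycenter_def)
qed

lemma bary_prod_integral_pos:
  assumes F: "int l simplex F" and S: "S <= verts F"
  shows "face_integral F (%x. PROD v:S. bary F v x) ~= 0"
proof
  assume z: "face_integral F (%x. PROD v:S. bary F v x) = 0"
  have "(PROD v:S. bary F v (barycenter F)) = 0" by (rule face_integral_pos_def[OF F bary_prod_continuous[OF F S] _ z barycenter(1)[OF F]])
      (use bary_nonneg[OF F] S in \<open>auto intro!: prod_nonneg\<close>)
  moreover have "(PROD v:S. bary F v (barycenter F)) > 0" using barycenter(2)[OF F] S by (auto intro!: prod_pos)
  ultimately show False by simp
qed

text \<open>For an edge v w take k further vertices S, which exist since k + 1 <= l. In the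
  integration by parts the moments belonging to S with v and to S with w are 0 by assumption; what
  remains is the slope along the edge times a nonzero integral. So the function is constant, and one
  more bubble shows that the constant is 0.\<close>

lemma affine_orthogonal_bubbles_zero:
  fixes F :: "'a::euclidean_space set"
  assumes F: "int l simplex F" and k: "k + 1 <= l"
    and orth: "!!S. S <= verts F ==> card S = k + 1 ==> face_integral F (%x. (a \<bullet> x + b) * (PROD v:S. bary F v x)) = 0"
    and x: "x : F"
  shows "a \<bullet> x + b = 0"
proof -
  let ?V = "verts F"
  note fin = simplexD(1)[OF F] and card = simplexD(3)[OF F]
  define p where "p x = a \<bullet> x + b" for x
  have contp: "continuous_on F p" unfolding p_def by (intro continuous_intros)
  have eq: "p v = p w" if v: "v : ?V" and w: "w : ?V" for v w
  proof (cases "v = w")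
    case False
    have "card (?V - {v, w}) = card ?V - card {v, w}" by (rule card_Diff_subset) (use v w in auto)
    hence "k <= card (?V - {v, w})" using card k False by simp
    then obtain S where S: "S <= ?V - {v, w}" "card S = k" by (rule obtain_subset_with_card_n)
    have finS: "finite S" using S fin by (meson finite_Diff finite_subset)
    let ?B = "%x. PROD u:S. bary F u x"
    have ins: "face_integral F (%x. p x * (bary F u x * ?B x)) = 0" if "u : {v, w}" for u
    proof -
      have u: "u ~: S" "insert u S <= ?V" using that S v w by auto
      hence "card (insert u S) = k + 1" using S(2) finS by simp
      with u show ?thesis using orth[of "insert u S"] finS by (simp add: p_def)
    qed
    have cB: "continuous_on F ?B" by (rule bary_prod_continuous[OF F]) (use S in blast)
    note cv = bary_continuous[OF F v] and cw = bary_continuous[OF F w]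
    let ?de = "a \<bullet> (v - w)"
    have "0 = face_integral F (%x. (bary F w x - bary F v x) * ?B x * p x + bary F v x * bary F w x * ?B x * ?de)"
      using face_integration_by_parts[OF F v w False S(1), of a b] by (simp add: p_def)
    also have "... = face_integral F (%x. (p x * (bary F w x * ?B x) + (-1) * (p x * (bary F v x * ?B x)))
        + ?de * (PROD u:insert v (insert w S). bary F u x))" by (rule face_integral_cong) (use S finS False in \<open>auto simp: algebra_simps prod.insert_if\<close>)
    also have "... = face_integral F (%x. p x * (bary F w x * ?B x) + (-1) * (p x * (bary F v x * ?B x)))
        + face_integral F (%x. ?de * (PROD u:insert v (insert w S). bary F u x))" by (rule face_integral_add[OF F])
        (use S v w in \<open>auto intro!: continuous_intros contp cB cv cw bary_prod_continuous[OF F]\<close>)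
    also have "face_integral F (%x. p x * (bary F w x * ?B x) + (-1) * (p x * (bary F v x * ?B x))) =
        face_integral F (%x. p x * (bary F w x * ?B x)) + face_integral F (%x. (-1) * (p x * (bary F v x * ?B x)))" by (rule face_integral_add[OF F]) (intro continuous_intros contp cB cv cw)+
    also have "... = 0" by (simp only: face_integral_scale ins insert_iff simp_thms mult_zero_right add_0)
    finally have "?de * face_integral F (%x. PROD u:insert v (insert w S). bary F u x) = 0" by (simp only: face_integral_scale add_0)
    moreover have "face_integral F (%x. PROD u:insert v (insert w S). bary F u x) ~= 0" by (rule bary_prod_integral_pos[OF F]) (use S v w in auto)
    ultimately have "?de = 0" by simp
    thus ?thesis by (simp add: p_def inner_diff_right)
  qed simp
  obtain v0 where v0: "v0 : ?V" using simplexD(3)[OF F] by (metis card.empty add_is_0 all_not_in_conv one_neq_zero)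
  have const: "p x = p v0" if x: "x : F" for x
  proof -
    note bp = bary_props[OF F simplex_affine_hull[OF F x]]
    have "p x = (SUM v:?V. bary F v x * (a \<bullet> v)) + b * (SUM v:?V. bary F v x)"
      unfolding p_def by (subst bp(2)[symmetric]) (simp add: inner_sum_right bp(1))
    also have "... = (SUM v:?V. bary F v x * p v)" by (simp add: p_def sum_distrib_left sum.distrib algebra_simps)
    also have "... = (SUM v:?V. bary F v x * p v0)" by (rule sum.cong) (use eq[OF _ v0] in auto)
    also have "... = p v0" using bp(1) by (simp flip: sum_distrib_right)
    finally show ?thesis .
  qed
  have "k + 1 <= card ?V" using card k by simp
  then obtain S where S: "S <= ?V" "card S = k + 1" by (rule obtain_subset_with_card_n)
  have "0 = face_integral F (%x. p x * (PROD v:S. bary F v x))" using orth[OF S] by (simp add: p_def)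
  also have "... = face_integral F (%x. p v0 * (PROD v:S. bary F v x))" by (rule face_integral_cong) (simp add: const)
  also have "... = p v0 * face_integral F (%x. PROD v:S. bary F v x)" by (rule face_integral_scale)
  finally have "p v0 = 0" using bary_prod_integral_pos[OF F S(1)] by simp
  thus ?thesis using const[OF x] by (simp add: p_def)
qed

section \<open>Solvability of finite systems of functionals\<close>

text \<open>The spaces used later are sets of functions rather than types, hence the set
  \<open>U\<close> with an abstract operation \<open>comb\<close>. Induction on the number of
  functionals: the claim holds on the kernel of one of them, and a vector outside this kernel fixes
  its coefficient.\<close>

lemma functional_in_span:
  fixes ph :: "'i => 'u => real" and comb :: "'u => real => 'u => 'u"
  assumes "finite I"
    and U: "!!u v c. u : U ==> v : U ==> comb u c v : U"
    and ph: "!!i u v c. i : I ==> u : U ==> v : U ==> ph i (comb u c v) = ph i u + c * ph i v"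
    and ps: "!!u v c. u : U ==> v : U ==> ps (comb u c v) = ps u + c * ps v"
    and ker: "!!u. u : U ==> (!!i. i : I ==> ph i u = 0) ==> ps u = 0"
  shows "EX c. ALL u:U. ps u = (SUM i:I. c i * ph i u)" using assms
proof (induction I arbitrary: U rule: finite_induct)
  case empty
  thus ?case by simp
next
  case (insert j I)
  let ?U = "{u : U. ph j u = 0}"
  have "EX c. ALL u:?U. ps u = (SUM i:I. c i * ph i u)"
  proof (rule insert.IH)
    fix u v c assume "u : ?U" "v : ?U"
    thus "comb u c v : ?U" "ps (comb u c v) = ps u + c * ps v" using insert.prems by auto
  next
    fix i u v c assume "i : I" "u : ?U" "v : ?U"
    thus "ph i (comb u c v) = ph i u + c * ph i v" using insert.prems(2) by simp
  next
    fix u assume u: "u : ?U" and z: "!!i. i : I ==> ph i u = 0"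
    show "ps u = 0" by (rule insert.prems(4)) (use u z in auto)
  qed
  then obtain c where c: "!!u. u : ?U ==> ps u = (SUM i:I. c i * ph i u)" by blast
  show ?case
  proof (cases "EX u1:U. ph j u1 ~= 0")
    case False
    have "ps u = (SUM i:insert j I. (c(j := 0)) i * ph i u)" if "u : U" for u
    proof -
      have "(SUM i:I. (c(j := 0)) i * ph i u) = (SUM i:I. c i * ph i u)" by (rule sum.cong) (use insert.hyps in auto)
      thus ?thesis using c[of u] that False insert.hyps by simp
    qed
    thus ?thesis by blast
  next
    case True
    then obtain u1 where u1: "u1 : U" "ph j u1 ~= 0" by blast
    define e where "e = (ps u1 - (SUM i:I. c i * ph i u1)) / ph j u1"
    have "ps u = (SUM i:insert j I. (c(j := e)) i * ph i u)" if u: "u : U" for u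
    proof -
      define t where "t = ph j u / ph j u1"
      have v: "comb u (- t) u1 : ?U" using insert.prems(1,2) u u1 by (simp add: t_def)
      have "ps u - t * ps u1 = ps (comb u (- t) u1)" using insert.prems(3) u u1 by simp
      also have "... = (SUM i:I. c i * (ph i u - t * ph i u1))" unfolding c[OF v] by (rule sum.cong) (use insert.prems(2) u u1 in auto)
      also have "... = (SUM i:I. c i * ph i u) - t * (SUM i:I. c i * ph i u1)" by (simp add: right_diff_distrib sum_subtractf sum_distrib_left mult.left_commute)
      finally have "ps u = (SUM i:I. c i * ph i u) + t * (ps u1 - (SUM i:I. c i * ph i u1))" by (simp add: algebra_simps)
      also have "t * (ps u1 - (SUM i:I. c i * ph i u1)) = e * ph j u" by (simp add: t_def e_def)
      finally have eq: "ps u = (SUM i:I. c i * ph i u) + e * ph j u" .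
      have "(SUM i:I. (c(j := e)) i * ph i u) = (SUM i:I. c i * ph i u)" by (rule sum.cong) (use insert.hyps in auto)
      thus ?thesis using eq insert.hyps by simp
    qed
    thus ?thesis by blast
  qed
qed

text \<open>A right-hand side that respects every linear relation between the functionals is
  attained. If the added functional is independent of the others, a common kernel vector corrects
  its value; otherwise the relation forces the value already attained.\<close>

lemma fredholm_alternative:
  fixes ph :: "'i => 'u => real" and comb :: "'u => real => 'u => 'u"
  assumes "finite I" and "U ~= {}"
    and U: "!!u v c. u : U ==> v : U ==> comb u c v : U"
    and ph: "!!i u v c. i : I ==> u : U ==> v : U ==> ph i (comb u c v) = ph i u + c * ph i v"
    and solv: "!!c. (!!u. u : U ==> (SUM i:I. c i * ph i u) = 0) ==> (SUM i:I. c i * l i) = 0"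
  shows "EX u:U. ALL i:I. ph i u = l i" using assms
proof (induction I rule: finite_induct)
  case empty
  thus ?case by blast
next
  case (insert j I)
  have upd: "(SUM i:insert j I. (c(j := e)) i * g i) = e * g j + (SUM i:I. c i * g i)" for c g and e :: real
  proof -
    have "(SUM i:I. (c(j := e)) i * g i) = (SUM i:I. c i * g i)" by (rule sum.cong) (use insert.hyps in auto)
    thus ?thesis using insert.hyps by simp
  qed
  have "EX u:U. ALL i:I. ph i u = l i"
  proof (rule insert.IH[OF insert.prems(1,2)])
    fix i u v c assume "i : I" "u : U" "v : U"
    thus "ph i (comb u c v) = ph i u + c * ph i v" using insert.prems(3) by simp
  next
    fix c assume "!!u. u : U ==> (SUM i:I. c i * ph i u) = 0"
    hence "!!u. u : U ==> (SUM i:insert j I. (c(j := 0)) i * ph i u) = 0" unfolding upd by simp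
    from insert.prems(4)[OF this] show "(SUM i:I. c i * l i) = 0" unfolding upd by simp
  qed
  then obtain u0 where u0: "u0 : U" "!!i. i : I ==> ph i u0 = l i" by blast
  show ?case
  proof (cases "EX u1:U. (ALL i:I. ph i u1 = 0) & ph j u1 ~= 0")
    case True
    then obtain u1 where u1: "u1 : U" "!!i. i : I ==> ph i u1 = 0" "ph j u1 ~= 0" by blast
    define t where "t = (l j - ph j u0) / ph j u1"
    have "ph i (comb u0 t u1) = l i" if "i : insert j I" for i
      using that insert.prems(3)[OF that u0(1) u1(1), of t] u0(2) u1(2,3) by (auto simp: t_def)
    thus ?thesis using insert.prems(2)[OF u0(1) u1(1)] by blast
  next
    case False
    have "EX c. ALL u:U. ph j u = (SUM i:I. c i * ph i u)" by (rule functional_in_span[where comb = comb]) (use insert.hyps insert.prems False in auto)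
    then obtain c where c: "!!u. u : U ==> ph j u = (SUM i:I. c i * ph i u)" by blast
    hence "!!u. u : U ==> (SUM i:insert j I. (c(j := -1)) i * ph i u) = 0" unfolding upd by simp
    from insert.prems(4)[OF this] have "l j = (SUM i:I. c i * l i)" unfolding upd by simp
    also have "... = ph j u0" unfolding c[OF u0(1)] by (rule sum.cong) (use u0 in auto)
    finally show ?thesis using u0 by (intro bexI[of _ u0]) auto
  qed
qed

section \<open>Finite-dimensional function spaces and nondegenerate pairings\<close>

definition subsp :: "('y => real) set => bool" where
  "subsp W \<longleftrightarrow> (%_. 0) : W & (ALL u:W. ALL v:W. ALL c. (%y. u y + c * v y) : W)"

definition lin_on :: "('y => real) set => (('y => real) => real) => bool" where
  "lin_on W L \<longleftrightarrow> (ALL u:W. ALL v:W. ALL c. L (%y. u y + c * v y) = L u + c * L v)"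

lemma subspD: "subsp W ==> u : W ==> v : W ==> (%y. u y + c * v y) : W" by (simp add: subsp_def)

lemma lin_onD: "lin_on W L ==> u : W ==> v : W ==> L (%y. u y + c * v y) = L u + c * L v" by (simp add: lin_on_def)

lemma lin_on_zero:
  assumes "subsp W" "lin_on W L"
  shows "L (%_. 0) = 0"
proof -
  have z: "(%_. 0) : W" using assms(1) by (simp add: subsp_def)
  show ?thesis using lin_onD[OF assms(2) z z, of "-1"] by simp
qed

lemma subsp_lin_on_sum:
  assumes W: "subsp W" and L: "lin_on W L" and h: "!!j. j : J ==> h j : W" and J: "finite J"
  shows "(%y. SUM j:J. c j * h j y) : W & L (%y. SUM j:J. c j * h j y) = (SUM j:J. c j * L (h j))" using J h
proof (induction J rule: finite_induct)
  case empty
  thus ?case using W lin_on_zero[OF W L] by (simp add: subsp_def)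
next
  case (insert j J)
  let ?s = "%y. SUM j:J. c j * h j y"
  have IH: "?s : W" "L ?s = (SUM j:J. c j * L (h j))" using insert by auto
  have hj: "h j : W" using insert.prems by simp
  have "(%y. ?s y + c j * h j y) : W" "L (%y. ?s y + c j * h j y) = L ?s + c j * L (h j)" by (rule subspD[OF W IH(1) hj], rule lin_onD[OF L IH(1) hj])
  thus ?case using insert.hyps IH(2) by (simp add: add.commute)
qed

text \<open>The generators \<open>G\<close> may lie outside \<open>W\<close>, as monomials do for a
  space of bubbles. They are exchanged one by one: an element of \<open>W\<close> that involves a
  generator takes its place, and multiples of this element remove the generator from all
  others.\<close>

lemma subsp_finite_basis:
  fixes G :: "'i => 'y => real"
  assumes "finite I" "subsp W" "!!w. w : W ==> EX c. w = (%y. SUM i:I. c i * G i y)"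
  shows "EX J h. J <= I & (ALL j:J. h j : W) & (ALL w:W. EX c. w = (%y. SUM j:J. c j * h j y))" using assms
proof (induction I arbitrary: W rule: finite_induct)
  case empty
  thus ?case by (intro exI[of _ "{}"]) auto
next
  case (insert i I)
  let ?W = "{w : W. EX c. w = (%y. SUM i:I. c i * G i y)}"
  have W: "(%_. 0) : W" "!!u v c. u : W ==> v : W ==> (%y. u y + c * v y) : W" using insert.prems(1) by (auto simp: subsp_def)
  have "subsp ?W" unfolding subsp_def
  proof (intro conjI ballI allI)
    show "(%_. 0) : ?W" using W(1) by (auto intro!: exI[of _ "%_. 0"])
    fix u v c assume u: "u : ?W" and v: "v : ?W"
    then obtain d e where "u = (%y. SUM i:I. d i * G i y)" "v = (%y. SUM i:I. e i * G i y)" by blast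
    hence "(%y. u y + c * v y) = (%y. SUM i:I. (d i + c * e i) * G i y)" by (simp add: algebra_simps sum.distrib sum_distrib_left)
    moreover have "(%y. u y + c * v y) : W" by (rule W(2)) (use u v in auto)
    ultimately show "(%y. u y + c * v y) : ?W" by (intro CollectI conjI exI[of _ "%i. d i + c * e i"])
  qed
  hence "EX J h. J <= I & (ALL j:J. h j : ?W) & (ALL w:?W. EX c. w = (%y. SUM j:J. c j * h j y))" by (rule insert.IH) simp
  then obtain J h where Jh: "J <= I & (ALL j:J. h j : ?W) & (ALL w:?W. EX c. w = (%y. SUM j:J. c j * h j y))" by (elim exE)
  hence J: "J <= I" "!!j. j : J ==> h j : ?W" by blast+
  have J3: "EX c. w = (%y. SUM j:J. c j * h j y)" if "w : ?W" for w using conjunct2[OF conjunct2[OF Jh]] that by (rule bspec)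
  show ?case
  proof (cases "W = ?W")
    case True
    have "ALL w:W. EX c. w = (%y. SUM j:J. c j * h j y)" by (subst True) (rule conjunct2[OF conjunct2[OF Jh]])
    moreover have "ALL j:J. h j : W" using J by blast
    ultimately have "ALL j:J. h j : W" "ALL w:W. EX c. w = (%y. SUM j:J. c j * h j y)" by blast+
    thus ?thesis using J(1) by (intro exI[of _ J] exI[of _ h]) auto
  next
    case False
    then obtain w0 where w0: "w0 : W" "~(EX c. w0 = (%y. SUM i:I. c i * G i y))" by blast
    have spl: "EX c e. w = (%y. e * G i y + (SUM i:I. c i * G i y))" if w: "w : W" for w
    proof -
      obtain c where "w = (%y. SUM i:insert i I. c i * G i y)" using insert.prems(2)[OF w] by blast
      thus ?thesis using insert.hyps by (intro exI[of _ c] exI[of _ "c i"]) simp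
    qed
    obtain c0 e0 where e0: "w0 = (%y. e0 * G i y + (SUM i:I. c0 i * G i y))" using spl[OF w0(1)] by blast
    have "e0 ~= 0" using w0(2) e0 by auto
    have iJ: "i ~: J" using J(1) insert.hyps by blast
    have finJ: "finite J" using J(1) insert.hyps finite_subset by blast
    have "EX d. w = (%y. SUM j:insert i J. d j * (h(i := w0)) j y)" if w: "w : W" for w
    proof -
      obtain c e where e: "w = (%y. e * G i y + (SUM i:I. c i * G i y))" using spl[OF w] by blast
      let ?v = "%y. w y + (- e / e0) * w0 y"
      have "?v = (%y. SUM i:I. (c i + (- e / e0) * c0 i) * G i y)"
        using \<open>e0 ~= 0\<close> by (simp add: e e0 fun_eq_iff algebra_simps sum.distrib sum_distrib_left sum_subtractf sum_negf)
      hence "?v : ?W" by (intro CollectI conjI W(2)[OF w w0(1)] exI[of _ "%i. c i + (- e / e0) * c0 i"])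
      then obtain d where d: "?v = (%y. SUM j:J. d j * h j y)" using J3 by blast
      have "w y = (SUM j:insert i J. (d(i := e / e0)) j * (h(i := w0)) j y)" for y
      proof -
        have "(SUM j:J. (d(i := e / e0)) j * (h(i := w0)) j y) = (SUM j:J. d j * h j y)" by (rule sum.cong) (use iJ in auto)
        thus ?thesis using fun_cong[OF d, of y] iJ finJ by simp
      qed
      thus ?thesis by blast
    qed
    moreover have "ALL j:insert i J. (h(i := w0)) j : W" using J(2) w0(1) by auto
    ultimately show ?thesis using J(1) by (intro exI[of _ "insert i J"] exI[of _ "h(i := w0)"]) auto
  qed
qed

text \<open>This takes the place of a dimension count. A relation between the tests
  \<open>h j\<close> that holds for all of \<open>U\<close> comes from a test function invisible to
  \<open>U\<close>; by nondegeneracy it is 0, where \<open>L\<close> vanishes too, so the relation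
  is respected.\<close>

lemma riesz_pairing:
  fixes G :: "'i => 'y => real" and bt :: "'u => ('y => real) => real"
  assumes I: "finite I" and W: "subsp W" and span: "!!w. w : W ==> EX c. w = (%y. SUM i:I. c i * G i y)"
    and U: "U ~= {}" "!!u v c. u : U ==> v : U ==> comb u c v : U"
    and btu: "!!u v c w. u : U ==> v : U ==> w : W ==> bt (comb u c v) w = bt u w + c * bt v w"
    and btw: "!!u. u : U ==> lin_on W (bt u)"
    and nondeg: "!!w. w : W ==> (!!u. u : U ==> bt u w = 0) ==> w = (%_. 0)"
    and L: "lin_on W L"
  shows "EX u:U. ALL w:W. bt u w = L w"
proof -
  obtain J h where J: "J <= I" "!!j. j : J ==> h j : W"
    "!!w. w : W ==> EX c. w = (%y. SUM j:J. c j * h j y)" using subsp_finite_basis[OF I W span] by blast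
  have finJ: "finite J" using J(1) I finite_subset by blast
  have bts: "bt u (%y. SUM j:J. c j * h j y) = (SUM j:J. c j * bt u (h j))" if "u : U" for u c
    using subsp_lin_on_sum[OF W btw[OF that], where h = h, OF J(2) finJ] by blast
  have Ls: "(%y. SUM j:J. c j * h j y) : W" "L (%y. SUM j:J. c j * h j y) = (SUM j:J. c j * L (h j))" for c
    using subsp_lin_on_sum[OF W L, where h = h, OF J(2) finJ] by blast+
  have "EX u:U. ALL j:J. bt u (h j) = L (h j)"
  proof (rule fredholm_alternative[where comb = comb, OF finJ U])
    fix c assume "!!u. u : U ==> (SUM j:J. c j * bt u (h j)) = 0"
    hence "bt u (%y. SUM j:J. c j * h j y) = 0" if "u : U" for u using bts that by simp
    hence "(%y. SUM j:J. c j * h j y) = (%_. 0)" by (rule nondeg[OF Ls(1)])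
    thus "(SUM j:J. c j * L (h j)) = 0" using Ls(2)[of c] lin_on_zero[OF W L] by simp
  qed (use btu J(2) in auto)
  then obtain u where u: "u : U" "!!j. j : J ==> bt u (h j) = L (h j)" by blast
  have "bt u w = L w" if w: "w : W" for w
  proof -
    obtain c where c: "w = (%y. SUM j:J. c j * h j y)" using J(3)[OF w] by blast
    show ?thesis unfolding c bts[OF u(1)] Ls(2) by (rule sum.cong) (use u in auto)
  qed
  thus ?thesis using u(1) by blast
qed

section \<open>Pairings of polynomials with bubbles\<close>

lemma subsp_Poly: "subsp (Poly s f)" unfolding subsp_def by (auto intro: Poly_zero Poly_add Poly_scale)

definition mono_on :: "'n::finite rvec set => ('n => nat) => 'n rvec => real" where
  "mono_on f al x = (if x : f then PROD i:UNIV. (x $ i) ^ al i else 0)"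

lemma Poly_mono_span:
  assumes "w : Poly s f"
  shows "EX c. w = (%y. SUM al:degs_le s. c al * mono_on f al y)"
proof -
  obtain c where "!!x. w x = (if x : f then SUM al:degs_le s. c al * (PROD i:UNIV. (x $ i) ^ al i) else 0)" using assms unfolding Poly_alt by blast
  thus ?thesis by (intro exI[of _ c]) (auto simp: mono_on_def)
qed

lemma face_integral_lin:
  assumes f: "int l simplex f" and "continuous_on f g" "continuous_on f h"
  shows "face_integral f (%x. g x + c * h x) = face_integral f g + c * face_integral f h" by (subst face_integral_add[OF f assms(2)]) (auto intro: continuous_intros assms(3) simp: face_integral_scale)

text \<open>On the segment to the barycenter all coordinates are positive except possibly at x
  itself, so \<open>g\<close> is 0 there, and continuity reaches x.\<close>

lemma simplex_rel_interior_dense_zero: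
  assumes f: "int l simplex f" and g: "continuous_on f g"
    and z: "!!x. x : f ==> (PROD v:verts f. bary f v x) * (g x)\<^sup>2 = (0::real)" and x: "x : f"
  shows "g x = 0"
proof -
  let ?b = "barycenter f"
  note V = simplexD(1)[OF f]
  have seg: "(1 - t) *\<^sub>R x + t *\<^sub>R ?b : f" if "0 <= t" "t <= 1" for t
    using simplex_convex[OF f] x barycenter(1)[OF f] that by (simp add: convex_alt)
  have pos: "g ((1 - t) *\<^sub>R x + t *\<^sub>R ?b) = 0" if t: "0 < t" "t <= 1" for t
  proof -
    let ?y = "(1 - t) *\<^sub>R x + t *\<^sub>R ?b"
    have y: "?y : f" using seg t by simp
    note bx = bary_props[OF f simplex_affine_hull[OF f x]]
      and bb = bary_props[OF f simplex_affine_hull[OF f barycenter(1)[OF f]]]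
    have "bary f v ?y > 0" if v: "v : verts f" for v
    proof -
      have "bary f v ?y = (1 - t) * bary f v x + t * bary f v ?b"
      proof (rule bary_unique[OF f _ _ v])
        show "(SUM v:verts f. (1 - t) * bary f v x + t * bary f v ?b) = 1" using bx(1) bb(1) by (simp add: sum.distrib flip: sum_distrib_left)
        have "(SUM w:verts f. ((1 - t) * bary f w x + t * bary f w ?b) *\<^sub>R w) =
            (1 - t) *\<^sub>R (SUM w:verts f. bary f w x *\<^sub>R w) + t *\<^sub>R (SUM w:verts f. bary f w ?b *\<^sub>R w)" by (simp add: scaleR_left_distrib sum.distrib scaleR_sum_right)
        thus "(SUM w:verts f. ((1 - t) * bary f w x + t * bary f w ?b) *\<^sub>R w) = ?y" using bx(2) bb(2) by simp
      qed
      moreover have "(1 - t) * bary f v x >= 0" using bary_nonneg[OF f x v] t by simp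
      moreover have "t * bary f v ?b > 0" using barycenter(2)[OF f v] t by simp
      ultimately show ?thesis by linarith
    qed
    hence "(PROD v:verts f. bary f v ?y) > 0" by (intro prod_pos) auto
    thus ?thesis using z[OF y] by auto
  qed
  let ?p = "%t :: real. g ((1 - t) *\<^sub>R x + t *\<^sub>R ?b)"
  have cont: "continuous_on {0..1} ?p" by (rule continuous_on_compose2[OF g]) (use seg in \<open>auto intro!: continuous_intros\<close>)
  have "?p 0 = 0"
  proof (rule continuous_constant_on_closure[of "{0<..1}" ?p 0 0])
    show "continuous_on (closure {0<..1}) ?p" using cont by simp
  qed (use pos in auto)
  thus ?thesis by simp
qed

text \<open>The bubble is positive inside f, so weighting by it gives an inner product on
  \<open>Poly s f\<close>. This prescribes moments by functions vanishing on the boundary of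
  f.\<close>

lemma bubble_riesz:
  fixes f :: "'n::finite rvec set"
  assumes f: "int l simplex f" and L: "lin_on (Poly s f) L"
  obtains q where "q : Poly s f"
    "!!p. p : Poly s f ==> face_integral f (%x. (PROD v:verts f. bary f v x) * q x * p x) = L p"
proof -
  let ?b = "%x. PROD v:verts f. bary f v x"
  have cb: "continuous_on f ?b" by (rule bary_prod_continuous[OF f order_refl])
  note cP = Poly_continuous
  have "EX q:Poly s f. ALL p:Poly s f. face_integral f (%x. ?b x * q x * p x) = L p"
  proof (rule riesz_pairing[where comb = "%u c v x. u x + c * v x", OF finite_degs_le subsp_Poly Poly_mono_span])
    show "Poly s f ~= {}" using Poly_zero by blast
    show "(%x. u x + c * v x) : Poly s f" if "u : Poly s f" "v : Poly s f" for u v c using that by (intro Poly_add Poly_scale)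
    show "face_integral f (%x. ?b x * (u x + c * v x) * w x) =
        face_integral f (%x. ?b x * u x * w x) + c * face_integral f (%x. ?b x * v x * w x)"
      if "u : Poly s f" "v : Poly s f" "w : Poly s f" for u v c w
    proof -
      have "face_integral f (%x. ?b x * u x * w x + c * (?b x * v x * w x)) =
          face_integral f (%x. ?b x * u x * w x) + c * face_integral f (%x. ?b x * v x * w x)" by (rule face_integral_lin[OF f]) (intro continuous_on_mult cb cP[OF that(1)] cP[OF that(2)] cP[OF that(3)])+
      thus ?thesis by (simp add: algebra_simps)
    qed
    show "lin_on (Poly s f) (%w. face_integral f (%x. ?b x * u x * w x))" if u: "u : Poly s f" for u unfolding lin_on_def
    proof (intro ballI allI)
      fix v w c assume v: "v : Poly s f" and w: "w : Poly s f"
      have "face_integral f (%x. ?b x * u x * v x + c * (?b x * u x * w x)) =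
          face_integral f (%x. ?b x * u x * v x) + c * face_integral f (%x. ?b x * u x * w x)" by (rule face_integral_lin[OF f]) (intro continuous_on_mult cb cP[OF u] cP[OF v] cP[OF w])+
      thus "face_integral f (%x. ?b x * u x * (v x + c * w x)) =
          face_integral f (%x. ?b x * u x * v x) + c * face_integral f (%x. ?b x * u x * w x)" by (simp add: algebra_simps)
    qed
    fix w assume w: "w : Poly s f" and z: "!!u. u : Poly s f ==> face_integral f (%x. ?b x * u x * w x) = 0"
    have cw: "continuous_on f w" by (rule cP[OF w])
    have nn: "0 <= ?b y * w y * w y" if "y : f" for y
      unfolding mult.assoc using bary_nonneg[OF f that] by (intro mult_nonneg_nonneg prod_nonneg zero_le_square) auto
    have "?b x * w x * w x = 0" if "x : f" for x by (rule face_integral_pos_def[OF f _ nn z[OF w] that]) (intro continuous_on_mult cb cw)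
    hence "w x = 0" if "x : f" for x by (intro simplex_rel_interior_dense_zero[OF f cw _ that]) (simp add: power2_eq_square mult.assoc)
    thus "w = (%_. 0)" using Poly_outside[OF w] by auto
  qed (assumption, rule L)
  thus thesis using that by blast
qed

text \<open>The scalar factor of the tests (d). It differs from the bubble space, yet the L2 pairing
  between the two is nondegenerate on both sides.\<close>

definition W1 :: "nat => nat => 'n::finite rvec set => ('n rvec => real) set" where
  "W1 r k F = {%x. p x + q x | p q. p : Poly 1 F & q : Bubble r k F \<inter> P1_perp F}"

lemma P1_perp_iff:
  fixes F :: "'n::finite rvec set"
  assumes F: "int l simplex F" and u: "u : Poly s F"
  shows "u : P1_perp F \<longleftrightarrow> (ALL p:Poly 1 F. face_integral F (%x. u x * p x) = 0)"
proof -
  have c: "continuous_on F u" by (rule Poly_continuous[OF u])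
  have "set_borel_measurable (face_measure F) F u"
    using borel_measurable_integrable[OF face_integrable[OF F c]] by (simp add: set_borel_measurable_def)
  moreover have "set_integrable (face_measure F) F (%x. (u x)\<^sup>2)"
    unfolding set_integrable_def by (rule face_integrable[OF F]) (intro continuous_intros c)
  ultimately show ?thesis by (simp add: P1_perp_def)
qed

text \<open>A test p + q orthogonal to all bubbles is tested with its own bubble part q; since q is
  orthogonal to p this gives q = 0, and p is affine and orthogonal to the bubbles. Conversely a
  bubble orthogonal to all tests is orthogonal to the affine functions and thus is itself a test.
  The bound on k makes k + 1 at most the dimension of F.\<close>

lemma W1_facts:
  fixes F :: "'n::finite rvec set"
  assumes F: "int (CARD('n) - 1) simplex F" and n: "CARD('n) >= 3" and k: "k <= CARD('n) - 2" and r: "r >= k + 1"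
  shows W1_Poly: "w : W1 r k F ==> w : Poly (int r) F"
    and W1_subsp: "subsp (W1 r k F)"
    and W1_nondeg: "w : W1 r k F ==> (!!u. u : Bubble r k F ==> face_integral F (%x. u x * w x) = 0) ==> w = (%_. 0)"
    and Bubble_nondeg: "u : Bubble r k F ==> (!!w. w : W1 r k F ==> face_integral F (%x. u x * w x) = 0) ==> u = (%_. 0)"
proof -
  let ?B = "Bubble r k F" and ?P = "Poly 1 F :: ('n rvec => real) set"
  have BP: "u : Poly (int r) F" if "u : ?B" for u using Bubble_Poly[OF F that] .
  have B0: "(%_. 0) : ?B" unfolding Bubble_def by (intro CollectI exI[of _ "%_ _. 0"]) (simp add: bubble_Poly_zero)
  note perp = P1_perp_iff[OF F BP]
  show WP: "w : Poly (int r) F" if "w : W1 r k F" for w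
  proof -
    obtain p q where "w = (%x. p x + q x)" "p : ?P" "q : ?B" using \<open>w : W1 r k F\<close> unfolding W1_def by blast
    moreover have "p : Poly (int r) F" by (rule Poly_mono[OF \<open>p : ?P\<close>]) (use r in simp)
    ultimately show ?thesis using Poly_add BP by blast
  qed
  show "subsp (W1 r k F)" unfolding subsp_def
  proof (intro conjI ballI allI)
    have "(%_. 0) : P1_perp F" using perp[OF B0] by (simp add: face_integral_zero)
    thus "(%_. 0) : W1 r k F" unfolding W1_def using B0 Poly_zero by (intro CollectI exI[of _ "%_. 0"]) auto
    fix u v c assume "u : W1 r k F" "v : W1 r k F"
    then obtain p q p' q' where u: "u = (%x. p x + q x)" "p : ?P" "q : ?B" "q : P1_perp F"
      and v: "v = (%x. p' x + q' x)" "p' : ?P" "q' : ?B" "q' : P1_perp F" unfolding W1_def by blast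
    have qq: "(%x. q x + c * q' x) : ?B" by (rule Bubble_lin[OF u(3) v(3)])
    have "face_integral F (%x. (q x + c * q' x) * s x) = 0" if s: "s : ?P" for s
    proof -
      have "face_integral F (%x. q x * s x + c * (q' x * s x)) = face_integral F (%x. q x * s x) + c * face_integral F (%x. q' x * s x)" by (rule face_integral_lin[OF F])
          (auto intro!: continuous_on_mult Poly_continuous[OF BP[OF u(3)]] Poly_continuous[OF BP[OF v(3)]] Poly_continuous[OF s])
      also have "... = 0" using u(4) v(4) s perp[OF u(3)] perp[OF v(3)] by simp
      finally show ?thesis by (simp add: algebra_simps)
    qed
    hence "(%x. q x + c * q' x) : P1_perp F" using perp[OF qq] by blast
    moreover have "(%x. p x + c * p' x) : ?P" by (intro Poly_add Poly_scale u v)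
    moreover have "(%x. u x + c * v x) = (%x. (p x + c * p' x) + (q x + c * q' x))" by (simp add: u v algebra_simps)
    ultimately show "(%y. u y + c * v y) : W1 r k F" unfolding W1_def using qq by (intro CollectI exI conjI) auto
  qed
  have sq: "u = (%_. 0)" if u: "u : ?B" and z: "face_integral F (%x. u x * u x) = 0" for u
  proof
    fix x
    have cu: "continuous_on F u" by (rule Poly_continuous[OF BP[OF u]])
    show "u x = 0"
    proof (cases "x : F")
      case True
      have "u x * u x = 0" by (rule face_integral_pos_def[OF F _ _ z True]) (auto intro!: continuous_on_mult cu)
      thus ?thesis by simp
    qed (rule Poly_outside[OF BP[OF u]])
  qed
  show "w = (%_. 0)" if w: "w : W1 r k F" and z: "!!u. u : ?B ==> face_integral F (%x. u x * w x) = 0" for w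
  proof -
    obtain p q where pq: "w = (%x. p x + q x)" "p : ?P" "q : ?B" "q : P1_perp F" using w unfolding W1_def by blast
    have cq: "continuous_on F q" by (rule Poly_continuous[OF BP[OF pq(3)]])
    have cp: "continuous_on F p" by (rule Poly_continuous[OF pq(2)])
    have "0 = face_integral F (%x. q x * p x + q x * q x)" using z[OF pq(3)] by (simp add: pq(1) distrib_left)
    also have "... = face_integral F (%x. q x * p x) + face_integral F (%x. q x * q x)" by (rule face_integral_add[OF F]) (intro continuous_on_mult cq cp)+
    also have "face_integral F (%x. q x * p x) = 0" using pq(2,4) perp[OF pq(3)] by blast
    finally have "q = (%_. 0)" using sq[OF pq(3)] by simp
    hence wp: "w = p" using pq(1) by simp
    have "p : Poly (int 1) F" using pq(2) by simp
    then obtain p0 where p0: "pf 1 p0" "p = (%x. if x : F then p0 x else 0)" unfolding Poly_iff_pf by blast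
    then obtain a b where ab: "p0 = (%x. a \<bullet> x + b)" using pf_1 by blast
    have "a \<bullet> x + b = 0" if x: "x : F" for x
    proof (rule affine_orthogonal_bubbles_zero[OF F _ _ x])
      show "k + 1 <= CARD('n) - 1" using k n by linarith
      fix S assume S: "S <= verts F" "card S = k + 1"
      let ?u = "%x. if x : F then PROD v:S. bary F v x else 0"
      \<comment> \<open>A face of dimension below k has at most k vertices, so it lacks one of the k
        + 1 vertices in the product.\<close>
      have "?u : ?B"
      proof (rule Poly_vanishing_Bubble[OF F])
        show "r >= 1" using r by simp
        show "?u : Poly (int r) F" by (rule Poly_mono[OF bubble_prod_Poly[OF F S(1)]]) (use S r in simp)
        fix m g y assume g: "m < k" "g : Delta m F" "y : g"
        have "card (verts g) < card S" using simplexD(3)[OF Delta_simplex[OF g(2)]] g(1) S(2) by simp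
        then obtain v where v: "v : S" "v ~: verts g" by (meson card_mono not_le simplexD(1)[OF Delta_simplex[OF g(2)]] subsetI)
        have "bary F v y = 0" using bary_face[OF F g(2) simplex_affine_hull[OF Delta_simplex[OF g(2)] g(3)], of v] v S(1) by auto
        hence "(PROD v:S. bary F v y) = 0" using v(1) S(2) by (intro prod_zero) (auto intro: card_ge_0_finite)
        thus "?u y = 0" by simp
      qed
      hence "face_integral F (%x. ?u x * w x) = 0" by (rule z)
      also have "face_integral F (%x. ?u x * w x) = face_integral F (%x. (a \<bullet> x + b) * (PROD v:S. bary F v x))" by (rule face_integral_cong) (simp add: wp p0(2) ab)
      finally show "face_integral F (%x. (a \<bullet> x + b) * (PROD v:S. bary F v x)) = 0" .
    qed
    thus ?thesis using wp p0(2) ab by auto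
  qed
  show "u = (%_. 0)" if u: "u : ?B" and z: "!!w. w : W1 r k F ==> face_integral F (%x. u x * w x) = 0" for u
  proof (rule sq[OF u])
    have "p : W1 r k F" if "p : ?P" for p
    proof -
      have "(%_. 0) : P1_perp F" using perp[OF B0] by (simp add: face_integral_zero)
      thus ?thesis unfolding W1_def using B0 that by (intro CollectI exI[of _ p] exI[of _ "%_. 0"]) auto
    qed
    hence "u : P1_perp F" using perp[OF u] z by blast
    hence "u : W1 r k F" unfolding W1_def using u Poly_zero by (intro CollectI exI[of _ "%_. 0"] exI[of _ u]) auto
    thus "face_integral F (%x. u x * u x) = 0" by (rule z)
  qed
qed

lemma W1_riesz:
  fixes F :: "'n::finite rvec set"
  assumes F: "int (CARD('n) - 1) simplex F" and n: "CARD('n) >= 3" and k: "k <= CARD('n) - 2" and r: "r >= k + 1"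
    and L: "lin_on (W1 r k F) L"
  obtains u where "u : Bubble r k F" "!!w. w : W1 r k F ==> face_integral F (%x. u x * w x) = L w"
proof -
  note WP = W1_Poly[OF F n k r] and BP = Bubble_Poly[OF F]
  have "EX u:Bubble r k F. ALL w:W1 r k F. face_integral F (%x. u x * w x) = L w"
  proof (rule riesz_pairing[where comb = "%u c v x. u x + c * v x", OF finite_degs_le W1_subsp[OF F n k r] Poly_mono_span[OF WP]])
    have "(%_. 0) : Bubble r k F" unfolding Bubble_def by (intro CollectI exI[of _ "%_ _. 0"]) (simp add: bubble_Poly_zero)
    thus "Bubble r k F ~= {}" by blast
    show "(%x. u x + c * v x) : Bubble r k F" if "u : Bubble r k F" "v : Bubble r k F" for u v c by (rule Bubble_lin[OF that])
    show "face_integral F (%x. (u x + c * v x) * w x) =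
        face_integral F (%x. u x * w x) + c * face_integral F (%x. v x * w x)"
      if "u : Bubble r k F" "v : Bubble r k F" "w : W1 r k F" for u v c w
    proof -
      have "face_integral F (%x. u x * w x + c * (v x * w x)) =
          face_integral F (%x. u x * w x) + c * face_integral F (%x. v x * w x)" by (rule face_integral_lin[OF F])
          (auto intro!: continuous_on_mult Poly_continuous[OF BP[OF that(1)]] Poly_continuous[OF BP[OF that(2)]] Poly_continuous[OF WP[OF that(3)]])
      thus ?thesis by (simp add: algebra_simps)
    qed
    show "lin_on (W1 r k F) (%w. face_integral F (%x. u x * w x))" if u: "u : Bubble r k F" for u unfolding lin_on_def
    proof (intro ballI allI)
      fix v w c assume v: "v : W1 r k F" and w: "w : W1 r k F"
      have "face_integral F (%x. u x * v x + c * (u x * w x)) =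
          face_integral F (%x. u x * v x) + c * face_integral F (%x. u x * w x)" by (rule face_integral_lin[OF F])
          (auto intro!: continuous_on_mult Poly_continuous[OF BP[OF u]] Poly_continuous[OF WP[OF v]] Poly_continuous[OF WP[OF w]])
      thus "face_integral F (%x. u x * (v x + c * w x)) =
          face_integral F (%x. u x * v x) + c * face_integral F (%x. u x * w x)" by (simp add: algebra_simps)
    qed
  qed (use W1_nondeg[OF F n k r] L in auto)
  thus thesis using that by blast
qed

section \<open>Normals of the facets at a face\<close>

lemma simplex_affine_UNIV:
  fixes T :: "'a::euclidean_space set"
  assumes T: "int DIM('a) simplex T"
  shows "affine hull (verts T) = UNIV" by (rule affine_independent_span_eq) (use simplexD[OF T] in auto)

lemma tangent_space_mono: "f <= g ==> tangent_space f <= tangent_space g" unfolding tangent_space_def by (rule span_mono) blast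

lemma verts_subset: "int l simplex f ==> verts f <= f" using simplexD(4)[of l f] hull_subset[of "verts f" convex] by auto

lemma verts_diff_tangent: "int l simplex f ==> u : verts f ==> v : verts f ==> u - v : tangent_space f"
  unfolding tangent_space_def using verts_subset by (intro span_base) blast

lemma facet_opposite:
  assumes T: "int m simplex T" and m: "m >= 1" and F: "F : Delta (m - 1) T"
  obtains v where "v : verts T" "verts F = verts T - {v}"
proof -
  note fin = simplexD(1)[OF T]
  have "card (verts T - verts F) = 1"
    using simplexD(3)[OF T] simplexD(1,3)[OF Delta_simplex[OF F]] Delta_verts[OF T F] m by (simp add: card_Diff_subset)
  then obtain v where "verts T - verts F = {v}" using card_1_singletonE by blast
  hence "v : verts T" "verts F = verts T - {v}" using Delta_verts[OF T F] by auto
  thus thesis by (rule that)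
qed

lemma opposite_facet:
  assumes T: "int m simplex T" and m: "m >= 1" and v: "v : verts T"
  shows "convex hull (verts T - {v}) : Delta (m - 1) T" "verts (convex hull (verts T - {v})) = verts T - {v}"
proof -
  have "card (verts T - {v}) = m" using simplexD(1,3)[OF T] v by simp
  moreover from this have "verts T - {v} ~= {}" using m by (metis card.empty not_one_le_zero)
  ultimately show "convex hull (verts T - {v}) : Delta (m - 1) T" "verts (convex hull (verts T - {v})) = verts T - {v}"
    using subset_simplex[OF T, of "verts T - {v}"] by auto
qed

lemma face_subset_iff:
  assumes T: "int m simplex T" and f: "f : Delta l T" and g: "g : Delta l' T"
  shows "f <= g \<longleftrightarrow> verts f <= verts g"
proof
  assume "verts f <= verts g"
  thus "f <= g" using hull_mono[of "verts f" "verts g" convex]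
      simplexD(4)[OF Delta_simplex[OF f]] simplexD(4)[OF Delta_simplex[OF g]] by simp
next
  assume fg: "f <= g"
  show "verts f <= verts g"
  proof
    fix v assume v: "v : verts f"
    hence "v : g" using fg verts_subset[OF Delta_simplex[OF f]] by blast
    moreover have "v : verts T" using v Delta_verts[OF T f] by blast
    moreover have "bary T v v = 1" using bary_vertex[OF T] \<open>v : verts T\<close> by simp
    ultimately show "v : verts g" using bary_face[OF T g simplex_affine_hull[OF Delta_simplex[OF g]], of v v] by (auto split: if_splits)
  qed
qed

lemma simplex_diff_edges:
  fixes T :: "'a::euclidean_space set"
  assumes T: "int DIM('a) simplex T" and v0: "v0 : verts T"
  shows "x = (SUM u:verts T. bary T u (v0 + x) *\<^sub>R (u - v0))"
proof -
  have "v0 + x : affine hull (verts T)" using simplex_affine_UNIV[OF T] by simp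
  note b = bary_props[OF T this]
  show ?thesis using b by (simp add: scaleR_right_diff_distrib sum_subtractf flip: scaleR_left.sum)
qed

text \<open>Otherwise the normal would be orthogonal to all edges at \<open>v0\<close>, and these
  span the space.\<close>

lemma facet_normal_nonzero:
  fixes T :: "'a::euclidean_space set"
  assumes T: "int DIM('a) simplex T" and F: "F : Delta (DIM('a) - 1) T" and nk: "unit_normal F nk"
    and v: "v : verts T" "v ~: verts F" and v0: "v0 : verts F"
  shows "nk \<bullet> (v - v0) ~= 0"
proof
  assume z: "nk \<bullet> (v - v0) = 0"
  have VF: "verts F <= verts T" by (rule Delta_verts[OF T F])
  obtain v' where v': "v' : verts T" "verts F = verts T - {v'}" using facet_opposite[OF T DIM_positive[THEN Suc_leI, folded One_nat_def] F] by blast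
  hence "v' = v" using v by auto
  have "nk \<bullet> (u - v0) = 0" if "u : verts T" for u
  proof (cases "u = v")
    case False
    hence "u : verts F" using that v' \<open>v' = v\<close> by auto
    thus ?thesis using nk verts_diff_tangent[OF Delta_simplex[OF F] _ v0] by (simp add: unit_normal_def)
  qed (simp add: z)
  hence "nk \<bullet> x = 0" for x by (subst simplex_diff_edges[OF T, of v0 x]) (use v0 VF in \<open>auto simp: inner_sum_right\<close>)
  hence "nk = 0" using inner_eq_zero_iff by blast
  thus False using nk by (simp add: unit_normal_def)
qed

text \<open>For a vertex v0 of f, the edge from v0 to the vertex opposite F lies in every other
  facet through f. It is orthogonal to their normals and, rescaled, dual to the normal of F. This is
  the independence of the normals at f in the form in which it is used.\<close>

lemma facet_normals_dual:
  fixes T :: "'a::euclidean_space set"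
  assumes T: "int DIM('a) simplex T" and f: "f : Delta l T"
    and nF: "!!F. F : Delta (DIM('a) - 1) T ==> unit_normal F (nF F)"
  obtains z where "!!F F'. F : Delta (DIM('a) - 1) T ==> F' : Delta (DIM('a) - 1) T ==> f <= F ==> f <= F' ==>
    nF F' \<bullet> z F = (if F = F' then 1 else 0)"
proof -
  have D1: "1 <= DIM('a)" using DIM_positive[THEN Suc_leI, folded One_nat_def] .
  obtain v0 where v0: "v0 : verts f" using simplexD(3)[OF Delta_simplex[OF f]] by (metis card.empty add_is_0 all_not_in_conv one_neq_zero)
  define op where "op F = (SOME v. v : verts T & verts F = verts T - {v})" for F
  have op: "op F : verts T & verts F = verts T - {op F}" if "F : Delta (DIM('a) - 1) T" for F
    unfolding op_def by (rule someI_ex) (use facet_opposite[OF T D1 that] in blast)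
  show thesis
  proof (rule that[of "%F. (1 / (nF F \<bullet> (op F - v0))) *\<^sub>R (op F - v0)"])
    fix F F' assume F: "F : Delta (DIM('a) - 1) T" and F': "F' : Delta (DIM('a) - 1) T" and sub: "f <= F" "f <= F'"
    have v0F: "v0 : verts F" "v0 : verts F'" using sub face_subset_iff[OF T f F] face_subset_iff[OF T f F'] v0 by auto
    show "nF F' \<bullet> ((1 / (nF F \<bullet> (op F - v0))) *\<^sub>R (op F - v0)) = (if F = F' then 1 else 0)"
    proof (cases "F = F'")
      case True
      have "nF F \<bullet> (op F - v0) ~= 0" by (rule facet_normal_nonzero[OF T F nF[OF F] _ _ v0F(1)]) (use op[OF F] in auto)
      thus ?thesis using True by simp
    next
      case False
      have "verts F ~= verts F'"
      proof
        assume "verts F = verts F'"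
        hence "convex hull (verts F) = convex hull (verts F')" by simp
        thus False
          using False unfolding simplexD(4)[OF Delta_simplex[OF F], symmetric] simplexD(4)[OF Delta_simplex[OF F'], symmetric] by contradiction
      qed
      moreover have a: "op F : verts T" "verts F = verts T - {op F}" "verts F' = verts T - {op F'}" using op[OF F] op[OF F'] by blast+
      ultimately have "op F ~= op F'" by metis
      hence "op F : verts F'" unfolding a(3) using a(1) by blast
      hence "op F - v0 : tangent_space F'" using verts_diff_tangent[OF Delta_simplex[OF F'] _ v0F(2)] by blast
      thus ?thesis using nF[OF F'] False by (simp add: unit_normal_def)
    qed
  qed
qed

text \<open>In the expansion of x by edges at a vertex of f, the normal of the facet opposite u sees
  only the edge to u. Hence the coefficients of the vertices outside f are 0.\<close>

lemma facet_normals_span: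
  fixes T :: "'a::euclidean_space set"
  assumes T: "int DIM('a) simplex T" and f: "f : Delta l T"
    and nF: "!!F. F : Delta (DIM('a) - 1) T ==> unit_normal F (nF F)"
    and x: "!!F. F : Delta (DIM('a) - 1) T ==> f <= F ==> nF F \<bullet> x = 0"
  shows "x : tangent_space f"
proof -
  have D1: "1 <= DIM('a)" using DIM_positive[THEN Suc_leI, folded One_nat_def] .
  obtain v0 where v0: "v0 : verts f" using simplexD(3)[OF Delta_simplex[OF f]] by (metis card.empty add_is_0 all_not_in_conv one_neq_zero)
  have v0T: "v0 : verts T" using v0 Delta_verts[OF T f] by blast
  note fin = simplexD(1)[OF T] and ed = simplex_diff_edges[OF T v0T, of x]
  let ?c = "%u. bary T u (v0 + x)"
  have "?c u = 0" if u: "u : verts T" "u ~: verts f" for u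
  proof -
    let ?F = "convex hull (verts T - {u})"
    note F = opposite_facet[OF T D1 u(1)]
    have v0F: "v0 : verts ?F" unfolding F(2) using v0 v0T u by auto
    have fF: "f <= ?F" unfolding face_subset_iff[OF T f F(1)] F(2) using u Delta_verts[OF T f] by auto
    have z: "nF ?F \<bullet> (w - v0) = 0" if "w : verts T - {u}" for w
      using verts_diff_tangent[OF Delta_simplex[OF F(1)] _ v0F, of w] that nF[OF F(1)] unfolding F(2) by (simp add: unit_normal_def)
    have "0 = nF ?F \<bullet> x" using x[OF F(1) fF] by simp
    also have "... = (SUM w:verts T. ?c w * (nF ?F \<bullet> (w - v0)))" by (subst ed) (simp add: inner_sum_right)
    also have "... = ?c u * (nF ?F \<bullet> (u - v0))" using z by (simp add: sum.remove[OF fin u(1)])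
    finally show ?thesis using facet_normal_nonzero[OF T F(1) nF[OF F(1)] u(1) _ v0F] unfolding F(2) by simp
  qed
  hence "x = (SUM u:verts f. ?c u *\<^sub>R (u - v0))" by (subst ed) (rule sum.mono_neutral_right[OF fin Delta_verts[OF T f]], auto)
  moreover have "(SUM u:verts f. ?c u *\<^sub>R (u - v0)) : tangent_space f" unfolding tangent_space_def
  proof (intro span_sum span_scale)
    fix u assume "u : verts f"
    thus "u - v0 : span {x - y |x y. x : f & y : f}" using verts_diff_tangent[OF Delta_simplex[OF f] _ v0] unfolding tangent_space_def by blast
  qed
  ultimately show ?thesis by simp
qed

section \<open>Bases adapted to a face\<close>

text \<open>The tangential and the normal block of the basis are orthogonal to each other, so the
  dual basis splits likewise: the normal part of \<open>bt i\<close> is orthogonal to every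
  \<open>b j\<close> and so 0.\<close>

lemma tn_dual_tangent:
  fixes b :: "nat => 'n::finite rvec"
  assumes tn: "tn_basis l f b" and bi: "biorth b bt" and l: "l <= CARD('n)" and i: "i : {1..l}"
  shows "bt i : tangent_space f"
proof -
  have sub: "span (tangent_space f) = tangent_space f" by (simp add: tangent_space_def)
  obtain s y where sy: "s : tangent_space f" "!!w. w : tangent_space f ==> orthogonal y w" "bt i = s + y"
    using orthogonal_subspace_decomp_exists[of "tangent_space f" "bt i"] unfolding sub by blast
  have "b j \<bullet> y = 0" if j: "j : {1..CARD('n)}" for j
  proof (cases "j <= l")
    case True
    hence "b j : tangent_space f" using tn j by (simp add: tn_basis_def)
    thus ?thesis using sy(2)[of "b j"] by (simp add: orthogonal_def inner_commute)
  next
    case False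
    hence jl: "j : {l + 1..DIM('n rvec)}" using j by simp
    hence "b j \<bullet> s = 0" using tn sy(1) unfolding tn_basis_def by blast
    moreover have "b j \<bullet> bt i = 0" using bi i j False l unfolding biorth_def by auto
    ultimately show ?thesis using sy(3) by (simp add: inner_add_right)
  qed
  hence "y = 0" by (subst biorth_expand[OF bi, of y]) simp
  thus ?thesis using sy by simp
qed

lemma tn_normal:
  fixes b :: "nat => 'n::finite rvec"
  assumes "tn_basis l f b" "i : {l + 1..CARD('n)}" "t : tangent_space f"
  shows "b i \<bullet> t = 0" using assms by (simp add: tn_basis_def)

lemma tn_tangent_span:
  fixes b :: "nat => 'n::finite rvec"
  assumes tn: "tn_basis l f b" and bi: "biorth b bt" and l: "l <= CARD('n)"
  shows "tangent_space f <= span (bt ` {1..l})"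
proof
  fix t assume t: "t : tangent_space f"
  have "t = (SUM i:{1..CARD('n)}. (b i \<bullet> t) *\<^sub>R bt i)" by (rule biorth_expand[OF bi])
  also have "... = (SUM i:{1..l}. (b i \<bullet> t) *\<^sub>R bt i)"
  proof (rule sum.mono_neutral_right)
    show "ALL i:{1..CARD('n)} - {1..l}. (b i \<bullet> t) *\<^sub>R bt i = 0"
    proof
      fix i assume "i : {1..CARD('n)} - {1..l}"
      hence "i : {l + 1..CARD('n)}" by auto
      thus "(b i \<bullet> t) *\<^sub>R bt i = 0" using tn_normal[OF tn _ t] by simp
    qed
  qed (use l in auto)
  also have "... : span (bt ` {1..l})" by (intro span_sum span_scale span_base) auto
  finally show "t : span (bt ` {1..l})" .
qed

lemma tn_normal_expand:
  fixes b :: "nat => 'n::finite rvec"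
  assumes tn: "tn_basis l f b" and bi: "biorth b bt" and l: "l <= CARD('n)"
    and nk: "!!t. t : tangent_space f ==> nk \<bullet> t = 0"
  shows "nk = (SUM i:{l + 1..CARD('n)}. (nk \<bullet> bt i) *\<^sub>R b i)"
proof -
  have "nk = (SUM i:{1..CARD('n)}. (bt i \<bullet> nk) *\<^sub>R b i)" by (rule biorth_expand[OF biorth_sym[OF bi]])
  also have "... = (SUM i:{l + 1..CARD('n)}. (bt i \<bullet> nk) *\<^sub>R b i)"
  proof (rule sum.mono_neutral_right)
    show "ALL i:{1..CARD('n)} - {l + 1..CARD('n)}. (bt i \<bullet> nk) *\<^sub>R b i = 0"
    proof
      fix i assume "i : {1..CARD('n)} - {l + 1..CARD('n)}"
      hence "i : {1..l}" by (auto simp: One_nat_def)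
      thus "(bt i \<bullet> nk) *\<^sub>R b i = 0" using nk[OF tn_dual_tangent[OF tn bi l]] by (simp add: inner_commute)
    qed
  qed auto
  finally show ?thesis by (simp add: inner_commute)
qed

text \<open>The complement of ta lies above l exactly if ta contains {1..l}. So the rows of normal
  constraints contain {1..l}; conversely such a row has an element above l, as it has k > l
  elements, and removing it gives a normal constraint.\<close>

lemma free_row_iff:
  assumes sg: "sg : Sig n k" and l: "l < k"
  shows "free_row n k l sg \<longleftrightarrow> ~{1..l} <= sg"
proof
  assume fr: "free_row n k l sg"
  show "~{1..l} <= sg"
  proof
    assume sub: "{1..l} <= sg"
    have "card {1..l} < card sg" using sg l by (simp add: Sig_def)
    then obtain j where j: "j : sg" "j ~: {1..l}" by (meson card_mono not_le finite_atLeastAtMost subsetI)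
    have jn: "j : {l + 1..n}" using j Sig_subset[OF sg] by (auto simp: One_nat_def)
    have "normal_constraint n k l (sg - {j})" unfolding normal_constraint_def
    proof (intro conjI ballI)
      show "sg - {j} : Sig n (k - 1)" using sg j(1) Sig_finite[OF sg] by (auto simp: Sig_def)
      fix i assume "i : {1..n} - (sg - {j})"
      thus "l + 1 <= i" using sub j jn by (cases "i = j") (auto simp: One_nat_def subset_iff not_le)
    qed
    moreover have "(sg, j) : constraint_seq n (sg - {j})" using j(1) jn by (auto simp: constraint_seq_def One_nat_def)
    ultimately show False using fr jn unfolding free_row_def by blast
  qed
next
  assume ns: "~{1..l} <= sg"
  show "free_row n k l sg" unfolding free_row_def
  proof (intro conjI ballI allI impI notI)
    fix i ta assume nc: "normal_constraint n k l ta" and "(sg, i) : constraint_seq n ta"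
    hence sgta: "sg = insert i ta" by (auto simp: constraint_seq_def)
    obtain j where j: "j : {1..l}" "j ~: sg" using ns by blast
    have "card ta = k - 1" "ta <= {1..n}" using nc by (auto simp: normal_constraint_def Sig_def)
    hence "k <= n + 1" using card_mono[of "{1..n}" ta] by auto
    hence "j : {1..n} - ta" using j sgta l by auto
    hence "l + 1 <= j" using nc unfolding normal_constraint_def by blast
    thus False using j(1) by simp
  qed (rule sg)
qed

text \<open>A normal constraint would place {1..l} inside a set of k - 1 elements. This is why the
  tests (b) and (c) stop at dimension k - 1.\<close>

lemma free_row_all:
  assumes sg: "sg : Sig n k" and l: "k <= l" "l <= n" and k: "k >= 1"
  shows "free_row n k l sg" unfolding free_row_def
proof (intro conjI ballI allI impI notI)
  fix i ta assume nc: "normal_constraint n k l ta"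
  have "{1..l} <= ta"
  proof
    fix j assume j: "j : {1..l}"
    show "j : ta"
    proof (rule ccontr)
      assume "j ~: ta"
      hence "j : {1..n} - ta" using j l(2) by auto
      hence "l + 1 <= j" using nc unfolding normal_constraint_def by blast
      thus False using j by simp
    qed
  qed
  moreover have ta: "ta : Sig n (k - 1)" using nc by (simp add: normal_constraint_def)
  ultimately have "l <= k - 1" using card_mono[OF Sig_finite[OF ta], of "{1..l}"] ta by (simp add: Sig_def)
  thus False using l k by simp
qed (rule sg)

section \<open>The degrees of freedom determine the traces\<close>

lemma vf_Poly:
  fixes d :: "'n::{finite,linorder} rvec => 'n rvec dform"
  assumes "!!a. (%x. d x a) : Poly s F"
  shows "(%x. nk \<bullet> vf (d x) ws) : Poly s F"
proof -
  have "(%x. SUM i:{1..CARD('n)}. ((-1) ^ (i - 1) * (nk \<bullet> unit_vec i)) * d x (ws, unit_vecs ({1..CARD('n)} - {i}))) : Poly s F" by (intro Poly_sum Poly_scale assms)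
  moreover have "(%x. nk \<bullet> vf (d x) ws) = (%x. SUM i:{1..CARD('n)}. ((-1) ^ (i - 1) * (nk \<bullet> unit_vec i)) * d x (ws, unit_vecs ({1..CARD('n)} - {i})))" by (simp add: vf_def starv_def inner_sum_right mult_ac)
  ultimately show ?thesis by simp
qed

text \<open>Vanishing on the boundary makes u the bubble times a polynomial q of degree r - (l + 1),
  which is the degree of the tests. With q as test the integrand is nonnegative.\<close>

lemma Poly_zero_by_moments:
  fixes f :: "'n::finite rvec set"
  assumes f: "int l simplex f" and r: "r >= 1" and u: "u : Poly (int r) F" and fF: "f <= F"
    and z: "!!m g y. m < l ==> g : Delta m f ==> y : g ==> u y = 0"
    and mom: "!!q. q : Poly (int r - int (l + 1)) f ==> face_integral f (%x. q x * u x) = 0"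
    and x: "x : f"
  shows "u x = 0"
proof -
  let ?u = "%x. if x : f then u x else 0" and ?b = "%x. PROD v:verts f. bary f v x"
  have uf: "?u : Poly (int r) f" by (rule Poly_restrict[OF u fF])
  have zf: "?u y = 0" if "m < l" "g : Delta m f" "y : g" for m g y using z[OF that] by simp
  obtain q where q: "q : Poly (int r - int (l + 1)) f" "!!x. x : f ==> ?u x = ?b x * q x"
  proof (rule Poly_vanishing_on_boundary[OF f r uf])
    show "?u y = 0" if "m < l" "g : Delta m f" "y : g" for m g y by (rule zf[OF that])
  qed (rule that)
  have "face_integral f (%x. ?b x * (q x * q x)) = face_integral f (%x. q x * u x)" by (rule face_integral_cong) (use q(2) in \<open>simp add: mult_ac\<close>)
  hence 0: "face_integral f (%x. ?b x * (q x * q x)) = 0" using mom[OF q(1)] by simp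
  have nn: "0 <= ?b y * (q y * q y)" if "y : f" for y using bary_nonneg[OF f that] by (intro mult_nonneg_nonneg prod_nonneg zero_le_square) auto
  have "?b x * (q x * q x) = 0" by (rule face_integral_pos_def[OF f _ nn 0 x])
      (intro continuous_on_mult bary_prod_continuous[OF f order_refl] Poly_continuous[OF q(1)])
  thus ?thesis using q(2)[OF x] x by auto
qed

lemma fun_tensor_single:
  assumes "i : I" "finite I" "q : P" "(%_. 0) : P"
  shows "(%x a. q x * g i a) : fun_tensor P I g" unfolding fun_tensor_def
proof (intro CollectI exI[of _ "%j. if j = i then q else (%_. 0)"] conjI ballI)
  show "(%x a. q x * g i a) = (%x a. SUM j:I. (if j = i then q else (%_. 0)) x * g j a)"
  proof (intro ext)
    fix x a
    have "(SUM j:I. (if j = i then q else (%_. 0)) x * g j a) = (SUM j:I. if j = i then q x * g i a else 0)" by (rule sum.cong) auto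
    thus "q x * g i a = (SUM j:I. (if j = i then q else (%_. 0)) x * g j a)" using assms by simp
  qed
qed (use assms in auto)

lemma finite_free_block: "finite {(sg, i) : normal_block n k l. free_index n k sg i}" by (rule finite_subset[of _ "Sig n k \<times> {l + 1..n}"]) (auto simp: normal_block_def)

lemma finite_free_rows: "finite {sg. free_row n k l sg}" by (rule finite_subset[of _ "Sig n k"]) (auto simp: free_row_def)

lemma dform_pair_tensor:
  fixes d :: "'n::{finite,linorder} rvec => 'n rvec dform"
  assumes d: "!!x. x : f ==> d x : Alt2 k (CARD('n) - 1)" and bi: "biorth b bt"
    and dyh: "!!i. i : {1..CARD('n)} ==> dyh i = covec (bt i)"
    and sg: "sg : Sig CARD('n) k" and i: "i : {1..CARD('n)}"
  shows "dform_pair k f d (%x a. q x * form_tensor (wedge_ix dyh sg) (star_ix CARD('n) dyh i) a) =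
    vol (bvecs bt {1..CARD('n)}) * face_integral f (%x. q x * (b i \<bullet> vf (d x) (bvecs bt sg)))"
proof -
  have "dform_inner k (CARD('n) - 1) (d x) (%a. q x * form_tensor (wedge_ix dyh sg) (star_ix CARD('n) dyh i) a) =
      vol (bvecs bt {1..CARD('n)}) * (q x * (b i \<bullet> vf (d x) (bvecs bt sg)))" if "x : f" for x
  proof -
    have "dform_inner k (CARD('n) - 1) (d x) (%a. q x * form_tensor (wedge_ix dyh sg) (star_ix CARD('n) dyh i) a) =
        q x * dform_inner k (CARD('n) - 1) (d x) (form_tensor (wedge_ix dyh sg) (star_ix CARD('n) dyh i))" by (simp add: dform_inner_def sum_distrib_left mult_ac)
    thus ?thesis using dform_inner_dual[OF d[OF that] bi dyh sg i] by simp
  qed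
  thus ?thesis unfolding dform_pair_def by (subst face_integral_scale[symmetric]) (rule face_integral_cong)
qed

lemma tr_div_eq:
  fixes d :: "'n::{finite,linorder} rvec => 'n rvec dform"
  assumes "!!x. x : F ==> d x : Alt2 k (CARD('n) - 1)"
  shows "tr_div k F nk d x ws = (if x : F then nk \<bullet> vf (d x) ws else 0)" using trace_eq_vf[OF assms, of x nk ws] by (auto simp: tr_div_def)

lemma form_pair_tensor:
  fixes d :: "'n::{finite,linorder} rvec => 'n rvec dform"
  assumes d: "!!x. x : F ==> d x : Alt2 k (CARD('n) - 1)" and fF: "f <= F"
  shows "form_pair k f (tr_div k F nk d) (%x a. q x * cow us a) = face_integral f (%x. q x * (nk \<bullet> vf (d x) us))" unfolding form_pair_def
proof (rule face_integral_cong)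
  fix x assume "x : f"
  hence x: "x : F" using fF by blast
  have "tr_div k F nk d x = (%ws. nk \<bullet> vf (d x) ws)" using tr_div_eq[OF d, of F] x by auto
  hence "form_inner k (tr_div k F nk d x) (%a. q x * cow us a) = q x * form_inner k (%ws. nk \<bullet> vf (d x) ws) (cow us)" by (simp add: form_inner_def sum_distrib_left mult_ac)
  also have "... = q x * (nk \<bullet> vf (d x) us)" by (subst form_inner_cow[OF vf_Alt[OF d[OF x]]]) simp
  finally show "form_inner k (tr_div k F nk d x) (%a. q x * cow us a) = q x * (nk \<bullet> vf (d x) us)" .
qed

lemma Delta_0_vertex:
  assumes F: "int m simplex F" and f: "f : Delta 0 F" and x: "x : f"
  shows "x : verts F"
proof -
  have "card (verts f) = 1" using simplexD(3)[OF Delta_simplex[OF f]] by simp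
  then obtain v where "verts f = {v}" using card_1_singletonE by blast
  moreover from this have "f = {v}" using simplexD(4)[OF Delta_simplex[OF f]] by simp
  ultimately show ?thesis using Delta_verts[OF F f] x by auto
qed

lemma bvecs_span:
  assumes "sg : Sig n k" "{1..l} <= sg"
  shows "span (bt ` {1..l}) <= span (set (bvecs bt sg))" by (rule span_mono) (use assms Sig_finite[OF assms(1)] in auto)

text \<open>
  The normal components of the rows containing \<open>{1..l}\<close> vanish.  In invariant terms this is the
  statement below about all argument lists whose span contains the tangent space, and in this form
  it passes from a face to the faces containing it.
\<close>

lemma normal_block_vanishes:
  fixes d :: "'n::{finite,linorder} rvec => 'n rvec dform"
  assumes F: "int m simplex F" and k: "1 <= k" "k <= CARD('n)" and r: "r >= 1"
    and d1: "!!a. (%x. d x a) : Poly (int r) F" and d2: "!!x. x : F ==> d x : XX k"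
    and tn: "!!l f. l <= CARD('n) - 1 ==> f : Delta l F ==> tn_basis l f (tn f)"
    and dual: "!!l f. l <= CARD('n) - 1 ==> f : Delta l F ==> dual_basis (%i. covec (tn f i)) (dyh f)"
    and va: "!!v. v : verts F ==> d v = (%_. 0)"
    and vb: "!!l f et. l : {1..k - 1} ==> f : Delta l F ==> et : test_b r k l f (dyh f) ==> dform_pair k f d et = 0"
  shows "l <= k - 1 ==> f : Delta l F ==> x : f ==> (!!t. t : tangent_space f ==> nk \<bullet> t = 0) ==>
    tangent_space f <= span (set ws) ==> nk \<bullet> vf (d x) ws = 0"
proof (induction l arbitrary: f x nk ws rule: less_induct)
  case (less l)
  note f = less.prems(2) and x = less.prems(3)
  show ?case
  proof (cases "l = 0")
    case True
    hence "x : verts F" using Delta_0_vertex[OF F] f x by blast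
    thus ?thesis using va by (simp add: vf_zero)
  next
    case l0: False
    let ?n = "CARD('n)"
    have fs: "int l simplex f" by (rule Delta_simplex[OF f])
    have fF: "f <= F" by (rule Delta_subset[OF f])
    have l: "l <= ?n - 1" "l <= ?n" "l < k" "l : {1..k - 1}" using less.prems(1) k l0 by auto
    note tnf = tn[OF l(1) f]
    obtain bt where bi: "biorth (tn f) bt" and dyh: "!!i. i : {1..?n} ==> dyh f i = covec (bt i)" by (rule dual_basis_biorth[OF dual[OF l(1) f]]) (rule that)
    let ?b = "tn f"
    have dA: "d x : Alt2 k (?n - 1)" if "x : F" for x using XX_Alt2[OF d2[OF that]] .
    \<comment> \<open>These are the components tested by (b). On the boundary of f they vanish by
      induction: a normal of f is normal to each face of f, and the dual vectors of a row containing
      {1..l} span the tangent space.\<close>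
    have free: "?b i \<bullet> vf (d y) (bvecs bt sg) = 0"
      if sg: "sg : Sig ?n k" and i: "i : {l + 1..?n}" and sub: "{1..l} <= sg" and fi: "free_index ?n k sg i"
        and y: "y : f" for sg i y
    proof (rule Poly_zero_by_moments[OF fs r vf_Poly[OF d1] fF _ _ y])
      fix m' g z assume m': "m' < l" and g: "g : Delta m' f" and z: "z : g"
      have gf: "g <= f" by (rule Delta_subset[OF g])
      show "?b i \<bullet> vf (d z) (bvecs bt sg) = 0"
      proof (rule less.IH[OF m' _ Delta_trans[OF g f] z])
        show "m' <= k - 1" using m' less.prems(1) by simp
        show "?b i \<bullet> t = 0" if "t : tangent_space g" for t using tn_normal[OF tnf i] that tangent_space_mono[OF gf] by blast
        show "tangent_space g <= span (set (bvecs bt sg))"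
          using tangent_space_mono[OF gf] tn_tangent_span[OF tnf bi l(2)] bvecs_span[OF sg sub, of bt] by blast
      qed
    next
      fix q :: "'n rvec => real" assume q: "q : Poly (int r - int (l + 1)) f"
      have iN: "i : {1..?n}" using i by auto
      have nb: "(sg, i) : normal_block ?n k l" using sg i sub free_row_iff[OF sg l(3)] by (simp add: normal_block_def)
      have "(%x a. q x * (case (sg, i) of (sg, i) => form_tensor (wedge_ix (dyh f) sg) (star_ix ?n (dyh f) i)) a) : test_b r k l f (dyh f)"
        unfolding test_b_def by (rule fun_tensor_single[OF _ finite_free_block q Poly_zero]) (use nb fi in auto)
      hence "dform_pair k f d (%x a. q x * form_tensor (wedge_ix (dyh f) sg) (star_ix ?n (dyh f) i) a) = 0" using vb[OF l(4) f] by simp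
      thus "face_integral f (%x. q x * (?b i \<bullet> vf (d x) (bvecs bt sg))) = 0"
        using dform_pair_tensor[of f d k, OF _ bi dyh sg iN, of q] dA fF vol_basis_nonzero[OF bi] by auto
    qed
    \<comment> \<open>An untested component is the pair index of a constraint whose other members
      all have free index, so the constraint expresses it by components already known to
      vanish.\<close>
    have block: "?b i \<bullet> vf (d x) (bvecs bt sg) = 0"
      if sg: "sg : Sig ?n k" and i: "i : {l + 1..?n}" and sub: "{1..l} <= sg" for sg i
    proof (cases "free_index ?n k sg i")
      case True
      thus ?thesis using free[OF sg i sub _ x] by blast
    next
      case False
      then obtain ta where ta: "ta : Sig ?n (k - 1)" and p: "(sg, i) = pair_index ?n ta" unfolding free_index_def by blast
      have im: "i = Min ({1..?n} - ta)" and sgta: "sg = insert i ta" using p by (auto simp: pair_index_def Let_def)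
      have "card ta < card {1..?n}" using ta k by (simp add: Sig_def)
      hence "{1..?n} - ta ~= {}" using Sig_subset[OF ta] by (metis Diff_eq_empty_iff less_irrefl subset_antisym)
      hence iN: "i : {1..?n} - ta" unfolding im by (intro Min_in) auto
      have subta: "{1..l} <= ta" using sub sgta i by auto
      let ?g = "%j. ?b j \<bullet> vf (d x) (bt j # bvecs bt ta)"
      have xF: "x : F" using x fF by blast
      note A = vf_Alt[OF dA[OF xF]]
      have oth: "?g j = 0" if j: "j : {1..?n}" "j ~= i" for j
      proof (cases "j : ta")
        case True
        hence "~distinct (bt j # bvecs bt ta)" using Sig_finite[OF ta] by simp
        thus ?thesis by (rule Alt_not_distinct[OF A])
      next
        case False
        have jl: "j : {l + 1..?n}" using j(1) False subta by (auto simp: subset_iff One_nat_def not_less_eq_eq)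
        have ins: "insert j ta : Sig ?n k" using ta j(1) False k Sig_finite[OF ta] by (auto simp: Sig_def)
        \<comment> \<open>The index belongs to the constraint sequence of ta alone, and in this
          sequence it is not the first.\<close>
        have "free_index ?n k (insert j ta) j" unfolding free_index_def
        proof
          fix ta' assume ta': "ta' : Sig ?n (k - 1)"
          show "(insert j ta, j) ~= pair_index ?n ta'"
          proof
            assume "(insert j ta, j) = pair_index ?n ta'"
            hence e: "j = Min ({1..?n} - ta')" "insert j ta = insert j ta'" by (auto simp: pair_index_def Let_def)
            have "card ta' < card {1..?n}" using ta' k by (simp add: Sig_def)
            hence "{1..?n} - ta' ~= {}" using Sig_subset[OF ta'] by (metis Diff_eq_empty_iff less_irrefl subset_antisym)
            hence "j : {1..?n} - ta'" unfolding e(1) by (intro Min_in) auto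
            hence "ta = ta'" using e(2) False by auto
            thus False using e(1) im j(2) by simp
          qed
        qed
        hence "?b j \<bullet> vf (d x) (bvecs bt (insert j ta)) = 0" using free[OF ins jl _ _ x] subta by blast
        thus ?thesis using abs_Alt_insert[OF A Sig_finite[OF ta] False, of "?b j" bt] by simp
      qed
      have "0 = (SUM j:{1..?n}. ?g j)" using XX_constraint[OF d2[OF xF] bi length_bvecs[OF ta], of bt] by simp
      also have "... = ?g i" using oth iN by (simp add: sum.remove[of "{1..?n}" i])
      finally show ?thesis using abs_Alt_insert[OF A Sig_finite[OF ta], of i "?b i" bt] iN by (simp add: sgta)
    qed
    have xF: "x : F" using x fF by blast
    \<comment> \<open>Back to arbitrary lists: a row that misses some j <= l contributes nothing,
      because \<open>bt j\<close> is tangential, so in the span of \<open>ws\<close>, and is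
      annihilated by the covectors of the row.\<close>
    have comp: "?b i \<bullet> vf (d x) ws = 0" if i: "i : {l + 1..?n}" for i
    proof -
      have "?b i \<bullet> vf (d x) ws = (SUM sg:Sig ?n k. (?b i \<bullet> vf (d x) (bvecs bt sg)) * cow (bvecs ?b sg) ws)" by (rule Alt_expand[OF bi vf_Alt[OF dA[OF xF]]])
      also have "... = 0"
      proof (rule sum.neutral, rule ballI)
        fix sg assume sg: "sg : Sig ?n k"
        show "(?b i \<bullet> vf (d x) (bvecs bt sg)) * cow (bvecs ?b sg) ws = 0"
        proof (cases "{1..l} <= sg")
          case True
          thus ?thesis using block[OF sg i] by simp
        next
          case False
          then obtain j where j: "j : {1..l}" "j ~: sg" by blast
          have jN: "j : {1..?n}" using j(1) l(2) by auto
          have "cow (bvecs ?b sg) ws = 0"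
          proof (rule Alt_zero_of_span[OF cow_Alt])
            show "bt j : span (set ws)" using tn_dual_tangent[OF tnf bi l(2) j(1)] less.prems(5) by blast
            show "bt j ~= 0" using bi jN unfolding biorth_def by fastforce
            fix us assume "bt j : set us"
            thus "cow (bvecs ?b sg) us = 0"
            proof (rule cow_zero_orthogonal)
              fix u assume "u : set (bvecs ?b sg)"
              then obtain i' where "i' : sg" "u = ?b i'" using Sig_finite[OF sg] by auto
              thus "u \<bullet> bt j = 0" using bi jN j(2) Sig_subset[OF sg] unfolding biorth_def by auto
            qed
          qed
          thus ?thesis by simp
        qed
      qed
      finally show ?thesis .
    qed
    have "nk = (SUM i:{l + 1..?n}. (nk \<bullet> bt i) *\<^sub>R ?b i)" by (rule tn_normal_expand[OF tnf bi l(2) less.prems(4)])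
    from arg_cong[OF this, of "%z. z \<bullet> vf (d x) ws"]
    have "nk \<bullet> vf (d x) ws = (SUM i:{l + 1..?n}. (nk \<bullet> bt i) * (?b i \<bullet> vf (d x) ws))" by (simp only: inner_sum_left inner_scaleR_left)
    thus ?thesis by (simp add: comp)
  qed
qed

text \<open>In low dimension the rows of the trace fall into two kinds. Those containing {1..l}
  concern the normal block, whose vanishing does not depend on F; the others are free rows and
  tested by (c) on F itself. The pairing of (d) is applied at the end, for each row of the standard
  basis separately.\<close>

lemma trace_vanishes:
  fixes d :: "'n::{finite,linorder} rvec => 'n rvec dform"
  assumes F: "int (CARD('n) - 1) simplex F" and n: "CARD('n) >= 3" and k: "1 <= k" "k <= CARD('n) - 2" and r: "r >= k + 1"
    and d1: "!!a. (%x. d x a) : Poly (int r) F" and d2: "!!x. x : F ==> d x : XX k"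
    and tn: "!!l f. l <= CARD('n) - 1 ==> f : Delta l F ==> tn_basis l f (tn f)"
    and dual: "!!l f. l <= CARD('n) - 1 ==> f : Delta l F ==> dual_basis (%i. covec (tn f i)) (dyh f)"
    and nk: "unit_normal F nk"
    and va: "!!v. v : verts F ==> d v = (%_. 0)"
    and vb: "!!l f et. l : {1..k - 1} ==> f : Delta l F ==> et : test_b r k l f (dyh f) ==> dform_pair k f d et = 0"
    and vc: "!!l f et. l : {1..k - 1} ==> f : Delta l F ==> et : test_c r k l f (dyh f) ==>
      form_pair k f (tr_div k F nk d) et = 0"
    and vd: "!!et. et : test_d r k F ==> form_pair k F (tr_div k F nk d) et = 0"
    and x: "x : F"
  shows "nk \<bullet> vf (d x) ws = 0"
proof -
  let ?n = "CARD('n)"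
  have kn: "k <= ?n" and r1: "r >= 1" using k n r by auto
  have dA: "d x : Alt2 k (?n - 1)" if "x : F" for x using XX_Alt2[OF d2[OF that]] .
  have low: "nk \<bullet> vf (d x) ws = 0" if "l <= k - 1" "f : Delta l F" "x : f" for l f x ws using that
  proof (induction l arbitrary: f x ws rule: less_induct)
    case (less l)
    note f = less.prems(2) and x = less.prems(3)
    show ?case
    proof (cases "l = 0")
      case True
      hence "x : verts F" using Delta_0_vertex[OF F] f x by blast
      thus ?thesis using va by (simp add: vf_zero)
    next
      case l0: False
      have fs: "int l simplex f" by (rule Delta_simplex[OF f])
      have fF: "f <= F" by (rule Delta_subset[OF f])
      have xF: "x : F" using x fF by blast
      have l: "l <= ?n - 1" "l <= ?n" "l < k" "l : {1..k - 1}" using less.prems(1) k l0 by auto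
      note tnf = tn[OF l(1) f]
      obtain bt where bi: "biorth (tn f) bt" and dyh: "!!i. i : {1..?n} ==> dyh f i = covec (bt i)" by (rule dual_basis_biorth[OF dual[OF l(1) f]]) (rule that)
      have comp: "nk \<bullet> vf (d x) (bvecs bt sg) = 0" if sg: "sg : Sig ?n k" for sg
      proof (cases "{1..l} <= sg")
        case True
        show ?thesis
        proof (rule normal_block_vanishes[OF F k(1) kn r1 d1 d2 tn dual va vb less.prems])
          show "nk \<bullet> t = 0" if "t : tangent_space f" for t using nk tangent_space_mono[OF fF] that by (auto simp: unit_normal_def)
          show "tangent_space f <= span (set (bvecs bt sg))" using tn_tangent_span[OF tnf bi l(2)] bvecs_span[OF sg True, of bt] by blast
        qed
      next
        case False
        hence fr: "free_row ?n k l sg" using free_row_iff[OF sg l(3)] by simp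
        show ?thesis
        proof (rule Poly_zero_by_moments[OF fs r1 vf_Poly[OF d1] fF _ _ x])
          show "nk \<bullet> vf (d z) (bvecs bt sg) = 0" if "m' < l" "g : Delta m' f" "z : g" for m' g z
            using less.IH[OF that(1) _ Delta_trans[OF that(2) f] that(3)] that(1) less.prems(1) by simp
          fix q :: "'n rvec => real" assume q: "q : Poly (int r - int (l + 1)) f"
          have "(%x a. q x * wedge_ix (dyh f) sg a) : test_c r k l f (dyh f)"
            unfolding test_c_def by (rule fun_tensor_single[OF _ finite_free_rows q Poly_zero]) (use fr in auto)
          hence "form_pair k f (tr_div k F nk d) (%x a. q x * cow (bvecs bt sg) a) = 0"
            using vc[OF l(4) f] wedge_ix_dual[OF dyh Sig_subset[OF sg]] by simp
          thus "face_integral f (%x. q x * (nk \<bullet> vf (d x) (bvecs bt sg))) = 0" using form_pair_tensor[OF dA fF] by simp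
        qed
      qed
      have "nk \<bullet> vf (d x) ws = (SUM sg:Sig ?n k. (nk \<bullet> vf (d x) (bvecs bt sg)) * cow (bvecs (tn f) sg) ws)" by (rule Alt_expand[OF bi vf_Alt[OF dA[OF xF]]])
      thus ?thesis by (simp add: comp)
    qed
  qed
  have unit: "nk \<bullet> vf (d x) (unit_vecs sg) = 0" if sg: "sg : Sig ?n k" for sg
  proof -
    let ?u = "%x. nk \<bullet> vf (d x) (unit_vecs sg)"
    have "?u : Bubble r k F"
    proof (rule Poly_vanishing_Bubble[OF F r1 vf_Poly[OF d1]])
      fix m g y assume "m < k" "g : Delta m F" "y : g"
      thus "?u y = 0" using low[of m g y] by simp
    qed
    hence "?u = (%_. 0)"
    proof (rule Bubble_nondeg[OF F n k(2) r])
      fix w assume w: "w : W1 r k F"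
      have "(%_. 0) : W1 r k F" using W1_subsp[OF F n k(2) r] by (simp add: subsp_def)
      hence "(%x a. w x * wedge_ix dx sg a) : test_d r k F" unfolding test_d_def W1_def[symmetric] by (intro fun_tensor_single sg finite_Sig w)
      hence "form_pair k F (tr_div k F nk d) (%x a. w x * cow (unit_vecs sg) a) = 0" using vd by (simp add: wedge_ix_dx_eq)
      thus "face_integral F (%x. ?u x * w x) = 0" using form_pair_tensor[OF dA order_refl] by (simp add: mult.commute)
    qed
    thus ?thesis by (rule fun_cong)
  qed
  have "nk \<bullet> vf (d x) ws = (SUM sg:Sig ?n k. (nk \<bullet> vf (d x) (bvecs unit_vec sg)) * cow (bvecs unit_vec sg) ws)" by (rule Alt_expand[OF biorth_unit vf_Alt[OF dA[OF x]]])
  thus ?thesis using unit by (simp add: unit_vecs_def)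
qed

section \<open>Linearity of the degrees of freedom\<close>

text \<open>Continuity of all components. The pairings are integrals of finite sums of products of
  components, so this suffices for their linearity.\<close>

definition cfun :: "'a::topological_space set => ('a => 'b => real) => bool" where
  "cfun f et \<longleftrightarrow> (ALL a. continuous_on f (%x. et x a))"

lemma cfun_tensor:
  assumes "et : fun_tensor P I g" "!!p. p : P ==> continuous_on f p"
  shows "cfun f et"
proof -
  obtain p where "!!i. i : I ==> p i : P" "et = (%x a. SUM i:I. p i x * g i a)" using assms(1) unfolding fun_tensor_def by blast
  thus ?thesis using assms(2) by (auto simp: cfun_def intro!: continuous_intros)
qed

lemma dform_inner_continuous:
  "cfun f om ==> cfun f et ==> continuous_on f (%x. dform_inner j m (om x) (et x))"
  unfolding cfun_def dform_inner_def by (auto intro!: continuous_intros)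

lemma form_inner_continuous:
  "cfun f om ==> cfun f et ==> continuous_on f (%x. form_inner j (om x) (et x))" unfolding cfun_def form_inner_def by (auto intro!: continuous_intros)

lemma dform_pair_lin_left:
  assumes "int l simplex f" "cfun f om" "cfun f om'" "cfun f et"
  shows "dform_pair k f (%x a. om x a + c * om' x a) et = dform_pair k f om et + c * dform_pair k f om' et"
proof -
  have "dform_inner j m (%a. om x a + c * om' x a) (et x) = dform_inner j m (om x) (et x) + c * dform_inner j m (om' x) (et x)" for x j m by (simp add: dform_inner_def algebra_simps sum.distrib sum_distrib_left)
  thus ?thesis unfolding dform_pair_def
    using face_integral_lin[OF assms(1) dform_inner_continuous[OF assms(2,4)] dform_inner_continuous[OF assms(3,4)]] by simp
qed

lemma dform_pair_lin_right:
  assumes "int l simplex f" "cfun f om" "cfun f et" "cfun f et'"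
  shows "dform_pair k f om (%x a. et x a + c * et' x a) = dform_pair k f om et + c * dform_pair k f om et'"
proof -
  have "dform_inner j m (om x) (%a. et x a + c * et' x a) = dform_inner j m (om x) (et x) + c * dform_inner j m (om x) (et' x)" for x j m by (simp add: dform_inner_def algebra_simps sum.distrib sum_distrib_left)
  thus ?thesis unfolding dform_pair_def
    using face_integral_lin[OF assms(1) dform_inner_continuous[OF assms(2,3)] dform_inner_continuous[OF assms(2,4)]] by simp
qed

lemma form_pair_lin_left:
  assumes "int l simplex f" "cfun f om" "cfun f om'" "cfun f et"
  shows "form_pair k f (%x a. om x a + c * om' x a) et = form_pair k f om et + c * form_pair k f om' et"
proof -
  have "form_inner j (%a. om x a + c * om' x a) (et x) = form_inner j (om x) (et x) + c * form_inner j (om' x) (et x)" for x j by (simp add: form_inner_def algebra_simps sum.distrib sum_distrib_left)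
  thus ?thesis unfolding form_pair_def
    using face_integral_lin[OF assms(1) form_inner_continuous[OF assms(2,4)] form_inner_continuous[OF assms(3,4)]] by simp
qed

lemma form_pair_lin_right:
  assumes "int l simplex f" "cfun f om" "cfun f et" "cfun f et'"
  shows "form_pair k f om (%x a. et x a + c * et' x a) = form_pair k f om et + c * form_pair k f om et'"
proof -
  have "form_inner j (om x) (%a. et x a + c * et' x a) = form_inner j (om x) (et x) + c * form_inner j (om x) (et' x)" for x j by (simp add: form_inner_def algebra_simps sum.distrib sum_distrib_left)
  thus ?thesis unfolding form_pair_def
    using face_integral_lin[OF assms(1) form_inner_continuous[OF assms(2,3)] form_inner_continuous[OF assms(2,4)]] by simp
qed

lemma dform_pair_cong: "(!!x. x : f ==> om x = om' x) ==> dform_pair k f om et = dform_pair k f om' et"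
  unfolding dform_pair_def by (rule face_integral_cong) simp

lemma form_pair_cong: "(!!x. x : f ==> om x = om' x) ==> form_pair k f om et = form_pair k f om' et"
  unfolding form_pair_def by (rule face_integral_cong) simp

lemma tr_div_lin:
  fixes F :: "'n::{finite,linorder} rvec set"
  shows "tr_div k F nk (%x a. om x a + c * om' x a) = (%x ws. tr_div k F nk om x ws + c * tr_div k F nk om' x ws)"
proof (intro ext)
  fix x :: "'n rvec" and ws :: "'n rvec list"
  have "coef (%a. om x a + c * om' x a) sg i = coef (om x) sg i + c * coef (om' x) sg i" for sg i by (simp add: coef_def algebra_simps)
  thus "tr_div k F nk (%x a. om x a + c * om' x a) x ws = tr_div k F nk om x ws + c * tr_div k F nk om' x ws" by (simp add: tr_div_def algebra_simps sum.distrib sum_distrib_left)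
qed

lemma tr_div_local: "(!!x. x : F ==> x : f ==> om x = om' x) ==> x : f ==> tr_div k F nk om x = tr_div k F nk om' x" by (auto simp: tr_div_def)

lemma tr_div_cfun:
  fixes F :: "'n::{finite,linorder} rvec set"
  assumes "cfun F om" "f <= F"
  shows "cfun f (tr_div k F nk om)" unfolding cfun_def
proof
  fix ws :: "'n::{finite,linorder} rvec list"
  have "continuous_on f (%x. SUM sg:Sig CARD('n) k. (SUM i:{1..CARD('n)}. coef (om x) sg i * (nk \<bullet> unit_vec i)) * wedge_ix dx sg ws)"
    unfolding coef_def using assms(1) continuous_on_subset[OF _ assms(2)] by (auto intro!: continuous_intros simp: cfun_def)
  thus "continuous_on f (%x. tr_div k F nk om x ws)" by (rule continuous_on_eq) (use assms(2) in \<open>auto simp: tr_div_def\<close>)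
qed

lemma fun_tensor_lin:
  assumes P: "subsp P" and "et : fun_tensor P I g" "ze : fun_tensor P I g"
  shows "(%x a. et x a + c * ze x a) : fun_tensor P I g"
proof -
  obtain p q where p: "!!i. i : I ==> p i : P" "et = (%x a. SUM i:I. p i x * g i a)"
    and q: "!!i. i : I ==> q i : P" "ze = (%x a. SUM i:I. q i x * g i a)" using assms(2,3) unfolding fun_tensor_def by blast
  show ?thesis unfolding fun_tensor_def
  proof (intro CollectI exI[of _ "%i x. p i x + c * q i x"] conjI ballI)
    show "(%x. p i x + c * q i x) : P" if "i : I" for i by (rule subspD[OF P p(1)[OF that] q(1)[OF that]])
  qed (simp add: p(2) q(2) algebra_simps sum.distrib sum_distrib_left)
qed

lemma linear_functional_onD:
  assumes P: "subsp P" and L: "linear_functional_on (fun_tensor P I g) L"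
    and "et : fun_tensor P I g" "ze : fun_tensor P I g"
  shows "L (%x a. et x a + c * ze x a) = L et + c * L ze"
proof -
  have "(%x a. 0) : fun_tensor P I g" unfolding fun_tensor_def using P by (intro CollectI exI[of _ "%_ _. 0"]) (auto simp: subsp_def)
  from fun_tensor_lin[OF P this assms(4), of c] have "(%x a. c * ze x a) : fun_tensor P I g" by simp
  thus ?thesis using L assms(3,4) unfolding linear_functional_on_def by metis
qed

lemma linear_functional_onI:
  assumes "!!et ze c. et : S ==> ze : S ==> L (%x a. et x a + c * ze x a) = L et + c * L ze" "(%x a. 0) : S"
  shows "linear_functional_on S L"
proof -
  have z: "L (%x a. 0) = 0" using assms(1)[OF assms(2,2), of "-1"] by simp
  show ?thesis unfolding linear_functional_on_def using assms(1)[of _ _ 1] assms(1)[OF assms(2)] z by simp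
qed

lemma fun_tensor_zero: "subsp P ==> (%x a. 0) : fun_tensor P I g"
  unfolding fun_tensor_def by (intro CollectI exI[of _ "%_ _. 0"]) (auto simp: subsp_def)

lemma functional_single_lin_on:
  assumes P: "subsp P" and I: "finite I" and L: "linear_functional_on (fun_tensor P I g) L" and i: "i : I"
  shows "lin_on P (%p. L (%x a. p x * g i a))" unfolding lin_on_def
proof (intro ballI allI)
  fix u v c assume u: "u : P" and v: "v : P"
  have z: "(%_. 0) : P" using P by (simp add: subsp_def)
  show "L (%x a. (u x + c * v x) * g i a) = L (%x a. u x * g i a) + c * L (%x a. v x * g i a)"
    using linear_functional_onD[OF P L fun_tensor_single[OF i I u z] fun_tensor_single[OF i I v z], of c] by (simp add: algebra_simps)
qed

lemma functional_eq_on_tensor: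
  assumes P: "subsp P" and I: "finite I" and L: "linear_functional_on (fun_tensor P I g) L"
    and M: "linear_functional_on (fun_tensor P I g) M"
    and eq: "!!i p. i : I ==> p : P ==> L (%x a. p x * g i a) = M (%x a. p x * g i a)"
    and et: "et : fun_tensor P I g"
  shows "L et = M et"
proof -
  let ?S = "fun_tensor P I g"
  obtain p where p: "!!i. i : I ==> p i : P" "et = (%x a. SUM i:I. p i x * g i a)" using et unfolding fun_tensor_def by blast
  have z: "(%_. 0) : P" using P by (simp add: subsp_def)
  have "(%x a. SUM i:J. p i x * g i a) : ?S & L (%x a. SUM i:J. p i x * g i a) = M (%x a. SUM i:J. p i x * g i a)"
    if "finite J" "J <= I" for J using that
  proof (induction J rule: finite_induct)
    case empty
    have z0: "(%x a. 0) : ?S" by (rule fun_tensor_zero[OF P])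
    have "L (%x a. 0) = 0" "M (%x a. 0) = 0"
      using linear_functional_onD[OF P L z0 z0, of "-1"] linear_functional_onD[OF P M z0 z0, of "-1"] by simp_all
    thus ?case using z0 by simp
  next
    case (insert j J)
    let ?s = "%x a. SUM i:J. p i x * g i a" and ?t = "%x a. p j x * g j a"
    have IH: "?s : ?S" "L ?s = M ?s" using insert by auto
    have j: "j : I" using insert.prems by simp
    have t: "?t : ?S" by (rule fun_tensor_single[OF j I p(1)[OF j] z])
    have e: "(%x a. SUM i:insert j J. p i x * g i a) = (%x a. ?s x a + 1 * ?t x a)" using insert.hyps by (simp add: add.commute)
    show ?case unfolding e using fun_tensor_lin[OF P IH(1) t, of 1] linear_functional_onD[OF P L IH(1) t, of 1]
        linear_functional_onD[OF P M IH(1) t, of 1] IH(2) eq[OF j p(1)[OF j]] by simp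
  qed
  from this[OF I order_refl] show ?thesis by (simp add: p(2))
qed

lemma linear_functional_diff:
  assumes "linear_functional_on S L" "linear_functional_on S M"
  shows "linear_functional_on S (%et. L et - M et)" using assms unfolding linear_functional_on_def by (auto simp: algebra_simps)

lemma dform_pair_functional:
  assumes "int l simplex f" "cfun f om" and P: "subsp P" and "!!p. p : P ==> continuous_on f p"
  shows "linear_functional_on (fun_tensor P I g) (dform_pair k f om)" by (rule linear_functional_onI, rule dform_pair_lin_right[OF assms(1,2)])
    (use cfun_tensor[of _ P I g f] assms(4) fun_tensor_zero[OF P] in auto)

lemma form_pair_functional:
  assumes "int l simplex f" "cfun f om" and P: "subsp P" and "!!p. p : P ==> continuous_on f p"
  shows "linear_functional_on (fun_tensor P I g) (form_pair k f om)" by (rule linear_functional_onI, rule form_pair_lin_right[OF assms(1,2)])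
    (use cfun_tensor[of _ P I g f] assms(4) fun_tensor_zero[OF P] in auto)

lemma test_b_functional: "int l simplex f ==> cfun f om ==> linear_functional_on (test_b r k m f dyh) (dform_pair k f om)"
  unfolding test_b_def by (rule dform_pair_functional[OF _ _ subsp_Poly Poly_continuous])

lemma test_c_functional: "int l simplex f ==> cfun f ph ==> linear_functional_on (test_c r k m f dyh) (form_pair k f ph)"
  unfolding test_c_def by (rule form_pair_functional[OF _ _ subsp_Poly Poly_continuous])

lemma test_b_cfun: "et : test_b r k m f dyh ==> cfun f et" unfolding test_b_def by (erule cfun_tensor) (rule Poly_continuous)

lemma test_c_cfun: "et : test_c r k m f dyh ==> cfun f et" unfolding test_c_def by (erule cfun_tensor) (rule Poly_continuous)

lemma Delta_facet_iff:
  assumes T: "int m simplex T" and F: "F : Delta l' T"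
  shows "f : Delta l F \<longleftrightarrow> f : Delta l T & f <= F"
proof
  assume "f : Delta l F"
  thus "f : Delta l T & f <= F" using Delta_trans[OF _ F] Delta_subset by blast
next
  assume f: "f : Delta l T & f <= F"
  hence "f face_of F" using F by (auto simp: Delta_def intro: face_of_subset dest: face_of_imp_subset)
  thus "f : Delta l F" using f by (simp add: Delta_def)
qed

lemma PolyX_lin: "om : PolyX r k T ==> et : PolyX r k T ==> (%x a. om x a + c * et x a) : PolyX r k T" by (simp add: PolyX_def Poly_add Poly_scale XX_add XX_scale)

lemma PolyX_zero: "(%x a. 0) : PolyX r k T" by (simp add: PolyX_def Poly_zero XX_zero)

lemma PolyX_sum: "(!!i. i : I ==> om i : PolyX r k T) ==> (%x a. SUM i:I. om i x a) : PolyX r k T" by (simp add: PolyX_def Poly_sum XX_sum)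

lemma PolyX_tensor: "p : Poly (int r) T ==> c : XX k ==> (%x a. p x * c a) : PolyX r k T"
proof -
  assume "p : Poly (int r) T" "c : XX k"
  moreover have "(%x. p x * c a) = (%x. c a * p x)" for a by (simp add: mult.commute)
  ultimately show "(%x a. p x * c a) : PolyX r k T" unfolding PolyX_def by (auto intro: XX_scale Poly_scale)
qed

lemma PolyX_cfun: "om : PolyX r k T ==> f <= T ==> cfun f om" unfolding PolyX_def cfun_def using Poly_continuous continuous_on_subset by blast

lemma PolyX_Alt2: "om : PolyX r k T ==> x : T ==> om x : Alt2 k (CARD('n) - 1)"
  for om :: "'n::{finite,linorder} rvec => 'n rvec dform" by (simp add: PolyX_def XX_Alt2)

lemma PolyX_outside: "om : PolyX r k T ==> x ~: T ==> om x = (%a. 0)" unfolding PolyX_def using Poly_outside by blast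

section \<open>Unisolvence on a simplex\<close>

locale simplex_dofs =
  fixes T :: "'n::{finite,linorder} rvec set" and r k :: nat
    and tn :: "'n rvec set => nat => 'n rvec" and dyh :: "'n rvec set => nat => 'n rvec form"
    and nF :: "'n rvec set => 'n rvec"
  assumes T: "int CARD('n) simplex T" and n3: "CARD('n) >= 3" and k: "1 <= k" "k <= CARD('n) - 2" and r: "r >= k + 1"
    and tn: "!!l f. l <= CARD('n) - 1 ==> f : Delta l T ==> tn_basis l f (tn f)"
    and dual: "!!l f. l <= CARD('n) - 1 ==> f : Delta l T ==> dual_basis (%i. covec (tn f i)) (dyh f)"
    and nF: "!!F. F : Delta (CARD('n) - 1) T ==> unit_normal F (nF F)"
begin

abbreviation "facets \<equiv> Delta (CARD('n) - 1) T"

lemma TD: "int DIM('n rvec) simplex T" using T by simp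

lemma finite_facets: "finite facets" by (rule finite_Delta[OF T])

lemma nF': "F : Delta (DIM('n rvec) - 1) T ==> unit_normal F (nF F)" using nF by simp

lemma normals_dual:
  assumes f: "f : Delta l T"
  obtains z where "!!F F'. F : facets ==> F' : facets ==> f <= F ==> f <= F' ==> nF F' \<bullet> z F = (if F = F' then 1 else 0)"
proof (rule facet_normals_dual[OF TD f nF'], assumption)
  fix z assume "!!F F'. F : Delta (DIM('n rvec) - 1) T ==> F' : Delta (DIM('n rvec) - 1) T ==> f <= F ==> f <= F' ==> nF F' \<bullet> z F = (if F = F' then 1 else 0)"
  thus thesis by (intro that[of z]) simp
qed

lemma trace_from_components:
  assumes f: "f : Delta l T" and l: "l <= CARD('n) - 1" and bi: "biorth (tn f) bt" and F: "F : facets" "f <= F"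
    and y: "!!i. i : {l + 1..CARD('n)} ==> tn f i \<bullet> w = tn f i \<bullet> w'"
  shows "nF F \<bullet> w = nF F \<bullet> w'"
proof -
  have ln: "l <= CARD('n)" using l by simp
  have "nF F \<bullet> t = 0" if "t : tangent_space f" for t using nF[OF F(1)] tangent_space_mono[OF F(2)] that by (auto simp: unit_normal_def)
  hence e: "nF F = (SUM i:{l + 1..CARD('n)}. (nF F \<bullet> bt i) *\<^sub>R tn f i)" by (rule tn_normal_expand[OF tn[OF l f] bi ln])
  have *: "nF F \<bullet> u = (SUM i:{l + 1..CARD('n)}. (nF F \<bullet> bt i) * (tn f i \<bullet> u))" for u
    using arg_cong[OF e, of "%z. z \<bullet> u"] by (simp only: inner_sum_left inner_scaleR_left)
  have "(SUM i:{l + 1..CARD('n)}. (nF F \<bullet> bt i) * (tn f i \<bullet> w)) = (SUM i:{l + 1..CARD('n)}. (nF F \<bullet> bt i) * (tn f i \<bullet> w'))" by (rule sum.cong) (simp_all add: y)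
  thus ?thesis by (simp only: *[of w] *[of w'])
qed

text \<open>A free row has n - l normal components and f lies in n - l facets of T. Thus one test
  per facet, as in (c), controls a free row completely.\<close>

definition bc_ix :: "nat => 'n rvec set => ((nat set \<times> nat) + ('n rvec set \<times> nat set)) set" where
  "bc_ix l f = {(sg, i) : normal_block CARD('n) k l. free_index CARD('n) k sg i} <+>
     ({F : facets. f <= F} \<times> {sg. free_row CARD('n) k l sg})"

definition bc_val :: "'n rvec set => (nat => 'n rvec) => ((nat set \<times> nat) + ('n rvec set \<times> nat set)) => 'n rvec dform => real" where
  "bc_val f bt ka c = (case ka of Inl (sg, i) => tn f i \<bullet> vf c (bvecs bt sg) | Inr (F, sg) => nF F \<bullet> vf c (bvecs bt sg))"

lemma finite_bc_ix: "finite (bc_ix l f)"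
  unfolding bc_ix_def by (intro finite_Plus finite_cartesian_product finite_free_block finite_free_rows finite_subset[OF _ finite_facets]) auto

lemma bc_val_sum:
  "bc_val f bt ka (%a. SUM i:I. p i * c i a) = (SUM i:I. p i * bc_val f bt ka (c i))" by (auto simp: bc_val_def vf_sum vf_scale inner_sum_right split: sum.split prod.split)

text \<open>For a test of (c) at F the normal components of the row are taken from
  \<open>z F\<close>, which pairs to 1 with the normal of F and to 0 with those of the other facets
  through f. Everything prescribed is at \<open>good\<close> indices, so some element of the kernel
  attains it.\<close>

lemma bc_dual:
  assumes f: "f : Delta l T" and l: "l : {1..k - 1}" and bi: "biorth (tn f) bt" and ka: "ka : bc_ix l f"
  shows "EX c:XX k. ALL ka':bc_ix l f. bc_val f bt ka' c = (if ka' = ka then 1 else 0)"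
proof -
  have ln: "l <= CARD('n) - 1" using l k by auto
  obtain z where z: "!!F F'. F : facets ==> F' : facets ==> f <= F ==> f <= F' ==> nF F' \<bullet> z F = (if F = F' then 1 else 0)"
    using normals_dual[OF f] by blast
  define y where "y rh j = (case ka of Inl (sg, i) => if rh = sg & j = i then 1 else 0
     | Inr (F, sg) => if rh = sg then tn f j \<bullet> z F else 0)" for rh j
  obtain c where c: "c : XX k" "!!sg i. sg : Sig CARD('n) k ==> i : {l + 1..CARD('n)} ==> good CARD('n) k l sg i ==>
      tn f i \<bullet> vf c (bvecs bt sg) = y sg i" using XX_prescribed[OF bi k(1)] by metis
  have "bc_val f bt ka' c = (if ka' = ka then 1 else 0)" if ka': "ka' : bc_ix l f" for ka'
  proof (cases ka')
    case (Inl p)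
    obtain sg i where p: "p = (sg, i)" by (cases p)
    hence nb: "(sg, i) : normal_block CARD('n) k l" "free_index CARD('n) k sg i" using ka' Inl by (auto simp: bc_ix_def)
    hence "tn f i \<bullet> vf c (bvecs bt sg) = y sg i" by (intro c(2)) (auto simp: normal_block_def good_def)
    moreover have "y sg i = (if ka' = ka then 1 else 0)" using ka nb Inl p by (auto simp: y_def bc_ix_def normal_block_def split: sum.splits)
    ultimately show ?thesis by (simp add: bc_val_def Inl p)
  next
    case (Inr p)
    obtain F sg where p: "p = (F, sg)" by (cases p)
    hence F: "F : facets" "f <= F" and fr: "free_row CARD('n) k l sg" using ka' Inr by (auto simp: bc_ix_def)
    have sg: "sg : Sig CARD('n) k" using fr by (simp add: free_row_def)
    define w where "w = (case ka of Inl _ => 0 | Inr (F', sg') => if sg = sg' then z F' else 0)"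
    have "nF F \<bullet> vf c (bvecs bt sg) = nF F \<bullet> w"
    proof (rule trace_from_components[OF f ln bi F])
      fix i assume i: "i : {l + 1..CARD('n)}"
      have "tn f i \<bullet> vf c (bvecs bt sg) = y sg i" by (rule c(2)[OF sg i]) (simp add: good_def fr)
      also have "... = tn f i \<bullet> w" using ka fr by (auto simp: y_def w_def bc_ix_def normal_block_def split: sum.splits)
      finally show "tn f i \<bullet> vf c (bvecs bt sg) = tn f i \<bullet> w" .
    qed
    also have "nF F \<bullet> w = (if ka' = ka then 1 else 0)" using ka z F Inr p by (auto simp: w_def bc_ix_def split: sum.splits if_splits)
    finally show ?thesis by (simp add: bc_val_def Inr p)
  qed
  with c(1) show ?thesis by blast
qed

lemma bubble_vanish:
  assumes f: "f : Delta l T" and g: "g : Delta m T" and nsub: "~f <= g" and x: "x : g"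
  shows "(PROD v:verts f. bary T v x) = 0"
proof -
  obtain v where v: "v : verts f" "v ~: verts g" using nsub face_subset_iff[OF T f g] by blast
  hence "bary T v x = 0" using bary_face[OF T g simplex_affine_hull[OF Delta_simplex[OF g] x], of v] Delta_verts[OF T f] by auto
  thus ?thesis using v(1) simplexD(1)[OF Delta_simplex[OF f]] by (intro prod_zero) auto
qed

text \<open>The correction combines the kernel elements dual to the tests at f; the coefficient for
  each test is the bubble of f times the solution of a scalar moment problem. Extended by the
  coordinates of T, the bubble vanishes on every face that does not contain f.\<close>

lemma bc_stage:
  assumes f: "f : Delta l T" and l: "l : {1..k - 1}"
    and Mb: "linear_functional_on (test_b r k l f (dyh f)) Mb"
    and Mc: "!!F. F : facets ==> f <= F ==> linear_functional_on (test_c r k l f (dyh f)) (Mc F)"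
  shows "EX e:PolyX r k T. (ALL m g x. g : Delta m T --> ~f <= g --> x : g --> e x = (%a. 0)) &
    (ALL et:test_b r k l f (dyh f). dform_pair k f e et = Mb et) &
    (ALL F:facets. f <= F --> (ALL et:test_c r k l f (dyh f). form_pair k f (tr_div k F (nF F) e) et = Mc F et))"
proof -
  have ln: "l <= CARD('n) - 1" and lr: "l + 1 <= r" using l k r by auto
  have fs: "int l simplex f" by (rule Delta_simplex[OF f])
  have fT: "f <= T" by (rule Delta_subset[OF f])
  let ?P = "Poly (int r - int (l + 1)) f :: ('n rvec => real) set"
  have s: "int r - int (l + 1) = int (r - (l + 1))" using lr by simp
  obtain bt where bi: "biorth (tn f) bt" and dyhbt: "!!i. i : {1..CARD('n)} ==> dyh f i = covec (bt i)" by (rule dual_basis_biorth[OF dual[OF ln f]]) (rule that)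
  let ?v = "vol (bvecs bt {1..CARD('n)})"
  have v0: "?v ~= 0" by (rule vol_basis_nonzero[OF bi])
  have "ALL ka:bc_ix l f. EX c. c : XX k & (ALL ka':bc_ix l f. bc_val f bt ka' c = (if ka' = ka then 1 else 0))" using bc_dual[OF f l bi] by blast
  from bchoice[OF this] obtain C where C: "!!ka. ka : bc_ix l f ==> C ka : XX k"
    "!!ka ka'. ka : bc_ix l f ==> ka' : bc_ix l f ==> bc_val f bt ka' (C ka) = (if ka' = ka then 1 else 0)" by blast
  let ?gb = "%(sg, i). form_tensor (wedge_ix (dyh f) sg) (star_ix CARD('n) (dyh f) i)" and ?gc = "wedge_ix (dyh f)"
  define L where "L ka p = (case ka of Inl q => Mb (%x a. p x * ?gb q a) / ?v
     | Inr (F, sg) => Mc F (%x a. p x * ?gc sg a))" for ka and p :: "'n rvec => real"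
  have Llin: "lin_on ?P (L ka)" if ka: "ka : bc_ix l f" for ka
  proof (cases ka)
    case (Inl q)
    hence q: "q : {(sg, i) : normal_block CARD('n) k l. free_index CARD('n) k sg i}" using ka by (auto simp: bc_ix_def)
    have "lin_on ?P (%p. Mb (%x a. p x * ?gb q a))" by (rule functional_single_lin_on[OF subsp_Poly finite_free_block Mb[unfolded test_b_def] q])
    thus ?thesis by (simp add: L_def Inl lin_on_def add_divide_distrib)
  next
    case (Inr q)
    then obtain F sg where q: "q = (F, sg)" "F : facets" "f <= F" "sg : {sg. free_row CARD('n) k l sg}" using ka by (cases q) (auto simp: bc_ix_def)
    have "lin_on ?P (%p. Mc F (%x a. p x * ?gc sg a))" by (rule functional_single_lin_on[OF subsp_Poly finite_free_rows Mc[OF q(2,3), unfolded test_c_def] q(4)])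
    thus ?thesis by (simp add: L_def Inr q(1) lin_on_def)
  qed
  let ?bf = "%x. PROD v:verts f. bary f v x" and ?bT = "%x. PROD v:verts f. bary T v x"
  have "ALL ka:bc_ix l f. EX q. q : Poly (int r - int (l + 1)) T &
      (ALL p:?P. face_integral f (%x. ?bf x * q x * p x) = L ka p)"
  proof
    fix ka assume ka: "ka : bc_ix l f"
    obtain q where q: "q : ?P" "!!p. p : ?P ==> face_integral f (%x. ?bf x * q x * p x) = L ka p" using bubble_riesz[OF fs Llin[OF ka]] by blast
    obtain q' where q': "q' : Poly (int r - int (l + 1)) T" "!!x. x : f ==> x : T ==> q' x = q x" using Poly_extend[OF q(1), of T] by blast
    have "face_integral f (%x. ?bf x * q' x * p x) = L ka p" if "p : ?P" for p
      unfolding q(2)[OF that, symmetric] by (rule face_integral_cong) (use q'(2) fT in auto)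
    thus "EX q. q : Poly (int r - int (l + 1)) T &
      (ALL p:?P. face_integral f (%x. ?bf x * q x * p x) = L ka p)" using q'(1) by blast
  qed
  from bchoice[OF this] obtain Q where Q: "!!ka. ka : bc_ix l f ==> Q ka : Poly (int r - int (l + 1)) T"
    "!!ka p. ka : bc_ix l f ==> p : ?P ==> face_integral f (%x. ?bf x * Q ka x * p x) = L ka p" by blast
  define P where "P ka x = (if x : T then ?bT x else 0) * Q ka x" for ka x
  have PP: "P ka : Poly (int r) T" if ka: "ka : bc_ix l f" for ka
  proof -
    have "(%x. (if x : T then ?bT x else 0) * Q ka x) : Poly (int (card (verts f) + (r - (l + 1)))) T" by (rule Poly_mult[OF bubble_prod_Poly[OF T Delta_verts[OF T f]]]) (rule Q(1)[OF ka, unfolded s])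
    moreover have "card (verts f) + (r - (l + 1)) = r" using simplexD(3)[OF fs] lr by simp
    ultimately show ?thesis by (simp add: P_def[abs_def])
  qed
  have bTf: "?bT x = ?bf x" if "x : f" for x by (rule prod.cong) (use bary_face[OF T f simplex_affine_hull[OF fs that]] Delta_verts[OF T f] in auto)
  define e where "e x a = (SUM ka:bc_ix l f. P ka x * C ka a)" for x a
  have eX: "e : PolyX r k T" unfolding e_def by (intro PolyX_sum PolyX_tensor PP C(1))
  have val: "bc_val f bt ka (e x) = ?bf x * Q ka x" if ka: "ka : bc_ix l f" and x: "x : f" for ka x
  proof -
    have "bc_val f bt ka (e x) = (SUM ka':bc_ix l f. P ka' x * bc_val f bt ka (C ka'))" unfolding e_def by (rule bc_val_sum)
    also have "... = (SUM ka':bc_ix l f. if ka' = ka then P ka x else 0)" by (rule sum.cong) (use C(2)[OF _ ka] in auto)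
    also have "... = P ka x" using ka finite_bc_ix by simp
    finally show ?thesis using x fT bTf[OF x] by (auto simp: P_def)
  qed
  have mom: "face_integral f (%x. p x * bc_val f bt ka (e x)) = L ka p" if ka: "ka : bc_ix l f" and p: "p : ?P" for ka p
    unfolding Q(2)[OF ka p, symmetric] by (rule face_integral_cong) (simp add: val[OF ka] mult_ac)
  have eA: "e x : Alt2 k (CARD('n) - 1)" if "x : f" for x using PolyX_Alt2[OF eX] fT that by blast
  have cfe: "cfun f e" by (rule PolyX_cfun[OF eX fT])
  have "dform_pair k f e et = Mb et" if et: "et : test_b r k l f (dyh f)" for et
  proof (rule functional_eq_on_tensor[OF subsp_Poly finite_free_block _ _ _ et[unfolded test_b_def]])
    show "linear_functional_on (fun_tensor ?P {(sg, i) : normal_block CARD('n) k l. free_index CARD('n) k sg i} ?gb) (dform_pair k f e)"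
      using test_b_functional[OF fs cfe] unfolding test_b_def .
    show "linear_functional_on (fun_tensor ?P {(sg, i) : normal_block CARD('n) k l. free_index CARD('n) k sg i} ?gb) Mb"
      using Mb unfolding test_b_def .
    fix q p assume q: "q : {(sg, i) : normal_block CARD('n) k l. free_index CARD('n) k sg i}" and p: "p : ?P"
    obtain sg i where si: "q = (sg, i)" by (cases q)
    have ka: "Inl (sg, i) : bc_ix l f" using q si by (auto simp: bc_ix_def)
    have sg: "sg : Sig CARD('n) k" "i : {1..CARD('n)}" using q si by (auto simp: normal_block_def)
    have "dform_pair k f e (%x a. p x * ?gb q a) = ?v * face_integral f (%x. p x * bc_val f bt (Inl (sg, i)) (e x))"
      using dform_pair_tensor[where d=e and f=f and q=p, OF eA bi dyhbt sg] by (simp add: si bc_val_def)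
    thus "dform_pair k f e (%x a. p x * ?gb q a) = Mb (%x a. p x * ?gb q a)" using mom[OF ka p] v0 by (simp add: L_def si)
  qed
  moreover have "form_pair k f (tr_div k F (nF F) e) et = Mc F et"
    if F: "F : facets" "f <= F" and et: "et : test_c r k l f (dyh f)" for F et
  proof (rule functional_eq_on_tensor[OF subsp_Poly finite_free_rows _ _ _ et[unfolded test_c_def]])
    have FT: "F <= T" by (rule Delta_subset[OF F(1)])
    show "linear_functional_on (fun_tensor ?P {sg. free_row CARD('n) k l sg} ?gc) (form_pair k f (tr_div k F (nF F) e))"
      using test_c_functional[OF fs tr_div_cfun[OF PolyX_cfun[OF eX FT] F(2)]] unfolding test_c_def .
    show "linear_functional_on (fun_tensor ?P {sg. free_row CARD('n) k l sg} ?gc) (Mc F)" using Mc[OF F] unfolding test_c_def .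
    fix sg p assume sg: "sg : {sg. free_row CARD('n) k l sg}" and p: "p : ?P"
    have ka: "Inr (F, sg) : bc_ix l f" using sg F by (auto simp: bc_ix_def)
    have sub: "sg <= {1..CARD('n)}" using sg Sig_subset by (auto simp: free_row_def)
    have wd: "wedge_ix (dyh f) sg = cow (bvecs bt sg)" by (rule wedge_ix_dual[OF _ sub]) (rule dyhbt)
    have eAF: "e x : Alt2 k (CARD('n) - 1)" if "x : F" for x using PolyX_Alt2[OF eX] FT that by blast
    have "form_pair k f (tr_div k F (nF F) e) (%x a. p x * ?gc sg a) =
        face_integral f (%x. p x * bc_val f bt (Inr (F, sg)) (e x))" unfolding wd by (simp add: bc_val_def) (rule form_pair_tensor[OF eAF F(2)])
    thus "form_pair k f (tr_div k F (nF F) e) (%x a. p x * ?gc sg a) = Mc F (%x a. p x * ?gc sg a)" using mom[OF ka p] by (simp add: L_def)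
  qed
  moreover have "e x = (%a. 0)" if "g : Delta m T" "~f <= g" "x : g" for m g x using bubble_vanish[OF f that] by (simp add: e_def P_def fun_eq_iff)
  ultimately show ?thesis using eX by blast
qed

text \<open>A correction at a face of dimension m + 1 vanishes on all faces of dimension at most m
  and on the other faces of dimension m + 1. So the corrections of one stage interfere neither with
  each other nor with what was achieved before.\<close>

lemma bc_existence:
  assumes A: "!!v. v : verts T ==> A v : XX k"
    and Lb: "!!l f. l : {1..k - 1} ==> f : Delta l T ==> linear_functional_on (test_b r k l f (dyh f)) (Lb f)"
    and Lc: "!!F l f. F : facets ==> l : {1..k - 1} ==> f : Delta l F ==> linear_functional_on (test_c r k l f (dyh f)) (Lc F f)"
  shows "m <= k - 1 ==> EX om:PolyX r k T. (ALL v:verts T. om v = A v) &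
    (ALL l:{1..m}. ALL f:Delta l T. (ALL et:test_b r k l f (dyh f). dform_pair k f om et = Lb f et) &
      (ALL F:facets. f <= F --> (ALL et:test_c r k l f (dyh f). form_pair k f (tr_div k F (nF F) om) et = Lc F f et)))"
proof (induction m)
  case 0
  \<comment> \<open>The r-th power of a coordinate is 1 at its vertex and 0 at the others, since r
    is positive.\<close>
  define om where "om x a = (SUM v:verts T. (if x : T then bary T v x ^ r else 0) * A v a)" for x a
  have "om : PolyX r k T" unfolding om_def
  proof (intro PolyX_sum PolyX_tensor A)
    fix v assume "v : verts T"
    thus "(%x. if x : T then bary T v x ^ r else 0) : Poly (int r) T"
      using bary_prod_Poly[OF T, of "{v}" "%_. r"] by (simp only: prod.insert prod.empty finite.emptyI empty_iff not_False_eq_True mult_1_right sum.insert sum.empty) simp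
  qed
  moreover have "om v = A v" if v: "v : verts T" for v
  proof
    fix a
    have vT: "v : T" using v verts_subset[OF T] by blast
    have "om v a = (SUM w:verts T. if w = v then A v a else 0)" unfolding om_def by (rule sum.cong) (use vT bary_vertex[OF T _ v] r in auto)
    thus "om v a = A v a" using v simplexD(1)[OF T] by simp
  qed
  ultimately show ?case by auto
next
  case (Suc m)
  let ?l = "Suc m"
  have l: "?l : {1..k - 1}" and ln: "?l <= CARD('n) - 1" using Suc.prems k by (auto simp: One_nat_def)
  have "m <= k - 1" using Suc.prems by simp
  from Suc.IH[OF this] obtain om where om1: "om : PolyX r k T" and om0: "(ALL v:verts T. om v = A v) &
    (ALL l:{1..m}. ALL f:Delta l T. (ALL et:test_b r k l f (dyh f). dform_pair k f om et = Lb f et) &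
      (ALL F:facets. f <= F --> (ALL et:test_c r k l f (dyh f). form_pair k f (tr_div k F (nF F) om) et = Lc F f et)))" ..
  have om: "om : PolyX r k T" "!!v. v : verts T ==> om v = A v"
    and omb: "!!l f et. l : {1..m} ==> f : Delta l T ==> et : test_b r k l f (dyh f) ==> dform_pair k f om et = Lb f et"
    and omc: "!!l f F et. l : {1..m} ==> f : Delta l T ==> F : facets ==> f <= F ==> et : test_c r k l f (dyh f) ==>
      form_pair k f (tr_div k F (nF F) om) et = Lc F f et" using om1 om0[THEN conjunct1] bspec[OF bspec[OF om0[THEN conjunct2]]] by simp_all
  have cfom: "cfun f om" if "f <= T" for f by (rule PolyX_cfun[OF om(1) that])
  let ?G = "%f e. e : PolyX r k T & (ALL m g x. g : Delta m T --> ~f <= g --> x : g --> e x = (%a. 0)) &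
    (ALL et:test_b r k ?l f (dyh f). dform_pair k f e et = Lb f et - dform_pair k f om et) &
    (ALL F:facets. f <= F --> (ALL et:test_c r k ?l f (dyh f). form_pair k f (tr_div k F (nF F) e) et =
      Lc F f et - form_pair k f (tr_div k F (nF F) om) et))"
  have "ALL f:Delta ?l T. EX e. ?G f e"
  proof
    fix f assume f: "f : Delta ?l T"
    note fs = Delta_simplex[OF f] and fT = Delta_subset[OF f]
    have "EX e:PolyX r k T. (ALL m g x. g : Delta m T --> ~f <= g --> x : g --> e x = (%a. 0)) &
    (ALL et:test_b r k ?l f (dyh f). dform_pair k f e et = Lb f et - dform_pair k f om et) &
    (ALL F:facets. f <= F --> (ALL et:test_c r k ?l f (dyh f). form_pair k f (tr_div k F (nF F) e) et =
      Lc F f et - form_pair k f (tr_div k F (nF F) om) et))"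
    proof (rule bc_stage[OF f l])
      show "linear_functional_on (test_b r k ?l f (dyh f)) (%et. Lb f et - dform_pair k f om et)" by (rule linear_functional_diff[OF Lb[OF l f] test_b_functional[OF fs cfom[OF fT]]])
      fix F assume F: "F : facets" "f <= F"
      have "f : Delta ?l F" using Delta_facet_iff[OF T F(1)] f F(2) by blast
      thus "linear_functional_on (test_c r k ?l f (dyh f)) (%et. Lc F f et - form_pair k f (tr_div k F (nF F) om) et)" by (intro linear_functional_diff Lc[OF F(1) l] test_c_functional[OF fs] tr_div_cfun[OF cfom[OF Delta_subset[OF F(1)]] F(2)])
    qed
    thus "EX e. ?G f e" by (simp only: Bex_def)
  qed
  from bchoice[OF this] obtain E where E0: "ALL f:Delta ?l T. ?G f (E f)" ..
  note E = bspec[OF E0]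
  note EX = conjunct1[OF E] and Ev = conjunct1[OF conjunct2[OF E], rule_format]
    and Eb = bspec[OF conjunct1[OF conjunct2[OF conjunct2[OF E]]]]
    and Ec = conjunct2[OF conjunct2[OF conjunct2[OF E]], rule_format]
  define om' where "om' x a = om x a + 1 * (SUM f:Delta ?l T. E f x a)" for x a
  have finD: "finite (Delta ?l T)" by (rule finite_Delta[OF T])
  have om'X: "om' : PolyX r k T" unfolding om'_def by (rule PolyX_lin[OF om(1) PolyX_sum]) (rule EX)
  have low: "om' x = om x" if g: "g : Delta l' T" "l' <= m" and x: "x : g" for g l' x
  proof
    fix a
    have "E f x a = 0" if f: "f : Delta ?l T" for f
    proof -
      have "~f <= g" using face_subset_iff[OF T f g(1)] card_mono[OF simplexD(1)[OF Delta_simplex[OF g(1)]], of "verts f"]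
          simplexD(3)[OF Delta_simplex[OF f]] simplexD(3)[OF Delta_simplex[OF g(1)]] g(2) by auto
      thus ?thesis using fun_cong[OF Ev[OF f g(1) _ x]] by simp
    qed
    thus "om' x a = om x a" by (simp add: om'_def)
  qed
  have top: "om' x = (%a. om x a + 1 * E g x a)" if g: "g : Delta ?l T" and x: "x : g" for g x
  proof
    fix a
    have "E f x a = 0" if f: "f : Delta ?l T" "f ~= g" for f
    proof -
      have "~f <= g"
      proof
        assume "f <= g"
        hence "verts f <= verts g" using face_subset_iff[OF T f(1) g] by blast
        hence "verts f = verts g" by (rule card_seteq[OF simplexD(1)[OF Delta_simplex[OF g]]])
            (simp add: simplexD(3)[OF Delta_simplex[OF f(1)]] simplexD(3)[OF Delta_simplex[OF g]])
        hence "convex hull (verts f) = convex hull (verts g)" by simp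
        thus False
          using f(2) unfolding simplexD(4)[OF Delta_simplex[OF f(1)], symmetric] simplexD(4)[OF Delta_simplex[OF g], symmetric] by contradiction
      qed
      thus ?thesis using fun_cong[OF Ev[OF f(1) g _ x]] by simp
    qed
    hence "(SUM f:Delta ?l T. E f x a) = E g x a" by (simp add: sum.remove[OF finD g])
    thus "om' x a = om x a + 1 * E g x a" by (simp add: om'_def)
  qed
  show ?case
  proof (intro bexI[OF _ om'X] conjI ballI impI)
    fix v assume v: "v : verts T"
    have "{v} : Delta 0 T" "v : {v}" using Delta_iff[OF T, of "{v}" 0] v by (auto intro!: exI[of _ "{v}"] simp: One_nat_def)
    thus "om' v = A v" using low[of "{v}" 0 v] om(2)[OF v] by simp
  next
    fix l f et assume l': "l : {1..?l}" and f: "f : Delta l T" and et: "et : test_b r k l f (dyh f)"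
    show "dform_pair k f om' et = Lb f et"
    proof (cases "l = ?l")
      case False
      hence "dform_pair k f om' et = dform_pair k f om et" using l' by (intro dform_pair_cong low[OF f]) auto
      thus ?thesis using omb[OF _ f et] False l' by simp
    next
      case True
      have f': "f : Delta ?l T" using f True by simp
      note fs = Delta_simplex[OF f'] and fT = Delta_subset[OF f']
      have Ef: "cfun f (E f)" by (rule PolyX_cfun[OF EX[OF f'] fT])
      have "dform_pair k f om' et = dform_pair k f (%x a. om x a + 1 * E f x a) et" by (rule dform_pair_cong) (rule top[OF f'])
      also have "... = dform_pair k f om et + 1 * dform_pair k f (E f) et" by (rule dform_pair_lin_left[OF fs cfom[OF fT] Ef test_b_cfun[OF et]])
      also have "... = Lb f et" using Eb[OF f' et[unfolded True]] by simp
      finally show ?thesis .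
    qed
  next
    fix l f F et assume l': "l : {1..?l}" and f: "f : Delta l T" and F: "F : facets" "f <= F" and et: "et : test_c r k l f (dyh f)"
    note FT = Delta_subset[OF F(1)]
    show "form_pair k f (tr_div k F (nF F) om') et = Lc F f et"
    proof (cases "l = ?l")
      case False
      have "form_pair k f (tr_div k F (nF F) om') et = form_pair k f (tr_div k F (nF F) om) et" by (rule form_pair_cong, rule tr_div_local[of F f]) (use low[OF f] l' False in auto)
      thus ?thesis using omc[OF _ f F et] False l' by simp
    next
      case True
      have f': "f : Delta ?l T" using f True by simp
      note fs = Delta_simplex[OF f'] and fT = Delta_subset[OF f']
      have EF: "cfun F (E f)" by (rule PolyX_cfun[OF EX[OF f'] FT])
      have "form_pair k f (tr_div k F (nF F) om') et = form_pair k f (tr_div k F (nF F) (%x a. om x a + 1 * E f x a)) et" by (rule form_pair_cong, rule tr_div_local[of F f]) (use top[OF f'] in auto)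
      also have "... = form_pair k f (tr_div k F (nF F) om) et + 1 * form_pair k f (tr_div k F (nF F) (E f)) et"
        unfolding tr_div_lin by (rule form_pair_lin_left[OF fs tr_div_cfun[OF cfom[OF FT] F(2)] tr_div_cfun[OF EF F(2)] test_c_cfun[OF et]])
      also have "... = Lc F f et" using Ec[OF f' F et[unfolded True]] by simp
      finally show ?thesis .
    qed
  qed
qed

end

section \<open>Extension of facet bubbles and comparison of traces\<close>

lemma bubble_Poly_extend:
  assumes T: "int m simplex T" and F: "F : Delta l' T" and f: "f : Delta l F" and p: "p : bubble_Poly F f s"
  shows "EX q:bubble_Poly T f s. ALL x:F. q x = p x"
proof -
  obtain c where c: "!!x. p x = (if x : F then (PROD v:verts f. bary F v x) * bern_sum F (verts f) s c x else 0)"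
    using p unfolding bubble_Poly_alt by blast
  have "bary T v x = bary F v x" if v: "v : verts f" and x: "x : F" for v x
  proof -
    have "v : verts F" using Delta_verts[OF Delta_simplex[OF F] f] v by blast
    moreover from this have "v : verts T" using Delta_verts[OF T F] by blast
    ultimately show ?thesis using bary_face[OF T F simplex_affine_hull[OF Delta_simplex[OF F] x], of v] by simp
  qed
  hence e: "(PROD v:verts f. bary T v x) * bern_sum T (verts f) s c x = p x" if "x : F" for x using that by (simp add: c bern_sum_def cong: prod.cong)
  show ?thesis
  proof (intro bexI ballI)
    show "(%x. if x : T then (PROD v:verts f. bary T v x) * bern_sum T (verts f) s c x else 0) : bubble_Poly T f s" unfolding bubble_Poly_alt by blast
  qed (use e Delta_subset[OF F] in auto)
qed

lemma test_d_functional: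
  fixes F :: "'n::{finite,linorder} rvec set"
  assumes F: "int (CARD('n) - 1) simplex F" and n: "CARD('n) >= 3" and k: "k <= CARD('n) - 2" and r: "r >= k + 1"
    and ph: "cfun F ph"
  shows "linear_functional_on (test_d r k F) (form_pair k F ph)"
  unfolding test_d_def W1_def[symmetric] by (rule form_pair_functional[OF F ph W1_subsp[OF F n k r]]) (rule Poly_continuous, rule W1_Poly[OF F n k r])

lemma test_d_cfun:
  fixes F :: "'n::{finite,linorder} rvec set"
  assumes F: "int (CARD('n) - 1) simplex F" and n: "CARD('n) >= 3" and k: "k <= CARD('n) - 2" and r: "r >= k + 1"
    and et: "et : test_d r k F"
  shows "cfun F et" using et unfolding test_d_def W1_def[symmetric] by (rule cfun_tensor) (rule Poly_continuous, rule W1_Poly[OF F n k r])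

lemma Alt2_unit_expand:
  fixes om :: "'n::{finite,linorder} rvec dform"
  assumes om: "om : Alt2 j m"
  shows "om (us, vs) = (SUM sg:Sig CARD('n) j. SUM rh:Sig CARD('n) m.
    om (unit_vecs sg, unit_vecs rh) * (cow (unit_vecs sg) us * cow (unit_vecs rh) vs))"
proof -
  have "om (us, vs) = (SUM sg:Sig CARD('n) j. om (unit_vecs sg, vs) * cow (unit_vecs sg) us)"
    using Alt_expand[OF biorth_unit Alt2_left[OF om], of us vs] by (simp only: unit_vecs_def)
  also have "... = (SUM sg:Sig CARD('n) j. (SUM rh:Sig CARD('n) m. om (unit_vecs sg, unit_vecs rh) * cow (unit_vecs rh) vs) * cow (unit_vecs sg) us)" by (rule sum.cong[OF refl], subst Alt_expand[OF biorth_unit Alt2_right[OF om]]) (simp only: unit_vecs_def)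
  finally show ?thesis by (simp add: sum_distrib_right sum_distrib_left mult_ac)
qed

lemma PolyX_zero_by_norm:
  fixes T :: "'n::{finite,linorder} rvec set"
  assumes T: "int l simplex T" and om: "om : PolyX r k T" and z: "dform_pair k T om om = 0"
  shows "om = (%x a. 0)"
proof -
  have cf: "cfun T om" by (rule PolyX_cfun[OF om order_refl])
  have "om x (us, vs) = 0" for x us vs
  proof (cases "x : T")
    case True
    have "dform_inner k (CARD('n) - 1) (om x) (om x) = 0" by (rule face_integral_pos_def[OF T dform_inner_continuous[OF cf cf] _ z[unfolded dform_pair_def] True])
        (auto simp: dform_inner_def intro!: sum_nonneg)
    hence "om x (unit_vecs sg, unit_vecs rh) = 0" if "sg : Sig CARD('n) k" "rh : Sig CARD('n) (CARD('n) - 1)" for sg rh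
      using that unfolding dform_inner_def by (subst (asm) sum_nonneg_eq_0_iff) (auto simp: finite_Sig sum_nonneg_eq_0_iff intro!: sum_nonneg)
    thus ?thesis unfolding Alt2_unit_expand[OF PolyX_Alt2[OF om True], of us vs] by (intro sum.neutral ballI) simp
  qed (simp add: PolyX_outside[OF om])
  thus ?thesis by (intro ext) (metis surj_pair)
qed

lemma PolyX_comp: "om : PolyX r k T ==> (%x. om x a) : Poly (int r) T" unfolding PolyX_def by blast

text \<open>With T = T' this serves uniqueness, with two simplices sharing F it serves conformity.
  The two polynomials live on different sets, so their difference is formed on F only.\<close>

lemma trace_agree:
  fixes F T T' :: "'n::{finite,linorder} rvec set"
  assumes F: "int (CARD('n) - 1) simplex F" and n: "CARD('n) >= 3" and k: "1 <= k" "k <= CARD('n) - 2" and r: "r >= k + 1"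
    and FT: "F <= T" "F <= T'" and om: "om : PolyX r k T" and om': "om' : PolyX r k T'"
    and tn: "!!l f. l <= CARD('n) - 1 ==> f : Delta l F ==> tn_basis l f (tn f)"
    and dual: "!!l f. l <= CARD('n) - 1 ==> f : Delta l F ==> dual_basis (%i. covec (tn f i)) (dyh f)"
    and nk: "unit_normal F nk"
    and va: "!!v. v : verts F ==> om v = om' v"
    and vb: "!!l f et. l : {1..k - 1} ==> f : Delta l F ==> et : test_b r k l f (dyh f) ==> dform_pair k f om et = dform_pair k f om' et"
    and vc: "!!l f et. l : {1..k - 1} ==> f : Delta l F ==> et : test_c r k l f (dyh f) ==>
      form_pair k f (tr_div k F nk om) et = form_pair k f (tr_div k F nk om') et"
    and vd: "!!et. et : test_d r k F ==> form_pair k F (tr_div k F nk om) et = form_pair k F (tr_div k F nk om') et"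
    and x: "x : F"
  shows "nk \<bullet> vf (om x) ws = nk \<bullet> vf (om' x) ws"
proof -
  define d where "d x a = (if x : F then om x a + (-1) * om' x a else 0)" for x a
  have d: "d x = (%a. om x a + (-1) * om' x a)" if "x : F" for x using that by (simp add: d_def fun_eq_iff)
  have cf: "cfun f om" "cfun f om'" if "f <= F" for f using PolyX_cfun[OF om, of f] PolyX_cfun[OF om', of f] that FT by auto
  have tr: "tr_div k F nk d x = tr_div k F nk (%x a. om x a + (-1) * om' x a) x" for x
  proof (cases "x : F")
    case True
    thus ?thesis by (intro tr_div_local[of F F]) (use d in auto)
  qed (simp add: tr_div_def fun_eq_iff)
  have trp: "form_pair k f (tr_div k F nk d) et = form_pair k f (tr_div k F nk om) et + (-1) * form_pair k f (tr_div k F nk om') et"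
    if "int l simplex f" "f <= F" "cfun f et" for l f et
  proof -
    have "form_pair k f (tr_div k F nk d) et = form_pair k f (tr_div k F nk (%x a. om x a + (-1) * om' x a)) et" by (rule form_pair_cong) (rule tr)
    also have "... = form_pair k f (tr_div k F nk om) et + (-1) * form_pair k f (tr_div k F nk om') et"
      unfolding tr_div_lin by (rule form_pair_lin_left[OF that(1) tr_div_cfun[OF cf(1)[OF order_refl] that(2)] tr_div_cfun[OF cf(2)[OF order_refl] that(2)] that(3)])
    finally show ?thesis .
  qed
  have "nk \<bullet> vf (d x) ws = 0"
  proof (rule trace_vanishes[OF F n k r _ _ tn dual nk _ _ _ _ x])
    show "(%x. d x a) : Poly (int r) F" for a
    proof -
      have "(%x. if x : F then om x a else 0) : Poly (int r) F" "(%x. if x : F then om' x a else 0) : Poly (int r) F" by (rule Poly_restrict[OF PolyX_comp[OF om] FT(1)], rule Poly_restrict[OF PolyX_comp[OF om'] FT(2)])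
      from Poly_diff[OF this] show ?thesis by (rule back_subst[of "%p. p : Poly (int r) F"]) (simp add: d_def fun_eq_iff)
    qed
    show "d x : XX k" if "x : F" for x unfolding d[OF that] using om om' FT that by (intro XX_add XX_scale) (auto simp: PolyX_def)
    show "d v = (%_. 0)" if "v : verts F" for v using va[OF that] verts_subset[OF F] that by (auto simp: d fun_eq_iff)
    show "dform_pair k f d et = 0" if "l : {1..k - 1}" "f : Delta l F" "et : test_b r k l f (dyh f)" for l f et
    proof -
      note fF = Delta_subset[OF that(2)]
      have "dform_pair k f d et = dform_pair k f (%x a. om x a + (-1) * om' x a) et" by (rule dform_pair_cong) (use d fF in blast)
      also have "... = dform_pair k f om et + (-1) * dform_pair k f om' et" by (rule dform_pair_lin_left[OF Delta_simplex[OF that(2)] cf[OF fF] test_b_cfun[OF that(3)]])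
      finally show ?thesis by (simp add: vb[OF that])
    qed
    show "form_pair k f (tr_div k F nk d) et = 0" if "l : {1..k - 1}" "f : Delta l F" "et : test_c r k l f (dyh f)" for l f et
      using trp[OF Delta_simplex[OF that(2)] Delta_subset[OF that(2)] test_c_cfun[OF that(3)]] vc[OF that] by simp
    show "form_pair k F (tr_div k F nk d) et = 0" if "et : test_d r k F" for et
      using trp[OF F order_refl test_d_cfun[OF F n k(2) r that]] vd[OF that] by simp
  qed
  thus ?thesis unfolding d[OF x] by (simp add: vf_add vf_scale inner_add_right vf_diff inner_diff_right)
qed

lemma Bdiv_lin:
  assumes "om : Bdiv r k nF T" "et : Bdiv r k nF T"
  shows "(%x a. om x a + c * et x a) : Bdiv r k nF T" using assms by (simp add: Bdiv_def PolyX_lin tr_div_lin)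

lemma Bdiv_zero: "(%x a. 0) : Bdiv r k nF T" by (simp add: Bdiv_def PolyX_zero tr_div_def coef_def fun_eq_iff)

context simplex_dofs
begin

text \<open>In dimension at least k every row is free, so the normal components of a kernel element
  at f are arbitrary. Taking them from \<open>z F\<close>, weighted by the values of the form dx_sg,
  gives trace dx_sg on F and 0 on the other facets through f.\<close>

lemma face_ge_dual:
  assumes f: "f : Delta l T" and l: "k <= l" "l <= CARD('n) - 1" and F: "F : facets" "f <= F" and sg: "sg : Sig CARD('n) k"
  shows "EX c:XX k. ALL F':facets. f <= F' -->
    (ALL ws. nF F' \<bullet> vf c ws = (if F' = F then 1 else 0) * cow (unit_vecs sg) ws)"
proof -
  obtain z where z: "!!F F'. F : facets ==> F' : facets ==> f <= F ==> f <= F' ==> nF F' \<bullet> z F = (if F = F' then 1 else 0)"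
    using normals_dual[OF f] by blast
  obtain bt where bi: "biorth (tn f) bt" by (rule dual_basis_biorth[OF dual[OF l(2) f]]) (rule that)
  obtain c where c: "c : XX k" "!!rh i. rh : Sig CARD('n) k ==> i : {l + 1..CARD('n)} ==> good CARD('n) k l rh i ==>
      tn f i \<bullet> vf c (bvecs bt rh) = cow (unit_vecs sg) (bvecs bt rh) * (tn f i \<bullet> z F)" by (rule XX_prescribed[OF bi k(1), of l "%rh i. cow (unit_vecs sg) (bvecs bt rh) * (tn f i \<bullet> z F)"]) (rule that)
  have cA: "cow (unit_vecs sg :: 'n rvec list) : Alt k" using cow_Alt[of "unit_vecs sg :: 'n rvec list"] by (simp add: length_unit_vecs[OF sg])
  have "(%ws. nF F' \<bullet> vf c ws) = (%ws. (if F' = F then 1 else 0) * cow (unit_vecs sg) ws)" if F': "F' : facets" "f <= F'" for F'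
  proof (rule Alt_eqI_basis[OF bi vf_Alt[OF XX_Alt2[OF c(1)]] Alt_scale[OF cA]])
    fix rh assume rh: "rh : Sig CARD('n) k"
    have "nF F' \<bullet> vf c (bvecs bt rh) = nF F' \<bullet> (cow (unit_vecs sg) (bvecs bt rh) *\<^sub>R z F)"
    proof (rule trace_from_components[OF f l(2) bi F'])
      fix i assume i: "i : {l + 1..CARD('n)}"
      have "good CARD('n) k l rh i" unfolding good_def using free_row_all[OF rh l(1) _ k(1)] l(2) by simp
      from c(2)[OF rh i this] show "tn f i \<bullet> vf c (bvecs bt rh) = tn f i \<bullet> (cow (unit_vecs sg) (bvecs bt rh) *\<^sub>R z F)" by simp
    qed
    thus "nF F' \<bullet> vf c (bvecs bt rh) = (if F' = F then 1 else 0) * cow (unit_vecs sg) (bvecs bt rh)" using z[OF F(1) F'(1) F(2) F'(2)] by auto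
  qed
  thus ?thesis using c(1) by (intro bexI[of _ c] ballI impI allI) (rule fun_cong)
qed

text \<open>The solution stays a sum over faces, extended to T face by face, because each summand is
  going to be multiplied by a different element of the kernel.\<close>

lemma face_bubbles_riesz:
  assumes F: "F : facets" and L: "lin_on (W1 r k F) L"
  shows "EX h. (ALL l:{k..CARD('n) - 1}. ALL f:Delta l F. h l f : bubble_Poly T f (int r - int (l + 1))) &
    (ALL w:W1 r k F. face_integral F (%x. (SUM l:{k..CARD('n) - 1}. SUM f:Delta l F. h l f x) * w x) = L w)"
proof -
  note Fs = Delta_simplex[OF F]
  obtain u where u: "u : Bubble r k F" "!!w. w : W1 r k F ==> face_integral F (%x. u x * w x) = L w" by (rule W1_riesz[OF Fs n3 k(2) r L]) (rule that)
  obtain g where g0: "ALL l:{k..DIM('n rvec) - 1}. ALL f:Delta l F. g f : bubble_Poly F f (int r - int (l + 1))"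
    and u0: "u = (%x. SUM l:{k..DIM('n rvec) - 1}. SUM f:Delta l F. g f x)" using u(1) unfolding Bubble_def by blast
  have g: "g f : bubble_Poly F f (int r - int (l + 1))" if "l : {k..CARD('n) - 1}" "f : Delta l F" for l f using g0 that by simp
  have ug: "u = (%x. SUM l:{k..CARD('n) - 1}. SUM f:Delta l F. g f x)" by (simp add: u0)
  define h where "h l f = (SOME q. q : bubble_Poly T f (int r - int (l + 1)) & (ALL x:F. q x = g f x))" for l f
  have h: "h l f : bubble_Poly T f (int r - int (l + 1)) & (ALL x:F. h l f x = g f x)"
    if "l : {k..CARD('n) - 1}" "f : Delta l F" for l f
  proof -
    have "EX q. q : bubble_Poly T f (int r - int (l + 1)) & (ALL x:F. q x = g f x)" using bubble_Poly_extend[OF T F that(2) g[OF that]] by blast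
    thus ?thesis unfolding h_def by (rule someI_ex)
  qed
  have "face_integral F (%x. (SUM l:{k..CARD('n) - 1}. SUM f:Delta l F. h l f x) * w x) = L w" if w: "w : W1 r k F" for w
    unfolding u(2)[OF w, symmetric]
  proof (rule face_integral_cong)
    fix x assume "x : F"
    hence "(SUM l:{k..CARD('n) - 1}. SUM f:Delta l F. h l f x) = u x" unfolding ug using h by (intro sum.cong refl) auto
    thus "(SUM l:{k..CARD('n) - 1}. SUM f:Delta l F. h l f x) * w x = u x * w x" by simp
  qed
  thus ?thesis using h by blast
qed

text \<open>The summand for f and F has a trace on F only: on the other facets through f its kernel
  element has trace 0, and on facets not containing f its bubble is 0. The facets can thus be
  treated independently, and their corrections may be added.\<close>

lemma d_stage:
  assumes Md: "!!F. F : facets ==> linear_functional_on (test_d r k F) (Md F)"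
  shows "EX e:PolyX r k T. (ALL m g x. m < k --> g : Delta m T --> x : g --> e x = (%a. 0)) &
    (ALL F:facets. ALL et:test_d r k F. form_pair k F (tr_div k F (nF F) e) et = Md F et)"
proof -
  let ?K = "{k..CARD('n) - 1}" and ?S = "Sig CARD('n) k"
  note W1' = W1_Poly[OF Delta_simplex n3 k(2) r] W1_subsp[OF Delta_simplex n3 k(2) r]
  let ?L = "%F sg p. Md F (%x a. p x * wedge_ix dx sg a)"
  let ?H = "%F sg h. (ALL l:?K. ALL f:Delta l F. h l f : bubble_Poly T f (int r - int (l + 1))) &
    (ALL w:W1 r k F. face_integral F (%x. (SUM l:?K. SUM f:Delta l F. h l f x) * w x) = ?L F sg w)"
  define h where "h F sg = (SOME h. ?H F sg h)" for F sg
  have h: "?H F sg (h F sg)" if F: "F : facets" and sg: "sg : ?S" for F sg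
  proof -
    have "lin_on (W1 r k F) (?L F sg)" by (rule functional_single_lin_on[OF W1'(2)[OF F] finite_Sig Md[OF F, unfolded test_d_def W1_def[symmetric]] sg])
    from face_bubbles_riesz[OF F this] show ?thesis unfolding h_def by (rule someI_ex)
  qed
  let ?C = "%f F sg c. c : XX k & (ALL F':facets. f <= F' -->
    (ALL ws. nF F' \<bullet> vf c ws = (if F' = F then 1 else 0) * cow (unit_vecs sg) ws))"
  define C where "C f F sg = (SOME c. ?C f F sg c)" for f F sg
  have C: "?C f F sg (C f F sg)" if "f : Delta l T" "l : ?K" "F : facets" "f <= F" "sg : ?S" for l f F sg
  proof -
    have "k <= l" "l <= CARD('n) - 1" using that(2) by auto
    hence "EX c. ?C f F sg c" using face_ge_dual[OF that(1) _ _ that(3-5)] by (simp only: Bex_def)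
    thus ?thesis unfolding C_def by (rule someI_ex)
  qed
  have hb: "h F sg l f : bubble_Poly T f (int r - int (l + 1))" if "f : Delta l T" "l : ?K" "F : facets" "f <= F" "sg : ?S" for F sg l f
  proof -
    have "f : Delta l F" using Delta_facet_iff[OF T that(3)] that(1,4) by blast
    thus ?thesis by (rule bspec[OF bspec[OF conjunct1[OF h[OF that(3,5)]] that(2)]])
  qed
  have hz: "h F sg l f x = 0" if "f : Delta l T" "l : ?K" "F : facets" "f <= F" "sg : ?S"
    and g: "g : Delta m T" "~f <= g" "x : g" for F sg l f m g x using hb[OF that(1-5)] bubble_vanish[OF that(1) g] by (auto simp: bubble_Poly_alt)
  define e where "e x a = (SUM l:?K. SUM f:Delta l T. SUM F:{F : facets. f <= F}. SUM sg:?S. h F sg l f x * C f F sg a)" for x a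
  have eX: "e : PolyX r k T" unfolding e_def
  proof (intro PolyX_sum PolyX_tensor)
    fix l f F sg assume a: "l : ?K" "f : Delta l T" "F : {F : facets. f <= F}" "sg : ?S"
    show "h F sg l f : Poly (int r) T" by (rule bubble_Poly_Poly[OF T a(2) hb[OF a(2,1) _ _ a(4)]]) (use a(3) in auto)
    have F: "F : facets" "f <= F" using a(3) by auto
    show "C f F sg : XX k" by (rule conjunct1[OF C[OF a(2,1) F a(4)]])
  qed
  have ez: "e x = (%a. 0)" if m: "m < k" and g: "g : Delta m T" and x: "x : g" for m g x
  proof
    fix a
    have "h F sg l f x = 0" if a: "l : ?K" "f : Delta l T" "F : {F : facets. f <= F}" "sg : ?S" for l f F sg
    proof (rule hz[OF a(2,1) _ _ a(4) g _ x])
      show "~f <= g" using face_subset_iff[OF T a(2) g] card_mono[OF simplexD(1)[OF Delta_simplex[OF g]], of "verts f"]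
          simplexD(3)[OF Delta_simplex[OF a(2)]] simplexD(3)[OF Delta_simplex[OF g]] a(1) m by auto
    qed (use a(3) in auto)
    thus "e x a = 0" unfolding e_def by (intro sum.neutral ballI) simp
  qed
  define U where "U F sg x = (SUM l:?K. SUM f:Delta l F. h F sg l f x)" for F sg x
  have tre: "nF F0 \<bullet> vf (e x) ws = (SUM sg:?S. U F0 sg x * cow (unit_vecs sg) ws)" if F0: "F0 : facets" and x: "x : F0" for F0 x ws
  proof -
    let ?t = "%l f F sg. h F sg l f x * (nF F0 \<bullet> vf (C f F sg) ws)"
    have "nF F0 \<bullet> vf (e x) ws = (SUM l:?K. SUM f:Delta l T. SUM F:{F : facets. f <= F}. SUM sg:?S. ?t l f F sg)"
      unfolding e_def by (simp add: vf_sum vf_scale inner_sum_right)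
    also have "... = (SUM l:?K. SUM f:Delta l F0. SUM sg:?S. h F0 sg l f x * cow (unit_vecs sg) ws)"
    proof (rule sum.cong[OF refl])
      fix l assume l: "l : ?K"
      have "(SUM f:Delta l T. SUM F:{F : facets. f <= F}. SUM sg:?S. ?t l f F sg) =
          (SUM f:Delta l F0. SUM F:{F : facets. f <= F}. SUM sg:?S. ?t l f F sg)"
      proof (rule sum.mono_neutral_right[OF finite_Delta[OF T]])
        show "Delta l F0 <= Delta l T" using Delta_facet_iff[OF T F0] by blast
        show "ALL f:Delta l T - Delta l F0. (SUM F:{F : facets. f <= F}. SUM sg:?S. ?t l f F sg) = 0"
        proof
          fix f assume f: "f : Delta l T - Delta l F0"
          hence nf: "~f <= F0" using Delta_facet_iff[OF T F0] by blast
          have "h F sg l f x = 0" if "F : {F : facets. f <= F}" "sg : ?S" for F sg by (rule hz[OF _ l _ _ that(2) F0 nf x]) (use f that(1) in auto)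
          thus "(SUM F:{F : facets. f <= F}. SUM sg:?S. ?t l f F sg) = 0" by (intro sum.neutral ballI) simp
        qed
      qed
      also have "... = (SUM f:Delta l F0. SUM sg:?S. h F0 sg l f x * cow (unit_vecs sg) ws)"
      proof (rule sum.cong[OF refl])
        fix f assume "f : Delta l F0"
        hence f: "f : Delta l T" "f <= F0" using Delta_facet_iff[OF T F0] by blast+
        have fin: "finite {F : facets. f <= F}" using finite_facets by simp
        have "(SUM F:{F : facets. f <= F}. SUM sg:?S. ?t l f F sg) =
            (SUM F:{F : facets. f <= F}. if F = F0 then SUM sg:?S. h F0 sg l f x * cow (unit_vecs sg) ws else 0)"
        proof (rule sum.cong[OF refl])
          fix F assume F: "F : {F : facets. f <= F}"
          have "?t l f F sg = (if F = F0 then h F0 sg l f x * cow (unit_vecs sg) ws else 0)" if sg: "sg : ?S" for sg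
          proof -
            have "nF F0 \<bullet> vf (C f F sg) ws = (if F0 = F then 1 else 0) * cow (unit_vecs sg) ws" by (rule mp[OF bspec[OF conjunct2[OF C[OF f(1) l _ _ sg, of F]] F0] f(2), rule_format]) (use F in auto)
            thus ?thesis by simp
          qed
          hence "(SUM sg:?S. ?t l f F sg) = (SUM sg:?S. if F = F0 then h F0 sg l f x * cow (unit_vecs sg) ws else 0)" by (rule sum.cong[OF refl])
          thus "(SUM sg:?S. ?t l f F sg) = (if F = F0 then SUM sg:?S. h F0 sg l f x * cow (unit_vecs sg) ws else 0)" by simp
        qed
        also have "... = (SUM sg:?S. h F0 sg l f x * cow (unit_vecs sg) ws)" using fin F0 f(2) by (subst sum.delta) auto
        finally show "(SUM F:{F : facets. f <= F}. SUM sg:?S. ?t l f F sg) = (SUM sg:?S. h F0 sg l f x * cow (unit_vecs sg) ws)" .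
      qed
      finally show "(SUM f:Delta l T. SUM F:{F : facets. f <= F}. SUM sg:?S. ?t l f F sg) =
        (SUM f:Delta l F0. SUM sg:?S. h F0 sg l f x * cow (unit_vecs sg) ws)" .
    qed
    also have "... = (SUM l:?K. SUM sg:?S. SUM f:Delta l F0. h F0 sg l f x * cow (unit_vecs sg) ws)" by (rule sum.cong[OF refl]) (rule sum.swap)
    also have "... = (SUM sg:?S. U F0 sg x * cow (unit_vecs sg) ws)" unfolding U_def sum_distrib_right by (rule sum.swap)
    finally show ?thesis .
  qed
  have "form_pair k F (tr_div k F (nF F) e) et = Md F et" if F: "F : facets" and et: "et : test_d r k F" for F et
  proof -
    note Fs = Delta_simplex[OF F] and FT = Delta_subset[OF F]
    have eA: "!!x. x : F ==> e x : Alt2 k (CARD('n) - 1)" using PolyX_Alt2[OF eX] FT by blast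
    show ?thesis
    proof (rule functional_eq_on_tensor[OF W1'(2)[OF F] finite_Sig _ _ _ et[unfolded test_d_def W1_def[symmetric]]])
      show "linear_functional_on (fun_tensor (W1 r k F) ?S (wedge_ix dx)) (form_pair k F (tr_div k F (nF F) e))"
        using test_d_functional[OF Fs n3 k(2) r tr_div_cfun[OF PolyX_cfun[OF eX FT] order_refl]] unfolding test_d_def W1_def[symmetric] .
      show "linear_functional_on (fun_tensor (W1 r k F) ?S (wedge_ix dx)) (Md F)" using Md[OF F] unfolding test_d_def W1_def[symmetric] .
      fix sg p assume sg: "sg : ?S" and p: "p : W1 r k F"
      have "form_pair k F (tr_div k F (nF F) e) (%x a. p x * wedge_ix dx sg a) =
          face_integral F (%x. p x * (nF F \<bullet> vf (e x) (unit_vecs sg)))" unfolding wedge_ix_dx_eq by (rule form_pair_tensor[OF eA order_refl])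
      also have "... = face_integral F (%x. U F sg x * p x)"
      proof (rule face_integral_cong)
        fix x assume x: "x : F"
        have "(SUM rh:?S. U F rh x * cow (unit_vecs rh) (unit_vecs sg :: 'n rvec list)) = (SUM rh:?S. if rh = sg then U F sg x else 0)" by (rule sum.cong) (use cow_biorth[OF biorth_unit _ sg] in \<open>auto simp: unit_vecs_def\<close>)
        thus "p x * (nF F \<bullet> vf (e x) (unit_vecs sg)) = U F sg x * p x" unfolding tre[OF F x] using sg by (simp add: finite_Sig)
      qed
      also have "... = ?L F sg p" unfolding U_def by (rule bspec[OF conjunct2[OF h[OF F sg]] p])
      finally show "form_pair k F (tr_div k F (nF F) e) (%x a. p x * wedge_ix dx sg a) = Md F (%x a. p x * wedge_ix dx sg a)" .
    qed
  qed
  thus ?thesis using eX ez by blast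
qed

text \<open>The pairing is the L2 inner product, so nondegeneracy is immediate. The functions with
  form values are uncurried, since \<open>riesz_pairing\<close> expects real functions of one
  argument.\<close>

lemma Bdiv_riesz:
  assumes L: "linear_functional_on (Bdiv r k nF T) L"
  shows "EX e:Bdiv r k nF T. ALL et:Bdiv r k nF T. dform_pair k T e et = L et"
proof -
  let ?B = "Bdiv r k nF T" and ?m = "CARD('n) - 1"
  let ?W = "(%om (x, a). om x a) ` ?B"
  \<comment> \<open>Finitely many generators suffice: monomials on T times products of wedges of the
    unit covectors.\<close>
  let ?I = "degs_le (int r) \<times> Sig CARD('n) k \<times> Sig CARD('n) ?m"
  let ?G = "%(al, sg, rh) (x, us, vs). mono_on T al x * (cow (unit_vecs sg) us * cow (unit_vecs rh) vs)"
  have BX: "om : PolyX r k T" if "om : ?B" for om using that by (simp add: Bdiv_def)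
  have cf: "cfun T om" if "om : ?B" for om by (rule PolyX_cfun[OF BX[OF that] order_refl])
  have Ladd: "L (%x a. et x a + c * ze x a) = L et + c * L ze" if "et : ?B" "ze : ?B" for et ze c
  proof -
    have "(%x a. c * ze x a) : ?B" using Bdiv_lin[OF Bdiv_zero that(2), of c] by simp
    thus ?thesis using L that unfolding linear_functional_on_def by simp
  qed
  have ex: "EX u:?B. ALL w:?W. dform_pair k T u (%x a. w (x, a)) = L (%x a. w (x, a))"
  proof (rule riesz_pairing[where I = ?I and G = ?G and comb = "%u c v x a. u x a + c * v x a"])
    show "finite ?I" by (simp add: finite_Sig finite_degs_le)
    show "subsp ?W" unfolding subsp_def
    proof (intro conjI ballI allI)
      show "(%_. 0) : ?W" by (rule image_eqI[OF _ Bdiv_zero]) (simp add: fun_eq_iff)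
      fix u v c assume "u : ?W" "v : ?W"
      then obtain om et where "om : ?B" "et : ?B" "u = (%(x, a). om x a)" "v = (%(x, a). et x a)" by blast
      thus "(%y. u y + c * v y) : ?W" by (intro image_eqI[OF _ Bdiv_lin[of om _ _ _ _ et c]]) (auto simp: fun_eq_iff)
    qed
    show "EX c. w = (%y. SUM i:?I. c i * ?G i y)" if wW: "w : ?W" for w
    proof -
      obtain om where om: "om : ?B" "w = (%(x, a). om x a)" using wW by blast
      have "ALL q. EX c. (%x. om x (unit_vecs (fst q), unit_vecs (snd q))) = (%y. SUM al:degs_le (int r). c al * mono_on T al y)"
        using BX[OF om(1)] by (auto simp: PolyX_def intro!: Poly_mono_span)
      from choice[OF this] obtain c where c0: "ALL q. (%x. om x (unit_vecs (fst q), unit_vecs (snd q))) = (%y. SUM al:degs_le (int r). c q al * mono_on T al y)" ..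
      have c: "om x (unit_vecs (fst q), unit_vecs (snd q)) = (SUM al:degs_le (int r). c q al * mono_on T al x)" for q x by (rule fun_cong[OF spec[OF c0]])
      have "w (x, us, vs) = (SUM i:?I. c (snd i) (fst i) * ?G i (x, us, vs))" for x us vs
      proof -
        have "om x (us, vs) = (SUM sg:Sig CARD('n) k. SUM rh:Sig CARD('n) ?m. om x (unit_vecs sg, unit_vecs rh) * (cow (unit_vecs sg) us * cow (unit_vecs rh) vs))"
        proof (cases "x : T")
          case True
          thus ?thesis by (rule Alt2_unit_expand[OF PolyX_Alt2[OF BX[OF om(1)]]])
        qed (simp add: PolyX_outside[OF BX[OF om(1)]])
        also have "... = (SUM sg:Sig CARD('n) k. SUM rh:Sig CARD('n) ?m. SUM al:degs_le (int r). c (sg, rh) al * ?G (al, sg, rh) (x, us, vs))" by (intro sum.cong refl) (simp only: c[of x "(_, _)", unfolded fst_conv snd_conv] sum_distrib_right prod.case mult.assoc)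
        also have "... = (SUM q:Sig CARD('n) k \<times> Sig CARD('n) ?m. SUM al:degs_le (int r). c q al * ?G (al, q) (x, us, vs))" by (subst sum.cartesian_product) (simp add: case_prod_beta)
        also have "... = (SUM al:degs_le (int r). SUM q:Sig CARD('n) k \<times> Sig CARD('n) ?m. c q al * ?G (al, q) (x, us, vs))" by (rule sum.swap)
        also have "... = (SUM i:?I. c (snd i) (fst i) * ?G i (x, us, vs))" by (subst sum.cartesian_product) (simp add: case_prod_beta)
        finally show ?thesis by (simp add: om(2))
      qed
      hence "w y = (SUM i:?I. c (snd i) (fst i) * ?G i y)" for y by (cases y) blast
      thus ?thesis by (intro exI[of _ "%i. c (snd i) (fst i)"] ext)
    qed
    show "?B ~= {}" using Bdiv_zero by blast
    show "(%x a. u x a + c * v x a) : ?B" if "u : ?B" "v : ?B" for u v c by (rule Bdiv_lin[OF that])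
    show "dform_pair k T (%x a. u x a + c * v x a) (%x a. w (x, a)) =
        dform_pair k T u (%x a. w (x, a)) + c * dform_pair k T v (%x a. w (x, a))" if "u : ?B" "v : ?B" "w : ?W" for u v c w by (rule dform_pair_lin_left[OF T cf[OF that(1)] cf[OF that(2)]]) (use that(3) cf in auto)
    show "lin_on ?W (%w. dform_pair k T u (%x a. w (x, a)))" if "u : ?B" for u unfolding lin_on_def
    proof (intro ballI allI)
      fix v w c assume "v : ?W" "w : ?W"
      thus "dform_pair k T u (%x a. v (x, a) + c * w (x, a)) =
        dform_pair k T u (%x a. v (x, a)) + c * dform_pair k T u (%x a. w (x, a))" by (intro dform_pair_lin_right[OF T cf[OF that]]) (use cf in auto)
    qed
    show "w = (%_. 0)" if w: "w : ?W" and z: "!!u. u : ?B ==> dform_pair k T u (%x a. w (x, a)) = 0" for w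
    proof -
      obtain om where om: "om : ?B" "w = (%(x, a). om x a)" using w by blast
      have "dform_pair k T om om = 0" using z[OF om(1)] by (simp add: om(2))
      from PolyX_zero_by_norm[OF T BX[OF om(1)] this] show ?thesis by (simp add: om(2) fun_eq_iff)
    qed
    show "lin_on ?W (%w. L (%x a. w (x, a)))" unfolding lin_on_def using Ladd by auto
  qed
  then obtain e where e: "e : ?B" "ALL w:?W. dform_pair k T e (%x a. w (x, a)) = L (%x a. w (x, a))" ..
  have "dform_pair k T e et = L et" if "et : ?B" for et using bspec[OF e(2) imageI[OF that]] by simp
  thus ?thesis using e(1) by blast
qed

text \<open>At a point of f the traces on all facets through f vanish, so the vector value is
  tangential to f. Its normal components, the ones in (b), are then 0, and at a vertex no tangential
  vectors are left.\<close>

lemma Bdiv_dofs: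
  assumes e: "e : Bdiv r k nF T"
  shows "v : verts T ==> e v = (%a. 0)"
    and "l : {1..k - 1} ==> f : Delta l T ==> et : test_b r k l f (dyh f) ==> dform_pair k f e et = 0"
    and "F : facets ==> tr_div k F (nF F) e = (%_ _. 0)"
proof -
  have eX: "e : PolyX r k T" using e by (simp add: Bdiv_def)
  show tr: "tr_div k F (nF F) e = (%_ _. 0)" if "F : facets" for F using e that by (simp add: Bdiv_def)
  have tang: "vf (e x) ws : tangent_space f" if f: "f : Delta l T" and x: "x : f" for l f x ws
  proof (rule facet_normals_span[OF TD f nF'])
    fix F assume F: "F : Delta (DIM('n rvec) - 1) T" "f <= F"
    hence F': "F : facets" by simp
    have "tr_div k F (nF F) e x ws = (if x : F then nF F \<bullet> vf (e x) ws else 0)" by (rule tr_div_eq) (use PolyX_Alt2[OF eX] Delta_subset[OF F'] in blast)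
    moreover have "x : F" using x F(2) by blast
    ultimately show "nF F \<bullet> vf (e x) ws = 0" using tr[OF F'] by simp
  qed
  show "e v = (%a. 0)" if v: "v : verts T"
  proof
    fix a
    have vT: "v : T" using v verts_subset[OF T] by blast
    have "{v} : Delta 0 T" using Delta_iff[OF T, of "{v}" 0] v by (auto intro!: exI[of _ "{v}"] simp: One_nat_def)
    hence "vf (e v) ws : tangent_space {v}" for ws by (rule tang) simp
    hence "vf (e v) ws = 0" for ws by (simp add: tangent_space_def)
    thus "e v a = 0" by (intro Alt2_eq_zero[OF PolyX_Alt2[OF eX vT]])
  qed
  show "dform_pair k f e et = 0" if l: "l : {1..k - 1}" and f: "f : Delta l T" and et: "et : test_b r k l f (dyh f)" for l f et
  proof (rule functional_eq_on_tensor[OF subsp_Poly finite_free_block _ _ _ et[unfolded test_b_def]])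
    have ln: "l <= CARD('n) - 1" using l k by auto
    note fs = Delta_simplex[OF f] and fT = Delta_subset[OF f]
    have cfe: "cfun f e" by (rule PolyX_cfun[OF eX fT])
    obtain bt where bi: "biorth (tn f) bt" and dyhbt: "!!i. i : {1..CARD('n)} ==> dyh f i = covec (bt i)" by (rule dual_basis_biorth[OF dual[OF ln f]]) (rule that)
    have eA: "e x : Alt2 k (CARD('n) - 1)" if "x : f" for x using PolyX_Alt2[OF eX] fT that by blast
    let ?gb = "%(sg, i). form_tensor (wedge_ix (dyh f) sg) (star_ix CARD('n) (dyh f) i)"
    let ?I = "{(sg, i) : normal_block CARD('n) k l. free_index CARD('n) k sg i}" and ?P = "Poly (int r - int (l + 1)) f :: ('n rvec => real) set"
    show "linear_functional_on (fun_tensor ?P ?I ?gb) (dform_pair k f e)" using test_b_functional[OF fs cfe] unfolding test_b_def .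
    show "linear_functional_on (fun_tensor ?P ?I ?gb) (%_. 0)" by (simp add: linear_functional_on_def)
    fix q p assume q: "q : ?I" and p: "p : ?P"
    obtain sg i where si: "q = (sg, i)" by (cases q)
    have sg: "sg : Sig CARD('n) k" "i : {1..CARD('n)}" and i: "i : {l + 1..CARD('n)}" using q si by (auto simp: normal_block_def)
    have "face_integral f (%x. p x * (tn f i \<bullet> vf (e x) (bvecs bt sg))) = face_integral f (%x. 0)" by (rule face_integral_cong) (simp add: tn_normal[OF tn[OF ln f] i tang[OF f]])
    thus "dform_pair k f e (%x a. p x * ?gb q a) = 0"
      using dform_pair_tensor[where d=e and f=f and q=p, OF eA bi dyhbt sg] by (simp add: si face_integral_zero)
  qed
qed

section \<open>Existence and uniqueness on one simplex\<close>

definition dofs_eq where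
  "dofs_eq A Lb Lc Ld Le om \<longleftrightarrow> om : PolyX r k T &
          (ALL v:verts T. om v = A v) &
          (ALL l:{1..k - 1}. ALL f:Delta l T. ALL et:test_b r k l f (dyh f).
             dform_pair k f om et = Lb f et) &
          (ALL F:Delta (CARD('n) - 1) T. ALL l:{1..k - 1}. ALL f:Delta l F.
             ALL et:test_c r k l f (dyh f). form_pair k f (tr_div k F (nF F) om) et = Lc F f et) &
          (ALL F:Delta (CARD('n) - 1) T. ALL et:test_d r k F.
             form_pair k F (tr_div k F (nF F) om) et = Ld F et) &
          (ALL et:Bdiv r k nF T. dform_pair k T om et = Le et)"

text \<open>Three parts are added in an order in which none spoils its predecessors: the second
  vanishes on faces of dimension below k, and the third has zero traces and zero values in (a) and
  (b).\<close>

lemma dofs_existence: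
  assumes A: "ALL v:verts T. A v : XX k"
    and Lb: "ALL l:{1..k - 1}. ALL f:Delta l T. linear_functional_on (test_b r k l f (dyh f)) (Lb f)"
    and Lc: "ALL F:facets. ALL l:{1..k - 1}. ALL f:Delta l F. linear_functional_on (test_c r k l f (dyh f)) (Lc F f)"
    and Ld: "ALL F:facets. linear_functional_on (test_d r k F) (Ld F)"
    and Le: "linear_functional_on (Bdiv r k nF T) Le"
  shows "EX om. dofs_eq A Lb Lc Ld Le om"
proof -
  obtain om1 where w1: "om1 : PolyX r k T" and w1A: "ALL v:verts T. om1 v = A v" and w1b: "ALL l:{1..k - 1}. ALL f:Delta l T. (ALL et:test_b r k l f (dyh f). dform_pair k f om1 et = Lb f et) &
      (ALL F:facets. f <= F --> (ALL et:test_c r k l f (dyh f). form_pair k f (tr_div k F (nF F) om1) et = Lc F f et))"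
  proof -
    have "EX om:PolyX r k T. (ALL v:verts T. om v = A v) &
    (ALL l:{1..k - 1}. ALL f:Delta l T. (ALL et:test_b r k l f (dyh f). dform_pair k f om et = Lb f et) &
      (ALL F:facets. f <= F --> (ALL et:test_c r k l f (dyh f). form_pair k f (tr_div k F (nF F) om) et = Lc F f et)))" by (rule bc_existence[OF bspec[OF A] bspec[OF bspec[OF Lb]] bspec[OF bspec[OF bspec[OF Lc]]] order_refl])
    thus thesis using that by (elim bexE conjE)
  qed
  note cf = PolyX_cfun[OF w1]
  obtain e where e: "e : PolyX r k T" and ez: "ALL m g x. m < k --> g : Delta m T --> x : g --> e x = (%a. 0)"
    and ed: "ALL F:facets. ALL et:test_d r k F. form_pair k F (tr_div k F (nF F) e) et = Ld F et - form_pair k F (tr_div k F (nF F) om1) et"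
  proof -
    have "EX e:PolyX r k T. (ALL m g x. m < k --> g : Delta m T --> x : g --> e x = (%a. 0)) &
      (ALL F:facets. ALL et:test_d r k F. form_pair k F (tr_div k F (nF F) e) et = Ld F et - form_pair k F (tr_div k F (nF F) om1) et)"
    proof (rule d_stage)
      fix F assume F: "F : facets"
      show "linear_functional_on (test_d r k F) (%et. Ld F et - form_pair k F (tr_div k F (nF F) om1) et)" by (rule linear_functional_diff[OF bspec[OF Ld F] test_d_functional[OF Delta_simplex[OF F] n3 k(2) r tr_div_cfun[OF cf[OF Delta_subset[OF F]] order_refl]]])
    qed
    thus thesis using that by (elim bexE conjE)
  qed
  define om2 where "om2 x a = om1 x a + 1 * e x a" for x a
  have w2: "om2 : PolyX r k T" unfolding om2_def by (rule PolyX_lin[OF w1 e])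
  have w2low: "om2 x = om1 x" if "m < k" "g : Delta m T" "x : g" for m g x using ez[rule_format, OF that] by (simp add: om2_def fun_eq_iff)
  have w2d: "form_pair k F (tr_div k F (nF F) om2) et = Ld F et" if F: "F : facets" and et: "et : test_d r k F" for F et
  proof -
    note FT = Delta_subset[OF F] and Fs = Delta_simplex[OF F]
    have "form_pair k F (tr_div k F (nF F) om2) et = form_pair k F (tr_div k F (nF F) om1) et + 1 * form_pair k F (tr_div k F (nF F) e) et"
      unfolding om2_def[abs_def] tr_div_lin by (rule form_pair_lin_left[OF Fs tr_div_cfun[OF cf[OF FT] order_refl] tr_div_cfun[OF PolyX_cfun[OF e FT] order_refl] test_d_cfun[OF Fs n3 k(2) r et]])
    thus ?thesis using bspec[OF bspec[OF ed F] et] by simp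
  qed
  have Bcf: "cfun T et" if "et : Bdiv r k nF T" for et using PolyX_cfun[of et r k T T] that by (simp add: Bdiv_def)
  have "linear_functional_on (Bdiv r k nF T) (%et. Le et - dform_pair k T om2 et)"
  proof (rule linear_functional_diff[OF Le linear_functional_onI[OF _ Bdiv_zero]])
    fix et ze c assume "et : Bdiv r k nF T" "ze : Bdiv r k nF T"
    thus "dform_pair k T om2 (%x a. et x a + c * ze x a) = dform_pair k T om2 et + c * dform_pair k T om2 ze" by (intro dform_pair_lin_right[OF T PolyX_cfun[OF w2 order_refl]] Bcf)
  qed
  from Bdiv_riesz[OF this] obtain b where b: "b : Bdiv r k nF T"
    and be: "ALL et:Bdiv r k nF T. dform_pair k T b et = Le et - dform_pair k T om2 et" ..
  have bX: "b : PolyX r k T" using b by (simp add: Bdiv_def)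
  define om where "om x a = om2 x a + 1 * b x a" for x a
  have wX: "om : PolyX r k T" unfolding om_def by (rule PolyX_lin[OF w2 bX])
  have tr: "tr_div k F (nF F) om = tr_div k F (nF F) om2" if "F : facets" for F unfolding om_def[abs_def] tr_div_lin Bdiv_dofs(3)[OF b that] by simp
  have "om v = A v" if v: "v : verts T" for v
  proof -
    have "{v} : Delta 0 T" "v : {v}" using Delta_iff[OF T, of "{v}" 0] v by (auto intro!: exI[of _ "{v}"] simp: One_nat_def)
    hence "om2 v = om1 v" using w2low[of 0 "{v}" v] k by simp
    thus ?thesis using bspec[OF w1A v] Bdiv_dofs(1)[OF b v] by (simp add: om_def[abs_def])
  qed
  moreover have "dform_pair k f om et = Lb f et" if l: "l : {1..k - 1}" and f: "f : Delta l T" and et: "et : test_b r k l f (dyh f)" for l f et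
  proof -
    note fT = Delta_subset[OF f]
    have lk: "l < k" using l k by auto
    have "dform_pair k f om et = dform_pair k f om2 et + 1 * dform_pair k f b et"
      unfolding om_def[abs_def] by (rule dform_pair_lin_left[OF Delta_simplex[OF f] PolyX_cfun[OF w2 fT] PolyX_cfun[OF bX fT] test_b_cfun[OF et]])
    also have "dform_pair k f om2 et = dform_pair k f om1 et" by (rule dform_pair_cong) (rule w2low[OF lk f])
    finally show ?thesis using bspec[OF conjunct1[OF bspec[OF bspec[OF w1b l] f]] et] Bdiv_dofs(2)[OF b l f et] by simp
  qed
  moreover have "form_pair k f (tr_div k F (nF F) om) et = Lc F f et"
    if F: "F : facets" and l: "l : {1..k - 1}" and f: "f : Delta l F" and et: "et : test_c r k l f (dyh f)" for F l f et
  proof -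
    have f': "f : Delta l T" "f <= F" using f Delta_facet_iff[OF T F] by blast+
    have lk: "l < k" using l k by auto
    have "form_pair k f (tr_div k F (nF F) om) et = form_pair k f (tr_div k F (nF F) om1) et"
      unfolding tr[OF F] by (rule form_pair_cong, rule tr_div_local[of F f]) (use w2low[OF lk f'(1)] in auto)
    thus ?thesis using bspec[OF mp[OF bspec[OF conjunct2[OF bspec[OF bspec[OF w1b l] f'(1)]] F] f'(2)] et] by simp
  qed
  moreover have "form_pair k F (tr_div k F (nF F) om) et = Ld F et" if "F : facets" "et : test_d r k F" for F et
    unfolding tr[OF that(1)] by (rule w2d[OF that])
  moreover have "dform_pair k T om et = Le et" if et: "et : Bdiv r k nF T" for et
  proof -
    have "dform_pair k T om et = dform_pair k T om2 et + 1 * dform_pair k T b et"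
      unfolding om_def[abs_def] by (rule dform_pair_lin_left[OF T PolyX_cfun[OF w2 order_refl] PolyX_cfun[OF bX order_refl] Bcf[OF et]])
    thus ?thesis using bspec[OF be et] by simp
  qed
  ultimately have "dofs_eq A Lb Lc Ld Le om" unfolding dofs_eq_def by (intro conjI ballI wX)
  thus ?thesis by (rule exI[of _ om])
qed

text \<open>Equal traces put the difference into \<open>Bdiv\<close>, so it is one of its own tests
  in (e).\<close>

lemma dofs_unique:
  assumes w: "dofs_eq A Lb Lc Ld Le om" and w': "dofs_eq A Lb Lc Ld Le om'"
  shows "om = om'"
proof -
  note W = w[unfolded dofs_eq_def] and W' = w'[unfolded dofs_eq_def]
  have X: "om : PolyX r k T" and X': "om' : PolyX r k T" by (rule conjunct1[OF W], rule conjunct1[OF W'])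
  note A = bspec[OF conjunct1[OF conjunct2[OF W]]] and A' = bspec[OF conjunct1[OF conjunct2[OF W']]]
  note R = conjunct2[OF conjunct2[OF W]] and R' = conjunct2[OF conjunct2[OF W']]
  note b = conjunct1[OF R, rule_format] and b' = conjunct1[OF R', rule_format]
  note c = conjunct1[OF conjunct2[OF R], rule_format] and c' = conjunct1[OF conjunct2[OF R'], rule_format]
  note d = conjunct1[OF conjunct2[OF conjunct2[OF R]], rule_format] and d' = conjunct1[OF conjunct2[OF conjunct2[OF R']], rule_format]
  note e = conjunct2[OF conjunct2[OF conjunct2[OF R]], rule_format] and e' = conjunct2[OF conjunct2[OF conjunct2[OF R']], rule_format]
  have trace: "nF F \<bullet> vf (om x) ws = nF F \<bullet> vf (om' x) ws" if F: "F : facets" and x: "x : F" for F x ws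
  proof (rule trace_agree[where tn = tn and dyh = dyh, OF Delta_simplex[OF F] n3 k r _ _ X X' _ _ nF[OF F] _ _ _ _ x])
    show "F <= T" "F <= T" by (rule Delta_subset[OF F])+
    note tr = Delta_trans[OF _ F]
    show "tn_basis l f (tn f)" if "l <= CARD('n) - 1" "f : Delta l F" for l f by (rule tn[OF that(1) tr[OF that(2)]])
    show "dual_basis (%i. covec (tn f i)) (dyh f)" if "l <= CARD('n) - 1" "f : Delta l F" for l f by (rule dual[OF that(1) tr[OF that(2)]])
    show "om v = om' v" if "v : verts F" for v using A A' Delta_verts[OF T F] that by auto
    show "dform_pair k f om et = dform_pair k f om' et" if "l : {1..k - 1}" "f : Delta l F" "et : test_b r k l f (dyh f)" for l f et
      using b[OF that(1) tr[OF that(2)] that(3)] b'[OF that(1) tr[OF that(2)] that(3)] by simp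
    show "form_pair k f (tr_div k F (nF F) om) et = form_pair k f (tr_div k F (nF F) om') et" if "l : {1..k - 1}" "f : Delta l F" "et : test_c r k l f (dyh f)" for l f et
      using c[OF F that] c'[OF F that] by simp
    show "form_pair k F (tr_div k F (nF F) om) et = form_pair k F (tr_div k F (nF F) om') et" if "et : test_d r k F" for et
      using d[OF F that] d'[OF F that] by simp
  qed
  let ?d = "%x a. om x a + (-1) * om' x a"
  have dX: "?d : PolyX r k T" by (rule PolyX_lin[OF X X'])
  have "?d : Bdiv r k nF T" unfolding Bdiv_def
  proof (intro CollectI conjI dX ballI ext)
    fix F x ws assume F: "F : facets"
    show "tr_div k F (nF F) ?d x ws = 0"
    proof (cases "x : F")
      case True
      hence "x : T" using Delta_subset[OF F] by blast
      have "tr_div k F (nF F) om x ws = (if x : F then nF F \<bullet> vf (om x) ws else 0)" by (rule tr_div_eq) (use PolyX_Alt2[OF X] Delta_subset[OF F] in blast)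
      moreover have "tr_div k F (nF F) om' x ws = (if x : F then nF F \<bullet> vf (om' x) ws else 0)" by (rule tr_div_eq) (use PolyX_Alt2[OF X'] Delta_subset[OF F] in blast)
      ultimately have "tr_div k F (nF F) om x ws = tr_div k F (nF F) om' x ws" using trace[OF F True, of ws] by simp
      thus ?thesis unfolding tr_div_lin by simp
    qed (simp add: tr_div_def)
  qed
  hence "dform_pair k T ?d ?d = 0" using e[of ?d] e'[of ?d]
      dform_pair_lin_left[OF T PolyX_cfun[OF X order_refl] PolyX_cfun[OF X' order_refl] PolyX_cfun[OF dX order_refl], of k "-1"] by simp
  from PolyX_zero_by_norm[OF T dX this] show ?thesis by (simp add: fun_eq_iff)
qed

theorem unisolvence: "unisolvent r k nF dyh T" unfolding unisolvent_def
proof (intro allI impI)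
  fix A :: "'n rvec => 'n rvec dform" and Lb Lc Ld Le
  assume a: "ALL v:verts T. A v : XX k"
    "ALL l:{1..k - 1}. ALL f:Delta l T. linear_functional_on (test_b r k l f (dyh f)) (Lb f)"
    "ALL F:facets. ALL l:{1..k - 1}. ALL f:Delta l F. linear_functional_on (test_c r k l f (dyh f)) (Lc F f)"
    "ALL F:facets. linear_functional_on (test_d r k F) (Ld F)" "linear_functional_on (Bdiv r k nF T) Le"
  have "EX! om. dofs_eq A Lb Lc Ld Le om" by (rule ex_ex1I[OF dofs_existence[OF a]]) (rule dofs_unique)
  thus "EX! om. om : PolyX r k T &
          (ALL v:verts T. om v = A v) &
          (ALL l:{1..k - 1}. ALL f:Delta l T. ALL et:test_b r k l f (dyh f).
             dform_pair k f om et = Lb f et) &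
          (ALL F:Delta (CARD('n) - 1) T. ALL l:{1..k - 1}. ALL f:Delta l F.
             ALL et:test_c r k l f (dyh f). form_pair k f (tr_div k F (nF F) om) et = Lc F f et) &
          (ALL F:Delta (CARD('n) - 1) T. ALL et:test_d r k F.
             form_pair k F (tr_div k F (nF F) om) et = Ld F et) &
          (ALL et:Bdiv r k nF T. dform_pair k T om et = Le et)" unfolding dofs_eq_def .
qed

end

text \<open>Translates by even multiples of ep along \<open>d1\<close> and \<open>d2\<close> are
  disjoint, because they are separated by \<open>p\<close> or by \<open>q\<close>. At least 1 / ep^2
  of them lie in one fixed ball.\<close>

lemma strip_volume:
  fixes E :: "real => 'a::euclidean_space set"
  assumes E: "!!ep. compact (E ep)" and ball: "!!ep. E ep <= cball 0 R"
    and p: "!!ep x. x : E ep ==> 0 <= p \<bullet> x + b & p \<bullet> x + b <= ep" and q: "!!ep x. x : E ep ==> 0 <= q \<bullet> x + c & q \<bullet> x + c <= ep"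
    and d: "p \<bullet> d1 = 1" "p \<bullet> d2 = 0" "q \<bullet> d1 = 0" "q \<bullet> d2 = 1"
  obtains C where "C >= 0" "!!ep. 0 < ep ==> ep <= 1 ==> measure lebesgue (E ep) <= C * ep\<^sup>2"
proof -
  \<comment> \<open>Shifts are at most 4 in each direction, as 2 i ep <= 2 N ep <= 4.\<close>
  define Q where "Q = \<bar>R\<bar> + 4 * norm d1 + 4 * norm d2"
  define C where "C = measure lebesgue (cball (0::'a) Q)"
  have "measure lebesgue (E ep) <= C * ep\<^sup>2" if ep: "0 < ep" "ep <= 1" for ep
  proof -
    define N where "N = nat \<lceil>1 / ep\<rceil>"
    have N: "1 / ep <= real N" "real N <= 1 / ep + 1" unfolding N_def using ep by (auto simp: le_of_int_ceiling of_nat_nat)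
    have Ne: "1 <= real N * ep" "real N * ep <= 2" using N ep by (auto simp: field_simps)
    let ?s = "%(i, j). (2 * real i * ep) *\<^sub>R d1 + (2 * real j * ep) *\<^sub>R d2"
    let ?I = "{..<N} \<times> {..<N}"
    have m: "(+) (?s ij) ` E ep : lmeasurable" for ij using lmeasurable_compact[OF compact_translation[OF E]] .
    have disj: "disjoint_family_on (%ij. (+) (?s ij) ` E ep) ?I" unfolding disjoint_family_on_def
    proof (intro ballI impI)
      fix ij kl :: "nat \<times> nat" assume ne: "ij ~= kl"
      show "(+) (?s ij) ` E ep \<inter> (+) (?s kl) ` E ep = {}"
      proof (rule ccontr)
        assume "(+) (?s ij) ` E ep \<inter> (+) (?s kl) ` E ep ~= {}"
        then obtain x y where xy: "x : E ep" "y : E ep" "?s ij + x = ?s kl + y" by auto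
        obtain i j k l where ij: "ij = (i, j)" "kl = (k, l)" by (cases ij, cases kl)
        have "2 * real i * ep + p \<bullet> x = 2 * real k * ep + p \<bullet> y" "2 * real j * ep + q \<bullet> x = 2 * real l * ep + q \<bullet> y"
          using arg_cong[OF xy(3), of "%z. p \<bullet> z"] arg_cong[OF xy(3), of "%z. q \<bullet> z"] d by (simp_all add: ij inner_add_right)
        hence "\<bar>2 * real i * ep - 2 * real k * ep\<bar> <= ep" "\<bar>2 * real j * ep - 2 * real l * ep\<bar> <= ep"
          using p[OF xy(1)] p[OF xy(2)] q[OF xy(1)] q[OF xy(2)] by linarith+
        moreover have "i = k" if "\<bar>2 * real i * ep - 2 * real k * ep\<bar> <= ep" for i k :: nat
        proof (rule ccontr)
          assume "i ~= k"
          hence "1 <= \<bar>real i - real k\<bar>" by linarith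
          hence "ep * 1 <= ep * \<bar>real i - real k\<bar>" using ep by (intro mult_left_mono) auto
          moreover have "2 * real i * ep - 2 * real k * ep = (2 * ep) * (real i - real k)" by (simp add: algebra_simps)
          hence "\<bar>2 * real i * ep - 2 * real k * ep\<bar> = 2 * (ep * \<bar>real i - real k\<bar>)" using ep by (simp add: abs_mult)
          ultimately show False using that ep by linarith
        qed
        ultimately show False using ne ij by blast
      qed
    qed
    have "real N * real N * measure lebesgue (E ep) = (SUM ij:?I. measure lebesgue ((+) (?s ij) ` E ep))" by (simp add: measure_translation)
    also have "... = measure lebesgue (UN ij:?I. (+) (?s ij) ` E ep)"
    proof (rule measure_finite_Union[symmetric, OF _ _ disj])
      show "(%ij. (+) (?s ij) ` E ep) ` ?I <= sets lebesgue" using fmeasurableD[OF m] by blast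
      show "emeasure lebesgue ((+) (?s ij) ` E ep) ~= \<infinity>" for ij using fmeasurableD2[OF m, of ij] by (simp only: infinity_ennreal_def not_False_eq_True)
    qed simp
    also have "... <= C" unfolding C_def
    proof (rule measure_mono_fmeasurable)
      show "(UN ij:?I. (+) (?s ij) ` E ep) <= cball 0 Q"
      proof
        fix y assume "y : (UN ij:?I. (+) (?s ij) ` E ep)"
        then obtain i j x where ij: "i < N" "j < N" and x: "x : E ep" and y: "y = ?s (i, j) + x" by auto
        have i2: "2 * real i * ep <= 4" if "i < N" for i
        proof -
          have "real i * ep <= real N * ep" using that ep by (intro mult_right_mono) auto
          thus ?thesis using Ne(2) by linarith
        qed
        have "norm y <= norm ((2 * real i * ep) *\<^sub>R d1) + norm ((2 * real j * ep) *\<^sub>R d2) + norm x"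
          unfolding y by (simp only: prod.case) (metis norm_triangle_ineq norm_triangle_mono order_refl)
        also have "... <= 4 * norm d1 + 4 * norm d2 + \<bar>R\<bar>"
        proof (intro add_mono)
          have a: "\<bar>2 * real i * ep\<bar> <= 4" if "i < N" for i using i2[OF that] ep by simp
          show "norm ((2 * real i * ep) *\<^sub>R d1) <= 4 * norm d1" "norm ((2 * real j * ep) *\<^sub>R d2) <= 4 * norm d2"
            unfolding norm_scaleR by (rule mult_right_mono[OF a[OF ij(1)] norm_ge_zero], rule mult_right_mono[OF a[OF ij(2)] norm_ge_zero])
          show "norm x <= \<bar>R\<bar>" using subsetD[OF ball x] by simp
        qed
        finally show "y : cball 0 Q" by (simp add: Q_def)
      qed
      show "(UN ij:?I. (+) (?s ij) ` E ep) : sets lebesgue" using fmeasurableD[OF m] by (intro sets.finite_UN) auto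
      show "cball (0::'a) Q : lmeasurable" by (rule lmeasurable_compact) simp
    qed
    finally have le: "(real N)\<^sup>2 * measure lebesgue (E ep) <= C" by (simp add: power2_eq_square)
    have "1 <= (real N * ep)\<^sup>2" using Ne(1) by (rule one_le_power)
    hence "measure lebesgue (E ep) <= (real N * ep)\<^sup>2 * measure lebesgue (E ep)"
      using mult_right_mono[of 1 "(real N * ep)\<^sup>2" "measure lebesgue (E ep)"] by simp
    also have "... = ((real N)\<^sup>2 * measure lebesgue (E ep)) * ep\<^sup>2" by (simp add: power_mult_distrib mult_ac)
    also have "... <= C * ep\<^sup>2" using le by (intro mult_right_mono) auto
    finally show ?thesis .
  qed
  thus thesis using that[of C] by (simp add: C_def)
qed

section \<open>Cutoff functions on a simplex\<close>

text \<open>A quadratic spline with knots 0, 1/2 and 1, rising from 0 to 1. It is just smooth enough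
  for \<open>C1\<close>, and its derivative is a hat function of height 2.\<close>

definition hstep :: "real => real" where
  "hstep t = 2 * (max 0 t)\<^sup>2 - 4 * (max 0 (t - 1/2))\<^sup>2 + 2 * (max 0 (t - 1))\<^sup>2"

definition hstep' :: "real => real" where
  "hstep' t = 4 * max 0 t - 8 * max 0 (t - 1/2) + 4 * max 0 (t - 1)"

lemma DERIV_pos_square: "((%t. (max 0 t)\<^sup>2) has_real_derivative 2 * max 0 t) (at (t::real))"
proof (cases t "0::real" rule: linorder_cases)
  case less
  have "((%t::real. 0) has_real_derivative 0) (at t)" by simp
  hence "((%t. (max 0 t)\<^sup>2) has_real_derivative 0) (at t)" by (rule has_field_derivative_transform_within_open[of _ _ _ "{..<0}"]) (use less in auto)
  thus ?thesis using less by (simp add: max_def)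
next
  case greater
  have "((%t::real. t\<^sup>2) has_real_derivative 2 * t) (at t)" by (auto intro!: derivative_eq_intros)
  hence "((%t. (max 0 t)\<^sup>2) has_real_derivative 2 * t) (at t)" by (rule has_field_derivative_transform_within_open[of _ _ _ "{0<..}"]) (use greater in auto)
  thus ?thesis using greater by (simp add: max_def)
next
  case equal
  have "((%h. max 0 h) \<longlongrightarrow> max 0 (0::real)) (at 0)" by (intro tendsto_intros)
  hence "((%h. max 0 h) \<longlongrightarrow> (0::real)) (at 0)" by simp
  hence "((%h. (max 0 h)\<^sup>2 / h) \<longlongrightarrow> (0::real)) (at 0)" by (rule Lim_transform_eventually) (auto simp: eventually_at_filter max_def power2_eq_square intro!: always_eventually)
  thus ?thesis using equal by (simp add: DERIV_def)
qed

lemma hstep_DERIV: "(hstep has_real_derivative hstep' t) (at t)"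
proof -
  have s: "((%t. (max 0 (t - c))\<^sup>2) has_real_derivative 2 * max 0 (t - c)) (at t)" for c :: real
  proof -
    have "((%t. t - c) has_real_derivative 1) (at t)" by (auto intro!: derivative_eq_intros)
    from DERIV_chain2[where f = "%t. (max 0 t)\<^sup>2", OF DERIV_pos_square this] show ?thesis by simp
  qed
  have "((%t. 2 * (max 0 (t - 0))\<^sup>2 - 4 * (max 0 (t - 1/2))\<^sup>2 + 2 * (max 0 (t - 1))\<^sup>2) has_real_derivative
      2 * (2 * max 0 (t - 0)) - 4 * (2 * max 0 (t - 1/2)) + 2 * (2 * max 0 (t - 1))) (at t)" by (intro DERIV_add DERIV_diff DERIV_cmult s)
  moreover have "hstep = (%t. 2 * (max 0 (t - 0))\<^sup>2 - 4 * (max 0 (t - 1/2))\<^sup>2 + 2 * (max 0 (t - 1))\<^sup>2)" by (simp add: hstep_def fun_eq_iff)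
  ultimately show ?thesis by (simp add: hstep'_def)
qed

lemma hstep_simps: "t <= 0 ==> hstep t = 0" "t <= 0 ==> hstep' t = 0" "1 <= t ==> hstep t = 1" "1 <= t ==> hstep' t = 0" by (simp_all add: hstep_def hstep'_def max_def) (auto simp: power2_eq_square field_simps)

lemma hstep_bounds: "0 <= hstep t" "hstep t <= 1" "\<bar>hstep' t\<bar> <= 2"
proof -
  show "\<bar>hstep' t\<bar> <= 2" by (auto simp: hstep'_def max_def)
  consider "t <= 0" | "0 < t" "t <= 1/2" | "1/2 < t" "t < 1" | "1 <= t" by linarith
  hence "0 <= hstep t & hstep t <= 1"
  proof cases
    case 2
    hence "hstep t = 2 * t\<^sup>2" by (simp add: hstep_def max_def)
    moreover have "t\<^sup>2 <= (1/2)\<^sup>2" using 2 by (intro power_mono) auto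
    ultimately show ?thesis by (simp add: power2_eq_square)
  next
    case 3
    hence "hstep t = 1 - 2 * (1 - t)\<^sup>2" by (simp add: hstep_def max_def power2_eq_square field_simps)
    moreover have "(1 - t)\<^sup>2 <= (1/2)\<^sup>2" using 3 by (intro power_mono) auto
    ultimately show ?thesis by (simp add: power2_eq_square)
  qed (simp_all add: hstep_simps)
  thus "0 <= hstep t" "hstep t <= 1" by auto
qed

text \<open>The coordinates of a full-dimensional simplex are affine on the whole space; this is
  their constant gradient, with \<open>bary T w 0\<close> as additive constant.\<close>

definition bgrad :: "'a::euclidean_space set => 'a => 'a" where
  "bgrad T w = (SOME a. ALL x. bary T w x = a \<bullet> x + bary T w 0)"

lemma bary_grad:
  fixes T :: "'a::euclidean_space set"
  assumes T: "int DIM('a) simplex T" and w: "w : verts T"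
  shows "bary T w x = bgrad T w \<bullet> x + bary T w 0"
proof -
  obtain a b where ab: "!!x. x : affine hull (verts T) ==> bary T w x = a \<bullet> x + b" by (rule bary_affine[OF T w]) (rule that)
  hence "ALL x. bary T w x = a \<bullet> x + bary T w 0" by (simp add: simplex_affine_UNIV[OF T])
  hence "ALL x. bary T w x = bgrad T w \<bullet> x + bary T w 0" unfolding bgrad_def by (rule someI)
  thus ?thesis ..
qed

definition cut1 :: "'a set => 'a => real => real => real" where
  "cut1 S w ep t = (if w : S then 1 - hstep (t / ep) else hstep (t / ep))"

definition cut1' :: "'a set => 'a => real => real => real" where
  "cut1' S w ep t = (if w : S then - hstep' (t / ep) / ep else hstep' (t / ep) / ep)"

text \<open>The factor of w is 1 on the facet opposite w if w is in S, and 0 there otherwise. So S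
  lists the facets that are close: the empty set gives the interior part, {v} the part at one facet,
  and larger S the parts at faces of codimension at least two.\<close>

definition cut :: "'a::euclidean_space set => 'a set => real => 'a => real" where
  "cut T S ep x = (PROD w:verts T. cut1 S w ep (bary T w x))"

definition dcut :: "'a::euclidean_space set => 'a set => real => 'a => 'a" where
  "dcut T S ep x = (SUM w:verts T. (PROD u:verts T - {w}. cut1 S u ep (bary T u x)) *\<^sub>R (cut1' S w ep (bary T w x) *\<^sub>R bgrad T w))"

lemma cut1_bounds: "0 <= cut1 S w ep t" "cut1 S w ep t <= 1" using hstep_bounds(1,2)[of "t / ep"] by (auto simp: cut1_def)

lemma cut1'_bound: "ep > 0 ==> \<bar>cut1' S w ep t\<bar> <= 2 / ep"
  using hstep_bounds(3)[of "t / ep"] by (auto simp: cut1'_def abs_divide divide_right_mono)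

lemma C1_hstep: "C1 (%x. hstep (a \<bullet> x + b)) (%x. hstep' (a \<bullet> x + b) *\<^sub>R a)" unfolding C1_def
proof (intro conjI allI)
  fix x
  have "((%x. a \<bullet> x + b) has_derivative (%h. a \<bullet> h)) (at x)" by (auto intro!: derivative_eq_intros)
  from has_derivative_compose[OF this hstep_DERIV[unfolded has_field_derivative_def]]
  show "((%x. hstep (a \<bullet> x + b)) has_derivative (\<bullet>) (hstep' (a \<bullet> x + b) *\<^sub>R a)) (at x)" by (rule has_derivative_eq_rhs) (simp add: fun_eq_iff)
next
  show "continuous_on UNIV (%x. hstep' (a \<bullet> x + b) *\<^sub>R a)" unfolding hstep'_def by (intro continuous_intros)
qed

lemma cut_C1:
  fixes T :: "'a::euclidean_space set"
  assumes T: "int DIM('a) simplex T" and ep: "ep > 0"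
  shows "C1 (cut T S ep) (dcut T S ep)" unfolding cut_def[abs_def] dcut_def[abs_def]
proof (rule C1_prod)
  fix w assume w: "w : verts T"
  obtain b where b: "!!x. bary T w x = bgrad T w \<bullet> x + b" using bary_grad[OF T w] by blast
  have s: "bary T w x / ep = (bgrad T w /\<^sub>R ep) \<bullet> x + b / ep" for x by (simp add: b divide_inverse algebra_simps)
  note h = C1_hstep[of "bgrad T w /\<^sub>R ep" "b / ep", folded s]
  show "C1 (%x. cut1 S w ep (bary T w x)) (%x. cut1' S w ep (bary T w x) *\<^sub>R bgrad T w)"
  proof (cases "w : S")
    case True
    have "C1 (%x. 1 + (- 1) * hstep (bary T w x / ep)) (%x. 0 + (- 1) *\<^sub>R (hstep' (bary T w x / ep) *\<^sub>R (bgrad T w /\<^sub>R ep)))"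
      using C1_add_scale[OF C1_affine[of 0 1] h, of "- 1"] by simp
    thus ?thesis using True by (simp add: cut1_def cut1'_def divide_inverse)
  qed (use h in \<open>simp add: cut1_def cut1'_def divide_inverse\<close>)
qed

lemma cut_zero:
  assumes T: "int m simplex T" and w: "w : verts T" and ep: "ep > 0"
    and z: "w ~: S & bary T w x <= 0 | w : S & ep <= bary T w x"
  shows "cut T S ep x = 0" "dcut T S ep x = 0"
proof -
  have "(bary T w x <= 0 --> bary T w x / ep <= 0) & (ep <= bary T w x --> 1 <= bary T w x / ep)" using ep by (simp add: divide_le_0_iff)
  hence c: "cut1 S w ep (bary T w x) = 0" and c': "cut1' S w ep (bary T w x) = 0" using z by (auto simp: cut1_def cut1'_def hstep_simps)
  show "cut T S ep x = 0" unfolding cut_def by (rule prod_zero[OF simplexD(1)[OF T]]) (use w c in blast)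
  have "(PROD u:verts T - {w'}. cut1 S u ep (bary T u x)) *\<^sub>R (cut1' S w' ep (bary T w' x) *\<^sub>R bgrad T w') = 0" for w'
  proof (cases "w' = w")
    case False
    hence "(PROD u:verts T - {w'}. cut1 S u ep (bary T u x)) = 0" using simplexD(1)[OF T] w c by (intro prod_zero) auto
    thus ?thesis by simp
  qed (simp add: c')
  thus "dcut T S ep x = 0" unfolding dcut_def by (intro sum.neutral ballI)
qed

text \<open>The product of (1 - h) + h over the vertices, multiplied out.\<close>

lemma cut_sum:
  assumes T: "int m simplex T"
  shows "(SUM S:Pow (verts T). cut T S ep x) = 1"
proof -
  let ?V = "verts T" and ?h = "%w. hstep (bary T w x / ep)"
  have fin: "finite ?V" by (rule simplexD(1)[OF T])
  have "1 = (PROD w:?V. (1 - ?h w) + ?h w)" by simp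
  also have "... = (SUM S:Pow ?V. (PROD w:S. 1 - ?h w) * (PROD w:?V - S. ?h w))" by (rule prod_add[OF fin])
  also have "... = (SUM S:Pow ?V. cut T S ep x)"
  proof (rule sum.cong[OF refl])
    fix S assume S: "S : Pow ?V"
    have "cut T S ep x = (PROD w:?V - S. cut1 S w ep (bary T w x)) * (PROD w:S. cut1 S w ep (bary T w x))"
      unfolding cut_def by (rule prod.subset_diff) (use S fin in auto)
    thus "(PROD w:S. 1 - ?h w) * (PROD w:?V - S. ?h w) = cut T S ep x" by (simp add: cut1_def mult.commute)
  qed
  finally show ?thesis by simp
qed

lemma cut_bound: "0 <= cut T S ep x" "cut T S ep x <= 1" unfolding cut_def by (auto intro!: prod_nonneg prod_le_1 simp: cut1_bounds)

lemma dcut_bound: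
  assumes "ep > 0"
  shows "norm (dcut T S ep x) <= 2 / ep * (SUM w:verts T. norm (bgrad T w))"
proof -
  have "norm ((PROD u:verts T - {w}. cut1 S u ep (bary T u x)) *\<^sub>R (cut1' S w ep (bary T w x) *\<^sub>R bgrad T w)) <= 2 / ep * norm (bgrad T w)" for w
  proof -
    have "\<bar>PROD u:verts T - {w}. cut1 S u ep (bary T u x)\<bar> <= 1" unfolding abs_prod by (rule prod_le_1) (simp add: cut1_bounds)
    hence "\<bar>PROD u:verts T - {w}. cut1 S u ep (bary T u x)\<bar> * \<bar>cut1' S w ep (bary T w x)\<bar> <= 1 * (2 / ep)" by (intro mult_mono cut1'_bound[OF assms]) auto
    from mult_right_mono[OF this, of "norm (bgrad T w)"] show ?thesis by (simp add: abs_mult mult.assoc)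
  qed
  thus ?thesis unfolding dcut_def sum_distrib_left by (intro sum_norm_le)
qed

text \<open>By the product rule the gradient of \<open>g\<close> times the cutoff, if
  \<open>D\<close> is the gradient of \<open>g\<close>.\<close>

definition gcut :: "('a::euclidean_space => real) => ('a => 'a) => 'a set => 'a set => real => 'a => 'a" where
  "gcut g D T S ep x = g x *\<^sub>R dcut T S ep x + cut T S ep x *\<^sub>R D x"

section \<open>Integrals of derivatives over one simplex and across a facet\<close>

definition TI :: "'a::euclidean_space set => ('a => real) => real" where
  "TI T f = (\<integral>x. indicator T x * f x \<partial>lborel)"

lemma TI_integrable: "compact T ==> continuous_on T f ==> integrable lborel (%x. indicator T x * f x)"
  for f :: "'a::euclidean_space => real" using borel_integrable_compact[of T f] by (simp add: scaleR_conv_of_real)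

lemma TI_add: "compact T ==> continuous_on T f ==> continuous_on T g ==> TI T (%x. f x + g x) = TI T f + TI T g"
  using Bochner_Integration.integral_add[OF TI_integrable TI_integrable, of T f T g] by (simp add: TI_def distrib_left)

lemma TI_sum:
  "compact T ==> (!!i. i : I ==> continuous_on T (f i)) ==> TI T (%x. SUM i:I. f i x) = (SUM i:I. TI T (f i))"
  unfolding TI_def sum_distrib_left by (rule Bochner_Integration.integral_sum) (rule TI_integrable)

lemma TI_cong: "(!!x. x : T ==> f x = g x) ==> TI T f = TI T g"
  unfolding TI_def by (rule Bochner_Integration.integral_cong[OF refl]) (simp add: indicator_def)

text \<open>The last assumption lets a point with nonzero value move a little both ways along d,
  with c = 1 and c = -1. So \<open>g\<close> is 0 at all entry and exit points and the truncated
  integration by parts applies.\<close>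

lemma lborel_ibp:
  fixes F :: "'a::euclidean_space set"
  assumes F: "compact F" "convex F" and g: "C1 g D"
    and stay: "!!x c. x : F ==> g x ~= 0 ==> EX t>0. x + (t * c) *\<^sub>R d : F"
  shows "TI F (%x. D x \<bullet> d) = 0" unfolding TI_def
proof (rule truncated_ibp[OF _ _ _ F g])
  show "distr lborel borel (%x. x + t *\<^sub>R d) = lborel" for t
    using lborel_distr_plus[of "t *\<^sub>R d"] by (simp add: add.commute cong: distr_cong)
  show "emeasure lborel (cball 0 R) < \<infinity>" for R by (rule emeasure_lborel_cball_finite)
  fix x assume x: "x : F"
  show "g x = 0" if "!!t. t > 0 ==> x + t *\<^sub>R d ~: F" using stay[OF x, of 1] that by auto
  show "g x = 0" if "!!t. t > 0 ==> x + t *\<^sub>R - d ~: F" using stay[OF x, of "- 1"] that by auto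
qed simp

lemma not_in_simplex:
  fixes T :: "'a::euclidean_space set"
  assumes T: "int DIM('a) simplex T" and x: "x ~: T"
  obtains w where "w : verts T" "bary T w x < 0" using in_simplex_iff_bary[OF T, of x] x that simplex_affine_UNIV[OF T] by (auto simp: not_le)

locale cutoff =
  fixes T :: "'a::euclidean_space set" and ep :: real
  assumes T: "int DIM('a) simplex T" and ep: "ep > 0"
begin

lemma TC: "compact T" by (rule simplex_compact[OF T])

lemma T_bound: obtains R where "!!x. norm x > R ==> x ~: T"
proof -
  obtain R where "ALL x:T. norm x <= R" using compact_imp_bounded[OF TC] unfolding bounded_iff ..
  thus thesis using that[of R] by (meson not_le)
qed

lemma gcut_C1: "C1 g D ==> C1 (%x. g x * cut T S ep x) (gcut g D T S ep)"
  using C1_mult[OF _ cut_C1[OF T ep], of g D S] by (simp add: gcut_def[abs_def])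

lemma gcut_continuous: "C1 g D ==> continuous_on A (%x. gcut g D T S ep x \<bullet> e)" by (intro continuous_intros C1_continuous(1)[OF gcut_C1])

lemma gcut_zero:
  assumes "w : verts T" "w ~: S & bary T w x <= 0 | w : S & ep <= bary T w x"
  shows "g x * cut T S ep x = 0" "gcut g D T S ep x = 0" using cut_zero[OF T assms(1) ep assms(2)] by (simp_all add: gcut_def)

lemma bgrad_nonzero:
  assumes v: "v : verts T"
  shows "bgrad T v ~= 0"
proof
  assume z: "bgrad T v = 0"
  have "card (verts T) = DIM('a) + 1" by (rule simplexD(3)[OF T])
  hence "verts T ~= {v}" using DIM_positive[where 'a = 'a] by auto
  then obtain w where w: "w : verts T" "w ~= v" using v by blast
  show False using bary_grad[OF T v, of v] bary_grad[OF T v, of w] bary_vertex[OF T v v] bary_vertex[OF T v w(1)] w(2) z by simp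
qed

text \<open>A line in direction e leaves T only through a facet that is not parallel to e, and there
  \<open>G\<close> is 0.\<close>

lemma TI_zero:
  assumes G: "C1 G D" and z: "!!x w. x : T ==> w : verts T ==> bary T w x = 0 ==> bgrad T w \<bullet> e ~= 0 ==> G x = 0"
  shows "TI T (%x. D x \<bullet> e) = 0"
proof (rule lborel_ibp[OF TC simplex_convex[OF T] G])
  fix x assume x: "x : T" and nz: "G x ~= 0"
  have "\<forall>\<^sub>F t in at_right 0. bary T w (x + (t * c) *\<^sub>R e) >= 0" if w: "w : verts T" for w c
  proof -
    obtain b where b: "!!x. bary T w x = bgrad T w \<bullet> x + b" using bary_grad[OF T w] by blast
    have e: "bary T w (x + (t * c) *\<^sub>R e) = bary T w x + (t * c) * (bgrad T w \<bullet> e)" for t by (simp add: b inner_add_right)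
    show ?thesis
    proof (cases "bgrad T w \<bullet> e = 0")
      case False
      hence "bary T w x > 0" using z[OF x w] nz bary_nonneg[OF T x w] by fastforce
      hence p: "bary T w x + (0 * c) * (bgrad T w \<bullet> e) > 0" by simp
      have "((%t. bary T w x + (t * c) * (bgrad T w \<bullet> e)) \<longlongrightarrow> bary T w x + (0 * c) * (bgrad T w \<bullet> e)) (at_right 0)" by (intro tendsto_intros)
      from order_tendstoD(1)[OF this p] show ?thesis unfolding e by eventually_elim simp
    qed (simp add: e bary_nonneg[OF T x w])
  qed
  hence "\<forall>\<^sub>F t in at_right (0::real). ALL w:verts T. bary T w (x + (t * c) *\<^sub>R e) >= 0" for c
    using simplexD(1)[OF T] by (simp add: eventually_ball_finite)
  hence "\<forall>\<^sub>F t in at_right (0::real). x + (t * c) *\<^sub>R e : T & 0 < t" for c by (intro eventually_conj eventually_at_right_less) (simp add: in_simplex_iff_bary[OF T] simplex_affine_UNIV[OF T])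
  from eventually_happens'[OF trivial_limit_at_right_real this] show "EX t>0. x + (t * c) *\<^sub>R e : T" for c by metis
qed

lemma TI_empty:
  assumes g: "C1 g D"
  shows "TI T (%x. gcut g D T {} ep x \<bullet> e) = 0" by (rule TI_zero[OF gcut_C1[OF g]]) (rule gcut_zero(1), auto)

text \<open>A point of this half-space outside T has a negative coordinate at some other vertex,
  where the cutoff is already 0. So the cut-off function extends by 0 from T to the
  half-space.\<close>

lemma halfspace_cut:
  assumes v: "v : verts T" and x: "bary T v x >= 0" "x ~: T"
  shows "g x * cut T {v} ep x = 0" "gcut g D T {v} ep x = 0"
proof -
  obtain w where w: "w : verts T" "bary T w x < 0" by (rule not_in_simplex[OF T x(2)]) (rule that)
  hence "w ~: {v}" using x(1) by auto
  thus "g x * cut T {v} ep x = 0" "gcut g D T {v} ep x = 0" using gcut_zero[OF w(1), of "{v}" x] w(2) by auto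
qed

lemma TI_one_sided:
  assumes v: "v : verts T" and g: "C1 g D"
    and z: "bgrad T v \<bullet> e = 0 | (ALL x:T. bary T v x = 0 --> g x = 0)"
  shows "TI T (%x. gcut g D T {v} ep x \<bullet> e) = 0"
proof (rule TI_zero[OF gcut_C1[OF g]])
  fix x w assume x: "x : T" and w: "w : verts T" "bary T w x = 0" "bgrad T w \<bullet> e ~= 0"
  show "g x * cut T {v} ep x = 0" using z x w gcut_zero(1)[OF w(1), of "{v}" x g] by (cases "w = v") auto
qed

text \<open>The tangential part of each direction integrates to 0, so the normal component of the
  field is all that is left at the facet. It is also all that is known to match on the two
  sides.\<close>

lemma TI_normal:
  assumes v: "v : verts T" and A: "!!i. i : I ==> C1 (A i) (DA i)" and nk: "norm nk = 1"
    and tang: "!!t. t \<bullet> nk = 0 ==> bgrad T v \<bullet> t = 0"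
  shows "(SUM i:I. TI T (%x. gcut (A i) (DA i) T {v} ep x \<bullet> e i)) =
    TI T (%x. gcut (%x. SUM i:I. (e i \<bullet> nk) * A i x) (%x. SUM i:I. (e i \<bullet> nk) *\<^sub>R DA i x) T {v} ep x \<bullet> nk)"
proof -
  have "TI T (%x. gcut (A i) (DA i) T {v} ep x \<bullet> e i) = TI T (%x. (e i \<bullet> nk) * (gcut (A i) (DA i) T {v} ep x \<bullet> nk))" if i: "i : I" for i
  proof -
    define t where "t = e i - (e i \<bullet> nk) *\<^sub>R nk"
    have "nk \<bullet> nk = 1" using nk by (simp add: norm_eq_1)
    hence t: "bgrad T v \<bullet> t = 0" by (intro tang) (simp add: t_def inner_diff_left)
    have "TI T (%x. gcut (A i) (DA i) T {v} ep x \<bullet> e i) =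
        TI T (%x. (e i \<bullet> nk) * (gcut (A i) (DA i) T {v} ep x \<bullet> nk) + gcut (A i) (DA i) T {v} ep x \<bullet> t)" by (rule TI_cong) (simp add: t_def inner_diff_right)
    also have "... = TI T (%x. (e i \<bullet> nk) * (gcut (A i) (DA i) T {v} ep x \<bullet> nk)) + TI T (%x. gcut (A i) (DA i) T {v} ep x \<bullet> t)" by (rule TI_add[OF TC]) (intro continuous_intros gcut_continuous[OF A[OF i]])+
    finally show ?thesis using TI_one_sided[OF v A[OF i], of t] t by simp
  qed
  hence "(SUM i:I. TI T (%x. gcut (A i) (DA i) T {v} ep x \<bullet> e i)) =
      TI T (%x. SUM i:I. (e i \<bullet> nk) * (gcut (A i) (DA i) T {v} ep x \<bullet> nk))" by (subst TI_sum[OF TC]) (auto intro!: continuous_intros gcut_continuous A)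
  also have "... = TI T (%x. gcut (%x. SUM i:I. (e i \<bullet> nk) * A i x) (%x. SUM i:I. (e i \<bullet> nk) *\<^sub>R DA i x) T {v} ep x \<bullet> nk)" by (rule TI_cong) (simp add: gcut_def inner_add_left inner_sum_left sum_distrib_left sum_distrib_right distrib_left sum.distrib mult_ac)
  finally show ?thesis .
qed

text \<open>Gradient of the constant 1, by uniqueness of derivatives.\<close>

lemma dcut_sum: "(SUM S:Pow (verts T). dcut T S ep x) = 0"
proof -
  let ?s = "SUM S:Pow (verts T). dcut T S ep x"
  have "C1 (%x. SUM S:Pow (verts T). 1 * cut T S ep x) (%x. SUM S:Pow (verts T). 1 *\<^sub>R dcut T S ep x)" by (rule C1_sum) (rule cut_C1[OF T ep])
  hence "C1 (%x. 1) (%x. SUM S:Pow (verts T). dcut T S ep x)" by (simp add: cut_sum[OF T])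
  from has_derivative_unique[OF C1_D[OF this] has_derivative_const] have "(%h. ?s \<bullet> h) = (%h. 0)" .
  from fun_cong[OF this, of ?s] show ?thesis by simp
qed

lemma TI_partition:
  assumes g: "C1 g D"
  shows "TI T (%x. D x \<bullet> e) = (SUM S:Pow (verts T). TI T (%x. gcut g D T S ep x \<bullet> e))"
proof -
  have "D x \<bullet> e = (SUM S:Pow (verts T). gcut g D T S ep x \<bullet> e)" for x
  proof -
    have "(SUM S:Pow (verts T). gcut g D T S ep x) = g x *\<^sub>R (SUM S:Pow (verts T). dcut T S ep x) + (SUM S:Pow (verts T). cut T S ep x) *\<^sub>R D x"
      unfolding gcut_def by (simp add: sum.distrib scaleR_sum_right scaleR_sum_left)
    hence "(SUM S:Pow (verts T). gcut g D T S ep x) = D x" by (simp add: dcut_sum cut_sum[OF T])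
    thus ?thesis by (simp flip: inner_sum_left)
  qed
  thus ?thesis by (subst TI_sum[OF TC, symmetric]) (auto intro!: gcut_continuous g)
qed

end

text \<open>The cut-off function of T is continued across the facet to a compactly supported
  \<open>?P\<close>, whose derivative has integral 0 over the space. On the half-space of T' the
  difference of the other cut-off function and \<open>?P\<close> vanishes at the boundary, so its
  derivative has integral 0 as well. Adding the two gives the claim.\<close>

lemma TI_two_sided:
  fixes T T' :: "'a::euclidean_space set"
  assumes c: "cutoff T ep" and c': "cutoff T' ep" and v: "v : verts T" and v': "v' : verts T'"
    and s: "s > 0" and opp: "!!x. bary T' v' x = - s * bary T v x"
    and g: "C1 g D" and g': "C1 g' D'"
    and agree: "!!x. bary T v x = 0 ==> g x * cut T {v} ep x = g' x * cut T' {v'} ep x"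
  shows "TI T (%x. gcut g D T {v} ep x \<bullet> e) + TI T' (%x. gcut g' D' T' {v'} ep x \<bullet> e) = 0"
proof -
  interpret c: cutoff T ep by (rule c)
  interpret c': cutoff T' ep by (rule c')
  obtain b where b: "!!x. bary T v x = bgrad T v \<bullet> x + b" using bary_grad[OF c.T v] by blast
  let ?a = "bgrad T v" and ?e = "%x. e"
  let ?u1 = "%x. g x * cut T {v} ep x" and ?u2 = "%x. g' x * cut T' {v'} ep x"
  let ?D1 = "gcut g D T {v} ep" and ?D2 = "gcut g' D' T' {v'} ep"
  \<comment> \<open>The step has the coordinate of v plus 1 as argument: it is 1 on the side of T
    and 0 where this coordinate is at most -1.\<close>
  let ?P = "%x. hstep (?a \<bullet> x + (b + 1)) * ?u1 x"
  let ?DP = "%x. hstep (?a \<bullet> x + (b + 1)) *\<^sub>R ?D1 x + ?u1 x *\<^sub>R (hstep' (?a \<bullet> x + (b + 1)) *\<^sub>R ?a)"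
  note C1P = C1_mult[OF C1_hstep[of ?a "b + 1"] c.gcut_C1[OF g, of "{v}"]]
  have side: "bary T' v' x >= 0 \<longleftrightarrow> bary T v x <= 0" for x unfolding opp using s by (simp add: mult_le_0_iff zero_le_mult_iff)
  obtain R' where R': "!!x. norm x > R' ==> x ~: T'" by (rule c'.T_bound) (rule that)
  define Q where "Q = (SUM w:verts T. 2 * norm w) + \<bar>R'\<bar>"
  \<comment> \<open>Where \<open>?P\<close> is nonzero the coordinate of v is at least -1 and the
    others are nonnegative. They sum to 1, so all are at most 2 in absolute value.\<close>
  have Q1: "norm x <= Q" if x: "?P x ~= 0 | x : T" for x
  proof -
    have nn: "bary T w x >= 0" if "w : verts T" "w ~= v" for w
      using x c.gcut_zero(1)[OF that(1), of "{v}" x g] bary_nonneg[OF c.T _ that(1), of x] that(2) by force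
    have nv: "bary T v x >= - 1" using x hstep_simps(1)[of "?a \<bullet> x + (b + 1)"] bary_nonneg[OF c.T _ v, of x] by (force simp: b not_le)
    note bp = bary_props[OF c.T, of x, unfolded simplex_affine_UNIV[OF c.T], OF UNIV_I]
    have "\<bar>bary T w x\<bar> <= 2" if w: "w : verts T" for w
    proof (cases "w = v")
      case False
      have "bary T v x + (SUM w:verts T - {v}. bary T w x) = 1" using bp(1) sum.remove[OF simplexD(1)[OF c.T] v, of "%w. bary T w x"] by simp
      moreover have "bary T w x <= (SUM w:verts T - {v}. bary T w x)" by (rule member_le_sum) (use w False nn simplexD(1)[OF c.T] in auto)
      ultimately show ?thesis using nn[OF w False] nv by linarith
    next
      case True
      have "0 <= (SUM w:verts T - {v}. bary T w x)" by (rule sum_nonneg) (use nn in auto)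
      thus ?thesis using True nv bp(1) sum.remove[OF simplexD(1)[OF c.T] v, of "%w. bary T w x"] by simp
    qed
    hence "norm (SUM w:verts T. bary T w x *\<^sub>R w) <= (SUM w:verts T. 2 * norm w)" by (intro sum_norm_le) (simp add: mult_right_mono)
    thus ?thesis unfolding bp(2) Q_def by simp
  qed
  have Q2: "norm x <= Q" if "x : T'" for x
  proof -
    have "norm x <= R'" using R'[of x] that by fastforce
    moreover have "0 <= (SUM w:verts T. 2 * norm w)" by (intro sum_nonneg) simp
    ultimately show ?thesis unfolding Q_def by linarith
  qed
  let ?B = "cball (0::'a) (Q + 1)" and ?N = "{x. ?a \<bullet> x <= - b}"
  \<comment> \<open>The larger radius Q + 1 leaves room for a short move in any direction; the bound
    de keeps the move inside the half-space as well.\<close>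
  have step: "EX t>0. t <= de & x + (t * c) *\<^sub>R e : ?B" if "norm x <= Q" "de > 0" for x c and de :: real
  proof (intro exI conjI)
    let ?t = "min de (1 / (1 + norm (c *\<^sub>R e)))"
    have n: "0 < 1 + norm (c *\<^sub>R e)" by (simp add: add_pos_nonneg)
    show "?t > 0" "?t <= de" using that(2) n by auto
    have "?t * norm (c *\<^sub>R e) <= 1 / (1 + norm (c *\<^sub>R e)) * norm (c *\<^sub>R e)" by (intro mult_right_mono) auto
    also have "... <= 1" using n by (simp add: divide_le_eq)
    finally have "norm ((?t * c) *\<^sub>R e) <= 1" using abs_of_pos[OF \<open>?t > 0\<close>] by (simp only: norm_scaleR abs_mult mult.assoc)
    with that(1) norm_triangle_ineq[of x "(?t * c) *\<^sub>R e"] have "norm (x + (?t * c) *\<^sub>R e) <= Q + 1" by linarith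
    thus "x + (?t * c) *\<^sub>R e : ?B" by (simp only: mem_cball_0)
  qed
  have whole: "TI ?B (%x. ?DP x \<bullet> e) = 0"
  proof (rule lborel_ibp[OF compact_cball convex_cball C1P])
    fix x c assume "?P x ~= 0"
    hence "norm x <= Q" by (intro Q1 disjI1)
    from step[OF this zero_less_one, of c] show "EX t>0. x + (t * c) *\<^sub>R e : ?B" by (elim exE conjE) (intro exI conjI)
  qed
  have half: "TI (?N \<inter> ?B) (%x. (?D2 x + (- 1) *\<^sub>R ?DP x) \<bullet> e) = 0"
  proof (rule lborel_ibp[OF _ _ C1_add_scale[OF c'.gcut_C1[OF g'] C1P]])
    show "compact (?N \<inter> ?B)" by (intro closed_Int_compact closed_halfspace_le compact_cball)
    show "convex (?N \<inter> ?B)" by (intro convex_Int convex_halfspace_le convex_cball)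
    fix x c assume x: "x : ?N \<inter> ?B" and nz: "?u2 x + (- 1) * ?P x ~= 0"
    have "x : T' | ?P x ~= 0" using nz x c'.halfspace_cut(1)[OF v', of x g'] side[of x] by (auto simp: b)
    hence n: "norm x <= Q" using Q1 Q2 by blast
    have "?a \<bullet> x ~= - b" using nz agree[of x] hstep_simps(3)[of "?a \<bullet> x + (b + 1)"] by (auto simp: b)
    hence lt: "?a \<bullet> x < - b" using x by simp
    let ?d = "(- b - ?a \<bullet> x) / (1 + \<bar>c * (?a \<bullet> e)\<bar>)"
    have dp: "?d > 0" using lt by (simp add: add_pos_nonneg)
    obtain t where t: "t > 0" "t <= ?d" "x + (t * c) *\<^sub>R e : ?B" using step[OF n dp] by blast
    have "t * (c * (?a \<bullet> e)) <= t * (1 + \<bar>c * (?a \<bullet> e)\<bar>)" using t(1) by (intro mult_left_mono) auto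
    also have "... <= - b - ?a \<bullet> x" using t(2) by (simp add: pos_le_divide_eq add_pos_nonneg)
    finally have "x + (t * c) *\<^sub>R e : ?N" by (simp add: inner_add_right mult.assoc)
    thus "EX t>0. x + (t * c) *\<^sub>R e : ?N \<inter> ?B" using t by blast
  qed
  have i: "integrable lborel (%x. indicator K x * (h x \<bullet> e))" if "compact K" "continuous_on UNIV h" for K :: "'a set" and h by (rule TI_integrable[OF that(1)]) (intro continuous_intros continuous_on_subset[OF that(2)] subset_UNIV)
  note c1 = C1_continuous(1)[OF c.gcut_C1[OF g, of "{v}"]] and c2 = C1_continuous(1)[OF c'.gcut_C1[OF g', of "{v'}"]] and c3 = C1_continuous(1)[OF C1P]
  have N: "compact (?N \<inter> ?B)" by (intro closed_Int_compact closed_halfspace_le compact_cball)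
  note ii = i[OF c.TC c1] i[OF c'.TC c2] i[OF compact_cball c3, of 0 "Q + 1"] i[OF N C1_continuous(1)[OF C1_add_scale[OF c'.gcut_C1[OF g', of "{v'}"] C1P, where c = "- 1"]]]
  have "TI T (%x. ?D1 x \<bullet> e) + TI T' (%x. ?D2 x \<bullet> e) = (\<integral>x. indicator T x * (?D1 x \<bullet> e) + indicator T' x * (?D2 x \<bullet> e) \<partial>lborel)"
    unfolding TI_def by (rule Bochner_Integration.integral_add[OF ii(1,2), symmetric])
  \<comment> \<open>Off the hyperplane: on the side of T the step is 1 and \<open>?DP\<close> equals
    \<open>?D1\<close>; on the other side the two occurrences of \<open>?DP\<close> cancel and
    \<open>?D2\<close> remains.\<close>
  also have "... = (\<integral>x. indicator ?B x * (?DP x \<bullet> e) + indicator (?N \<inter> ?B) x * ((?D2 x + (- 1) *\<^sub>R ?DP x) \<bullet> e) \<partial>lborel)"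
  proof (rule integral_cong_AE)
    have "AE x in lborel. x ~: {x. ?a \<bullet> x = - b}"
    proof (rule AE_not_in)
      have "{x. ?a \<bullet> x = - b} : null_sets lebesgue" using negligible_hyperplane[of ?a "- b"] c.bgrad_nonzero[OF v] by (auto simp: negligible_iff_null_sets)
      moreover have "{x. ?a \<bullet> x = - b} : sets lborel" by measurable
      ultimately show "{x. ?a \<bullet> x = - b} : null_sets lborel" by (simp add: null_sets_completion_iff)
    qed
    thus "AE x in lborel. indicator T x * (?D1 x \<bullet> e) + indicator T' x * (?D2 x \<bullet> e) =
      indicator ?B x * (?DP x \<bullet> e) + indicator (?N \<inter> ?B) x * ((?D2 x + (- 1) *\<^sub>R ?DP x) \<bullet> e)"
    proof eventually_elim
      fix x assume x: "x ~: {x. ?a \<bullet> x = - b}"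
      have TB: "x : T ==> x : ?B" "x : T' ==> x : ?B" using Q1[of x] Q2[of x] by auto
      show "indicator T x * (?D1 x \<bullet> e) + indicator T' x * (?D2 x \<bullet> e) =
        indicator ?B x * (?DP x \<bullet> e) + indicator (?N \<inter> ?B) x * ((?D2 x + (- 1) *\<^sub>R ?DP x) \<bullet> e)"
      proof (cases "?a \<bullet> x > - b")
        case True
        hence nT': "x ~: T'" using bary_nonneg[OF c'.T _ v', of x] side[of x] by (auto simp: b)
        have "hstep (?a \<bullet> x + (b + 1)) = 1" "hstep' (?a \<bullet> x + (b + 1)) = 0" using True by (auto intro!: hstep_simps)
        moreover have "?D1 x = 0" if "x ~: T" using c.halfspace_cut(2)[OF v _ that, of g D] True by (simp add: b)
        ultimately show ?thesis using True nT' TB by (auto simp: indicator_def)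
      next
        case False
        hence lt: "?a \<bullet> x < - b" using x by auto
        hence nT: "x ~: T" using bary_nonneg[OF c.T _ v, of x] by (auto simp: b)
        have "?D2 x = 0" if "x ~: T'" using c'.halfspace_cut(2)[OF v' _ that, of g' D'] side[of x] lt by (simp add: b)
        thus ?thesis using lt nT TB by (cases "x : T'") (auto simp: indicator_def inner_simps)
      qed
    qed
  qed (use ii in \<open>simp_all add: borel_measurable_integrable\<close>)
  also have "... = TI ?B (%x. ?DP x \<bullet> e) + TI (?N \<inter> ?B) (%x. (?D2 x + (- 1) *\<^sub>R ?DP x) \<bullet> e)"
    unfolding TI_def by (rule Bochner_Integration.integral_add[OF ii(3,4)])
  finally show ?thesis using whole half by simp
qed

text \<open>Dimension at least 2 provides a third vertex w. The edges u - w and v - w are dual to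
  the gradients of the two small coordinates, as \<open>strip_volume\<close> requires.\<close>

lemma TI_corner_small:
  fixes T :: "'a::euclidean_space set"
  assumes T: "int DIM('a) simplex T" and D2: "DIM('a) >= 2" and u: "u : verts T" "u : S" and v: "v : verts T" "v : S" "u ~= v"
    and g: "C1 g D"
  obtains C where "!!ep. 0 < ep ==> ep <= 1 ==> \<bar>TI T (%x. gcut g D T S ep x \<bullet> e)\<bar> <= C * ep"
proof -
  have TC: "compact T" by (rule simplex_compact[OF T])
  obtain b where b: "!!x. bary T u x = bgrad T u \<bullet> x + b" using bary_grad[OF T u(1)] by blast
  obtain c where c: "!!x. bary T v x = bgrad T v \<bullet> x + c" using bary_grad[OF T v(1)] by blast
  have "~verts T <= {u, v}"
  proof
    assume "verts T <= {u, v}"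
    from card_mono[OF _ this] have "card (verts T) <= 2" using v(3) by simp
    thus False using simplexD(3)[OF T] D2 by simp
  qed
  then obtain w where w: "w : verts T" "w ~= u" "w ~= v" by blast
  have d: "bgrad T u \<bullet> (u - w) = 1" "bgrad T u \<bullet> (v - w) = 0" "bgrad T v \<bullet> (u - w) = 0" "bgrad T v \<bullet> (v - w) = 1"
    using b[of u] b[of v] b[of w] c[of u] c[of v] c[of w] bary_vertex[OF T u(1) u(1)] bary_vertex[OF T u(1) v(1)] bary_vertex[OF T u(1) w(1)]
      bary_vertex[OF T v(1) u(1)] bary_vertex[OF T v(1) v(1)] bary_vertex[OF T v(1) w(1)] v(3) w(2,3) by (auto simp: inner_diff_right)
  define E where "E ep = T \<inter> {x. bgrad T u \<bullet> x <= ep - b} \<inter> {x. bgrad T v \<bullet> x <= ep - c}" for ep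
  have Ecomp: "compact (E ep)" for ep unfolding E_def by (intro compact_Int_closed TC closed_halfspace_le)
  obtain R where R: "ALL x:T. norm x <= R" using compact_imp_bounded[OF TC] unfolding bounded_iff ..
  have ball: "E ep <= cball 0 R" for ep using R by (auto simp: E_def)
  have su: "0 <= bgrad T u \<bullet> x + b & bgrad T u \<bullet> x + b <= ep" and sv: "0 <= bgrad T v \<bullet> x + c & bgrad T v \<bullet> x + c <= ep" if "x : E ep" for ep x
    using that bary_nonneg[OF T _ u(1), of x] bary_nonneg[OF T _ v(1), of x] by (auto simp: E_def b c)
  obtain C where C: "C >= 0" "!!ep. 0 < ep ==> ep <= 1 ==> measure lebesgue (E ep) <= C * ep\<^sup>2" by (rule strip_volume[where E = E, OF Ecomp ball su sv d]) (assumption, assumption, rule that)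
  have cb: "bounded (f ` T)" if "continuous_on T f" for f :: "'a => 'b::real_normed_vector" by (rule compact_imp_bounded[OF compact_continuous_image[OF that TC]])
  obtain Kg where Kg: "ALL y:g ` T. norm y <= Kg" using cb[OF C1_continuous(2)[OF g]] unfolding bounded_iff ..
  obtain Kd where Kd: "ALL y:D ` T. norm y <= Kd" using cb[OF C1_continuous(1)[OF g]] unfolding bounded_iff ..
  define B where "B = (SUM w:verts T. norm (bgrad T w))"
  define K where "K = (2 * \<bar>Kg\<bar> * B + \<bar>Kd\<bar>) * norm e"
  have B0: "B >= 0" by (simp add: B_def sum_nonneg)
  have K0: "K >= 0" using B0 by (simp add: K_def)
  have "\<bar>TI T (%x. gcut g D T S ep x \<bullet> e)\<bar> <= (K * C) * ep" if eps: "0 < ep" "ep <= 1" for ep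
  proof -
    interpret cutoff T ep by unfold_locales (rule T, rule eps(1))
    let ?f = "%x. gcut g D T S ep x \<bullet> e"
    have pt: "norm (indicator T x * ?f x) <= indicator (E ep) x * (K / ep)" for x
    proof (cases "x : E ep")
      case True
      hence xT: "x : T" by (simp add: E_def)
      have e1: "1 <= 1 / ep" using eps by simp
      have "norm (gcut g D T S ep x) <= \<bar>g x\<bar> * norm (dcut T S ep x) + \<bar>cut T S ep x\<bar> * norm (D x)"
        unfolding gcut_def by (rule norm_triangle_le) simp
      also have "... <= \<bar>Kg\<bar> * (2 / ep * B) + 1 * \<bar>Kd\<bar>"
      proof (intro add_mono mult_mono)
        show "\<bar>g x\<bar> <= \<bar>Kg\<bar>" using Kg xT by force
        show "norm (D x) <= \<bar>Kd\<bar>" using Kd xT by force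
        show "norm (dcut T S ep x) <= 2 / ep * B" unfolding B_def by (rule dcut_bound[OF eps(1)])
        show "\<bar>cut T S ep x\<bar> <= 1" using cut_bound[of T S ep x] by simp
      qed (use B0 eps in auto)
      also have "... <= \<bar>Kg\<bar> * (2 / ep * B) + (1 / ep) * \<bar>Kd\<bar>" using mult_right_mono[OF e1, of "\<bar>Kd\<bar>"] by simp
      also have "... = (2 * \<bar>Kg\<bar> * B + \<bar>Kd\<bar>) / ep" by (simp add: add_divide_distrib)
      finally have n: "norm (gcut g D T S ep x) <= (2 * \<bar>Kg\<bar> * B + \<bar>Kd\<bar>) / ep" .
      have "\<bar>?f x\<bar> <= norm (gcut g D T S ep x) * norm e" by (rule Cauchy_Schwarz_ineq2)
      also have "... <= (2 * \<bar>Kg\<bar> * B + \<bar>Kd\<bar>) / ep * norm e" by (rule mult_right_mono[OF n]) simp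
      also have "... = K / ep" by (simp add: K_def)
      finally show ?thesis using True xT by simp
    next
      case False
      have "indicator T x * ?f x = 0"
      proof (cases "x : T")
        case True
        hence "ep <= bary T u x | ep <= bary T v x" using False by (auto simp: E_def b c)
        hence "gcut g D T S ep x = 0" using gcut_zero(2)[OF u(1), of S x g D] gcut_zero(2)[OF v(1), of S x g D] u(2) v(2) by blast
        thus ?thesis by simp
      qed simp
      thus ?thesis using False by simp
    qed
    have Es: "E ep : sets lborel" using compact_imp_closed[OF Ecomp] by (simp add: borel_closed)
    have Ef: "emeasure lborel (E ep) < \<infinity>" using emeasure_compact_finite[OF Ecomp] by (simp add: top.not_eq_extremum)
    have "\<bar>TI T ?f\<bar> <= (\<integral>x. indicator (E ep) x * (K / ep) \<partial>lborel)" unfolding TI_def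
    proof (rule order_trans[OF integral_norm_bound[of lborel "%x. indicator T x * ?f x", unfolded real_norm_def]])
      show "(\<integral>x. \<bar>indicator T x * ?f x\<bar> \<partial>lborel) <= (\<integral>x. indicator (E ep) x * (K / ep) \<partial>lborel)"
      proof (rule integral_mono)
        show "integrable lborel (%x. \<bar>indicator T x * ?f x\<bar>)" using TI_integrable[OF TC gcut_continuous[OF g]] by (rule integrable_abs)
        show "integrable lborel (%x. indicator (E ep) x * (K / ep))" using Es Ef by simp
        show "\<bar>indicator T x * ?f x\<bar> <= indicator (E ep) x * (K / ep)" for x using pt[of x] by (simp only: real_norm_def)
      qed
    qed
    also have "... = measure lborel (E ep) * (K / ep)" using Es by simp
    also have "measure lborel (E ep) = measure lebesgue (E ep)" using Es by (simp add: measure_completion)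
    also have "measure lebesgue (E ep) * (K / ep) <= C * ep\<^sup>2 * (K / ep)" using C(2)[OF eps] K0 eps by (intro mult_right_mono) auto
    also have "... = (K * C) * ep" using eps by (simp add: power2_eq_square field_simps)
    finally show ?thesis .
  qed
  thus thesis by (rule that)
qed

text \<open>The faces of codimension at least two do not contribute, since their \<open>ep\<close>-neighbourhoods have volume
  \<open>O(ep\<^sup>2)\<close> while the gradients of the cutoffs are \<open>O(1/ep)\<close>.\<close>

lemma piecewise_divergence:
  fixes Th :: "'a::euclidean_space set set"
  assumes Th: "finite Th" and T: "!!T. T : Th ==> int DIM('a) simplex T" and D2: "DIM('a) >= 2" and I: "finite I"
    and A: "!!T i. T : Th ==> i : I ==> C1 (A T i) (DA T i)"
    and bal: "!!ep. ep > 0 ==> (SUM T:Th. SUM v:verts T. SUM i:I. TI T (%x. gcut (A T i) (DA T i) T {v} ep x \<bullet> e i)) = 0"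
  shows "(SUM T:Th. SUM i:I. TI T (%x. DA T i x \<bullet> e i)) = 0"
proof -
  let ?N = "%T i S ep. TI T (%x. gcut (A T i) (DA T i) T S ep x \<bullet> e i)"
  let ?big = "%T. {S : Pow (verts T). EX u:S. EX v:S. u ~= v}"
  let ?s = "SUM T:Th. SUM i:I. TI T (%x. DA T i x \<bullet> e i)"
  have fin: "finite (verts T)" if "T : Th" for T by (rule simplexD(1)[OF T[OF that]])
  have "EX C. ALL ep. 0 < ep --> ep <= 1 --> \<bar>?N T i S ep\<bar> <= C * ep" if Ti: "T : Th" "i : I" and S: "S : ?big T" for T i S
  proof -
    obtain u v where uv: "u : S" "v : S" "u ~= v" using S by blast
    have V: "u : verts T" "v : verts T" using uv S by auto
    obtain C where "!!ep. 0 < ep ==> ep <= 1 ==> \<bar>?N T i S ep\<bar> <= C * ep" by (rule TI_corner_small[OF T[OF Ti(1)] D2 V(1) uv(1) V(2) uv(2,3) A[OF Ti], of "e i"]) blast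
    thus ?thesis by blast
  qed
  note ex = this
  define C where "C T i S = (SOME C. ALL ep. 0 < ep --> ep <= 1 --> \<bar>?N T i S ep\<bar> <= C * ep)" for T i S
  have C: "\<bar>?N T i S ep\<bar> <= C T i S * ep" if "T : Th" "i : I" "S : ?big T" "0 < ep" "ep <= 1" for T i S ep
    using someI_ex[OF ex[OF that(1-3)]] that(4,5) unfolding C_def by blast
  define Q where "Q = (SUM T:Th. SUM i:I. SUM S:?big T. C T i S)"
  have le: "\<bar>?s\<bar> <= Q * ep" if ep: "0 < ep" "ep <= 1" for ep
  proof -
    have part: "TI T (%x. DA T i x \<bullet> e i) = (SUM v:verts T. ?N T i {v} ep) + (SUM S:?big T. ?N T i S ep)" if Ti: "T : Th" "i : I" for T i
    proof -
      interpret cutoff T ep by unfold_locales (rule T[OF Ti(1)], rule ep(1))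
      let ?V = "verts T"
      have P: "Pow ?V = insert {} ((%v. {v}) ` ?V \<union> ?big T)"
      proof (rule set_eqI)
        fix S :: "'a set"
        have "S = {} | (EX v. S = {v}) | (EX u:S. EX v:S. u ~= v)" by (cases "S = {}") blast+
        thus "S : Pow ?V \<longleftrightarrow> S : insert {} ((%v. {v}) ` ?V \<union> ?big T)" by auto
      qed
      have "TI T (%x. DA T i x \<bullet> e i) = (SUM S:Pow ?V. ?N T i S ep)" by (rule TI_partition[OF A[OF Ti]])
      also have "... = ?N T i {} ep + (SUM S:(%v. {v}) ` ?V \<union> ?big T. ?N T i S ep)"
      proof -
        have "(SUM S:Pow ?V. ?N T i S ep) = (SUM S:insert {} ((%v. {v}) ` ?V \<union> ?big T). ?N T i S ep)" by (rule sum.cong[OF P refl])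
        also have "... = ?N T i {} ep + (SUM S:(%v. {v}) ` ?V \<union> ?big T. ?N T i S ep)" by (rule sum.insert) (use fin[OF Ti(1)] in auto)
        finally show ?thesis .
      qed
      also have "?N T i {} ep = 0" by (rule TI_empty[OF A[OF Ti]])
      also have "(SUM S:(%v. {v}) ` ?V \<union> ?big T. ?N T i S ep) = (SUM S:(%v. {v}) ` ?V. ?N T i S ep) + (SUM S:?big T. ?N T i S ep)" by (rule sum.union_disjoint) (use fin[OF Ti(1)] in auto)
      also have "(SUM S:(%v. {v}) ` ?V. ?N T i S ep) = (SUM v:?V. ?N T i {v} ep)" by (subst sum.reindex) (auto simp: inj_on_def)
      finally show ?thesis by simp
    qed
    have "?s = (SUM T:Th. SUM i:I. SUM v:verts T. ?N T i {v} ep) + (SUM T:Th. SUM i:I. SUM S:?big T. ?N T i S ep)" by (simp add: part sum.distrib)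
    also have "(SUM T:Th. SUM i:I. SUM v:verts T. ?N T i {v} ep) = (SUM T:Th. SUM v:verts T. SUM i:I. ?N T i {v} ep)" by (rule sum.cong[OF refl]) (rule sum.swap)
    also have "... = 0" by (rule bal[OF ep(1)])
    finally have "\<bar>?s\<bar> = \<bar>SUM T:Th. SUM i:I. SUM S:?big T. ?N T i S ep\<bar>" by simp
    also have "... <= (SUM T:Th. SUM i:I. SUM S:?big T. C T i S * ep)" by (rule order_trans[OF order_trans[OF sum_abs sum_mono[OF order_trans[OF sum_abs sum_mono[OF sum_abs]]]]])
        (intro sum_mono C ep)
    also have "... = Q * ep" by (simp add: Q_def sum_distrib_right)
    finally show ?thesis .
  qed
  show ?thesis
  proof (rule ccontr)
    assume n: "?s ~= 0"
    \<comment> \<open>Chosen so that (\<bar>Q\<bar> + 1) ep is at most half the absolute value of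
      the sum, whatever the sign of Q.\<close>
    define ep where "ep = min 1 (\<bar>?s\<bar> / (2 * (\<bar>Q\<bar> + 1)))"
    have ep: "0 < ep" "ep <= 1" "ep <= \<bar>?s\<bar> / (2 * (\<bar>Q\<bar> + 1))" using n by (auto simp: ep_def)
    have "\<bar>?s\<bar> <= (\<bar>Q\<bar> + 1) * ep" using le[OF ep(1,2)] mult_right_mono[of Q "\<bar>Q\<bar> + 1" ep] ep(1) by linarith
    also have "... <= (\<bar>Q\<bar> + 1) * (\<bar>?s\<bar> / (2 * (\<bar>Q\<bar> + 1)))" using ep(3) by (intro mult_left_mono) auto
    also have "... = \<bar>?s\<bar> / 2" by (simp add: field_simps)
    finally show False using n by simp
  qed
qed

section \<open>Facets of a mesh\<close>

text \<open>The segment from a to x can be prolonged beyond x inside F. A face that contains an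
  inner point of a segment in T contains its ends.\<close>

lemma positive_in_face:
  fixes F :: "'a::euclidean_space set"
  assumes F: "int l simplex F" and FT: "F <= T" and G: "G face_of T" and x: "x : G" "x : F"
    and pos: "!!w. w : verts F ==> bary F w x > 0"
  shows "F <= G"
proof
  fix a assume a: "a : F"
  show "a : G"
  proof (cases "a = x")
    case False
    let ?V = "verts F"
    have fin: "finite ?V" "?V ~= {}" using simplexD(1,3)[OF F] by auto
    \<comment> \<open>The smallest coordinate of x bounds how far beyond x the segment stays in
      F.\<close>
    define m where "m = Min ((%w. bary F w x) ` ?V)"
    have m: "m > 0" "!!w. w : ?V ==> m <= bary F w x" using fin pos by (auto simp: m_def)
    note bx = bary_props[OF F simplex_affine_hull[OF F x(2)]] and ba = bary_props[OF F simplex_affine_hull[OF F a]]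
    define b where "b = (1 + m) *\<^sub>R x - m *\<^sub>R a"
    have bF: "b : F"
    proof (rule in_simplexI[OF F, of "%w. (1 + m) * bary F w x - m * bary F w a"])
      show "(SUM w:?V. (1 + m) * bary F w x - m * bary F w a) = 1" by (simp add: sum_subtractf bx(1) ba(1) flip: sum_distrib_left)
      show "(SUM w:?V. ((1 + m) * bary F w x - m * bary F w a) *\<^sub>R w) = b" by (simp only: scaleR_left_diff_distrib sum_subtractf scaleR_scaleR[symmetric] scaleR_sum_right[symmetric] bx(2) ba(2) b_def)
      fix w assume w: "w : ?V"
      have "bary F w a <= (SUM w:?V. bary F w a)" by (rule member_le_sum) (use w fin bary_nonneg[OF F a] in auto)
      hence "m * bary F w a <= m * 1" using m(1) ba(1) by (intro mult_left_mono) auto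
      moreover have "1 * m <= (1 + m) * bary F w x" using m(1) m(2)[OF w] by (intro mult_mono) auto
      ultimately show "0 <= (1 + m) * bary F w x - m * bary F w a" by simp
    qed
    have ab: "a ~= b"
    proof
      assume "a = b"
      hence "(1 + m) *\<^sub>R a = (1 + m) *\<^sub>R x" by (simp add: b_def algebra_simps)
      thus False using False m(1) by simp
    qed
    define u where "u = 1 / (1 + m)"
    have u: "0 < u" "u < 1" "u * (1 + m) = 1" using m(1) by (auto simp: u_def)
    have "(1 - u) - u * m = 0" using u(3) by (simp add: algebra_simps)
    moreover have "(1 - u) *\<^sub>R a + u *\<^sub>R b = (u * (1 + m)) *\<^sub>R x + ((1 - u) - u * m) *\<^sub>R a" by (simp add: b_def algebra_simps)
    ultimately have "x = (1 - u) *\<^sub>R a + u *\<^sub>R b" using u(3) by simp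
    hence "x : open_segment a b" using ab u by (auto simp: in_segment)
    from face_ofD[OF G this] show ?thesis using a bF FT x(1) by blast
  qed (use x in simp)
qed

text \<open>Both sides are affine and vanish on the facet. The factor is the reciprocal of the
  signed height of v over F, so its sign tells the side.\<close>

lemma facet_bary:
  fixes T :: "'a::euclidean_space set"
  assumes T: "int DIM('a) simplex T" and F: "F : Delta (DIM('a) - 1) T" and nk: "unit_normal F nk"
    and v: "v : verts T" "verts F = verts T - {v}" and v0: "v0 : verts F"
  obtains s where "s ~= 0" "!!x. bary T v x = s * (nk \<bullet> (x - v0))" "s * (nk \<bullet> (v - v0)) = 1"
proof -
  let ?c = "nk \<bullet> (v - v0)"
  have v0T: "v0 : verts T" using v0 v(2) by blast
  have c: "?c ~= 0" by (rule facet_normal_nonzero[OF T F nk v(1) _ v0]) (use v(2) in blast)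
  have e: "nk \<bullet> (x - v0) = bary T v x * ?c" for x
  proof -
    have "x - v0 = (SUM u:verts T. bary T u x *\<^sub>R (u - v0))" using simplex_diff_edges[OF T v0T, of "x - v0"] by simp
    hence "nk \<bullet> (x - v0) = (SUM u:verts T. bary T u x * (nk \<bullet> (u - v0)))" by (simp only: inner_sum_right inner_scaleR_right)
    also have "... = (SUM u:verts T. if u = v then bary T v x * ?c else 0)"
    proof (rule sum.cong[OF refl])
      fix u assume u: "u : verts T"
      show "bary T u x * (nk \<bullet> (u - v0)) = (if u = v then bary T v x * ?c else 0)"
      proof (cases "u = v")
        case False
        hence "u - v0 : tangent_space F" using verts_diff_tangent[OF Delta_simplex[OF F] _ v0] u v(2) by blast
        thus ?thesis using nk False by (simp add: unit_normal_def)
      qed simp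
    qed
    also have "... = bary T v x * ?c" using v(1) simplexD(1)[OF T] by simp
    finally show ?thesis .
  qed
  show thesis
  proof (rule that[of "1 / ?c"])
    show "bary T v x = 1 / ?c * (nk \<bullet> (x - v0))" for x unfolding e[of x] using c by simp
  qed (use c in simp_all)
qed

text \<open>In the hyperplane of F the cutoff involves the coordinates of F alone, so the cutoffs of
  two simplices at a common facet agree there.\<close>

lemma cut_on_facet:
  fixes T :: "'a::euclidean_space set"
  assumes T: "int DIM('a) simplex T" and F: "F : Delta (DIM('a) - 1) T" and v: "v : verts T" "verts F = verts T - {v}"
    and x: "x : affine hull (verts F)"
  shows "cut T {v} ep x = (PROD w:verts F. hstep (bary F w x / ep))"
proof -
  have b: "bary T w x = (if w : verts F then bary F w x else 0)" if "w : verts T" for w by (rule bary_face[OF T F x that])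
  have "cut T {v} ep x = cut1 {v} v ep (bary T v x) * (PROD w:verts T - {v}. cut1 {v} w ep (bary T w x))"
    unfolding cut_def by (rule prod.remove[OF simplexD(1)[OF T] v(1)])
  also have "cut1 {v} v ep (bary T v x) = 1" using b[OF v(1)] v(2) by (simp add: cut1_def hstep_simps)
  also have "(PROD w:verts T - {v}. cut1 {v} w ep (bary T w x)) = (PROD w:verts F. hstep (bary F w x / ep))" by (rule prod.cong) (use v(2) b in \<open>auto simp: cut1_def\<close>)
  finally show ?thesis by simp
qed

section \<open>Neighbouring simplices and cancellation at common facets\<close>

locale simplicial_mesh =
  fixes \<Omega> :: "'a::euclidean_space set" and Th :: "'a set set"
  assumes op: "open \<Omega>" and mesh: "conforming_mesh \<Omega> Th" and dim2: "DIM('a) >= 2"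
begin

lemma fin: "finite Th" and sx: "T : Th ==> int DIM('a) simplex T"
  and inter: "T : Th ==> T' : Th ==> (T \<inter> T') face_of T" and cover: "\<Omega> <= \<Union>Th"
  using mesh closure_subset[of \<Omega>] unfolding conforming_mesh_def triangulation_def by blast+

lemma mesh_subset_eq:
  assumes "T : Th" "T' : Th" "T <= T'"
  shows "T = T'"
proof (rule ccontr)
  assume ne: "T ~= T'"
  have "(T' \<inter> T) face_of T'" by (rule inter[OF assms(2,1)])
  moreover have "T' \<inter> T = T" using assms(3) by blast
  ultimately have "T face_of T'" by simp
  from face_of_aff_dim_lt[OF simplex_convex[OF sx[OF assms(2)]] this ne]
  show False using aff_dim_simplex[OF sx[OF assms(1)]] aff_dim_simplex[OF sx[OF assms(2)]] by simp
qed

text \<open>Otherwise the points moving from the barycenter of F towards v are at first inside both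
  simplices. An interior point of T in the common face puts all of T into T', against equality of
  dimensions.\<close>

lemma opposite_sides:
  assumes TT: "T : Th" "T' : Th" "T ~= T'" and F: "F : Delta (DIM('a) - 1) T" "F : Delta (DIM('a) - 1) T'"
    and v: "v : verts T" "verts F = verts T - {v}" and v': "v' : verts T'" "verts F = verts T' - {v'}"
    and s: "s ~= 0" "!!x. bary T v x = s * (nk \<bullet> (x - v0))" and s': "s' ~= 0" "!!x. bary T' v' x = s' * (nk \<bullet> (x - v0))"
  shows "s * s' < 0"
proof (rule ccontr)
  assume "~s * s' < 0"
  moreover have "s * s' ~= 0" using s(1) s'(1) by simp
  ultimately have ss: "s' / s > 0" by (simp add: zero_less_mult_iff zero_less_divide_iff) (auto simp: mult_less_0_iff not_less)
  note T = sx[OF TT(1)] and T' = sx[OF TT(2)] and Fs = Delta_simplex[OF F(1)]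
  define x0 where "x0 = barycenter F"
  have x0F: "x0 : F" and x0p: "!!w. w : verts F ==> bary F w x0 > 0" using barycenter[OF Fs] by (auto simp: x0_def)
  have x0b: "bary T w x0 = (if w : verts F then bary F w x0 else 0)" if "w : verts T" for w by (rule bary_face[OF T F(1) simplex_affine_hull[OF Fs x0F] that])
  have x0b': "bary T' w x0 = (if w : verts F then bary F w x0 else 0)" if "w : verts T'" for w by (rule bary_face[OF T' F(2) simplex_affine_hull[OF Fs x0F] that])
  define y where "y t = x0 + t *\<^sub>R (v - x0)" for t
  have aff: "bary S w (y t) = (1 - t) * bary S w x0 + t * bary S w v" if S: "int DIM('a) simplex S" "w : verts S" for S w t
  proof -
    obtain b where b: "!!x. bary S w x = bgrad S w \<bullet> x + b" using bary_grad[OF S] by blast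
    show ?thesis unfolding b y_def by (simp add: inner_add_right inner_diff_right algebra_simps)
  qed
  have ev: "\<forall>\<^sub>F t in at_right 0. bary T' w (y t) > 0" if w: "w : verts T'" for w
  proof (cases "w = v'")
    case True
    have "bary T' w (y t) = t * (s' / s)" for t
    proof -
      have "bary T' v' z = (s' / s) * bary T v z" for z using s(1) unfolding s(2) s'(2) by simp
      moreover have "bary T v (y t) = t" using aff[OF T v(1), of t] x0b[OF v(1)] bary_vertex[OF T v(1) v(1)] v(2) by simp
      ultimately show ?thesis using True by simp
    qed
    moreover have "0 < t * (s' / s)" if "0 < t" for t by (rule mult_pos_pos[OF that ss])
    ultimately show ?thesis by (intro eventually_mono[OF eventually_at_right_less[of 0]]) simp
  next
    case False
    hence "bary T' w (y 0) > 0" using x0b'[OF w] x0p[of w] w v'(2) by (simp add: y_def)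
    moreover have "((%t. bary T' w (y t)) \<longlongrightarrow> bary T' w (y 0)) (at_right 0)" unfolding aff[OF T' w] by (intro tendsto_intros)
    ultimately show ?thesis using order_tendstoD(1) by blast
  qed
  have "\<forall>\<^sub>F t in at_right 0. ALL w:verts T'. bary T' w (y t) > 0" using ev simplexD(1)[OF T'] by (simp add: eventually_ball_finite)
  moreover have "\<forall>\<^sub>F t in at_right (0::real). t < 1" by (rule eventually_at_rightI[of 0 1]) auto
  moreover have "\<forall>\<^sub>F t in at_right (0::real). 0 < t" by (rule eventually_at_right_less)
  ultimately have "\<forall>\<^sub>F t in at_right (0::real). (ALL w:verts T'. bary T' w (y t) > 0) & t < 1 & 0 < t" by eventually_elim simp
  then obtain t where t: "ALL w:verts T'. bary T' w (y t) > 0" "t < 1" "0 < t"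
    using eventually_happens[of _ "at_right (0::real)"] by (auto simp: trivial_limit_at_right_real)
  have yT': "y t : T'" using in_simplex_iff_bary[OF T', of "y t"] t(1) simplex_affine_UNIV[OF T'] by (auto intro: less_imp_le)
  have yp: "bary T w (y t) > 0" if w: "w : verts T" for w
  proof (cases "w = v")
    case True
    thus ?thesis using aff[OF T w, of t] x0b[OF w] bary_vertex[OF T w v(1)] v(2) t by simp
  next
    case False
    thus ?thesis using aff[OF T w, of t] x0b[OF w] x0p[of w] bary_vertex[OF T w v(1)] v(2) t w by simp
  qed
  have yT: "y t : T" using in_simplex_iff_bary[OF T, of "y t"] yp simplex_affine_UNIV[OF T] by (auto intro: less_imp_le)
  have "T <= T \<inter> T'" by (rule positive_in_face[OF T order_refl inter[OF TT(1,2)] _ yT yp]) (use yT yT' in auto)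
  thus False using mesh_subset_eq[OF TT(1,2)] TT(3) by blast
qed

text \<open>Points just beyond F are still in the domain but not in T. The remaining simplices are
  finitely many closed sets, so one of them contains x; its intersection with T is a face through a
  relative interior point of F and hence contains F.\<close>

lemma neighbour_exists:
  assumes T: "T : Th" and F: "F : Delta (DIM('a) - 1) T" and x: "x : F" "x : \<Omega>" and pos: "!!w. w : verts F ==> bary F w x > 0"
  shows "EX T':Th. T' ~= T & F : Delta (DIM('a) - 1) T'"
proof -
  note Ts = sx[OF T] and Fs = Delta_simplex[OF F] and FT = Delta_subset[OF F]
  have D1: "1 <= DIM('a)" using dim2 by simp
  obtain v where v: "v : verts T" "verts F = verts T - {v}" by (rule facet_opposite[OF Ts D1 F]) (rule that)
  obtain b where b: "!!x. bary T v x = bgrad T v \<bullet> x + b" using bary_grad[OF Ts v(1)] by blast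
  define y where "y m = x - inverse (real (Suc m)) *\<^sub>R (v - x)" for m
  have "bary T v x = 0" using bary_face[OF Ts F simplex_affine_hull[OF Fs x(1)] v(1)] v(2) by simp
  hence "bary T v (y m) < 0" for m
  proof -
    have "bary T v (y m) = bary T v x - inverse (real (Suc m)) * (bary T v v - bary T v x)" unfolding b y_def by (simp add: inner_diff_right)
    thus ?thesis using \<open>bary T v x = 0\<close> bary_vertex[OF Ts v(1) v(1)] by simp
  qed
  note neg = this
  have yT: "y m ~: T" for m
  proof
    assume "y m : T"
    from bary_nonneg[OF Ts this v(1)] neg[of m] show False by simp
  qed
  have "(%m. x - inverse (real (Suc m)) *\<^sub>R (v - x)) \<longlonglongrightarrow> x - 0 *\<^sub>R (v - x)" by (intro tendsto_intros LIMSEQ_inverse_real_of_nat)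
  hence lim: "y \<longlonglongrightarrow> x" by (simp add: y_def[abs_def])
  have "\<forall>\<^sub>F m in sequentially. y m : \<Omega>" using topological_tendstoD[OF lim op x(2)] .
  hence ev: "\<forall>\<^sub>F m in sequentially. y m : \<Union>(Th - {T})" by eventually_elim (use cover yT in blast)
  have cl: "closed (\<Union>(Th - {T}))" using fin sx simplex_closed by (intro closed_Union) auto
  have "x : \<Union>(Th - {T})" by (rule Lim_in_closed_set[OF cl ev _ lim]) simp
  then obtain T' where T': "T' : Th" "T' ~= T" "x : T'" by blast
  have FG: "F <= T \<inter> T'" by (rule positive_in_face[OF Fs FT inter[OF T T'(1)] _ x(1) pos]) (use x FT T' in auto)
  have "F face_of T" using F by (simp add: Delta_def)
  hence "F face_of (T \<inter> T')" by (rule face_of_subset[OF _ FG]) blast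
  moreover have "(T \<inter> T') face_of T'" using inter[OF T'(1) T] by (simp add: Int_commute)
  ultimately have "F face_of T'" by (rule face_of_trans)
  thus ?thesis using T' Fs by (auto simp: Delta_def)
qed

text \<open>The pairs (T, v) are regrouped by the facet opposite v. A facet on which
  \<open>ph\<close> vanishes contributes 0. Any other has a relative interior point in the domain
  and belongs to exactly two simplices, whose contributions cancel.\<close>

lemma facet_balance:
  fixes ph :: "'a => real"
  assumes I: "finite I" and ep: "ep > 0" and A: "!!T i. T : Th ==> i : I ==> C1 (A T i) (DA T i)"
    and ph: "continuous_on UNIV ph" "!!x. x ~: \<Omega> ==> ph x = 0" and A0: "!!T i x. ph x = 0 ==> A T i x = 0"
    and nF: "!!T F. T : Th ==> F : Delta (DIM('a) - 1) T ==> unit_normal F (nF F)"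
    and cont: "!!T T' F x. T : Th ==> T' : Th ==> F : Delta (DIM('a) - 1) T ==> F : Delta (DIM('a) - 1) T' ==> x : F ==>
      (SUM i:I. (e i \<bullet> nF F) * A T i x) = (SUM i:I. (e i \<bullet> nF F) * A T' i x)"
  shows "(SUM T:Th. SUM v:verts T. SUM i:I. TI T (%x. gcut (A T i) (DA T i) T {v} ep x \<bullet> e i)) = 0"
proof -
  define N where "N p = (SUM i:I. TI (fst p) (%x. gcut (A (fst p) i) (DA (fst p) i) (fst p) {snd p} ep x \<bullet> e i))" for p
  define fac where "fac p = convex hull (verts (fst p) - {snd p})" for p :: "'a set \<times> 'a"
  let ?P = "Sigma Th verts"
  have finP: "finite ?P" using fin simplexD(1)[OF sx] by (intro finite_SigmaI) auto
  have D1: "1 <= DIM('a)" using dim2 by simp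
  have fac: "fac (T, v) : Delta (DIM('a) - 1) T" "verts (fac (T, v)) = verts T - {v}" if "T : Th" "v : verts T" for T v
    using opposite_facet[OF sx[OF that(1)] D1 that(2)] by (simp_all add: fac_def)
  have cutoff: "cutoff T ep" if "T : Th" for T by unfold_locales (rule sx[OF that], rule ep)
  have grp: "(SUM p:{p : ?P. fac p = F}. N p) = 0" if FP: "F : fac ` ?P" for F
  proof -
    obtain T v where T: "T : Th" "v : verts T" "F = fac (T, v)" using FP by auto
    have F: "F : Delta (DIM('a) - 1) T" "verts F = verts T - {v}" using fac[OF T(1,2)] T(3) by simp_all
    note Fs = Delta_simplex[OF F(1)]
    show ?thesis
    proof (cases "ALL x:F. ph x = 0")
      \<comment> \<open>Every facet outside the open domain is of this kind, so the boundary needs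
        no separate treatment.\<close>
      case True
      have "N p = 0" if p: "p : ?P" "fac p = F" for p
      proof -
        obtain T' v' where p': "p = (T', v')" "T' : Th" "v' : verts T'" using p(1) by auto
        have F': "F : Delta (DIM('a) - 1) T'" "verts F = verts T' - {v'}" using fac[OF p'(2,3)] p(2) p'(1) by simp_all
        interpret c: cutoff T' ep by (rule cutoff[OF p'(2)])
        have "TI T' (%x. gcut (A T' i) (DA T' i) T' {v'} ep x \<bullet> e i) = 0" if i: "i : I" for i
        proof (rule c.TI_one_sided[OF p'(3) A[OF p'(2) i]], intro disjI2 ballI impI)
          fix x assume x: "x : T'" "bary T' v' x = 0"
          hence "x : F" using in_face_iff_bary[OF c.T F'(1) x(1)] F'(2) by auto
          thus "A T' i x = 0" using True A0 by blast
        qed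
        thus ?thesis by (simp add: N_def p'(1))
      qed
      thus ?thesis by (intro sum.neutral) auto
    next
      case False
      then obtain z where z: "z : F" "ph z ~= 0" by blast
      \<comment> \<open>\<open>z\<close> may lie on the boundary of F; by density there is also a
        relative interior point where \<open>ph\<close> is nonzero.\<close>
      have "EX x:F. (PROD w:verts F. bary F w x) * (ph x)\<^sup>2 ~= 0"
        using simplex_rel_interior_dense_zero[OF Fs continuous_on_subset[OF ph(1)], of z] z by blast
      then obtain x where x: "x : F" "(PROD w:verts F. bary F w x) ~= 0" "ph x ~= 0" by auto
      have pos: "bary F w x > 0" if w: "w : verts F" for w using x(2) w bary_nonneg[OF Fs x(1) w] simplexD(1)[OF Fs] by (auto simp: order_less_le)
      have "x : \<Omega>" using ph(2) x(3) by blast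
      from neighbour_exists[OF T(1) F(1) x(1) this pos] obtain T' where T': "T' : Th" "T' ~= T" "F : Delta (DIM('a) - 1) T'" by blast
      obtain v' where v': "v' : verts T'" "verts F = verts T' - {v'}" by (rule facet_opposite[OF sx[OF T'(1)] D1 T'(3)]) (rule that)
      obtain v0 where v0: "v0 : verts F" using simplexD(3)[OF Fs] by fastforce
      note nu = nF[OF T(1) F(1)]
      let ?n = "nF F"
      obtain s where s: "s ~= 0" "!!x. bary T v x = s * (?n \<bullet> (x - v0))" by (rule facet_bary[OF sx[OF T(1)] F(1) nu T(2) F(2) v0]) (rule that)
      obtain s' where s': "s' ~= 0" "!!x. bary T' v' x = s' * (?n \<bullet> (x - v0))" by (rule facet_bary[OF sx[OF T'(1)] T'(3) nu v' v0]) (rule that)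
      have ss: "s * s' < 0" by (rule opposite_sides[OF T(1) T'(1) T'(2)[symmetric] F(1) T'(3) T(2) F(2) v' s s'])
      have P: "{p : ?P. fac p = F} = {(T, v), (T', v')}"
      proof (intro subset_antisym subsetI)
        fix p assume "p : {p : ?P. fac p = F}"
        then obtain T2 v2 where p: "p = (T2, v2)" "T2 : Th" "v2 : verts T2" "fac (T2, v2) = F" by auto
        have F2: "F : Delta (DIM('a) - 1) T2" "verts F = verts T2 - {v2}" using fac[OF p(2,3)] p(4) by simp_all
        obtain s2 where s2: "s2 ~= 0" "!!x. bary T2 v2 x = s2 * (?n \<bullet> (x - v0))" by (rule facet_bary[OF sx[OF p(2)] F2(1) nu p(3) F2(2) v0]) (rule that)
        \<comment> \<open>Of three simplices at F two would lie on the same side: three nonzero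
          numbers cannot have pairwise negative products.\<close>
        have "T2 = T | T2 = T'"
        proof (rule ccontr)
          assume ne: "~(T2 = T | T2 = T')"
          have "s * s2 < 0" by (rule opposite_sides[OF T(1) p(2) _ F(1) F2(1) T(2) F(2) p(3) F2(2) s s2]) (use ne in blast)
          moreover have "s' * s2 < 0" by (rule opposite_sides[OF T'(1) p(2) _ T'(3) F2(1) v' p(3) F2(2) s' s2]) (use ne in blast)
          ultimately show False using ss by (auto simp: mult_less_0_iff)
        qed
        thus "p : {(T, v), (T', v')}" using p(1,3) F2(2) F(2) v' T(2) by auto
      next
        fix p assume p: "p : {(T, v), (T', v')}"
        have "fac (T', v') = F" using v'(2) simplexD(4)[OF Fs] by (simp add: fac_def)
        thus "p : {p : ?P. fac p = F}" using p T T'(1) v'(1) by auto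
      qed
      let ?g = "%T x. SUM i:I. (e i \<bullet> ?n) * A T i x" and ?D = "%T x. SUM i:I. (e i \<bullet> ?n) *\<^sub>R DA T i x"
      have norm: "N (T, v) = TI T (%x. gcut (?g T) (?D T) T {v} ep x \<bullet> ?n)"
        if T: "T : Th" "v : verts T" and s: "!!x. bary T v x = s * (?n \<bullet> (x - v0))" for T v s
      proof -
        interpret c: cutoff T ep by (rule cutoff[OF T(1)])
        obtain b where b: "!!x. bary T v x = bgrad T v \<bullet> x + b" using bary_grad[OF c.T T(2)] by blast
        have "bgrad T v \<bullet> t = 0" if "t \<bullet> ?n = 0" for t
        proof -
          have "bgrad T v \<bullet> t = bary T v (v0 + t) - bary T v v0" by (simp add: b inner_add_right)
          also have "... = s * (?n \<bullet> t)" unfolding s by simp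
          finally show ?thesis using that by (simp add: inner_commute)
        qed
        hence "(SUM i:I. TI T (%x. gcut (A T i) (DA T i) T {v} ep x \<bullet> e i)) = TI T (%x. gcut (?g T) (?D T) T {v} ep x \<bullet> ?n)" by (intro c.TI_normal[OF T(2) A[OF T(1)]]) (use nu in \<open>auto simp: unit_normal_def\<close>)
        thus ?thesis by (simp add: N_def)
      qed
      have C1g: "C1 (?g T) (?D T)" if "T : Th" for T by (rule C1_sum) (rule A[OF that])
      have "TI T (%x. gcut (?g T) (?D T) T {v} ep x \<bullet> ?n) + TI T' (%x. gcut (?g T') (?D T') T' {v'} ep x \<bullet> ?n) = 0"
      proof (rule TI_two_sided[OF cutoff[OF T(1)] cutoff[OF T'(1)] T(2) v'(1) _ _ C1g[OF T(1)] C1g[OF T'(1)]])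
        show "- (s' / s) > 0" using ss by (auto simp: mult_less_0_iff divide_less_0_iff)
        show "bary T' v' x = - (- (s' / s)) * bary T v x" for x using s(1) unfolding s(2) s'(2) by simp
        fix x assume bx: "bary T v x = 0"
        note bp = bary_props[OF sx[OF T(1)], of x, unfolded simplex_affine_UNIV[OF sx[OF T(1)]], OF UNIV_I]
        note rem = sum.remove[OF simplexD(1)[OF sx[OF T(1)]] T(2)]
        have "(SUM w:verts F. bary T w x) = 1" "(SUM w:verts F. bary T w x *\<^sub>R w) = x"
          using bp unfolding rem[of "%w. bary T w x"] rem[of "%w. bary T w x *\<^sub>R w"] bx F(2) by simp_all
        hence xa: "x : affine hull (verts F)" unfolding affine_hull_finite[OF simplexD(1)[OF Fs]] by blast
        note c1 = cut_on_facet[OF sx[OF T(1)] F(1) T(2) F(2) xa] and c2 = cut_on_facet[OF sx[OF T'(1)] T'(3) v' xa]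
        show "?g T x * cut T {v} ep x = ?g T' x * cut T' {v'} ep x"
        proof (cases "x : F")
          case True
          show ?thesis unfolding c1 c2 cont[OF T(1) T'(1) F(1) T'(3) True] by (rule refl)
        next
          \<comment> \<open>The normal components are known to match on F only. In the rest of its
            hyperplane both cutoffs are 0.\<close>
          case False
          then obtain w where w: "w : verts F" "bary F w x < 0" using in_simplex_iff_bary[OF Fs xa] by (auto simp: not_le)
          hence "bary F w x / ep <= 0" using ep by (simp add: divide_le_0_iff)
          hence "(PROD w:verts F. hstep (bary F w x / ep)) = 0" using w(1) simplexD(1)[OF Fs] hstep_simps(1) by (intro prod_zero) blast+
          thus ?thesis unfolding c1 c2 by simp
        qed
      qed
      thus ?thesis unfolding P using norm[OF T(1,2) s(2)] norm[OF T'(1) v'(1) s'(2)] T'(2) by simp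
    qed
  qed
  have "(SUM T:Th. SUM v:verts T. SUM i:I. TI T (%x. gcut (A T i) (DA T i) T {v} ep x \<bullet> e i)) = (SUM p:?P. N p)" by (subst sum.Sigma) (use fin simplexD(1)[OF sx] in \<open>auto simp: N_def case_prod_beta\<close>)
  also have "... = (SUM F:fac ` ?P. SUM p:{p : ?P. fac p = F}. N p)" by (rule sum.image_gen[OF finP])
  also have "... = 0" by (rule sum.neutral) (use grp in blast)
  finally show ?thesis .
qed

text \<open>A common face other than T lies in the frontier of T, and frontiers of convex sets are
  null.\<close>

lemma overlap_negligible:
  assumes "T : Th" "T' : Th" "T ~= T'"
  shows "negligible (T \<inter> T')"
proof (rule negligible_subset[OF negligible_convex_frontier[OF simplex_convex[OF sx[OF assms(1)]]]])
  have "T \<inter> T' ~= T" using mesh_subset_eq[OF assms(1,2)] assms(3) by blast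
  hence "T \<inter> T' <= rel_frontier T" by (rule face_of_subset_rel_frontier[OF inter[OF assms(1,2)]])
  also have "... <= frontier T" using interior_subset_rel_interior[of T] by (auto simp: rel_frontier_def frontier_def)
  finally show "T \<inter> T' <= frontier T" .
qed

end

section \<open>The weak divergence\<close>

lemma Poly_C1:
  fixes p :: "'n::finite rvec => real"
  assumes "p : Poly (int s) T"
  shows "EX q D. C1 q D & (ALL x:T. p x = q x)"
proof -
  obtain q where q: "pf s q" "p = (%x. if x : T then q x else 0)" using assms unfolding Poly_iff_pf by blast
  obtain D where "ALL x. (q has_derivative (%h. D x \<bullet> h)) (at x)" "continuous_on UNIV D" using pf_derivative[OF q(1)] by blast
  hence "C1 q D" by (simp add: C1_def)
  thus ?thesis using q(2) by auto
qed

lemma C1_partial: "C1 ph D ==> partial i ph x = D x \<bullet> unit_vec i"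
  using frechet_derivative_at[OF C1_D, of ph D x] by (simp add: partial_def fun_eq_iff)

lemma test_function_C1:
  fixes \<Omega> :: "'n::{finite,linorder} rvec set"
  assumes "ph : test_functions \<Omega>"
  obtains D where "C1 ph D"
proof -
  have "Ck (Suc 0) ph" using assms by (auto simp: test_functions_def)
  hence d: "ph differentiable_on UNIV" and c: "!!i. i : {1..CARD('n)} ==> continuous_on UNIV (partial i ph)" by auto
  define D :: "'n rvec => 'n rvec" where "D x = (SUM i:{1..CARD('n)}. partial i ph x *\<^sub>R unit_vec i)" for x
  have "(ph has_derivative (%h. D x \<bullet> h)) (at x)" for x
  proof -
    let ?f = "frechet_derivative ph (at x)"
    have f: "(ph has_derivative ?f) (at x)" using d frechet_derivative_works by (auto simp: differentiable_on_def)
    have lin: "linear ?f" using has_derivative_linear[OF f] .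
    have "?f h = D x \<bullet> h" for h
    proof -
      have "?f h = ?f (SUM i:{1..CARD('n)}. (unit_vec i \<bullet> h) *\<^sub>R unit_vec i)" using biorth_expand[OF biorth_unit, of h] by simp
      also have "... = (SUM i:{1..CARD('n)}. (unit_vec i \<bullet> h) * ?f (unit_vec i))" by (simp add: linear_sum[OF lin] linear_scale[OF lin])
      also have "... = D x \<bullet> h" by (simp add: D_def partial_def inner_sum_left mult.commute)
      finally show ?thesis .
    qed
    hence "?f = (%h. D x \<bullet> h)" by (rule ext)
    thus ?thesis using f by simp
  qed
  moreover have "continuous_on UNIV D" unfolding D_def by (intro continuous_intros c)
  ultimately have "C1 ph D" by (simp add: C1_def)
  thus thesis by (rule that)
qed

text \<open>Over a bounded domain this gives \<open>L2\<close>. It is kept by finite sums and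
  multiples, which covers piecewise polynomial functions.\<close>

definition bdmeas :: "('a::euclidean_space => real) => bool" where
  "bdmeas u \<longleftrightarrow> u : borel_measurable borel & (EX B. ALL x. \<bar>u x\<bar> <= B)"

lemma bdmeas_indicator:
  assumes T: "compact T" and g: "continuous_on UNIV g"
  shows "bdmeas (%x. indicator T x * g x)"
proof -
  have "bounded (g ` T)" by (rule compact_imp_bounded[OF compact_continuous_image[OF continuous_on_subset[OF g] T]]) simp
  then obtain B where "ALL y:g ` T. norm y <= B" unfolding bounded_iff ..
  hence "\<bar>indicator T x * g x\<bar> <= \<bar>B\<bar>" for x by (cases "x : T") force+
  moreover have "(%x. indicator T x * g x) : borel_measurable borel"
    using compact_imp_closed[OF T] g by (intro borel_measurable_times borel_measurable_indicator borel_closed borel_measurable_continuous_onI)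
  ultimately show ?thesis unfolding bdmeas_def by blast
qed

lemma bdmeas_scale: "bdmeas u ==> bdmeas (%x. c * u x)"
proof -
  assume "bdmeas u"
  then obtain B where u: "u : borel_measurable borel" "!!x. \<bar>u x\<bar> <= B" by (auto simp: bdmeas_def)
  have "\<bar>c * u x\<bar> <= \<bar>c\<bar> * B" for x unfolding abs_mult by (rule mult_left_mono[OF u(2)]) simp
  thus ?thesis using u(1) by (auto simp: bdmeas_def)
qed

lemma bdmeas_sum: "(!!i. i : I ==> bdmeas (u i)) ==> bdmeas (%x. SUM i:I. u i x)"
proof (induction I rule: infinite_finite_induct)
  case (insert j J)
  hence j: "bdmeas (u j)" and J: "bdmeas (%x. SUM i:J. u i x)" by auto
  obtain B where "!!x. \<bar>u j x\<bar> <= B" using j by (auto simp: bdmeas_def)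
  moreover obtain C where "!!x. \<bar>SUM i:J. u i x\<bar> <= C" using J by (auto simp: bdmeas_def)
  ultimately have *: "u j : borel_measurable borel" "!!x. \<bar>u j x\<bar> <= B"
    "(%x. SUM i:J. u i x) : borel_measurable borel" "!!x. \<bar>SUM i:J. u i x\<bar> <= C" using j J by (simp_all add: bdmeas_def)
  have "\<bar>u j x + (SUM i:J. u i x)\<bar> <= B + C" for x using *(2,4)[of x] by linarith
  thus ?case using * insert.hyps by (auto simp: bdmeas_def)
qed (auto simp: bdmeas_def)

lemma bdmeas_L2:
  fixes \<Omega> :: "'a::euclidean_space set"
  assumes u: "bdmeas u" and \<Omega>: "open \<Omega>" "bounded \<Omega>"
  shows "u : L2 \<Omega>"
proof -
  obtain B where B: "u : borel_measurable borel" "!!x. \<bar>u x\<bar> <= B" using u by (auto simp: bdmeas_def)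
  interpret finite_measure "lebesgue_on \<Omega>" by (rule finite_measure_lebesgue_on[OF lmeasurable_open[OF \<Omega>(2,1)]])
  have m: "u : borel_measurable (lebesgue_on \<Omega>)" using B(1) by (intro measurable_restrict_space1 measurable_completion) simp
  have "integrable (lebesgue_on \<Omega>) (%x. (u x)\<^sup>2)"
  proof (rule Bochner_Integration.integrable_bound[of _ "%_. B\<^sup>2"])
    show "AE x in lebesgue_on \<Omega>. norm ((u x)\<^sup>2) <= norm (B\<^sup>2)"
      using B(2) by (intro AE_I2) (simp add: abs_le_square_iff[symmetric] order_trans[OF B(2) abs_ge_self])
  qed (use m in simp_all)
  thus ?thesis using m by (simp add: L2_def)
qed

text \<open>Transfers an integral over the domain to a Borel function on the whole space. Equality
  almost everywhere is enough, as the functions in \<open>Vh\<close> agree with polynomials only up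
  to null sets.\<close>

lemma LINT_lebesgue_on:
  fixes f B :: "'a::euclidean_space => real"
  assumes \<Omega>: "\<Omega> : sets lebesgue" and f: "f : borel_measurable (lebesgue_on \<Omega>)" and B: "B : borel_measurable borel"
    and eq: "AE x in lebesgue. indicator \<Omega> x * f x = B x"
  shows "(LINT x|lebesgue_on \<Omega>. f x) = integral\<^sup>L lborel B"
proof -
  have s: "\<Omega> \<inter> space lebesgue : sets lebesgue" using \<Omega> by simp
  have "(LINT x|lebesgue_on \<Omega>. f x) = (\<integral>x. indicator \<Omega> x *\<^sub>R f x \<partial>lebesgue)" by (rule integral_restrict_space[OF s])
  also have "... = integral\<^sup>L lebesgue B"
  proof (rule integral_cong_AE)
    show "(%x. indicator \<Omega> x *\<^sub>R f x) : borel_measurable lebesgue" using f borel_measurable_restrict_space_iff[OF s, of f] by simp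
    show "B : borel_measurable lebesgue" using B by (intro measurable_completion) simp
    show "AE x in lebesgue. indicator \<Omega> x *\<^sub>R f x = B x" using eq by simp
  qed
  also have "... = integral\<^sup>L lborel B" by (rule integral_completion) (use B in simp)
  finally show ?thesis .
qed

lemma partial_outside:
  fixes \<Omega> :: "'n::{finite,linorder} rvec set"
  assumes ph: "ph : test_functions \<Omega>" and x: "x ~: \<Omega>"
  shows "ph x = 0" "partial i ph x = 0"
proof -
  let ?U = "- closure {x. ph x ~= 0}"
  have U: "open ?U" "x : ?U" using ph x by (auto simp: test_functions_def)
  have z: "ph y = 0" if "y : ?U" for y using that closure_subset[of "{x. ph x ~= 0}"] by blast
  show "ph x = 0" by (rule z[OF U(2)])
  have "(ph has_derivative (%h. 0)) (at x)"
  proof (rule has_derivative_transform_within_open[OF _ U])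
    show "((%_. 0) has_derivative (%h. 0)) (at x)" by (rule has_derivative_const)
    fix y assume "y : ?U"
    thus "0 = ph y" by (simp only: z)
  qed
  from frechet_derivative_at[OF this] show "partial i ph x = 0" by (simp add: partial_def fun_eq_iff)
qed

text \<open>The piecewise divergence is bounded, so it is a candidate in L2. That it is the weak
  divergence follows by inserting the test function times the polynomial field into
  \<open>piecewise_divergence\<close>; continuity of the traces makes the facet terms
  balance.\<close>

theorem Vh_subset_Hdiv:
  fixes \<Omega> :: "'n::{finite,linorder} rvec set"
  assumes n3: "CARD('n) >= 3" and k: "1 <= k" "k <= CARD('n) - 2" and r: "r >= k + 1"
    and \<Omega>: "open \<Omega>" "bounded \<Omega>" and mesh: "conforming_mesh \<Omega> Th"
    and tn: "!!l f. l <= CARD('n) - 1 ==> f : mesh_Delta l Th ==> tn_basis l f (tn f)"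
    and dual: "!!l f. l <= CARD('n) - 1 ==> f : mesh_Delta l Th ==> dual_basis (%i. covec (tn f i)) (dyh f)"
    and nF: "!!F. F : mesh_Delta (CARD('n) - 1) Th ==> unit_normal F (nF F)"
  shows "Vh r k nF dyh \<Omega> Th <= Hdiv k \<Omega>"
proof
  fix om assume "om : Vh r k nF dyh \<Omega> Th"
  from CollectD[OF this[unfolded Vh_def]] obtain w where om: "om : L2_forms \<Omega> (XX k)"
    and w: "ALL T:Th. w T : PolyX r k T & (AE x in lebesgue_on (T \<inter> \<Omega>). om x = w T x)"
    and wa: "ALL T:Th. ALL T':Th. ALL v:verts T \<inter> verts T'. w T v = w T' v"
    and wb: "ALL l:{1..k - 1}. ALL f:mesh_Delta l Th. ALL T:Th. ALL T':Th. f <= T --> f <= T' -->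
        (ALL et:test_b r k l f (dyh f). dform_pair k f (w T) et = dform_pair k f (w T') et)"
    and wcd: "ALL F:mesh_Delta (CARD('n) - 1) Th. ALL T:Th. ALL T':Th. F <= T --> F <= T' -->
        (ALL l:{1..k - 1}. ALL f:Delta l F. ALL et:test_c r k l f (dyh f).
           form_pair k f (tr_div k F (nF F) (w T)) et = form_pair k f (tr_div k F (nF F) (w T')) et) &
        (ALL et:test_d r k F. form_pair k F (tr_div k F (nF F) (w T)) et = form_pair k F (tr_div k F (nF F) (w T')) et)" by (elim conjE exE) (rule that, assumption+)
  interpret simplicial_mesh \<Omega> Th by unfold_locales (rule \<Omega>(1), rule mesh, use n3 in simp)
  have wX: "w T : PolyX r k T" if "T : Th" for T using w that by blast
  have sx': "int CARD('n) simplex T" if "T : Th" for T using sx[OF that] by simp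
  have trace: "nF F \<bullet> vf (w T x) ws = nF F \<bullet> vf (w T' x) ws"
    if T: "T : Th" "T' : Th" and F: "F : Delta (CARD('n) - 1) T" "F : Delta (CARD('n) - 1) T'" and x: "x : F" for T T' F x ws
  proof -
    note FT = Delta_subset[OF F(1)] Delta_subset[OF F(2)] and tr = Delta_trans[OF _ F(1)]
    have md: "f : mesh_Delta l Th" if "f : Delta l F" for l f using tr[OF that] T(1) by (auto simp: mesh_Delta_def)
    have mF: "F : mesh_Delta (CARD('n) - 1) Th" using F(1) T(1) by (auto simp: mesh_Delta_def)
    note cd = mp[OF mp[OF bspec[OF bspec[OF bspec[OF wcd mF] T(1)] T(2)] FT(1)] FT(2)]
    show ?thesis
    proof (rule trace_agree[where tn = tn and dyh = dyh, OF Delta_simplex[OF F(1)] n3 k r FT wX[OF T(1)] wX[OF T(2)] _ _ nF[OF mF] _ _ _ _ x])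
      show "tn_basis l f (tn f)" if "l <= CARD('n) - 1" "f : Delta l F" for l f by (rule tn[OF that(1) md[OF that(2)]])
      show "dual_basis (%i. covec (tn f i)) (dyh f)" if "l <= CARD('n) - 1" "f : Delta l F" for l f by (rule dual[OF that(1) md[OF that(2)]])
      show "w T v = w T' v" if "v : verts F" for v using wa T Delta_verts[OF sx'[OF T(1)] F(1)] Delta_verts[OF sx'[OF T(2)] F(2)] that by blast
      show "dform_pair k f (w T) et = dform_pair k f (w T') et" if "l : {1..k - 1}" "f : Delta l F" "et : test_b r k l f (dyh f)" for l f et
        using bspec[OF bspec[OF bspec[OF bspec[OF wb that(1)] md[OF that(2)]] T(1)] T(2)] Delta_subset[OF that(2)] FT that(3) by blast
      show "form_pair k f (tr_div k F (nF F) (w T)) et = form_pair k f (tr_div k F (nF F) (w T')) et"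
        if "l : {1..k - 1}" "f : Delta l F" "et : test_c r k l f (dyh f)" for l f et by (rule bspec[OF bspec[OF bspec[OF conjunct1[OF cd] that(1)] that(2)] that(3)])
      show "form_pair k F (tr_div k F (nF F) (w T)) et = form_pair k F (tr_div k F (nF F) (w T')) et" if "et : test_d r k F" for et by (rule bspec[OF conjunct2[OF cd] that])
    qed
  qed
  let ?I = "{1..CARD('n)}" and ?S = "Sig CARD('n) k"
  \<comment> \<open>The coefficients are polynomials set to 0 outside T. Differentiable extensions
    to the whole space are chosen, each with its gradient.\<close>
  define QD where "QD T sg i = (SOME p. C1 (fst p) (snd p) & (ALL x:T. coef (w T x) sg i = fst p x))" for T sg i
  define q where "q T sg i = fst (QD T sg i)" for T sg i
  define Dq where "Dq T sg i = snd (QD T sg i)" for T sg i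
  have qD: "C1 (q T sg i) (Dq T sg i) & (ALL x:T. coef (w T x) sg i = q T sg i x)" if T: "T : Th" for T sg i
  proof -
    have "(%x. coef (w T x) sg i) : Poly (int r) T" unfolding coef_def by (rule Poly_scale[OF PolyX_comp[OF wX[OF T]]])
    from Poly_C1[OF this] have "EX p. C1 (fst p) (snd p) & (ALL x:T. coef (w T x) sg i = fst p x)" by auto
    thus ?thesis unfolding q_def Dq_def QD_def by (rule someI_ex)
  qed
  note qC1 = qD[THEN conjunct1] and qeq = bspec[OF qD[THEN conjunct2]]
  define dv where "dv T sg x = (SUM i:?I. Dq T sg i x \<bullet> unit_vec i)" for T sg x
  have dvc: "continuous_on UNIV (dv T sg)" if "T : Th" for T sg unfolding dv_def by (intro continuous_intros C1_continuous(1)[OF qC1[OF that]])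
  \<comment> \<open>Where simplices overlap the values add up; this happens on a null set
    only.\<close>
  define d where "d x ws = (SUM T:Th. SUM sg:?S. (indicator T x * dv T sg x) * cow (unit_vecs sg) ws)" for x and ws :: "'n rvec list"
  have TC: "compact T" if "T : Th" for T by (rule simplex_compact[OF sx[OF that]])
  have dL2: "d : L2_forms \<Omega> (Alt k)" unfolding L2_forms_def
  proof (intro CollectI conjI allI)
    show "(%x. d x ws) : L2 \<Omega>" for ws
    proof (rule bdmeas_L2[OF _ \<Omega>])
      have "bdmeas (%x. SUM T:Th. SUM sg:?S. cow (unit_vecs sg) ws * (indicator T x * dv T sg x))" by (intro bdmeas_sum bdmeas_scale bdmeas_indicator TC dvc)
      thus "bdmeas (%x. d x ws)" by (simp add: d_def mult.commute)
    qed
    have "d x : Alt k" for x unfolding d_def[abs_def]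
    proof (intro Alt_sum Alt_scale)
      fix sg assume "sg : ?S"
      thus "cow (unit_vecs sg :: 'n rvec list) : Alt k" using cow_Alt[of "unit_vecs sg :: 'n rvec list"] by (simp add: length_unit_vecs)
    qed
    thus "AE x in lebesgue_on \<Omega>. d x : Alt k" by (intro AE_I2)
  qed
  have \<Omega>s: "\<Omega> : sets lebesgue" using lmeasurable_open[OF \<Omega>(2,1)] by (rule fmeasurableD)
  have uniq: "AE x in lebesgue. ALL T:Th. ALL T':Th. T ~= T' --> x ~: T \<inter> T'"
  proof (intro AE_finite_allI fin)
    fix T T' assume T: "T : Th" "T' : Th"
    show "AE x in lebesgue. T ~= T' --> x ~: T \<inter> T'"
    proof (cases "T = T'")
      case False
      have "T \<inter> T' : null_sets lebesgue" using overlap_negligible[OF T False] by (simp add: negligible_iff_null_sets)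
      from AE_not_in[OF this] show ?thesis by eventually_elim simp
    qed simp
  qed
  have val: "AE x in lebesgue. ALL T:Th. x : T \<inter> \<Omega> --> om x = w T x"
  proof (intro AE_finite_allI fin)
    fix T assume T: "T : Th"
    have "T : sets lebesgue" using lmeasurable_compact[OF TC[OF T]] by (rule fmeasurableD)
    hence "T \<inter> \<Omega> \<inter> space lebesgue : sets lebesgue" using \<Omega>s by auto
    thus "AE x in lebesgue. x : T \<inter> \<Omega> --> om x = w T x" using w T by (simp only: AE_restrict_space_iff[symmetric])
  qed
  have "weak_div k \<Omega> om d" unfolding weak_div_def
  proof (intro ballI)
    fix ph sg assume ph: "ph : test_functions \<Omega>" and sg: "sg : ?S"
    obtain D where D: "C1 ph D" by (rule test_function_C1[OF ph]) (rule that)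
    note pD = C1_partial[OF D]
    define A where "A T i x = ph x * q T sg i x" for T i x
    define DA where "DA T i x = ph x *\<^sub>R Dq T sg i x + q T sg i x *\<^sub>R D x" for T i x
    have C1A: "C1 (A T i) (DA T i)" if "T : Th" for T i unfolding A_def[abs_def] DA_def[abs_def] by (rule C1_mult[OF D qC1[OF that]])
    define h where "h T x = (SUM i:?I. q T sg i x * partial i ph x)" for T x
    have hc: "continuous_on UNIV (h T)" if "T : Th" for T
      unfolding h_def pD by (intro continuous_intros C1_continuous(1)[OF D] C1_continuous(2)[OF qC1[OF that]])
    have phdv: "continuous_on UNIV (%x. dv T sg x * ph x)" if "T : Th" for T by (intro continuous_intros dvc[OF that] C1_continuous(2)[OF D])
    have sum0: "(SUM T:Th. SUM i:?I. TI T (%x. DA T i x \<bullet> unit_vec i)) = 0"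
    proof (rule piecewise_divergence[OF fin sx dim2 _ C1A])
      fix ep :: real assume ep: "ep > 0"
      show "(SUM T:Th. SUM v:verts T. SUM i:?I. TI T (%x. gcut (A T i) (DA T i) T {v} ep x \<bullet> unit_vec i)) = 0"
      proof (rule facet_balance[OF _ ep C1A C1_continuous(2)[OF D] partial_outside(1)[OF ph], where nF = nF])
        show "A T i x = 0" if "ph x = 0" for T i x by (simp add: A_def that)
        show "unit_normal F (nF F)" if "T : Th" "F : Delta (DIM('n rvec) - 1) T" for T F by (rule nF) (use that in \<open>auto simp: mesh_Delta_def\<close>)
        show "(SUM i:?I. (unit_vec i \<bullet> nF F) * A T i x) = (SUM i:?I. (unit_vec i \<bullet> nF F) * A T' i x)"
          if T: "T : Th" "T' : Th" and F: "F : Delta (DIM('n rvec) - 1) T" "F : Delta (DIM('n rvec) - 1) T'" and x: "x : F" for T T' F x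
        proof -
          have e: "(SUM i:?I. (unit_vec i \<bullet> nF F) * A T i x) = ph x * (nF F \<bullet> vf (w T x) (unit_vecs sg))" if T: "T : Th" and x: "x : T" for T
            unfolding coef_sum_vf[symmetric] sum_distrib_left by (rule sum.cong) (simp_all add: A_def qeq[OF T x] inner_commute mult_ac)
          have xT: "x : T" "x : T'" using Delta_subset[OF F(1)] Delta_subset[OF F(2)] x by auto
          show ?thesis unfolding e[OF T(1) xT(1)] e[OF T(2) xT(2)] using trace[OF T _ _ x, of "unit_vecs sg"] F by simp
        qed
      qed simp_all
    qed simp_all
    have DAe: "(SUM i:?I. TI T (%x. DA T i x \<bullet> unit_vec i)) = TI T (h T) + TI T (%x. dv T sg x * ph x)" if T: "T : Th" for T
    proof -
      have "(SUM i:?I. TI T (%x. DA T i x \<bullet> unit_vec i)) = TI T (%x. SUM i:?I. DA T i x \<bullet> unit_vec i)" by (rule TI_sum[OF TC[OF T], symmetric]) (intro continuous_intros C1_continuous(1)[OF C1A[OF T]])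
      also have "... = TI T (%x. h T x + dv T sg x * ph x)" by (rule TI_cong) (simp add: DA_def h_def dv_def pD inner_add_left sum.distrib sum_distrib_left mult.commute)
      also have "... = TI T (h T) + TI T (%x. dv T sg x * ph x)" by (rule TI_add[OF TC[OF T] continuous_on_subset[OF hc[OF T]] continuous_on_subset[OF phdv[OF T]]]) simp_all
      finally show ?thesis .
    qed
    have TIsum: "integral\<^sup>L lborel (%x. SUM T:Th. indicator T x * g T x) = (SUM T:Th. TI T (g T))"
      and TImeas: "(%x. SUM T:Th. indicator T x * g T x) : borel_measurable borel"
      if "!!T. T : Th ==> continuous_on UNIV (g T)" for g
    proof -
      show "integral\<^sup>L lborel (%x. SUM T:Th. indicator T x * g T x) = (SUM T:Th. TI T (g T))"
        unfolding TI_def by (rule Bochner_Integration.integral_sum) (intro TI_integrable TC continuous_on_subset[OF that] subset_UNIV)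
      have "bdmeas (%x. SUM T:Th. indicator T x * g T x)" by (intro bdmeas_sum bdmeas_indicator TC that)
      thus "(%x. SUM T:Th. indicator T x * g T x) : borel_measurable borel" by (simp add: bdmeas_def)
    qed
    have bm: "g : borel_measurable (lebesgue_on \<Omega>)" if "continuous_on UNIV g" for g :: "'n rvec => real"
      using borel_measurable_continuous_onI[OF that] by (intro measurable_restrict_space1 measurable_completion) simp
    have omm: "(%x. om x a) : borel_measurable (lebesgue_on \<Omega>)" for a using om unfolding L2_forms_def L2_def by blast
    have dm: "(%x. d x a) : borel_measurable (lebesgue_on \<Omega>)" for a using dL2 unfolding L2_forms_def L2_def by blast
    have "(LINT x|lebesgue_on \<Omega>. (SUM i:?I. coef (om x) sg i * partial i ph x)) =
        integral\<^sup>L lborel (%x. SUM T:Th. indicator T x * h T x)"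
    proof (rule LINT_lebesgue_on[OF \<Omega>s])
      show "(%x. SUM i:?I. coef (om x) sg i * partial i ph x) : borel_measurable (lebesgue_on \<Omega>)"
        unfolding coef_def pD by (intro borel_measurable_sum borel_measurable_times borel_measurable_const omm bm continuous_intros C1_continuous(1)[OF D])
      show "(%x. SUM T:Th. indicator T x * h T x) : borel_measurable borel" by (rule TImeas[OF hc])
      show "AE x in lebesgue. indicator \<Omega> x * (SUM i:?I. coef (om x) sg i * partial i ph x) = (SUM T:Th. indicator T x * h T x)" using uniq val
      proof eventually_elim
        fix x assume u: "ALL T:Th. ALL T':Th. T ~= T' --> x ~: T \<inter> T'" and v: "ALL T:Th. x : T \<inter> \<Omega> --> om x = w T x"
        show "indicator \<Omega> x * (SUM i:?I. coef (om x) sg i * partial i ph x) = (SUM T:Th. indicator T x * h T x)"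
        proof (cases "x : \<Omega>")
          case True
          then obtain T where T: "T : Th" "x : T" using cover by blast
          have "(SUM T':Th. indicator T' x * h T' x) = (SUM T':Th. if T' = T then h T x else 0)" by (rule sum.cong) (use u T in auto)
          also have "... = h T x" using T(1) fin by simp
          also have "... = (SUM i:?I. coef (om x) sg i * partial i ph x)" using v T True qeq[OF T] by (simp add: h_def)
          finally show ?thesis using True by simp
        next
          case False
          thus ?thesis by (simp add: h_def partial_outside(2)[OF ph])
        qed
      qed
    qed
    also have "... = (SUM T:Th. TI T (h T))" by (rule TIsum[OF hc])
    also have "... = - (SUM T:Th. TI T (%x. dv T sg x * ph x))" using sum0 by (simp add: DAe sum.distrib)
    also have "(SUM T:Th. TI T (%x. dv T sg x * ph x)) = integral\<^sup>L lborel (%x. SUM T:Th. indicator T x * (dv T sg x * ph x))" by (rule TIsum[OF phdv, symmetric])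
    also have "... = (LINT x|lebesgue_on \<Omega>. d x (unit_vecs sg) * ph x)"
    proof (rule LINT_lebesgue_on[OF \<Omega>s, symmetric])
      show "(%x. d x (unit_vecs sg) * ph x) : borel_measurable (lebesgue_on \<Omega>)" by (intro borel_measurable_times dm bm C1_continuous(2)[OF D])
      show "(%x. SUM T:Th. indicator T x * (dv T sg x * ph x)) : borel_measurable borel" by (rule TImeas[OF phdv])
      have dval: "d x (unit_vecs sg) = (SUM T:Th. indicator T x * dv T sg x)" for x
      proof -
        have "(SUM rh:?S. (indicator T x * dv T rh x) * cow (unit_vecs rh) (unit_vecs sg :: 'n rvec list)) =
            (SUM rh:?S. if rh = sg then indicator T x * dv T sg x else 0)" for T by (rule sum.cong) (use cow_biorth[OF biorth_unit _ sg] in \<open>auto simp: unit_vecs_def\<close>)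
        thus ?thesis using sg by (simp add: d_def finite_Sig)
      qed
      show "AE x in lebesgue. indicator \<Omega> x * (d x (unit_vecs sg) * ph x) = (SUM T:Th. indicator T x * (dv T sg x * ph x))"
      proof (rule AE_I2)
        fix x
        show "indicator \<Omega> x * (d x (unit_vecs sg) * ph x) = (SUM T:Th. indicator T x * (dv T sg x * ph x))"
          unfolding dval using partial_outside(1)[OF ph, of x] by (cases "x : \<Omega>") (simp_all add: sum_distrib_right mult.assoc)
      qed
    qed
    finally show "(LINT x|lebesgue_on \<Omega>. (SUM i:?I. coef (om x) sg i * partial i ph x)) =
      - (LINT x|lebesgue_on \<Omega>. d x (unit_vecs sg) * ph x)" .
  qed
  thus "om : Hdiv k \<Omega>" using om dL2 by (auto simp: Hdiv_def)
qed

theorem theorem6p11: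
  fixes \<Omega> :: "'n::{finite,linorder} rvec set"
    and Th :: "'n rvec set set"
    and r k :: nat
    and tn :: "'n rvec set \<Rightarrow> nat \<Rightarrow> 'n rvec"
    and dyh :: "'n rvec set \<Rightarrow> nat \<Rightarrow> 'n rvec form"
    and nF :: "'n rvec set \<Rightarrow> 'n rvec"
  assumes "CARD('n) \<ge> 3" and "1 \<le> k" and "k \<le> CARD('n) - 2" and "r \<ge> k + 1"
    and "open \<Omega>" and "connected \<Omega>" and "bounded \<Omega>" and "\<Omega> \<noteq> {}"
    and "conforming_mesh \<Omega> Th"
    and "\<And>l f. l \<le> CARD('n) - 1 \<Longrightarrow> f \<in> mesh_Delta l Th \<Longrightarrow> tn_basis l f (tn f)"
    and "\<And>l f. l \<le> CARD('n) - 1 \<Longrightarrow> f \<in> mesh_Delta l Th \<Longrightarrow>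
           dual_basis (\<lambda>i. covec (tn f i)) (dyh f)"
    and "\<And>F. F \<in> mesh_Delta (CARD('n) - 1) Th \<Longrightarrow> unit_normal F (nF F)"
  shows "(\<forall>T\<in>Th. unisolvent r k nF dyh T) \<and> Vh r k nF dyh \<Omega> Th \<subseteq> Hdiv k \<Omega>"
proof (intro conjI ballI)
  fix T assume T: "T : Th"
  have m: "f : mesh_Delta l Th" if "f : Delta l T" for l f using that T by (auto simp: mesh_Delta_def)
  interpret simplex_dofs T r k tn dyh nF
  proof
    show "int CARD('n) simplex T" using assms(9) T by (auto simp: conforming_mesh_def)
  qed (use assms(1-4) assms(10-12) m in auto)
  show "unisolvent r k nF dyh T" by (rule unisolvence)
next
  show "Vh r k nF dyh \<Omega> Th <= Hdiv k \<Omega>" by (rule Vh_subset_Hdiv[OF assms(1-4,5,7,9-12)])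
qed

end
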